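(* Let $\mathcal{A}$ be a weakly idempotent complete exact category. Then a model structure on $\mathcal{A}$ is both exact and weakly projective if and only if it is projective. If this is the case, then the left triangulated structure on the homotopy category $\mathrm{Ho}(\mathcal{A})$ is in fact a triangulated category.
   Context: Exact categories are in the sense of Quillen, with inflations, deflations and admissible exact sequences. $\mathcal{A}$ is weakly idempotent complete if every splitting epimorphism is a deflation. A model structure on a category is a triple $(\mathrm{CoFib},\mathrm{Fib},\mathrm{Weq})$ of classes of morphisms (cofibrations, fibrations, weak equivalences) satisfying: (two out of three) if two of $f,g,gf$ are in $\mathrm{Weq}$ so is the third; (retract) each of the three classes is closed under retracts; (lifting) cofibrations have the left lifting property with respect to $\mathrm{Fib}\cap\mathrm{Weq}$, and fibrations have the right lifting property with respect to $\mathrm{CoFib}\cap\mathrm{Weq}$; (factorization) every morphism $f$ factors as $f=pi$ with $i\in\mathrm{CoFib}\cap\mathrm{Weq}$, $p\in\mathrm{Fib}$, and as $f=qj$ with $j\in\mathrm{CoFib}$, $q\in\mathrm{Fib}\cap\mathrm{Weq}$. No limits or colimits are required. Trivial fibrations are the morphisms in $\mathrm{Fib}\cap\mathrm{Weq}$. An object $X$ is cofibrant if $0\to X$ is a cofibration, fibrant if $X\to0$ is a fibration, trivial if $0\to X$ (equivalently $X\to0$) is a weak equivalence; trivially cofibrant means trivial and cofibrant. A model structure on an exact category is: exact if cofibrations are precisely the inflations with cofibrant cokernel and fibrations are precisely the deflations with fibrant kernel; projective if it is exact and each object is fibrant; weakly projective if cofibrations are precisely the inflations with cofibrant cokernel,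 each trivial fibration is a deflation, and each object is fibrant. $\mathrm{Ho}(\mathcal{A})=\mathcal{A}[\mathrm{Weq}^{-1}]$. For a projective model structure with class $\mathcal{C}$ of cofibrant objects, the trivially cofibrant objects are exactly the projective objects $\mathcal{P}$ of $\mathcal{A}$, $\mathcal{A}$ has enough projective objects, $\mathcal{C}$ is closed under extensions and under kernels of deflations, and $\mathrm{Ho}(\mathcal{A})$ is equivalent to the additive quotient $\mathcal{C}/\mathcal{P}$ (same objects as $\mathcal{C}$, morphisms modulo those factoring through objects of $\mathcal{P}$). The left triangulated structure on $\mathrm{Ho}(\mathcal{A})\simeq\mathcal{C}/\mathcal{P}$ is the standard one: the loop functor $\Omega$ sends $X\in\mathcal{C}$ to the kernel of a chosen deflation $P_X\to X$ with $P_X\in\mathcal{P}$, and the left triangles are the sequences $\Omega Z\to X\to Y\to Z$ isomorphic in $\mathcal{C}/\mathcal{P}$ to those induced by admissible exact sequences $0\to X\to Y\to Z\to 0$ with all terms in $\mathcal{C}$, where $\Omega Z\to X$ is obtained by lifting $P_Z\to Z$ to $P_Z\to Y$ and restricting to kernels (up to the usual sign convention). That it is a triangulated category means that $\Omega$ is an autoequivalence and these left triangles are the distinguished triangles of a triangulated structure (with suspension $\Omega^{-1}$). *)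

theory Defs
  imports Main
begin

section \<open>Categories and functors\<close>

record ('o, 'm) cat =
  Ob :: "'o set"
  Ar :: "'m set"
  src :: "'m \<Rightarrow> 'o"
  tgt :: "'m \<Rightarrow> 'o"
  ident :: "'o \<Rightarrow> 'm"
  cmp :: "'m \<Rightarrow> 'm \<Rightarrow> 'm" (infixl \<open>\<cdot>\<index>\<close> 70)

text \<open>Composition is written in applicative order: \<open>g \<cdot> f\<close> is \<open>f\<close> followed by \<open>g\<close>. Its values
  on non-composable pairs are irrelevant.\<close>

definition hom :: "('o, 'm, 'z) cat_scheme \<Rightarrow> 'o \<Rightarrow> 'o \<Rightarrow> 'm set" where
  "hom C x y = {f \<in> Ar C. src C f = x \<and> tgt C f = y}"

locale category =
  fixes C :: "('o, 'm, 'z) cat_scheme" (structure)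
  assumes src_Ob: "f \<in> Ar C \<Longrightarrow> src C f \<in> Ob C"
    and tgt_Ob: "f \<in> Ar C \<Longrightarrow> tgt C f \<in> Ob C"
    and ident_hom: "x \<in> Ob C \<Longrightarrow> ident C x \<in> hom C x x"
    and cmp_hom: "\<lbrakk>f \<in> hom C x y; g \<in> hom C y z\<rbrakk> \<Longrightarrow> g \<cdot> f \<in> hom C x z"
    and ident_right: "f \<in> hom C x y \<Longrightarrow> f \<cdot> ident C x = f"
    and ident_left: "f \<in> hom C x y \<Longrightarrow> ident C y \<cdot> f = f"
    and cmp_assoc: "\<lbrakk>f \<in> hom C w x; g \<in> hom C x y; h \<in> hom C y z\<rbrakk>
      \<Longrightarrow> h \<cdot> (g \<cdot> f) = (h \<cdot> g) \<cdot> f"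

definition iso_arr :: "('o, 'm, 'z) cat_scheme \<Rightarrow> 'm \<Rightarrow> bool" where
  "iso_arr C f \<longleftrightarrow> f \<in> Ar C \<and> (\<exists>g \<in> hom C (tgt C f) (src C f).
     g \<cdot>\<^bsub>C\<^esub> f = ident C (src C f) \<and> f \<cdot>\<^bsub>C\<^esub> g = ident C (tgt C f))"

definition zero_object :: "('o, 'm, 'z) cat_scheme \<Rightarrow> 'o \<Rightarrow> bool" where
  "zero_object C z \<longleftrightarrow> z \<in> Ob C \<and>
     (\<forall>x \<in> Ob C. (\<exists>!f. f \<in> hom C z x) \<and> (\<exists>!f. f \<in> hom C x z))"

record ('o, 'm, 'p, 'n) funct =
  fo :: "'o \<Rightarrow> 'p"
  fm :: "'m \<Rightarrow> 'n"

definition is_functor ::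
  "('o, 'm, 'y) cat_scheme \<Rightarrow> ('p, 'n, 'z) cat_scheme \<Rightarrow> ('o, 'm, 'p, 'n) funct \<Rightarrow> bool" where
  "is_functor S T F \<longleftrightarrow> category S \<and> category T \<and>
     (\<forall>x \<in> Ob S. fo F x \<in> Ob T) \<and>
     (\<forall>f \<in> Ar S. fm F f \<in> hom T (fo F (src S f)) (fo F (tgt S f))) \<and>
     (\<forall>x \<in> Ob S. fm F (ident S x) = ident T (fo F x)) \<and>
     (\<forall>f \<in> Ar S. \<forall>g \<in> Ar S. tgt S f = src S g \<longrightarrow> fm F (g \<cdot>\<^bsub>S\<^esub> f) = fm F g \<cdot>\<^bsub>T\<^esub> fm F f)"

definition fid :: "('o, 'm, 'o, 'm) funct" where
  "fid = \<lparr>fo = (\<lambda>x. x), fm = (\<lambda>f. f)\<rparr>"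

definition fcomp :: "('p, 'n, 'q, 'k) funct \<Rightarrow> ('o, 'm, 'p, 'n) funct \<Rightarrow> ('o, 'm, 'q, 'k) funct" where
  "fcomp G F = \<lparr>fo = (\<lambda>x. fo G (fo F x)), fm = (\<lambda>f. fm G (fm F f))\<rparr>"

definition nat_iso :: "('o, 'm, 'y) cat_scheme \<Rightarrow> ('p, 'n, 'z) cat_scheme \<Rightarrow>
    ('o, 'm, 'p, 'n) funct \<Rightarrow> ('o, 'm, 'p, 'n) funct \<Rightarrow> ('o \<Rightarrow> 'n) \<Rightarrow> bool" where
  "nat_iso S T F G \<eta> \<longleftrightarrow> is_functor S T F \<and> is_functor S T G \<and>
     (\<forall>x \<in> Ob S. \<eta> x \<in> hom T (fo F x) (fo G x) \<and> iso_arr T (\<eta> x)) \<and>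
     (\<forall>f \<in> Ar S. \<eta> (tgt S f) \<cdot>\<^bsub>T\<^esub> fm F f = fm G f \<cdot>\<^bsub>T\<^esub> \<eta> (src S f))"

definition quasi_inverse :: "('o, 'm, 'y) cat_scheme \<Rightarrow> ('p, 'n, 'z) cat_scheme \<Rightarrow>
    ('o, 'm, 'p, 'n) funct \<Rightarrow> ('p, 'n, 'o, 'm) funct \<Rightarrow> bool" where
  "quasi_inverse S T F G \<longleftrightarrow> is_functor S T F \<and> is_functor T S G \<and>
     (\<exists>\<eta>. nat_iso S S fid (fcomp G F) \<eta>) \<and> (\<exists>\<epsilon>. nat_iso T T (fcomp F G) fid \<epsilon>)"

definition is_equivalence ::
  "('o, 'm, 'y) cat_scheme \<Rightarrow> ('p, 'n, 'z) cat_scheme \<Rightarrow> ('o, 'm, 'p, 'n) funct \<Rightarrow> bool" where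
  "is_equivalence S T F \<longleftrightarrow> (\<exists>G. quasi_inverse S T F G)"


section \<open>Additive categories\<close>

record ('o, 'm) addcat = "('o, 'm) cat" +
  add :: "'m \<Rightarrow> 'm \<Rightarrow> 'm" (infixl \<open>\<oplus>\<index>\<close> 65)
  zer :: "'o \<Rightarrow> 'o \<Rightarrow> 'm"
  neg :: "'m \<Rightarrow> 'm"

locale additive_category = category A
  for A :: "('o, 'm, 'z) addcat_scheme" (structure) +
  assumes add_hom: "\<lbrakk>f \<in> hom A x y; g \<in> hom A x y\<rbrakk> \<Longrightarrow> f \<oplus> g \<in> hom A x y"
    and zer_hom: "\<lbrakk>x \<in> Ob A; y \<in> Ob A\<rbrakk> \<Longrightarrow> zer A x y \<in> hom A x y"
    and neg_hom: "f \<in> hom A x y \<Longrightarrow> neg A f \<in> hom A x y"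
    and add_assoc: "\<lbrakk>f \<in> hom A x y; g \<in> hom A x y; h \<in> hom A x y\<rbrakk> \<Longrightarrow> (f \<oplus> g) \<oplus> h = f \<oplus> (g \<oplus> h)"
    and add_comm: "\<lbrakk>f \<in> hom A x y; g \<in> hom A x y\<rbrakk> \<Longrightarrow> f \<oplus> g = g \<oplus> f"
    and add_zer: "f \<in> hom A x y \<Longrightarrow> f \<oplus> zer A x y = f"
    and add_neg: "f \<in> hom A x y \<Longrightarrow> f \<oplus> neg A f = zer A x y"
    and cmp_add_right: "\<lbrakk>f \<in> hom A x y; g \<in> hom A x y; h \<in> hom A y z\<rbrakk>
      \<Longrightarrow> h \<cdot> (f \<oplus> g) = (h \<cdot> f) \<oplus> (h \<cdot> g)"
    and cmp_add_left: "\<lbrakk>f \<in> hom A x y; g \<in> hom A y z; h \<in> hom A y z\<rbrakk>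
      \<Longrightarrow> (g \<oplus> h) \<cdot> f = (g \<cdot> f) \<oplus> (h \<cdot> f)"
    and ex_zero_object: "\<exists>z. zero_object A z"
    and ex_biproduct: "\<lbrakk>x \<in> Ob A; y \<in> Ob A\<rbrakk> \<Longrightarrow>
      \<exists>b \<in> Ob A. \<exists>i \<in> hom A x b. \<exists>j \<in> hom A y b. \<exists>p \<in> hom A b x. \<exists>q \<in> hom A b y.
        p \<cdot> i = ident A x \<and> q \<cdot> j = ident A y \<and> q \<cdot> i = zer A x y \<and> p \<cdot> j = zer A y x \<and>
        (i \<cdot> p) \<oplus> (j \<cdot> q) = ident A b"


section \<open>Exact categories\<close>

definition is_kernel :: "('o, 'm, 'z) addcat_scheme \<Rightarrow> 'm \<Rightarrow> 'm \<Rightarrow> bool" where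
  "is_kernel A k f \<longleftrightarrow> k \<in> Ar A \<and> f \<in> Ar A \<and> tgt A k = src A f \<and>
     f \<cdot>\<^bsub>A\<^esub> k = zer A (src A k) (tgt A f) \<and>
     (\<forall>t \<in> Ar A. tgt A t = src A f \<longrightarrow> f \<cdot>\<^bsub>A\<^esub> t = zer A (src A t) (tgt A f) \<longrightarrow>
        (\<exists>!s. s \<in> hom A (src A t) (src A k) \<and> k \<cdot>\<^bsub>A\<^esub> s = t))"

definition is_cokernel :: "('o, 'm, 'z) addcat_scheme \<Rightarrow> 'm \<Rightarrow> 'm \<Rightarrow> bool" where
  "is_cokernel A c f \<longleftrightarrow> c \<in> Ar A \<and> f \<in> Ar A \<and> tgt A f = src A c \<and>
     c \<cdot>\<^bsub>A\<^esub> f = zer A (src A f) (tgt A c) \<and>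
     (\<forall>t \<in> Ar A. src A t = tgt A f \<longrightarrow> t \<cdot>\<^bsub>A\<^esub> f = zer A (src A f) (tgt A t) \<longrightarrow>
        (\<exists>!s. s \<in> hom A (tgt A c) (tgt A t) \<and> s \<cdot>\<^bsub>A\<^esub> c = t))"

text \<open>\<open>is_pushout C f g f' g'\<close>: the square \<open>f' \<cdot> f = g' \<cdot> g\<close> is a pushout; so \<open>g'\<close> is the
  pushout of \<open>f\<close> along \<open>g\<close>. Dually, \<open>is_pullback C f g f' g'\<close>: the square \<open>f \<cdot> f' = g \<cdot> g'\<close> is a
  pullback and \<open>g'\<close> is the pullback of \<open>f\<close> along \<open>g\<close>.\<close>

definition is_pushout :: "('o, 'm, 'z) cat_scheme \<Rightarrow> 'm \<Rightarrow> 'm \<Rightarrow> 'm \<Rightarrow> 'm \<Rightarrow> bool" where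
  "is_pushout C f g f' g' \<longleftrightarrow> {f, g, f', g'} \<subseteq> Ar C \<and> src C f = src C g \<and>
     src C f' = tgt C f \<and> src C g' = tgt C g \<and> tgt C f' = tgt C g' \<and>
     f' \<cdot>\<^bsub>C\<^esub> f = g' \<cdot>\<^bsub>C\<^esub> g \<and>
     (\<forall>s \<in> Ar C. \<forall>t \<in> Ar C. src C s = tgt C f \<longrightarrow> src C t = tgt C g \<longrightarrow> tgt C s = tgt C t \<longrightarrow>
        s \<cdot>\<^bsub>C\<^esub> f = t \<cdot>\<^bsub>C\<^esub> g \<longrightarrow>
        (\<exists>!r. r \<in> hom C (tgt C f') (tgt C s) \<and> r \<cdot>\<^bsub>C\<^esub> f' = s \<and> r \<cdot>\<^bsub>C\<^esub> g' = t))"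

definition is_pullback :: "('o, 'm, 'z) cat_scheme \<Rightarrow> 'm \<Rightarrow> 'm \<Rightarrow> 'm \<Rightarrow> 'm \<Rightarrow> bool" where
  "is_pullback C f g f' g' \<longleftrightarrow> {f, g, f', g'} \<subseteq> Ar C \<and> tgt C f = tgt C g \<and>
     tgt C f' = src C f \<and> tgt C g' = src C g \<and> src C f' = src C g' \<and>
     f \<cdot>\<^bsub>C\<^esub> f' = g \<cdot>\<^bsub>C\<^esub> g' \<and>
     (\<forall>s \<in> Ar C. \<forall>t \<in> Ar C. tgt C s = src C f \<longrightarrow> tgt C t = src C g \<longrightarrow> src C s = src C t \<longrightarrow>
        f \<cdot>\<^bsub>C\<^esub> s = g \<cdot>\<^bsub>C\<^esub> t \<longrightarrow>
        (\<exists>!r. r \<in> hom C (src C s) (src C f') \<and> f' \<cdot>\<^bsub>C\<^esub> r = s \<and> g' \<cdot>\<^bsub>C\<^esub> r = t))"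

text \<open>\<open>(i, d) \<in> adm A\<close> says that \<open>0 \<rightarrow> X \<rightarrow> Y \<rightarrow> Z \<rightarrow> 0\<close>, with maps \<open>i\<close> and \<open>d\<close>, is an
  admissible exact sequence.\<close>

record ('o, 'm) exactcat = "('o, 'm) addcat" +
  adm :: "('m \<times> 'm) set"

definition inflations :: "('o, 'm, 'z) exactcat_scheme \<Rightarrow> 'm set" where
  "inflations A = {i. \<exists>d. (i, d) \<in> adm A}"

definition deflations :: "('o, 'm, 'z) exactcat_scheme \<Rightarrow> 'm set" where
  "deflations A = {d. \<exists>i. (i, d) \<in> adm A}"

text \<open>Quillen's axioms, in the reduced form that omits the redundant obscure axiom.\<close>

locale exact_category = additive_category A
  for A :: "('o, 'm, 'z) exactcat_scheme" (structure) +
  assumes adm_kernel: "(i, d) \<in> adm A \<Longrightarrow> is_kernel A i d"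
    and adm_cokernel: "(i, d) \<in> adm A \<Longrightarrow> is_cokernel A d i"
    and adm_iso: "\<lbrakk>(i, d) \<in> adm A; i' \<in> Ar A; d' \<in> Ar A; tgt A i' = src A d';
        a \<in> hom A (src A i) (src A i'); b \<in> hom A (tgt A i) (tgt A i'); c \<in> hom A (tgt A d) (tgt A d');
        iso_arr A a; iso_arr A b; iso_arr A c; b \<cdot> i = i' \<cdot> a; c \<cdot> d = d' \<cdot> b\<rbrakk>
        \<Longrightarrow> (i', d') \<in> adm A"
    and ident_inflation: "x \<in> Ob A \<Longrightarrow> ident A x \<in> inflations A"
    and ident_deflation: "x \<in> Ob A \<Longrightarrow> ident A x \<in> deflations A"
    and cmp_inflation: "\<lbrakk>i \<in> inflations A; j \<in> inflations A; tgt A i = src A j\<rbrakk>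
        \<Longrightarrow> j \<cdot> i \<in> inflations A"
    and cmp_deflation: "\<lbrakk>d \<in> deflations A; e \<in> deflations A; tgt A d = src A e\<rbrakk>
        \<Longrightarrow> e \<cdot> d \<in> deflations A"
    and pushout_inflation: "\<lbrakk>i \<in> inflations A; f \<in> Ar A; src A f = src A i\<rbrakk>
        \<Longrightarrow> \<exists>f' i'. is_pushout A i f f' i' \<and> i' \<in> inflations A"
    and pullback_deflation: "\<lbrakk>d \<in> deflations A; f \<in> Ar A; tgt A f = tgt A d\<rbrakk>
        \<Longrightarrow> \<exists>f' d'. is_pullback A d f f' d' \<and> d' \<in> deflations A"

definition weakly_idempotent_complete :: "('o, 'm, 'z) exactcat_scheme \<Rightarrow> bool" where
  "weakly_idempotent_complete A \<longleftrightarrow>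
     (\<forall>r \<in> Ar A. (\<exists>s \<in> hom A (tgt A r) (src A r). r \<cdot>\<^bsub>A\<^esub> s = ident A (tgt A r)) \<longrightarrow> r \<in> deflations A)"

definition projective_objects :: "('o, 'm, 'z) exactcat_scheme \<Rightarrow> 'o set" where
  "projective_objects A = {p \<in> Ob A. \<forall>d \<in> deflations A. \<forall>f \<in> hom A p (tgt A d).
     \<exists>g \<in> hom A p (src A d). d \<cdot>\<^bsub>A\<^esub> g = f}"


section \<open>Model structures\<close>

record 'm model =
  CoFib :: "'m set"
  Fib :: "'m set"
  Weq :: "'m set"

definition retract_of :: "('o, 'm, 'z) cat_scheme \<Rightarrow> 'm \<Rightarrow> 'm \<Rightarrow> bool" where
  "retract_of C f g \<longleftrightarrow> f \<in> Ar C \<and> g \<in> Ar C \<and>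
     (\<exists>a \<in> hom C (src C f) (src C g). \<exists>b \<in> hom C (tgt C f) (tgt C g).
      \<exists>r \<in> hom C (src C g) (src C f). \<exists>s \<in> hom C (tgt C g) (tgt C f).
        r \<cdot>\<^bsub>C\<^esub> a = ident C (src C f) \<and> s \<cdot>\<^bsub>C\<^esub> b = ident C (tgt C f) \<and>
        g \<cdot>\<^bsub>C\<^esub> a = b \<cdot>\<^bsub>C\<^esub> f \<and> f \<cdot>\<^bsub>C\<^esub> r = s \<cdot>\<^bsub>C\<^esub> g)"

definition has_lifting :: "('o, 'm, 'z) cat_scheme \<Rightarrow> 'm \<Rightarrow> 'm \<Rightarrow> bool" where
  "has_lifting C i p \<longleftrightarrow> (\<forall>u \<in> hom C (src C i) (src C p). \<forall>v \<in> hom C (tgt C i) (tgt C p).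
     p \<cdot>\<^bsub>C\<^esub> u = v \<cdot>\<^bsub>C\<^esub> i \<longrightarrow>
     (\<exists>h \<in> hom C (tgt C i) (src C p). h \<cdot>\<^bsub>C\<^esub> i = u \<and> p \<cdot>\<^bsub>C\<^esub> h = v))"

locale model_structure = category C
  for C :: "('o, 'm, 'z) cat_scheme" (structure) and M :: "'m model" +
  assumes CoFib_Ar: "CoFib M \<subseteq> Ar C" and Fib_Ar: "Fib M \<subseteq> Ar C" and Weq_Ar: "Weq M \<subseteq> Ar C"
    and Weq_cmp: "\<lbrakk>f \<in> Weq M; g \<in> Weq M; tgt C f = src C g\<rbrakk> \<Longrightarrow> g \<cdot> f \<in> Weq M"
    and Weq_cancel_left: "\<lbrakk>f \<in> Ar C; g \<in> Weq M; tgt C f = src C g; g \<cdot> f \<in> Weq M\<rbrakk> \<Longrightarrow> f \<in> Weq M"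
    and Weq_cancel_right: "\<lbrakk>f \<in> Weq M; g \<in> Ar C; tgt C f = src C g; g \<cdot> f \<in> Weq M\<rbrakk> \<Longrightarrow> g \<in> Weq M"
    and retract_CoFib: "\<lbrakk>retract_of C f g; g \<in> CoFib M\<rbrakk> \<Longrightarrow> f \<in> CoFib M"
    and retract_Fib: "\<lbrakk>retract_of C f g; g \<in> Fib M\<rbrakk> \<Longrightarrow> f \<in> Fib M"
    and retract_Weq: "\<lbrakk>retract_of C f g; g \<in> Weq M\<rbrakk> \<Longrightarrow> f \<in> Weq M"
    and lift_CoFib: "\<lbrakk>i \<in> CoFib M; p \<in> Fib M \<inter> Weq M\<rbrakk> \<Longrightarrow> has_lifting C i p"
    and lift_Fib: "\<lbrakk>i \<in> CoFib M \<inter> Weq M; p \<in> Fib M\<rbrakk> \<Longrightarrow> has_lifting C i p"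
    and factor_Fib: "f \<in> Ar C \<Longrightarrow>
        \<exists>i \<in> CoFib M \<inter> Weq M. \<exists>p \<in> Fib M. tgt C i = src C p \<and> p \<cdot> i = f \<and>
          src C i = src C f \<and> tgt C p = tgt C f"
    and factor_CoFib: "f \<in> Ar C \<Longrightarrow>
        \<exists>j \<in> CoFib M. \<exists>q \<in> Fib M \<inter> Weq M. tgt C j = src C q \<and> q \<cdot> j = f \<and>
          src C j = src C f \<and> tgt C q = tgt C f"

definition cofibrant_objects :: "('o, 'm, 'z) cat_scheme \<Rightarrow> 'm model \<Rightarrow> 'o set" where
  "cofibrant_objects C M = {x \<in> Ob C. \<exists>z. zero_object C z \<and> (\<exists>f \<in> hom C z x. f \<in> CoFib M)}"

definition fibrant_objects :: "('o, 'm, 'z) cat_scheme \<Rightarrow> 'm model \<Rightarrow> 'o set" where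
  "fibrant_objects C M = {x \<in> Ob C. \<exists>z. zero_object C z \<and> (\<exists>f \<in> hom C x z. f \<in> Fib M)}"

definition exact_model :: "('o, 'm, 'z) exactcat_scheme \<Rightarrow> 'm model \<Rightarrow> bool" where
  "exact_model A M \<longleftrightarrow> model_structure A M \<and>
     CoFib M = {i. \<exists>d. (i, d) \<in> adm A \<and> tgt A d \<in> cofibrant_objects A M} \<and>
     Fib M = {d. \<exists>i. (i, d) \<in> adm A \<and> src A i \<in> fibrant_objects A M}"

definition projective_model :: "('o, 'm, 'z) exactcat_scheme \<Rightarrow> 'm model \<Rightarrow> bool" where
  "projective_model A M \<longleftrightarrow> exact_model A M \<and> fibrant_objects A M = Ob A"

definition weakly_projective_model :: "('o, 'm, 'z) exactcat_scheme \<Rightarrow> 'm model \<Rightarrow> bool" where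
  "weakly_projective_model A M \<longleftrightarrow> model_structure A M \<and>
     CoFib M = {i. \<exists>d. (i, d) \<in> adm A \<and> tgt A d \<in> cofibrant_objects A M} \<and>
     Fib M \<inter> Weq M \<subseteq> deflations A \<and>
     fibrant_objects A M = Ob A"


section \<open>Localization and the homotopy category\<close>

text \<open>The category \<open>C[W\<inverse>]\<close> of Gabriel and Zisman. A path is a list of letters read from source to
  target, where \<open>Fwd f\<close> traverses an arrow \<open>f\<close> of \<open>C\<close> and \<open>Bwd w\<close> traverses \<open>w \<in> W\<close> backwards. An
  arrow of \<open>C[W\<inverse>]\<close> is a source, an equivalence class of paths and a target.\<close>

datatype 'm letter = Fwd 'm | Bwd 'm

fun is_path :: "('o, 'm, 'z) cat_scheme \<Rightarrow> 'm set \<Rightarrow> 'o \<Rightarrow> 'm letter list \<Rightarrow> 'o \<Rightarrow> bool" where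
  "is_path C W x [] y \<longleftrightarrow> x \<in> Ob C \<and> x = y"
| "is_path C W x (Fwd f # p) y \<longleftrightarrow> f \<in> Ar C \<and> src C f = x \<and> is_path C W (tgt C f) p y"
| "is_path C W x (Bwd w # p) y \<longleftrightarrow> w \<in> W \<and> w \<in> Ar C \<and> tgt C w = x \<and> is_path C W (src C w) p y"

inductive path_eq ::
  "('o, 'm, 'z) cat_scheme \<Rightarrow> 'm set \<Rightarrow> 'o \<Rightarrow> 'o \<Rightarrow> 'm letter list \<Rightarrow> 'm letter list \<Rightarrow> bool"
  for C W where
  path_refl: "is_path C W x p y \<Longrightarrow> path_eq C W x y p p"
| path_sym: "path_eq C W x y p q \<Longrightarrow> path_eq C W x y q p"
| path_trans: "\<lbrakk>path_eq C W x y p q; path_eq C W x y q r\<rbrakk> \<Longrightarrow> path_eq C W x y p r"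
| path_cong: "\<lbrakk>is_path C W x p u; path_eq C W u v q q'; is_path C W v r y\<rbrakk>
    \<Longrightarrow> path_eq C W x y (p @ q @ r) (p @ q' @ r)"
| path_cmp: "\<lbrakk>f \<in> hom C x y; g \<in> hom C y z\<rbrakk> \<Longrightarrow> path_eq C W x z [Fwd f, Fwd g] [Fwd (g \<cdot>\<^bsub>C\<^esub> f)]"
| path_ident: "x \<in> Ob C \<Longrightarrow> path_eq C W x x [Fwd (ident C x)] []"
| path_inv: "\<lbrakk>w \<in> W; w \<in> hom C x y\<rbrakk> \<Longrightarrow> path_eq C W x x [Fwd w, Bwd w] []"
| path_inv': "\<lbrakk>w \<in> W; w \<in> hom C x y\<rbrakk> \<Longrightarrow> path_eq C W y y [Bwd w, Fwd w] []"

type_synonym ('o, 'm) loc_arr = "'o \<times> 'm letter list set \<times> 'o"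

definition loc_class ::
  "('o, 'm, 'z) cat_scheme \<Rightarrow> 'm set \<Rightarrow> 'o \<Rightarrow> 'm letter list \<Rightarrow> 'o \<Rightarrow> ('o, 'm) loc_arr" where
  "loc_class C W x p y = (x, {q. path_eq C W x y p q}, y)"

definition localization ::
  "('o, 'm, 'z) cat_scheme \<Rightarrow> 'm set \<Rightarrow> ('o, ('o, 'm) loc_arr) cat" where
  "localization C W =
    \<lparr>Ob = Ob C,
     Ar = {loc_class C W x p y | x p y. is_path C W x p y},
     src = (\<lambda>(x, S, y). x),
     tgt = (\<lambda>(x, S, y). y),
     ident = (\<lambda>x. loc_class C W x [] x),
     cmp = (\<lambda>(y', T, z) (x, S, y). (x, {r. \<exists>p \<in> S. \<exists>q \<in> T. path_eq C W x z (p @ q) r}, z))\<rparr>"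

definition loc_arrow :: "('o, 'm, 'z) cat_scheme \<Rightarrow> 'm set \<Rightarrow> 'm \<Rightarrow> ('o, 'm) loc_arr" where
  "loc_arrow C W f = loc_class C W (src C f) [Fwd f] (tgt C f)"

definition Ho :: "('o, 'm, 'z) cat_scheme \<Rightarrow> 'm model \<Rightarrow> ('o, ('o, 'm) loc_arr) cat" where
  "Ho C M = localization C (Weq M)"


section \<open>The additive quotient\<close>

text \<open>\<open>quot_class A P f\<close> consists of the arrows parallel to \<open>f\<close> whose difference with \<open>f\<close> factors
  through an object of \<open>P\<close>; these classes are the arrows of the quotient by \<open>P\<close>.\<close>

definition quot_class :: "('o, 'm, 'z) addcat_scheme \<Rightarrow> 'o set \<Rightarrow> 'm \<Rightarrow> 'm set" where
  "quot_class A P f = {g \<in> hom A (src A f) (tgt A f).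
     \<exists>p \<in> P. \<exists>a \<in> hom A (src A f) p. \<exists>b \<in> hom A p (tgt A f). f \<oplus>\<^bsub>A\<^esub> neg A g = b \<cdot>\<^bsub>A\<^esub> a}"

definition add_quotient ::
  "('o, 'm, 'z) addcat_scheme \<Rightarrow> 'o set \<Rightarrow> 'o set \<Rightarrow> ('o, 'm set) cat" where
  "add_quotient A X P =
    \<lparr>Ob = X,
     Ar = {quot_class A P f | f. f \<in> Ar A \<and> src A f \<in> X \<and> tgt A f \<in> X},
     src = (\<lambda>S. the_elem (src A ` S)),
     tgt = (\<lambda>S. the_elem (tgt A ` S)),
     ident = (\<lambda>x. quot_class A P (ident A x)),
     cmp = (\<lambda>T S. \<Union>{quot_class A P (g \<cdot>\<^bsub>A\<^esub> f) | f g. f \<in> S \<and> g \<in> T})\<rparr>"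

abbreviation stable_category ::
  "('o, 'm, 'z) exactcat_scheme \<Rightarrow> 'm model \<Rightarrow> ('o, 'm set) cat" where
  "stable_category A M \<equiv> add_quotient A (cofibrant_objects A M) (projective_objects A)"

definition stable_to_Ho ::
  "('o, 'm, 'z) exactcat_scheme \<Rightarrow> 'm model \<Rightarrow> ('o, 'm set, 'o, ('o, 'm) loc_arr) funct" where
  "stable_to_Ho A M =
    \<lparr>fo = (\<lambda>x. x), fm = (\<lambda>S. the_elem (loc_arrow A (Weq M) ` S))\<rparr>"


section \<open>Loop functor and left triangles\<close>

text \<open>A choice of admissible exact sequences \<open>0 \<rightarrow> \<Omega>x \<rightarrow> P\<^sub>x \<rightarrow> x \<rightarrow> 0\<close>, with maps \<open>\<iota> x\<close> and \<open>\<pi> x\<close>,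
  for all objects \<open>x \<in> X\<close>.\<close>

definition loop_choice ::
  "('o, 'm, 'z) exactcat_scheme \<Rightarrow> 'o set \<Rightarrow> ('o \<Rightarrow> 'm) \<Rightarrow> ('o \<Rightarrow> 'm) \<Rightarrow> bool" where
  "loop_choice A X \<iota> \<pi> \<longleftrightarrow> (\<forall>x \<in> X. (\<iota> x, \<pi> x) \<in> adm A \<and> tgt A (\<pi> x) = x \<and>
     src A (\<pi> x) \<in> projective_objects A)"

definition loop_lift ::
  "('o, 'm, 'z) exactcat_scheme \<Rightarrow> ('o \<Rightarrow> 'm) \<Rightarrow> ('o \<Rightarrow> 'm) \<Rightarrow> 'm \<Rightarrow> 'm \<Rightarrow> bool" where
  "loop_lift A \<iota> \<pi> f g \<longleftrightarrow> (let x = src A f; y = tgt A f in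
     g \<in> hom A (src A (\<iota> x)) (src A (\<iota> y)) \<and>
     (\<exists>h \<in> hom A (src A (\<pi> x)) (src A (\<pi> y)).
        \<pi> y \<cdot>\<^bsub>A\<^esub> h = f \<cdot>\<^bsub>A\<^esub> \<pi> x \<and> \<iota> y \<cdot>\<^bsub>A\<^esub> g = h \<cdot>\<^bsub>A\<^esub> \<iota> x))"

definition loop_functor ::
  "('o, 'm, 'z) exactcat_scheme \<Rightarrow> ('o \<Rightarrow> 'm) \<Rightarrow> ('o \<Rightarrow> 'm) \<Rightarrow> ('o, 'm set, 'o, 'm set) funct" where
  "loop_functor A \<iota> \<pi> =
    \<lparr>fo = (\<lambda>x. src A (\<iota> x)),
     fm = (\<lambda>S. \<Union>{quot_class A (projective_objects A) g | f g. f \<in> S \<and> loop_lift A \<iota> \<pi> f g})\<rparr>"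

text \<open>A left triangle \<open>\<Omega>z \<rightarrow> x \<rightarrow> y \<rightarrow> z\<close> is recorded as its triple of arrows \<open>(h, f, g)\<close>.\<close>

definition left_sequence :: "('o, 'm, 'z) cat_scheme \<Rightarrow> ('o, 'm, 'o, 'm) funct \<Rightarrow> 'm \<Rightarrow> 'm \<Rightarrow> 'm \<Rightarrow> bool" where
  "left_sequence C \<Omega> h f g \<longleftrightarrow> h \<in> Ar C \<and> f \<in> Ar C \<and> g \<in> Ar C \<and>
     src C h = fo \<Omega> (tgt C g) \<and> tgt C h = src C f \<and> tgt C f = src C g"

text \<open>The connecting arrow \<open>\<Omega>z \<rightarrow> x\<close> of \<open>0 \<rightarrow> x \<rightarrow> y \<rightarrow> z \<rightarrow> 0\<close> carries no sign; this is the
  convention under which left triangles rotate to \<open>(- \<Omega>g, h, f)\<close>.\<close>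

definition connecting ::
  "('o, 'm, 'z) exactcat_scheme \<Rightarrow> ('o \<Rightarrow> 'm) \<Rightarrow> ('o \<Rightarrow> 'm) \<Rightarrow> 'm \<Rightarrow> 'm \<Rightarrow> 'm \<Rightarrow> bool" where
  "connecting A \<iota> \<pi> i d k \<longleftrightarrow> (let z = tgt A d in
     k \<in> hom A (src A (\<iota> z)) (src A i) \<and>
     (\<exists>l \<in> hom A (src A (\<pi> z)) (src A d). d \<cdot>\<^bsub>A\<^esub> l = \<pi> z \<and> i \<cdot>\<^bsub>A\<^esub> k = l \<cdot>\<^bsub>A\<^esub> \<iota> z))"

definition stable_left_triangles ::
  "('o, 'm, 'z) exactcat_scheme \<Rightarrow> 'm model \<Rightarrow> ('o \<Rightarrow> 'm) \<Rightarrow> ('o \<Rightarrow> 'm) \<Rightarrow>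
    ('m set \<times> 'm set \<times> 'm set) set" where
  "stable_left_triangles A M \<iota> \<pi> =
    (let X = cofibrant_objects A M; Q = stable_category A M; \<Omega> = loop_functor A \<iota> \<pi>;
         q = quot_class A (projective_objects A) in
     {(h, f, g). left_sequence Q \<Omega> h f g \<and>
       (\<exists>i d k a b c. (i, d) \<in> adm A \<and> src A i \<in> X \<and> tgt A i \<in> X \<and> tgt A d \<in> X \<and>
          connecting A \<iota> \<pi> i d k \<and>
          a \<in> hom Q (src Q f) (src A i) \<and> b \<in> hom Q (tgt Q f) (tgt A i) \<and> c \<in> hom Q (tgt Q g) (tgt A d) \<and>
          iso_arr Q a \<and> iso_arr Q b \<and> iso_arr Q c \<and>
          a \<cdot>\<^bsub>Q\<^esub> h = q k \<cdot>\<^bsub>Q\<^esub> fm \<Omega> c \<and> b \<cdot>\<^bsub>Q\<^esub> f = q i \<cdot>\<^bsub>Q\<^esub> a \<and> c \<cdot>\<^bsub>Q\<^esub> g = q d \<cdot>\<^bsub>Q\<^esub> b)})"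

text \<open>Transport of a loop functor and left triangles from \<open>S\<close> to \<open>T\<close> along an equivalence
  \<open>F : S \<rightarrow> T\<close> with quasi-inverse \<open>G\<close> and \<open>\<eta> : 1 \<rightarrow> GF\<close>. The loop functor of \<open>T\<close> is \<open>F\<Omega>G\<close>, and a
  sequence \<open>(h, f, g)\<close> in \<open>T\<close> is a left triangle if its image under \<open>G\<close> is one, once the source
  \<open>GF\<Omega>Gz\<close> of \<open>Gh\<close> has been identified with \<open>\<Omega>Gz\<close> through \<open>\<eta>\<close>.\<close>

definition transport_left_triangles :: "('o, 'm, 'y) cat_scheme \<Rightarrow> ('p, 'n, 'z) cat_scheme \<Rightarrow>
    ('o, 'm, 'p, 'n) funct \<Rightarrow> ('p, 'n, 'o, 'm) funct \<Rightarrow> ('o \<Rightarrow> 'm) \<Rightarrow>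
    ('o, 'm, 'o, 'm) funct \<Rightarrow> ('m \<times> 'm \<times> 'm) set \<Rightarrow> ('n \<times> 'n \<times> 'n) set" where
  "transport_left_triangles S T F G \<eta> \<Omega> \<Delta> =
    {(h, f, g). left_sequence T (fcomp F (fcomp \<Omega> G)) h f g \<and>
       (fm G h \<cdot>\<^bsub>S\<^esub> \<eta> (fo \<Omega> (fo G (tgt T g))), fm G f, fm G g) \<in> \<Delta>}"

text \<open>The left triangulated structure of the homotopy category. It depends on the chosen \<open>P\<^sub>x \<rightarrow> x\<close>
  and on a quasi-inverse of \<open>\<C>/\<P> \<rightarrow> Ho(\<A>)\<close>, hence the formulation as a predicate.\<close>

definition Ho_left_triangulation ::
  "('o, 'm, 'z) exactcat_scheme \<Rightarrow> 'm model \<Rightarrow>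
    ('o, ('o, 'm) loc_arr, 'o, ('o, 'm) loc_arr) funct \<Rightarrow>
    (('o, 'm) loc_arr \<times> ('o, 'm) loc_arr \<times> ('o, 'm) loc_arr) set \<Rightarrow> bool" where
  "Ho_left_triangulation A M \<Omega> \<Delta> \<longleftrightarrow>
    (let Q = stable_category A M; F = stable_to_Ho A M in
     \<exists>\<iota> \<pi> G \<eta>. loop_choice A (cofibrant_objects A M) \<iota> \<pi> \<and>
       quasi_inverse Q (Ho A M) F G \<and> nat_iso Q Q fid (fcomp G F) \<eta> \<and>
       \<Omega> = fcomp F (fcomp (loop_functor A \<iota> \<pi>) G) \<and>
       \<Delta> = transport_left_triangles Q (Ho A M) F G \<eta>
             (loop_functor A \<iota> \<pi>) (stable_left_triangles A M \<iota> \<pi>))"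


section \<open>Triangulated categories\<close>

definition triangle_sequence :: "('o, 'm, 'z) cat_scheme \<Rightarrow> ('o, 'm, 'o, 'm) funct \<Rightarrow> 'm \<Rightarrow> 'm \<Rightarrow> 'm \<Rightarrow> bool" where
  "triangle_sequence T \<Sigma> u v w \<longleftrightarrow> u \<in> Ar T \<and> v \<in> Ar T \<and> w \<in> Ar T \<and>
     tgt T u = src T v \<and> tgt T v = src T w \<and> tgt T w = fo \<Sigma> (src T u)"

locale triangulated_category = additive_category T
  for T :: "('o, 'm, 'z) addcat_scheme" (structure)
    and \<Sigma> :: "('o, 'm, 'o, 'm) funct" and \<Delta> :: "('m \<times> 'm \<times> 'm) set" +
  assumes susp_equivalence: "is_equivalence T T \<Sigma>"
    and susp_additive: "\<lbrakk>f \<in> hom T x y; g \<in> hom T x y\<rbrakk> \<Longrightarrow> fm \<Sigma> (f \<oplus> g) = fm \<Sigma> f \<oplus> fm \<Sigma> g"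
    and dist_sequence: "(u, v, w) \<in> \<Delta> \<Longrightarrow> triangle_sequence T \<Sigma> u v w"
    and dist_iso: "\<lbrakk>(u, v, w) \<in> \<Delta>; triangle_sequence T \<Sigma> u' v' w';
        a \<in> hom T (src T u) (src T u'); b \<in> hom T (tgt T u) (tgt T u'); c \<in> hom T (tgt T v) (tgt T v');
        iso_arr T a; iso_arr T b; iso_arr T c;
        b \<cdot> u = u' \<cdot> a; c \<cdot> v = v' \<cdot> b; fm \<Sigma> a \<cdot> w = w' \<cdot> c\<rbrakk> \<Longrightarrow> (u', v', w') \<in> \<Delta>"
    and dist_ident: "\<lbrakk>x \<in> Ob T; zero_object T z\<rbrakk> \<Longrightarrow> (ident T x, zer T x z, zer T z (fo \<Sigma> x)) \<in> \<Delta>"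
    and dist_complete: "u \<in> Ar T \<Longrightarrow> \<exists>v w. (u, v, w) \<in> \<Delta>"
    and dist_rotate: "triangle_sequence T \<Sigma> u v w \<Longrightarrow> (u, v, w) \<in> \<Delta> \<longleftrightarrow> (v, w, neg T (fm \<Sigma> u)) \<in> \<Delta>"
    and dist_morphism: "\<lbrakk>(u, v, w) \<in> \<Delta>; (u', v', w') \<in> \<Delta>;
        a \<in> hom T (src T u) (src T u'); b \<in> hom T (tgt T u) (tgt T u'); b \<cdot> u = u' \<cdot> a\<rbrakk> \<Longrightarrow>
        \<exists>c \<in> hom T (tgt T v) (tgt T v'). c \<cdot> v = v' \<cdot> b \<and> fm \<Sigma> a \<cdot> w = w' \<cdot> c"
    and octahedron: "\<lbrakk>tgt T u = src T v;
        (u, i, j) \<in> \<Delta>; (v, k, l) \<in> \<Delta>; (v \<cdot> u, m, n) \<in> \<Delta>\<rbrakk> \<Longrightarrow>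
        \<exists>f \<in> hom T (tgt T i) (tgt T m). \<exists>g \<in> hom T (tgt T m) (tgt T k).
          f \<cdot> i = m \<cdot> v \<and> n \<cdot> f = j \<and> g \<cdot> m = k \<and> l \<cdot> g = fm \<Sigma> u \<cdot> n \<and>
          (f, g, fm \<Sigma> i \<cdot> l) \<in> \<Delta>"

text \<open>The addition on the arrows of an additive category is determined by the underlying category,
  so it can be quantified existentially.\<close>

definition is_triangulation :: "('o, 'm) cat \<Rightarrow> ('o, 'm, 'o, 'm) funct \<Rightarrow> ('m \<times> 'm \<times> 'm) set \<Rightarrow> bool" where
  "is_triangulation C \<Sigma> \<Delta> \<longleftrightarrow>
    (\<exists>T :: ('o, 'm) addcat. cat.truncate T = C \<and> triangulated_category T \<Sigma> \<Delta>)"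

text \<open>A left triangulated structure \<open>(\<Omega>, \<Delta>)\<close> is triangulated: \<open>\<Omega>\<close> is an autoequivalence, and for a
  quasi-inverse \<open>\<Sigma>\<close> with \<open>\<theta> : \<Omega>\<Sigma> \<rightarrow> 1\<close> the sequences \<open>(u, v, w)\<close> for which \<open>\<Omega>w\<close>, followed by \<open>\<theta>\<close>,
  and \<open>u\<close>, \<open>v\<close> form a left triangle are the distinguished triangles of a triangulation. (Replacing
  \<open>\<Sigma>\<close> or \<open>\<theta>\<close> yields isomorphic data.)\<close>

definition left_triangulation_is_triangulated ::
  "('o, 'm) cat \<Rightarrow> ('o, 'm, 'o, 'm) funct \<Rightarrow> ('m \<times> 'm \<times> 'm) set \<Rightarrow> bool" where
  "left_triangulation_is_triangulated C \<Omega> \<Delta> \<longleftrightarrow> is_equivalence C C \<Omega> \<and>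
    (\<forall>\<Sigma> \<theta>. quasi_inverse C C \<Omega> \<Sigma> \<longrightarrow> nat_iso C C (fcomp \<Omega> \<Sigma>) fid \<theta> \<longrightarrow>
      is_triangulation C \<Sigma>
        {(u, v, w). triangle_sequence C \<Sigma> u v w \<and> (\<theta> (src C u) \<cdot>\<^bsub>C\<^esub> fm \<Omega> w, u, v) \<in> \<Delta>})"

end

theory Submission
  imports Defs
begin

text \<open>The equivalence of the two notions is immediate: a weakly projective structure has only fibrant
  objects, and in an exact structure all fibrations are deflations.

  For a projective structure, trivial objects are injective relative to inflations with cofibrant
  cokernel, because \<open>I \<rightarrow> 0\<close> is a trivial fibration when \<open>I\<close> is trivial. A cofibration from a
  cofibrant \<open>x\<close> into a trivial object therefore embeds \<open>x\<close> into a projective object that is also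
  relatively injective, so the cofibrant objects form a Frobenius category, and its stable category is
  triangulated. The only point that does not come directly from the lifting axioms is that syzygies of
  cofibrant objects are cofibrant. The triangulation is carried to the homotopy category along the
  equivalence whose inverse is cofibrant replacement.\<close>

section \<open>Categories and equivalences\<close>

text \<open>The triangulation is claimed for every choice of syzygies, of a quasi-inverse
  \<open>G\<close> with unit \<eta>, of a suspension \<Sigma> and of \<theta>. No suspension is
  therefore built on the stable category. Its triangles stay in left form, axiomatized in
  \<open>loop_category\<close> over a fully faithful additive loop functor, and
  \<open>loop_transport\<close> carries them over along \<psi>, an isomorphism from
  \<Omega>G\<Sigma> to G composed from \<eta> and \<theta>. Two points shape these axioms. Cones are
  unique only up to noncanonical isomorphism: an octahedron is built for one convenient choice of
  cones, and cones are compared by a square-zero argument in place of a five lemma for Hom functors.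
  Inverse rotation has no suspension to refer to and speaks instead of an object \<open>s\<close>
  whose loop object is isomorphic to the given one. On the homological side, the compatibilities of
  \<Omega> with connecting arrows reduce to one uniqueness statement, \<open>lifts_unique\<close>.
  Signs enter in the pullback that gives a rotation and in the pushout that gives its
  inverse.\<close>

declare hom_def [simp]

context category
begin

text \<open>Hom-set membership is unfolded everywhere, so the locale axioms are restated through
  \<open>Ar\<close>, \<open>src\<close> and \<open>tgt\<close>, where composability becomes a goal
  for the simplifier.\<close>

lemma cmp_Ar [simp]: "\<lbrakk>f \<in> Ar C; g \<in> Ar C; tgt C f = src C g\<rbrakk> \<Longrightarrow> g \<cdot> f \<in> Ar C"
  and src_cmp [simp]: "\<lbrakk>f \<in> Ar C; g \<in> Ar C; tgt C f = src C g\<rbrakk> \<Longrightarrow> src C (g \<cdot> f) = src C f"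
  and tgt_cmp [simp]: "\<lbrakk>f \<in> Ar C; g \<in> Ar C; tgt C f = src C g\<rbrakk> \<Longrightarrow> tgt C (g \<cdot> f) = tgt C g"
  using cmp_hom[of f "src C f" "tgt C f" g "tgt C g"] by auto

lemma ident_Ar [simp]: "x \<in> Ob C \<Longrightarrow> ident C x \<in> Ar C"
  and src_ident [simp]: "x \<in> Ob C \<Longrightarrow> src C (ident C x) = x"
  and tgt_ident [simp]: "x \<in> Ob C \<Longrightarrow> tgt C (ident C x) = x"
  using ident_hom[of x] by auto

lemma cmp_ident [simp]: "\<lbrakk>f \<in> Ar C; src C f = x\<rbrakk> \<Longrightarrow> f \<cdot> ident C x = f"
  and ident_cmp [simp]: "\<lbrakk>f \<in> Ar C; tgt C f = y\<rbrakk> \<Longrightarrow> ident C y \<cdot> f = f"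
  using ident_right[of f "src C f" "tgt C f"] ident_left[of f "src C f" "tgt C f"] by auto

lemma assoc [simp]: "\<lbrakk>f \<in> Ar C; g \<in> Ar C; h \<in> Ar C; tgt C f = src C g; tgt C g = src C h\<rbrakk>
    \<Longrightarrow> (h \<cdot> g) \<cdot> f = h \<cdot> (g \<cdot> f)"
  using cmp_assoc[of f "src C f" "tgt C f" g "tgt C g" h "tgt C h"] by auto

lemma src_in_Ob [simp]: "f \<in> Ar C \<Longrightarrow> src C f \<in> Ob C"
  and tgt_in_Ob [simp]: "f \<in> Ar C \<Longrightarrow> tgt C f \<in> Ob C"
  by (simp_all add: src_Ob tgt_Ob)

text \<open>Composites are normalized to the right, so an equation for \<open>g \<cdot> f\<close>
  does not match inside a longer composite. Instantiated with that equation, this is the rewrite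
  rule with a tail \<open>t\<close>.\<close>

lemma reassoc: "\<lbrakk>g \<cdot> f = k; t \<in> Ar C; f \<in> Ar C; g \<in> Ar C; tgt C t = src C f; tgt C f = src C g\<rbrakk>
    \<Longrightarrow> g \<cdot> (f \<cdot> t) = k \<cdot> t"
  by (metis assoc)

lemma iso_arrI: "\<lbrakk>f \<in> Ar C; g \<in> Ar C; src C g = tgt C f; tgt C g = src C f;
    g \<cdot> f = ident C (src C f); f \<cdot> g = ident C (tgt C f)\<rbrakk> \<Longrightarrow> iso_arr C f"
  unfolding iso_arr_def by auto

lemma iso_arrE:
  assumes "iso_arr C f"
  obtains g where "f \<in> Ar C" "g \<in> Ar C" "src C g = tgt C f" "tgt C g = src C f"
    "g \<cdot> f = ident C (src C f)" "f \<cdot> g = ident C (tgt C f)" "iso_arr C g"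
proof -
  obtain g where "f \<in> Ar C" "g \<in> Ar C" "src C g = tgt C f" "tgt C g = src C f"
    "g \<cdot> f = ident C (src C f)" "f \<cdot> g = ident C (tgt C f)"
    using assms unfolding iso_arr_def by auto
  then show ?thesis using that iso_arrI[of g f] by simp
qed

lemma iso_ident [simp]: "x \<in> Ob C \<Longrightarrow> iso_arr C (ident C x)"
  by (rule iso_arrI[of _ "ident C x"]) auto

lemma iso_cmp: assumes "iso_arr C f" "iso_arr C g" "tgt C f = src C g" shows "iso_arr C (g \<cdot> f)"
proof -
  obtain f' where f: "f \<in> Ar C" "f' \<in> Ar C" "src C f' = tgt C f" "tgt C f' = src C f"
    "f' \<cdot> f = ident C (src C f)" "f \<cdot> f' = ident C (tgt C f)" using iso_arrE[OF assms(1)] by blast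
  obtain g' where g: "g \<in> Ar C" "g' \<in> Ar C" "src C g' = tgt C g" "tgt C g' = src C g"
    "g' \<cdot> g = ident C (src C g)" "g \<cdot> g' = ident C (tgt C g)" using iso_arrE[OF assms(2)] by blast
  have "g' \<cdot> (g \<cdot> f) = f" using f g assms(3) by (simp add: reassoc[OF g(5)])
  moreover have "f \<cdot> (f' \<cdot> g') = g'" using f g assms(3) by (simp add: reassoc[OF f(6)])
  ultimately show ?thesis using f g assms(3) by (intro iso_arrI[of _ "f' \<cdot> g'"]) auto
qed

lemma iso_cancel_left:
  assumes "iso_arr C k" "f \<in> Ar C" "g \<in> Ar C" "tgt C f = src C k" "tgt C g = src C k" "k \<cdot> f = k \<cdot> g"
  shows "f = g"
proof -
  obtain k' where k: "k \<in> Ar C" "k' \<in> Ar C" "src C k' = tgt C k" "tgt C k' = src C k"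
    "k' \<cdot> k = ident C (src C k)" using iso_arrE[OF assms(1)] by blast
  have "k' \<cdot> (k \<cdot> f) = f" "k' \<cdot> (k \<cdot> g) = g"
    using k(1-4) assms(2-5) by (simp_all add: reassoc[OF k(5)])
  then show ?thesis using assms(6) by metis
qed

lemma iso_cancel_right:
  assumes "iso_arr C k" "f \<in> Ar C" "g \<in> Ar C" "src C f = tgt C k" "src C g = tgt C k" "f \<cdot> k = g \<cdot> k"
  shows "f = g"
proof -
  obtain k' where k: "k \<in> Ar C" "k' \<in> Ar C" "src C k' = tgt C k" "tgt C k' = src C k"
    "k \<cdot> k' = ident C (tgt C k)" using iso_arrE[OF assms(1)] by blast
  have "(f \<cdot> k) \<cdot> k' = f" "(g \<cdot> k) \<cdot> k' = g" using k assms(2-5) by simp_all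
  then show ?thesis using assms(6) by metis
qed

text \<open>With \<open>k\<close> inverse to \<open>g \<cdot> f\<close> and \<open>l\<close> inverse
  to \<open>f \<cdot> g\<close>, the arrows \<open>k \<cdot> g\<close> and
  \<open>g \<cdot> l\<close> are a left and a right inverse of \<open>f\<close>, hence equal. This
  serves comparisons whose composites are isomorphisms but perhaps not identities.\<close>

lemma iso_two_sided:
  assumes "f \<in> Ar C" "g \<in> Ar C" "src C g = tgt C f" "tgt C g = src C f"
    "iso_arr C (g \<cdot> f)" "iso_arr C (f \<cdot> g)"
  shows "iso_arr C f"
proof -
  obtain k where "k \<in> Ar C" "src C k = tgt C (g \<cdot> f)" "tgt C k = src C (g \<cdot> f)"
      "k \<cdot> (g \<cdot> f) = ident C (src C (g \<cdot> f))" by (rule iso_arrE[OF assms(5)])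
  then have k: "k \<in> Ar C" "src C k = src C f" "tgt C k = src C f"
      "k \<cdot> (g \<cdot> f) = ident C (src C f)" using assms(1-4) by simp_all
  obtain l where "l \<in> Ar C" "src C l = tgt C (f \<cdot> g)" "tgt C l = src C (f \<cdot> g)"
      "(f \<cdot> g) \<cdot> l = ident C (tgt C (f \<cdot> g))" by (rule iso_arrE[OF assms(6)])
  then have l: "l \<in> Ar C" "src C l = tgt C f" "tgt C l = tgt C f"
      "f \<cdot> (g \<cdot> l) = ident C (tgt C f)" using assms(1-4) by simp_all
  have "k \<cdot> g = (k \<cdot> g) \<cdot> (f \<cdot> (g \<cdot> l))" using k l assms(1-4) by simp
  also have "\<dots> = (k \<cdot> (g \<cdot> f)) \<cdot> (g \<cdot> l)" using k(1-3) l(1-3) assms(1-4) by simp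
  also have "\<dots> = g \<cdot> l" unfolding k(4) using l assms(1-4) by simp
  finally have e: "k \<cdot> g = g \<cdot> l" .
  show ?thesis
  proof (rule iso_arrI[of f "k \<cdot> g"])
    show "f \<cdot> (k \<cdot> g) = ident C (tgt C f)" unfolding e by (rule l(4))
  qed (use k assms in simp_all)
qed

definition arr_inv :: "'m \<Rightarrow> 'm" where
  "arr_inv f = (SOME g. g \<in> hom C (tgt C f) (src C f) \<and> g \<cdot> f = ident C (src C f) \<and> f \<cdot> g = ident C (tgt C f))"

lemma arr_inv:
  assumes "iso_arr C f"
  shows "arr_inv f \<in> Ar C" "src C (arr_inv f) = tgt C f" "tgt C (arr_inv f) = src C f"
    "arr_inv f \<cdot> f = ident C (src C f)" "f \<cdot> arr_inv f = ident C (tgt C f)" "iso_arr C (arr_inv f)"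
proof -
  have "\<exists>g. g \<in> hom C (tgt C f) (src C f) \<and> g \<cdot> f = ident C (src C f) \<and> f \<cdot> g = ident C (tgt C f)"
    using assms unfolding iso_arr_def by auto
  from someI_ex[OF this] show *: "arr_inv f \<in> Ar C" "src C (arr_inv f) = tgt C f" "tgt C (arr_inv f) = src C f"
    "arr_inv f \<cdot> f = ident C (src C f)" "f \<cdot> arr_inv f = ident C (tgt C f)"
    unfolding arr_inv_def by auto
  show "iso_arr C (arr_inv f)" using assms * by (intro iso_arrI[of _ f]) (auto simp: iso_arr_def)
qed

lemma iso_Ar: "iso_arr C f \<Longrightarrow> f \<in> Ar C" by (simp add: iso_arr_def)

lemma arr_inv_simps:
  assumes "iso_arr C f" "t \<in> Ar C"
  shows "tgt C t = src C f \<Longrightarrow> arr_inv f \<cdot> (f \<cdot> t) = t"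
    and "tgt C t = tgt C f \<Longrightarrow> f \<cdot> (arr_inv f \<cdot> t) = t"
  using arr_inv(1-3)[OF assms(1)] iso_Ar[OF assms(1)] assms(2)
  by (simp_all add: reassoc[OF arr_inv(4)[OF assms(1)]] reassoc[OF arr_inv(5)[OF assms(1)]])

end

section \<open>Functors, natural isomorphisms and equivalences\<close>

lemma is_functorD:
  assumes "is_functor S T F"
  shows "category S" "category T" "x \<in> Ob S \<Longrightarrow> fo F x \<in> Ob T"
    "f \<in> Ar S \<Longrightarrow> fm F f \<in> Ar T" "f \<in> Ar S \<Longrightarrow> src T (fm F f) = fo F (src S f)"
    "f \<in> Ar S \<Longrightarrow> tgt T (fm F f) = fo F (tgt S f)"
    "x \<in> Ob S \<Longrightarrow> fm F (ident S x) = ident T (fo F x)"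
    "\<lbrakk>f \<in> Ar S; g \<in> Ar S; tgt S f = src S g\<rbrakk> \<Longrightarrow> fm F (g \<cdot>\<^bsub>S\<^esub> f) = fm F g \<cdot>\<^bsub>T\<^esub> fm F f"
  using assms unfolding is_functor_def by auto

lemma nat_isoD:
  assumes "nat_iso S T F G \<eta>"
  shows "is_functor S T F" "is_functor S T G"
    "x \<in> Ob S \<Longrightarrow> \<eta> x \<in> Ar T" "x \<in> Ob S \<Longrightarrow> src T (\<eta> x) = fo F x" "x \<in> Ob S \<Longrightarrow> tgt T (\<eta> x) = fo G x"
    "x \<in> Ob S \<Longrightarrow> iso_arr T (\<eta> x)"
    "f \<in> Ar S \<Longrightarrow> \<eta> (tgt S f) \<cdot>\<^bsub>T\<^esub> fm F f = fm G f \<cdot>\<^bsub>T\<^esub> \<eta> (src S f)"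
  using assms unfolding nat_iso_def by auto

lemma fo_fid [simp]: "fo fid x = x" and fm_fid [simp]: "fm fid f = f"
  by (simp_all add: fid_def)

lemma fo_fcomp [simp]: "fo (fcomp G F) x = fo G (fo F x)" and fm_fcomp [simp]: "fm (fcomp G F) f = fm G (fm F f)"
  by (simp_all add: fcomp_def)

lemma functor_fid: "category C \<Longrightarrow> is_functor C C fid"
  by (auto simp: is_functor_def category.src_in_Ob category.tgt_in_Ob)

lemma functor_fcomp: "is_functor S T F \<Longrightarrow> is_functor T U G \<Longrightarrow> is_functor S U (fcomp G F)"
  unfolding is_functor_def by simp

lemma functor_iso:
  assumes F: "is_functor S T F" and f: "iso_arr S f" shows "iso_arr T (fm F f)"
proof -
  interpret S: category S using is_functorD(1)[OF F] .
  interpret T: category T using is_functorD(2)[OF F] .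
  obtain g where g: "f \<in> Ar S" "g \<in> Ar S" "src S g = tgt S f" "tgt S g = src S f"
    "g \<cdot>\<^bsub>S\<^esub> f = ident S (src S f)" "f \<cdot>\<^bsub>S\<^esub> g = ident S (tgt S f)" using S.iso_arrE[OF f] by blast
  show ?thesis
    using is_functorD(4-8)[OF F] g
    by (intro T.iso_arrI[of "fm F f" "fm F g"]) (simp_all, metis S.src_in_Ob, metis S.tgt_in_Ob)
qed

lemma nat_iso_inv:
  assumes n: "nat_iso S T F G \<eta>"
  shows "nat_iso S T G F (\<lambda>x. category.arr_inv T (\<eta> x))"
proof -
  note F = nat_isoD(1)[OF n] and G = nat_isoD(2)[OF n] and N = nat_isoD(3-)[OF n]
  interpret S: category S using is_functorD(1)[OF F] .
  interpret T: category T using is_functorD(2)[OF F] .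
  have "T.arr_inv (\<eta> (tgt S f)) \<cdot>\<^bsub>T\<^esub> fm G f = fm F f \<cdot>\<^bsub>T\<^esub> T.arr_inv (\<eta> (src S f))" if f: "f \<in> Ar S" for f
  proof (rule T.iso_cancel_right[of "\<eta> (src S f)"])
    have i: "iso_arr T (\<eta> (tgt S f))" "iso_arr T (\<eta> (src S f))" using N f by auto
    note I = T.arr_inv[OF i(1)] T.arr_inv[OF i(2)]
    have "(T.arr_inv (\<eta> (tgt S f)) \<cdot>\<^bsub>T\<^esub> fm G f) \<cdot>\<^bsub>T\<^esub> \<eta> (src S f)
        = T.arr_inv (\<eta> (tgt S f)) \<cdot>\<^bsub>T\<^esub> (\<eta> (tgt S f) \<cdot>\<^bsub>T\<^esub> fm F f)"
      using N f I is_functorD(3-6)[OF F] is_functorD(3-6)[OF G] by simp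
    also have "\<dots> = fm F f" using N f is_functorD(3-6)[OF F]
      by (intro T.arr_inv_simps) auto
    finally show "(T.arr_inv (\<eta> (tgt S f)) \<cdot>\<^bsub>T\<^esub> fm G f) \<cdot>\<^bsub>T\<^esub> \<eta> (src S f)
        = (fm F f \<cdot>\<^bsub>T\<^esub> T.arr_inv (\<eta> (src S f))) \<cdot>\<^bsub>T\<^esub> \<eta> (src S f)"
      using N f I is_functorD(3-6)[OF F] by simp
  qed (use N f T.arr_inv is_functorD(3-6)[OF F] is_functorD(3-6)[OF G] in \<open>auto\<close>)
  then show ?thesis unfolding nat_iso_def using F G N T.arr_inv by auto
qed

text \<open>Exchanging the two functors makes the properties below available for \<open>G\<close> as
  well as for \<open>F\<close>.\<close>

lemma quasi_inverse_sym: "quasi_inverse S T F G \<Longrightarrow> quasi_inverse T S G F"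
  unfolding quasi_inverse_def by (auto intro: exI nat_iso_inv)

text \<open>Naturality of \<eta> computes \<open>\<eta> y\<close> after \<open>f\<close> from
  \<open>fm G (fm F f)\<close>, and the isomorphism \<open>\<eta> y\<close> can be
  cancelled.\<close>

lemma quasi_inverse_faithful:
  assumes q: "quasi_inverse S T F G" and f: "f \<in> hom S x y" "g \<in> hom S x y" and e: "fm F f = fm F g"
  shows "f = g"
proof -
  obtain \<eta> where n: "nat_iso S S fid (fcomp G F) \<eta>" using q unfolding quasi_inverse_def by auto
  interpret S: category S using nat_isoD(1)[OF n] is_functorD(1) by auto
  note N [simp] = nat_isoD(3-6)[OF n] and nat = nat_isoD(7)[OF n]
  have xy [simp]: "x \<in> Ob S" "y \<in> Ob S" using f by auto
  have "\<eta> y \<cdot>\<^bsub>S\<^esub> f = \<eta> y \<cdot>\<^bsub>S\<^esub> g" using nat[of f] nat[of g] f e by simp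
  then show ?thesis using f by (intro S.iso_cancel_left[of "\<eta> y" f g]) simp_all
qed

text \<open>Naturality of \<eta> forces the preimage: it is \<open>fm G h\<close> conjugated by
  \<eta>. This only gives equality after \<open>G\<close>, so faithfulness of \<open>G\<close>
  finishes.\<close>

lemma quasi_inverse_full:
  assumes q: "quasi_inverse S T F G" and x [simp]: "x \<in> Ob S" "y \<in> Ob S" and h: "h \<in> hom T (fo F x) (fo F y)"
  shows "\<exists>f \<in> hom S x y. fm F f = h"
proof -
  obtain \<eta> where n: "nat_iso S S fid (fcomp G F) \<eta>" using q unfolding quasi_inverse_def by auto
  have F: "is_functor S T F" and G: "is_functor T S G" using q unfolding quasi_inverse_def by auto
  note [simp] = is_functorD(3-6)[OF F] is_functorD(3-6)[OF G]
  interpret S: category S using nat_isoD(1)[OF n] is_functorD(1) by auto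
  note N [simp] = nat_isoD(3-6)[OF n] and nat = nat_isoD(7)[OF n]
  have i: "iso_arr S (\<eta> y)" "iso_arr S (\<eta> x)" by simp_all
  note I [simp] = S.arr_inv(1-3)[OF i(1)] and h' [simp] = h[simplified]
  define f where "f = S.arr_inv (\<eta> y) \<cdot>\<^bsub>S\<^esub> (fm G h \<cdot>\<^bsub>S\<^esub> \<eta> x)"
  have f [simp]: "f \<in> Ar S" "src S f = x" "tgt S f = y" unfolding f_def by simp_all
  have "fm G (fm F f) \<cdot>\<^bsub>S\<^esub> \<eta> x = \<eta> y \<cdot>\<^bsub>S\<^esub> f" using nat[OF f(1)] by simp
  also have "\<dots> = fm G h \<cdot>\<^bsub>S\<^esub> \<eta> x" unfolding f_def by (intro S.arr_inv_simps i) simp_all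
  finally have "fm G (fm F f) = fm G h" by (rule S.iso_cancel_right[OF i(2), rotated -1]) simp_all
  then have "fm F f = h"
    by (rule quasi_inverse_faithful[OF quasi_inverse_sym[OF q], of _ "fo F x" "fo F y", rotated -1]) simp_all
  then show ?thesis by (intro bexI[of _ f]) simp_all
qed

lemma quasi_inverse_ess_surj:
  assumes q: "quasi_inverse S T F G" and y: "y \<in> Ob T"
  shows "\<exists>x \<in> Ob S. \<exists>e \<in> hom T (fo F x) y. iso_arr T e"
proof -
  obtain \<epsilon> where n: "nat_iso T T (fcomp F G) fid \<epsilon>" using q unfolding quasi_inverse_def by auto
  have G: "is_functor T S G" using q unfolding quasi_inverse_def by auto
  show ?thesis
    by (rule bexI[OF _ is_functorD(3)[OF G y]], rule bexI[of _ "\<epsilon> y"]) (use nat_isoD(3-6)[OF n y] in simp_all)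
qed

text \<open>The quasi-inverse chooses an object \<open>g0 y\<close> with an isomorphism
  \<open>e y\<close> from its image, and on arrows the preimage of the conjugate by
  \<open>e\<close>. Functoriality of \<open>G\<close> and the laws of the unit are checked after
  applying \<open>F\<close> and pulled back by faithfulness.\<close>

lemma equivalenceI:
  assumes F: "is_functor S T F"
    and faithful: "\<And>x y f g. \<lbrakk>f \<in> hom S x y; g \<in> hom S x y; fm F f = fm F g\<rbrakk> \<Longrightarrow> f = g"
    and full: "\<And>x y h. \<lbrakk>x \<in> Ob S; y \<in> Ob S; h \<in> hom T (fo F x) (fo F y)\<rbrakk> \<Longrightarrow> \<exists>f \<in> hom S x y. fm F f = h"
    and surj: "\<And>y. y \<in> Ob T \<Longrightarrow> \<exists>x \<in> Ob S. \<exists>e \<in> hom T (fo F x) y. iso_arr T e"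
  shows "is_equivalence S T F"
proof -
  interpret S: category S using is_functorD(1)[OF F] .
  interpret T: category T using is_functorD(2)[OF F] .
  note FD [simp] = is_functorD(3-8)[OF F]
  obtain g0 where g0: "\<And>y. y \<in> Ob T \<Longrightarrow> g0 y \<in> Ob S \<and> (\<exists>e \<in> hom T (fo F (g0 y)) y. iso_arr T e)"
    using surj by metis
  then obtain e where e: "\<And>y. y \<in> Ob T \<Longrightarrow> e y \<in> hom T (fo F (g0 y)) y \<and> iso_arr T (e y)" by metis
  have e' [simp]: "e y \<in> Ar T" "src T (e y) = fo F (g0 y)" "tgt T (e y) = y" "iso_arr T (e y)" "g0 y \<in> Ob S"
    if "y \<in> Ob T" for y using e[OF that] g0[OF that] by auto
  have ei [simp]: "T.arr_inv (e y) \<in> Ar T" "src T (T.arr_inv (e y)) = y" "tgt T (T.arr_inv (e y)) = fo F (g0 y)"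
    "T.arr_inv (e y) \<cdot>\<^bsub>T\<^esub> e y = ident T (fo F (g0 y))" "e y \<cdot>\<^bsub>T\<^esub> T.arr_inv (e y) = ident T y" "iso_arr T (T.arr_inv (e y))"
    if "y \<in> Ob T" for y using T.arr_inv[of "e y"] that by auto
  have es [simp]: "T.arr_inv (e y) \<cdot>\<^bsub>T\<^esub> (e y \<cdot>\<^bsub>T\<^esub> t) = t" if "y \<in> Ob T" "t \<in> Ar T" "tgt T t = fo F (g0 y)" for y t
    using T.arr_inv_simps(1)[of "e y" t] that by auto
  have es' [simp]: "e y \<cdot>\<^bsub>T\<^esub> (T.arr_inv (e y) \<cdot>\<^bsub>T\<^esub> t) = t" if "y \<in> Ob T" "t \<in> Ar T" "tgt T t = y" for y t
    using T.arr_inv_simps(2)[of "e y" t] that by auto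
  have "\<exists>f. f \<in> Ar S \<and> src S f = g0 (src T h) \<and> tgt S f = g0 (tgt T h) \<and>
      fm F f = T.arr_inv (e (tgt T h)) \<cdot>\<^bsub>T\<^esub> (h \<cdot>\<^bsub>T\<^esub> e (src T h))" if "h \<in> Ar T" for h
    using full[of "g0 (src T h)" "g0 (tgt T h)" "T.arr_inv (e (tgt T h)) \<cdot>\<^bsub>T\<^esub> (h \<cdot>\<^bsub>T\<^esub> e (src T h))"] that by auto
  then obtain g1 where g1 [simp]: "\<And>h. h \<in> Ar T \<Longrightarrow> g1 h \<in> Ar S" "\<And>h. h \<in> Ar T \<Longrightarrow> src S (g1 h) = g0 (src T h)"
     "\<And>h. h \<in> Ar T \<Longrightarrow> tgt S (g1 h) = g0 (tgt T h)"
     "\<And>h. h \<in> Ar T \<Longrightarrow> fm F (g1 h) = T.arr_inv (e (tgt T h)) \<cdot>\<^bsub>T\<^esub> (h \<cdot>\<^bsub>T\<^esub> e (src T h))" by metis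
  define G where "G = \<lparr>fo = g0, fm = g1\<rparr>"
  have G [simp]: "fo G = g0" "fm G = g1" by (simp_all add: G_def)
  have GF: "is_functor T S G"
  proof -
    have "g1 (ident T y) = ident S (g0 y)" if "y \<in> Ob T" for y
      by (rule faithful[of _ "g0 y" "g0 y"]) (use that in simp_all)
    moreover have "g1 (k \<cdot>\<^bsub>T\<^esub> h) = g1 k \<cdot>\<^bsub>S\<^esub> g1 h" if "h \<in> Ar T" "k \<in> Ar T" "tgt T h = src T k" for h k
      by (rule faithful[of _ "g0 (src T h)" "g0 (tgt T k)"]) (use that in simp_all)
    ultimately show ?thesis unfolding is_functor_def using S.category_axioms T.category_axioms by simp
  qed
  have "nat_iso T T (fcomp F G) fid e"
    unfolding nat_iso_def using functor_fcomp[OF GF F] functor_fid[OF T.category_axioms] by auto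
  moreover
  have "\<exists>f. f \<in> Ar S \<and> src S f = x \<and> tgt S f = g0 (fo F x) \<and> fm F f = T.arr_inv (e (fo F x))" if "x \<in> Ob S" for x
    using full[of x "g0 (fo F x)" "T.arr_inv (e (fo F x))"] that by auto
  then obtain n where n [simp]: "\<And>x. x \<in> Ob S \<Longrightarrow> n x \<in> Ar S" "\<And>x. x \<in> Ob S \<Longrightarrow> src S (n x) = x"
    "\<And>x. x \<in> Ob S \<Longrightarrow> tgt S (n x) = g0 (fo F x)" "\<And>x. x \<in> Ob S \<Longrightarrow> fm F (n x) = T.arr_inv (e (fo F x))" by metis
  have "iso_arr S (n x)" if x: "x \<in> Ob S" for x
  proof -
    obtain m where m: "m \<in> Ar S" "src S m = g0 (fo F x)" "tgt S m = x" "fm F m = e (fo F x)"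
      using full[of "g0 (fo F x)" x "e (fo F x)"] x by auto
    show ?thesis
      by (rule S.iso_arrI[of _ m]; (rule faithful[of _ x x] faithful[of _ "g0 (fo F x)" "g0 (fo F x)"])?) (use m x in simp_all)
  qed
  moreover have "n (tgt S f) \<cdot>\<^bsub>S\<^esub> f = g1 (fm F f) \<cdot>\<^bsub>S\<^esub> n (src S f)" if "f \<in> Ar S" for f
    by (rule faithful[of _ "src S f" "g0 (fo F (tgt S f))"]) (use that in simp_all)
  ultimately have "nat_iso S S fid (fcomp G F) n"
    unfolding nat_iso_def using functor_fcomp[OF F GF] functor_fid[OF S.category_axioms] by auto
  with \<open>nat_iso T T (fcomp F G) fid e\<close> show ?thesis
    unfolding is_equivalence_def quasi_inverse_def using F GF by auto
qed

section \<open>Additive categories\<close>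

context additive_category
begin

lemma add_Ar [simp]: "\<lbrakk>f \<in> Ar A; g \<in> Ar A; src A f = src A g; tgt A f = tgt A g\<rbrakk> \<Longrightarrow> f \<oplus> g \<in> Ar A"
  and src_add [simp]: "\<lbrakk>f \<in> Ar A; g \<in> Ar A; src A f = src A g; tgt A f = tgt A g\<rbrakk> \<Longrightarrow> src A (f \<oplus> g) = src A g"
  and tgt_add [simp]: "\<lbrakk>f \<in> Ar A; g \<in> Ar A; src A f = src A g; tgt A f = tgt A g\<rbrakk> \<Longrightarrow> tgt A (f \<oplus> g) = tgt A g"
  using add_hom[of f "src A g" "tgt A g" g] by auto

lemma zer_Ar [simp]: "\<lbrakk>x \<in> Ob A; y \<in> Ob A\<rbrakk> \<Longrightarrow> zer A x y \<in> Ar A"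
  and src_zer [simp]: "\<lbrakk>x \<in> Ob A; y \<in> Ob A\<rbrakk> \<Longrightarrow> src A (zer A x y) = x"
  and tgt_zer [simp]: "\<lbrakk>x \<in> Ob A; y \<in> Ob A\<rbrakk> \<Longrightarrow> tgt A (zer A x y) = y"
  using zer_hom[of x y] by auto

lemma neg_Ar [simp]: "f \<in> Ar A \<Longrightarrow> neg A f \<in> Ar A"
  and src_neg [simp]: "f \<in> Ar A \<Longrightarrow> src A (neg A f) = src A f"
  and tgt_neg [simp]: "f \<in> Ar A \<Longrightarrow> tgt A (neg A f) = tgt A f"
  using neg_hom[of f "src A f" "tgt A f"] by auto

lemma add_commute: "\<lbrakk>f \<in> Ar A; g \<in> Ar A; src A f = src A g; tgt A f = tgt A g\<rbrakk> \<Longrightarrow> f \<oplus> g = g \<oplus> f"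
  using add_comm[of f "src A g" "tgt A g" g] by auto

lemma add_associate: "\<lbrakk>f \<in> Ar A; g \<in> Ar A; h \<in> Ar A; src A f = src A g; tgt A f = tgt A g; src A g = src A h; tgt A g = tgt A h\<rbrakk>
    \<Longrightarrow> (f \<oplus> g) \<oplus> h = f \<oplus> (g \<oplus> h)"
  using add_assoc[of f "src A g" "tgt A g" g h] by auto

lemma add_left_commute: "\<lbrakk>f \<in> Ar A; g \<in> Ar A; h \<in> Ar A; src A f = src A g; tgt A f = tgt A g; src A g = src A h; tgt A g = tgt A h\<rbrakk>
    \<Longrightarrow> f \<oplus> (g \<oplus> h) = g \<oplus> (f \<oplus> h)"
  by (metis add_commute add_associate)

lemmas add_ac = add_associate add_commute add_left_commute

lemma add_zer_right [simp]: "\<lbrakk>f \<in> Ar A; src A f = x; tgt A f = y\<rbrakk> \<Longrightarrow> f \<oplus> zer A x y = f"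
  using add_zer[of f x y] by auto

lemma add_zer_left [simp]: assumes "f \<in> Ar A" "src A f = x" "tgt A f = y" shows "zer A x y \<oplus> f = f"
  using add_commute[of "zer A x y" f] assms by (auto simp del: add_zer_right simp: add_zer_right[OF assms])

lemma add_neg_right [simp]: "f \<in> Ar A \<Longrightarrow> f \<oplus> neg A f = zer A (src A f) (tgt A f)"
  using add_neg[of f "src A f" "tgt A f"] by auto

lemma add_neg_left [simp]: "f \<in> Ar A \<Longrightarrow> neg A f \<oplus> f = zer A (src A f) (tgt A f)"
  using add_commute[of "neg A f" f] by simp

lemma add_cancel_left:
  assumes "h \<in> Ar A" "f \<in> Ar A" "g \<in> Ar A" "src A f = src A h" "tgt A f = tgt A h" "src A g = src A h" "tgt A g = tgt A h"
    "h \<oplus> f = h \<oplus> g"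
  shows "f = g"
proof -
  have "neg A h \<oplus> (h \<oplus> f) = f" "neg A h \<oplus> (h \<oplus> g) = g"
    using assms(1-7) by (simp_all add: add_associate[symmetric])
  then show ?thesis using assms(8) by metis
qed

lemma neg_unique:
  assumes "f \<in> Ar A" "g \<in> Ar A" "src A f = src A g" "tgt A f = tgt A g" "f \<oplus> g = zer A (src A g) (tgt A g)"
  shows "neg A f = g"
  by (rule add_cancel_left[of f]) (use assms in simp_all)

lemma neg_neg [simp]: "f \<in> Ar A \<Longrightarrow> neg A (neg A f) = f"
  by (rule neg_unique) simp_all

lemma add_neg_cancel [simp]:
  "\<lbrakk>f \<in> Ar A; g \<in> Ar A; src A f = src A g; tgt A f = tgt A g\<rbrakk> \<Longrightarrow> f \<oplus> (neg A f \<oplus> g) = g"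
  "\<lbrakk>f \<in> Ar A; g \<in> Ar A; src A f = src A g; tgt A f = tgt A g\<rbrakk> \<Longrightarrow> neg A f \<oplus> (f \<oplus> g) = g"
  by (simp_all add: add_associate[symmetric])

lemma add_neg_cancel_middle [simp]:
  assumes "f \<in> Ar A" "g \<in> Ar A" "src A f = src A g" "tgt A f = tgt A g"
  shows "f \<oplus> (g \<oplus> neg A f) = g" "neg A f \<oplus> (g \<oplus> f) = g"
  using assms add_commute[of g "neg A f"] add_commute[of g f] add_neg_cancel[of f g] by simp_all

lemma neg_zer [simp]: "\<lbrakk>x \<in> Ob A; y \<in> Ob A\<rbrakk> \<Longrightarrow> neg A (zer A x y) = zer A x y"
  by (rule neg_unique) simp_all

lemma neg_add [simp]:
  "\<lbrakk>f \<in> Ar A; g \<in> Ar A; src A f = src A g; tgt A f = tgt A g\<rbrakk> \<Longrightarrow> neg A (f \<oplus> g) = neg A f \<oplus> neg A g"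
  by (rule neg_unique) (simp_all add: add_ac)

lemma cmp_add [simp]: "\<lbrakk>f \<in> Ar A; g \<in> Ar A; h \<in> Ar A; src A f = src A g; tgt A f = tgt A g; tgt A g = src A h\<rbrakk>
    \<Longrightarrow> h \<cdot> (f \<oplus> g) = (h \<cdot> f) \<oplus> (h \<cdot> g)"
  using cmp_add_right[of f "src A g" "src A h" g h "tgt A h"] by auto

lemma add_cmp [simp]: "\<lbrakk>f \<in> Ar A; g \<in> Ar A; h \<in> Ar A; src A g = src A h; tgt A g = tgt A h; tgt A f = src A h\<rbrakk>
    \<Longrightarrow> (g \<oplus> h) \<cdot> f = (g \<cdot> f) \<oplus> (h \<cdot> f)"
  using cmp_add_left[of f "src A f" "src A h" g "tgt A h" h] by auto

text \<open>The zero arrow is its own double, hence so is the composite, and cancellation leaves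
  zero.\<close>

lemma cmp_zer [simp]: assumes "x \<in> Ob A" "h \<in> Ar A" "src A h = y" shows "h \<cdot> zer A x y = zer A x (tgt A h)"
proof (rule add_cancel_left[of "h \<cdot> zer A x y"])
  have [simp]: "y \<in> Ob A" using assms by auto
  show "h \<cdot> zer A x y \<oplus> h \<cdot> zer A x y = h \<cdot> zer A x y \<oplus> zer A x (tgt A h)"
    using assms cmp_add[of "zer A x y" "zer A x y" h] by simp
qed (use assms in \<open>auto simp: src_in_Ob\<close>)

lemma zer_cmp [simp]: assumes "y \<in> Ob A" "h \<in> Ar A" "tgt A h = x" shows "zer A x y \<cdot> h = zer A (src A h) y"
proof (rule add_cancel_left[of "zer A x y \<cdot> h"])
  have [simp]: "x \<in> Ob A" using assms by auto
  show "zer A x y \<cdot> h \<oplus> zer A x y \<cdot> h = zer A x y \<cdot> h \<oplus> zer A (src A h) y"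
    using assms add_cmp[of h "zer A x y" "zer A x y"] by simp
qed (use assms in \<open>auto simp: src_in_Ob\<close>)

lemma cmp_neg [simp]: "\<lbrakk>f \<in> Ar A; g \<in> Ar A; tgt A f = src A g\<rbrakk> \<Longrightarrow> g \<cdot> neg A f = neg A (g \<cdot> f)"
  by (rule neg_unique[symmetric]) (simp_all add: cmp_add[symmetric] del: cmp_add)

lemma neg_cmp [simp]: "\<lbrakk>f \<in> Ar A; g \<in> Ar A; tgt A f = src A g\<rbrakk> \<Longrightarrow> neg A g \<cdot> f = neg A (g \<cdot> f)"
  by (rule neg_unique[symmetric]) (simp_all add: add_cmp[symmetric] del: add_cmp)

lemma diff_zer_iff:
  assumes "f \<in> Ar A" "g \<in> Ar A" "src A f = x" "tgt A f = y" "src A g = x" "tgt A g = y"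
  shows "f \<oplus> neg A g = zer A x y \<longleftrightarrow> f = g"
proof
  assume "f \<oplus> neg A g = zer A x y"
  then have "f \<oplus> neg A g = zer A (src A (neg A g)) (tgt A (neg A g))" using assms by simp
  then have "neg A f = neg A g" by (rule neg_unique[rotated -1]) (use assms in simp_all)
  then have "neg A (neg A f) = neg A (neg A g)" by (rule arg_cong)
  then show "f = g" using assms(1,2) by (simp only: neg_neg)
qed (use assms in auto)

lemma diff_eq_iff:
  assumes "f \<in> Ar A" "g \<in> Ar A" "h \<in> Ar A" "src A f = x" "tgt A f = y" "src A g = x" "tgt A g = y"
    "src A h = x" "tgt A h = y"
  shows "f \<oplus> neg A g = h \<longleftrightarrow> f = g \<oplus> h"
proof
  assume "f \<oplus> neg A g = h"
  moreover have "f = g \<oplus> (f \<oplus> neg A g)" using assms by (simp add: add_ac)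
  ultimately show "f = g \<oplus> h" by metis
next
  assume "f = g \<oplus> h"
  moreover have "(g \<oplus> h) \<oplus> neg A g = h" using assms by (simp add: add_ac)
  ultimately show "f \<oplus> neg A g = h" by metis
qed

lemma iso_neg: assumes "iso_arr A f" shows "iso_arr A (neg A f)"
proof -
  note [simp] = arr_inv(1-5)[OF assms] iso_Ar[OF assms]
  show ?thesis by (rule iso_arrI[of _ "neg A (arr_inv f)"]) simp_all
qed

text \<open>If the identity of \<open>z\<close> is zero, every arrow to or from \<open>z\<close>
  factors through a zero arrow. The equational form passes through any functor that preserves
  identities and zero arrows.\<close>

lemma zero_object_iff: "zero_object A z \<longleftrightarrow> z \<in> Ob A \<and> ident A z = zer A z z"
proof
  assume "zero_object A z"
  then have z: "z \<in> Ob A" and u: "\<And>f g. f \<in> hom A z z \<Longrightarrow> g \<in> hom A z z \<Longrightarrow> f = g"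
    unfolding zero_object_def by blast+
  show "z \<in> Ob A \<and> ident A z = zer A z z" using z u[of "ident A z" "zer A z z"] by simp
next
  assume z: "z \<in> Ob A \<and> ident A z = zer A z z"
  show "zero_object A z" unfolding zero_object_def
  proof (intro conjI ballI)
    fix x assume x: "x \<in> Ob A"
    have "f = zer A z x" if "f \<in> hom A z x" for f
      using cmp_ident[of f z] z x that by (auto simp del: cmp_ident)
    then show "\<exists>!f. f \<in> hom A z x" using z x by (intro ex1I[of _ "zer A z x"]) auto
    have "f = zer A x z" if "f \<in> hom A x z" for f
      using ident_cmp[of f z] z x that by (auto simp del: ident_cmp)
    then show "\<exists>!f. f \<in> hom A x z" using z x by (intro ex1I[of _ "zer A x z"]) auto
  qed (use z in simp)
qed

lemma biproductE:
  assumes "x \<in> Ob A" "y \<in> Ob A"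
  obtains b i j p q where "b \<in> Ob A" "i \<in> Ar A" "src A i = x" "tgt A i = b" "j \<in> Ar A" "src A j = y" "tgt A j = b"
    "p \<in> Ar A" "src A p = b" "tgt A p = x" "q \<in> Ar A" "src A q = b" "tgt A q = y"
    "p \<cdot> i = ident A x" "q \<cdot> j = ident A y" "q \<cdot> i = zer A x y" "p \<cdot> j = zer A y x"
    "(i \<cdot> p) \<oplus> (j \<cdot> q) = ident A b"
proof -
  obtain b i j p q where "b \<in> Ob A" "i \<in> hom A x b" "j \<in> hom A y b" "p \<in> hom A b x" "q \<in> hom A b y"
    "p \<cdot> i = ident A x" "q \<cdot> j = ident A y" "q \<cdot> i = zer A x y" "p \<cdot> j = zer A y x"
    "(i \<cdot> p) \<oplus> (j \<cdot> q) = ident A b"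
    using ex_biproduct[OF assms] by blast
  then show ?thesis by (intro that[of b i j p q]) simp_all
qed

lemma zero_object_Ob: "zero_object A z \<Longrightarrow> z \<in> Ob A"
  by (simp add: zero_object_iff)

lemma from_zero: "\<lbrakk>zero_object A z; f \<in> Ar A; src A f = z\<rbrakk> \<Longrightarrow> f = zer A z (tgt A f)"
  using cmp_ident[of f z] by (auto simp del: cmp_ident simp: zero_object_iff)

lemma to_zero: "\<lbrakk>zero_object A z; f \<in> Ar A; tgt A f = z\<rbrakk> \<Longrightarrow> f = zer A (src A f) z"
  using ident_cmp[of f z] by (auto simp del: ident_cmp simp: zero_object_iff)

end

section \<open>Left triangulated categories with invertible loop functor\<close>

locale loop_base = additive_category Q
  for Q :: "('q, 'n, 'z) addcat_scheme" (structure) +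
  fixes \<Omega> :: "('q, 'n, 'q, 'n) funct"
  assumes loop_functor: "is_functor Q Q \<Omega>"
    and loop_add: "\<lbrakk>f \<in> hom Q x y; g \<in> hom Q x y\<rbrakk> \<Longrightarrow> fm \<Omega> (f \<oplus> g) = fm \<Omega> f \<oplus> fm \<Omega> g"
    and loop_full: "\<lbrakk>x \<in> Ob Q; y \<in> Ob Q; g \<in> hom Q (fo \<Omega> x) (fo \<Omega> y)\<rbrakk> \<Longrightarrow> \<exists>f \<in> hom Q x y. fm \<Omega> f = g"
    and loop_faithful: "\<lbrakk>f \<in> hom Q x y; g \<in> hom Q x y; fm \<Omega> f = fm \<Omega> g\<rbrakk> \<Longrightarrow> f = g"
begin

lemma loop_simps [simp]:
  "x \<in> Ob Q \<Longrightarrow> fo \<Omega> x \<in> Ob Q"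
  "f \<in> Ar Q \<Longrightarrow> fm \<Omega> f \<in> Ar Q"
  "f \<in> Ar Q \<Longrightarrow> src Q (fm \<Omega> f) = fo \<Omega> (src Q f)"
  "f \<in> Ar Q \<Longrightarrow> tgt Q (fm \<Omega> f) = fo \<Omega> (tgt Q f)"
  "x \<in> Ob Q \<Longrightarrow> fm \<Omega> (ident Q x) = ident Q (fo \<Omega> x)"
  "\<lbrakk>f \<in> Ar Q; g \<in> Ar Q; tgt Q f = src Q g\<rbrakk> \<Longrightarrow> fm \<Omega> (g \<cdot> f) = fm \<Omega> g \<cdot> fm \<Omega> f"
  using is_functorD(3-8)[OF loop_functor] by simp_all

lemma loop_sum [simp]: "\<lbrakk>f \<in> Ar Q; g \<in> Ar Q; src Q f = src Q g; tgt Q f = tgt Q g\<rbrakk>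
    \<Longrightarrow> fm \<Omega> (f \<oplus> g) = fm \<Omega> f \<oplus> fm \<Omega> g"
  by (rule loop_add[of _ "src Q g" "tgt Q g"]) simp_all

lemma loop_zer [simp]: assumes "x \<in> Ob Q" "y \<in> Ob Q" shows "fm \<Omega> (zer Q x y) = zer Q (fo \<Omega> x) (fo \<Omega> y)"
  by (rule add_cancel_left[of "fm \<Omega> (zer Q x y)"]) (use assms loop_sum[of "zer Q x y" "zer Q x y"] in simp_all)

lemma loop_neg [simp]: assumes "f \<in> Ar Q" shows "fm \<Omega> (neg Q f) = neg Q (fm \<Omega> f)"
  by (rule neg_unique[symmetric]) (use assms loop_sum[of f "neg Q f"] in simp_all)

lemma loop_inv:
  assumes "iso_arr Q a"
  shows "fm \<Omega> (arr_inv a) \<cdot> fm \<Omega> a = ident Q (fo \<Omega> (src Q a))" "fm \<Omega> a \<cdot> fm \<Omega> (arr_inv a) = ident Q (fo \<Omega> (tgt Q a))"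
  using arr_inv(1-3)[OF assms] iso_Ar[OF assms]
  by (simp_all add: loop_simps(6)[symmetric] arr_inv(4,5)[OF assms] del: loop_simps(6))

end

text \<open>Left triangles with strong enough axioms to recover a triangulation once \<Omega> has a
  quasi-inverse. \<open>tri_unrotate\<close> is the inverse rotation: its object \<open>s\<close>,
  whose loop object is isomorphic to the first vertex, plays the part of the suspension.
  \<open>tri_octahedron\<close> provides one octahedron for each composable pair, with cones of its
  own choice, and thereby also a triangle on every arrow.\<close>

locale loop_category = loop_base Q \<Omega>
  for Q :: "('q, 'n, 'z) addcat_scheme" (structure) and \<Omega> :: "('q, 'n, 'q, 'n) funct" +
  fixes \<Delta> :: "('n \<times> 'n \<times> 'n) set"
  assumes tri_sequence: "(h, f, g) \<in> \<Delta> \<Longrightarrow> left_sequence Q \<Omega> h f g"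
    and tri_iso: "\<lbrakk>(h, f, g) \<in> \<Delta>; left_sequence Q \<Omega> h' f' g';
        a \<in> hom Q (src Q f) (src Q f'); b \<in> hom Q (tgt Q f) (tgt Q f'); c \<in> hom Q (tgt Q g) (tgt Q g');
        iso_arr Q a; iso_arr Q b; iso_arr Q c;
        a \<cdot> h = h' \<cdot> fm \<Omega> c; b \<cdot> f = f' \<cdot> a; c \<cdot> g = g' \<cdot> b\<rbrakk> \<Longrightarrow> (h', f', g') \<in> \<Delta>"
    and tri_trivial: "\<lbrakk>x \<in> Ob Q; zero_object Q z\<rbrakk> \<Longrightarrow> (zer Q (fo \<Omega> z) x, ident Q x, zer Q x z) \<in> \<Delta>"
    and tri_weak_cokernel: "\<lbrakk>(h, f, g) \<in> \<Delta>; t \<in> Ar Q; src Q t = tgt Q f; t \<cdot> f = zer Q (src Q f) (tgt Q t)\<rbrakk>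
        \<Longrightarrow> \<exists>s \<in> hom Q (tgt Q g) (tgt Q t). t = s \<cdot> g"
    and tri_rotate: "(h, f, g) \<in> \<Delta> \<Longrightarrow> (neg Q (fm \<Omega> g), h, f) \<in> \<Delta>"
    and tri_unrotate: "(h, f, g) \<in> \<Delta> \<Longrightarrow> \<exists>s \<in> Ob Q. \<exists>\<kappa> \<in> hom Q (fo \<Omega> s) (src Q f). \<exists>c \<in> hom Q (tgt Q g) s.
        iso_arr Q \<kappa> \<and> \<kappa> \<cdot> fm \<Omega> c = h \<and> (neg Q (f \<cdot> \<kappa>), g, c) \<in> \<Delta>"
    and tri_morphism: "\<lbrakk>(h, f, g) \<in> \<Delta>; (h', f', g') \<in> \<Delta>;
        a \<in> hom Q (src Q f) (src Q f'); b \<in> hom Q (tgt Q f) (tgt Q f'); b \<cdot> f = f' \<cdot> a\<rbrakk> \<Longrightarrow>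
        \<exists>c \<in> hom Q (tgt Q g) (tgt Q g'). c \<cdot> g = g' \<cdot> b \<and> a \<cdot> h = h' \<cdot> fm \<Omega> c"
    and tri_octahedron: "\<lbrakk>u \<in> Ar Q; v \<in> Ar Q; tgt Q u = src Q v\<rbrakk> \<Longrightarrow>
        \<exists>h1 i h2 k h3 m f g. (h1, u, i) \<in> \<Delta> \<and> (h2, v, k) \<in> \<Delta> \<and> (h3, v \<cdot> u, m) \<in> \<Delta> \<and>
          f \<in> hom Q (tgt Q i) (tgt Q m) \<and> g \<in> hom Q (tgt Q m) (tgt Q k) \<and>
          f \<cdot> i = m \<cdot> v \<and> h3 \<cdot> fm \<Omega> f = h1 \<and> g \<cdot> m = k \<and> u \<cdot> h3 = h2 \<cdot> fm \<Omega> g \<and> (i \<cdot> h2, f, g) \<in> \<Delta>"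
begin

lemma triD:
  assumes "(h, f, g) \<in> \<Delta>"
  shows "h \<in> Ar Q" "f \<in> Ar Q" "g \<in> Ar Q" "src Q h = fo \<Omega> (tgt Q g)" "tgt Q h = src Q f" "tgt Q f = src Q g"
  using tri_sequence[OF assms] by (simp_all add: left_sequence_def)

lemma triI_iso:
  assumes "(h, f, g) \<in> \<Delta>" "h' \<in> Ar Q" "f' \<in> Ar Q" "g' \<in> Ar Q" "src Q h' = fo \<Omega> (tgt Q g')"
    "tgt Q h' = src Q f'" "tgt Q f' = src Q g'" "iso_arr Q a" "iso_arr Q b" "iso_arr Q c"
    "src Q a = src Q f" "tgt Q a = src Q f'" "src Q b = tgt Q f" "tgt Q b = tgt Q f'"
    "src Q c = tgt Q g" "tgt Q c = tgt Q g'"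
    "a \<cdot> h = h' \<cdot> fm \<Omega> c" "b \<cdot> f = f' \<cdot> a" "c \<cdot> g = g' \<cdot> b"
  shows "(h', f', g') \<in> \<Delta>"
  by (rule tri_iso[of h f g h' f' g' a b c])
     (use assms in \<open>simp_all add: left_sequence_def iso_Ar\<close>)

text \<open>A comparison over the identity differs from the identity by an endomorphism of square zero.\<close>

lemma tri_endo_iso:
  assumes t: "(h, f, g) \<in> \<Delta>" and c: "c \<in> Ar Q" "src Q c = tgt Q g" "tgt Q c = tgt Q g"
    and cg: "c \<cdot> g = g" and hc: "h \<cdot> fm \<Omega> c = h"
  shows "iso_arr Q c"
proof -
  note [simp] = triD[OF t] c
  define z where "z = tgt Q g"
  have z [simp]: "z \<in> Ob Q" "tgt Q g = z" by (simp_all add: z_def)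
  define e where "e = c \<oplus> neg Q (ident Q z)"
  have e [simp]: "e \<in> Ar Q" "src Q e = z" "tgt Q e = z" by (simp_all add: e_def)
  have eg: "e \<cdot> g = zer Q (src Q g) z" by (simp add: e_def cg)
  have he: "h \<cdot> fm \<Omega> e = zer Q (fo \<Omega> z) (src Q f)" by (simp add: e_def hc)
  \<comment> \<open>Unrotating turns the condition on \<open>h\<close> into one on an arrow
    \<open>d\<close> out of the cone: \<open>h\<close> kills \<open>fm \<Omega> e\<close>, so
    \<open>d\<close> kills \<open>e\<close>, as \<kappa> is invertible and \<Omega> faithful. Since
    \<open>e\<close> kills \<open>g\<close>, it factors through \<open>d\<close>. Hence
    \<open>e \<cdot> e\<close> is zero, and the identity minus \<open>e\<close> inverts
    \<open>c\<close>.\<close>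
  obtain s \<kappa> d where s [simp]: "s \<in> Ob Q" and \<kappa> [simp]: "\<kappa> \<in> Ar Q" "src Q \<kappa> = fo \<Omega> s" "tgt Q \<kappa> = src Q f"
    and d [simp]: "d \<in> Ar Q" "src Q d = z" "tgt Q d = s"
    and iso: "iso_arr Q \<kappa>" and kd: "\<kappa> \<cdot> fm \<Omega> d = h" and t': "(neg Q (f \<cdot> \<kappa>), g, d) \<in> \<Delta>"
    using tri_unrotate[OF t] by auto
  have "\<kappa> \<cdot> fm \<Omega> (d \<cdot> e) = \<kappa> \<cdot> zer Q (fo \<Omega> z) (fo \<Omega> s)"
    using he by (simp add: reassoc[OF kd])
  then have "fm \<Omega> (d \<cdot> e) = zer Q (fo \<Omega> z) (fo \<Omega> s)"
    by (rule iso_cancel_left[OF iso, rotated -1]) simp_all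
  then have de: "d \<cdot> e = zer Q z s"
    by (intro loop_faithful[of "d \<cdot> e" z s]) simp_all
  obtain e' where e' [simp]: "e' \<in> Ar Q" "src Q e' = s" "tgt Q e' = z" and "e = e' \<cdot> d"
    using tri_weak_cokernel[OF t', of e] eg by auto
  then have "e \<cdot> e = e' \<cdot> (d \<cdot> e)" by simp
  then have ee: "e \<cdot> e = zer Q z z" by (simp add: de)
  have ce: "c = ident Q z \<oplus> e" by (simp add: e_def add_ac)
  show ?thesis
    by (rule iso_arrI[of _ "ident Q z \<oplus> neg Q e"]) (simp_all add: ce ee add_ac)
qed

text \<open>In place of the five lemma: \<open>tri_morphism\<close> gives comparison arrows in both
  directions over the identity, and both composites are isomorphisms by
  \<open>tri_endo_iso\<close>.\<close>

lemma tri_comparison: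
  assumes t: "(h, f, g) \<in> \<Delta>" and t': "(h', f, g') \<in> \<Delta>"
  obtains c where "iso_arr Q c" "c \<in> Ar Q" "src Q c = tgt Q g" "tgt Q c = tgt Q g'" "c \<cdot> g = g'" "h' \<cdot> fm \<Omega> c = h"
proof -
  note [simp] = triD[OF t] triD[OF t', simplified]
  note mor = tri_morphism[of _ f _ _ f _ "ident Q (src Q f)" "ident Q (src Q g)"]
  obtain c where c [simp]: "c \<in> Ar Q" "src Q c = tgt Q g" "tgt Q c = tgt Q g'" and cc: "c \<cdot> g = g'" "h' \<cdot> fm \<Omega> c = h"
    using mor[OF t t'] by auto
  obtain d where d [simp]: "d \<in> Ar Q" "src Q d = tgt Q g'" "tgt Q d = tgt Q g" and dd: "d \<cdot> g' = g" "h \<cdot> fm \<Omega> d = h'"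
    using mor[OF t' t] by auto
  have "iso_arr Q (d \<cdot> c)"
    by (rule tri_endo_iso[OF t]) (simp_all add: cc dd reassoc[OF dd(2)])
  moreover have "iso_arr Q (c \<cdot> d)"
    by (rule tri_endo_iso[OF t']) (simp_all add: cc dd reassoc[OF cc(2)])
  ultimately have "iso_arr Q c" by (intro iso_two_sided[of c d]) simp_all
  then show ?thesis using that[of c] cc by simp
qed

text \<open>The octahedron of \<open>u\<close> followed by an identity contains a triangle on
  \<open>u\<close>.\<close>

lemma tri_extend:
  assumes "u \<in> Ar Q" obtains h v where "(h, u, v) \<in> \<Delta>"
  using tri_octahedron[of u "ident Q (tgt Q u)"] assms by auto

text \<open>The given cones are isomorphic to those of the octahedron that the axiom supplies;
  conjugating its two new arrows by the comparisons \<open>a\<close>, \<open>b\<close>,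
  \<open>c\<close> yields the arrows for the given cones.\<close>

lemma tri_octahedron_all:
  assumes uv: "tgt Q u = src Q v" and t1: "(h1, u, i) \<in> \<Delta>" and t2: "(h2, v, k) \<in> \<Delta>" and t3: "(h3, v \<cdot> u, m) \<in> \<Delta>"
  shows "\<exists>f \<in> hom Q (tgt Q i) (tgt Q m). \<exists>g \<in> hom Q (tgt Q m) (tgt Q k).
          f \<cdot> i = m \<cdot> v \<and> h3 \<cdot> fm \<Omega> f = h1 \<and> g \<cdot> m = k \<and> u \<cdot> h3 = h2 \<cdot> fm \<Omega> g \<and> (i \<cdot> h2, f, g) \<in> \<Delta>"
proof -
  note [simp] = uv[symmetric] triD(1-5)[OF t1] triD(1-5)[OF t2] triD(1,3-5)[OF t3] triD(2)[OF t2]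
    triD(6)[OF t1, symmetric] triD(6)[OF t2, symmetric]
  have [simp]: "src Q m = tgt Q v" using triD(6)[OF t3, symmetric] by simp
  obtain h1' i' h2' k' h3' m' f g where T: "(h1', u, i') \<in> \<Delta>" "(h2', v, k') \<in> \<Delta>" "(h3', v \<cdot> u, m') \<in> \<Delta>"
      "f \<in> hom Q (tgt Q i') (tgt Q m')" "g \<in> hom Q (tgt Q m') (tgt Q k')"
    and E: "f \<cdot> i' = m' \<cdot> v" "h3' \<cdot> fm \<Omega> f = h1'" "g \<cdot> m' = k'" "u \<cdot> h3' = h2' \<cdot> fm \<Omega> g"
    and T4: "(i' \<cdot> h2', f, g) \<in> \<Delta>"
    using tri_octahedron[of u v] by auto
  note [simp] = triD(1-5)[OF T(1)] triD(1-5)[OF T(2)] triD(1,3-5)[OF T(3)]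
    triD(6)[OF T(1), symmetric] triD(6)[OF T(2), symmetric]
  have [simp]: "src Q m' = tgt Q v" using triD(6)[OF T(3), symmetric] by simp
  have fg [simp]: "f \<in> Ar Q" "src Q f = tgt Q i'" "tgt Q f = tgt Q m'" "g \<in> Ar Q" "src Q g = tgt Q m'" "tgt Q g = tgt Q k'"
    using T(4,5) by simp_all
  obtain a where a: "iso_arr Q a" and a' [simp]: "a \<in> Ar Q" "src Q a = tgt Q i'" "tgt Q a = tgt Q i" and ae: "a \<cdot> i' = i" "h1 \<cdot> fm \<Omega> a = h1'"
    by (rule tri_comparison[OF T(1) t1])
  obtain b where b: "iso_arr Q b" and b' [simp]: "b \<in> Ar Q" "src Q b = tgt Q k'" "tgt Q b = tgt Q k" and be: "b \<cdot> k' = k" "h2 \<cdot> fm \<Omega> b = h2'"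
    by (rule tri_comparison[OF T(2) t2])
  obtain c where c: "iso_arr Q c" and c' [simp]: "c \<in> Ar Q" "src Q c = tgt Q m'" "tgt Q c = tgt Q m" and ce: "c \<cdot> m' = m" "h3 \<cdot> fm \<Omega> c = h3'"
    by (rule tri_comparison[OF T(3) t3])
  note ai = arr_inv(1-5)[OF a, simplified] and ci = arr_inv(1-5)[OF c, simplified]
  note [simp] = ai(1-3) ci(1-3)
  have ai': "arr_inv a \<cdot> i = i'" using reassoc[OF ai(4), of i'] by (simp add: ae)
  have ci': "arr_inv c \<cdot> m = m'" using reassoc[OF ci(4), of m'] by (simp add: ce)
  have hai: "h1' \<cdot> fm \<Omega> (arr_inv a) = h1"
    by (simp add: ae(2)[symmetric] loop_inv(2)[OF a])
  have hci: "h3' \<cdot> fm \<Omega> (arr_inv c) = h3"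
    by (simp add: ce(2)[symmetric] loop_inv(2)[OF c])
  show ?thesis
  proof (intro bexI conjI)
    let ?f = "c \<cdot> (f \<cdot> arr_inv a)" and ?g = "b \<cdot> (g \<cdot> arr_inv c)"
    show "?f \<in> hom Q (tgt Q i) (tgt Q m)" "?g \<in> hom Q (tgt Q m) (tgt Q k)" by simp_all
    show "?f \<cdot> i = m \<cdot> v" by (simp add: ai' E(1) reassoc[OF ce(1)])
    show "h3 \<cdot> fm \<Omega> ?f = h1" by (simp add: reassoc[OF ce(2)] reassoc[OF E(2)] hai)
    show "?g \<cdot> m = k" by (simp add: ci' E(3) be(1))
    show "u \<cdot> h3 = h2 \<cdot> fm \<Omega> ?g"
      by (simp add: reassoc[OF be(2)] reassoc[OF E(4)[symmetric]] hci)
    show "(i \<cdot> h2, ?f, ?g) \<in> \<Delta>"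
    proof (rule triI_iso[OF T4, of _ _ _ a c b])
      show "a \<cdot> (i' \<cdot> h2') = (i \<cdot> h2) \<cdot> fm \<Omega> b" by (simp add: reassoc[OF ae(1)] be(2))
      show "c \<cdot> f = ?f \<cdot> a" by (simp add: ai(4))
      show "b \<cdot> g = ?g \<cdot> c" by (simp add: ci(4))
    qed (simp_all add: a b c)
  qed
qed

end

section \<open>Transport along an equivalence\<close>

text \<open>Since \<open>\<psi>\<close> identifies \<open>\<Omega>G\<Sigma>\<close> with \<open>G\<close>, a sequence \<open>(u, v, w)\<close> in \<open>T\<close> corresponds to
  \<open>(\<psi> \<cdot> \<Omega>Gw, Gu, Gv)\<close> in \<open>Q\<close>.\<close>

locale loop_transport = loop_category Q \<Omega> \<Delta> + T: additive_category T
  for Q :: "('q, 'n, 'z) addcat_scheme" and \<Omega> \<Delta> and T :: "('o, 'm, 'y) addcat_scheme" +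
  fixes G :: "('o, 'm, 'q, 'n) funct" and \<Sigma> :: "('o, 'm, 'o, 'm) funct" and \<psi> :: "'o \<Rightarrow> 'n"
  assumes G_functor: "is_functor T Q G"
    and G_add: "\<lbrakk>f \<in> hom T x y; g \<in> hom T x y\<rbrakk> \<Longrightarrow> fm G (f \<oplus>\<^bsub>T\<^esub> g) = fm G f \<oplus>\<^bsub>Q\<^esub> fm G g"
    and G_full: "\<lbrakk>x \<in> Ob T; y \<in> Ob T; h \<in> hom Q (fo G x) (fo G y)\<rbrakk> \<Longrightarrow> \<exists>f \<in> hom T x y. fm G f = h"
    and G_faithful: "\<lbrakk>f \<in> hom T x y; g \<in> hom T x y; fm G f = fm G g\<rbrakk> \<Longrightarrow> f = g"
    and G_surj: "q \<in> Ob Q \<Longrightarrow> \<exists>y \<in> Ob T. \<exists>e \<in> hom Q (fo G y) q. iso_arr Q e"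
    and susp: "is_equivalence T T \<Sigma>"
    and \<psi>_hom: "x \<in> Ob T \<Longrightarrow> \<psi> x \<in> hom Q (fo \<Omega> (fo G (fo \<Sigma> x))) (fo G x)"
    and \<psi>_iso: "x \<in> Ob T \<Longrightarrow> iso_arr Q (\<psi> x)"
    and \<psi>_nat: "f \<in> Ar T \<Longrightarrow> \<psi> (tgt T f) \<cdot>\<^bsub>Q\<^esub> fm \<Omega> (fm G (fm \<Sigma> f)) = fm G f \<cdot>\<^bsub>Q\<^esub> \<psi> (src T f)"
begin

lemma susp_functor: "is_functor T T \<Sigma>"
  using susp unfolding is_equivalence_def quasi_inverse_def by auto

lemma G_simps [simp]:
  "x \<in> Ob T \<Longrightarrow> fo G x \<in> Ob Q"
  "f \<in> Ar T \<Longrightarrow> fm G f \<in> Ar Q"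
  "f \<in> Ar T \<Longrightarrow> src Q (fm G f) = fo G (src T f)"
  "f \<in> Ar T \<Longrightarrow> tgt Q (fm G f) = fo G (tgt T f)"
  "x \<in> Ob T \<Longrightarrow> fm G (ident T x) = ident Q (fo G x)"
  "\<lbrakk>f \<in> Ar T; g \<in> Ar T; tgt T f = src T g\<rbrakk> \<Longrightarrow> fm G (g \<cdot>\<^bsub>T\<^esub> f) = fm G g \<cdot>\<^bsub>Q\<^esub> fm G f"
  using is_functorD(3-8)[OF G_functor] by simp_all

lemma susp_simps [simp]:
  "x \<in> Ob T \<Longrightarrow> fo \<Sigma> x \<in> Ob T"
  "f \<in> Ar T \<Longrightarrow> fm \<Sigma> f \<in> Ar T"
  "f \<in> Ar T \<Longrightarrow> src T (fm \<Sigma> f) = fo \<Sigma> (src T f)"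
  "f \<in> Ar T \<Longrightarrow> tgt T (fm \<Sigma> f) = fo \<Sigma> (tgt T f)"
  "x \<in> Ob T \<Longrightarrow> fm \<Sigma> (ident T x) = ident T (fo \<Sigma> x)"
  "\<lbrakk>f \<in> Ar T; g \<in> Ar T; tgt T f = src T g\<rbrakk> \<Longrightarrow> fm \<Sigma> (g \<cdot>\<^bsub>T\<^esub> f) = fm \<Sigma> g \<cdot>\<^bsub>T\<^esub> fm \<Sigma> f"
  using is_functorD(3-8)[OF susp_functor] by simp_all

lemma \<psi>_simps [simp]:
  "x \<in> Ob T \<Longrightarrow> \<psi> x \<in> Ar Q"
  "x \<in> Ob T \<Longrightarrow> src Q (\<psi> x) = fo \<Omega> (fo G (fo \<Sigma> x))"
  "x \<in> Ob T \<Longrightarrow> tgt Q (\<psi> x) = fo G x"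
  using \<psi>_hom[of x] by simp_all

lemma G_sum [simp]: "\<lbrakk>f \<in> Ar T; g \<in> Ar T; src T f = src T g; tgt T f = tgt T g\<rbrakk>
    \<Longrightarrow> fm G (f \<oplus>\<^bsub>T\<^esub> g) = fm G f \<oplus>\<^bsub>Q\<^esub> fm G g"
  by (rule G_add[of _ "src T g" "tgt T g"]) simp_all

lemma G_zer [simp]: assumes "x \<in> Ob T" "y \<in> Ob T" shows "fm G (zer T x y) = zer Q (fo G x) (fo G y)"
  by (rule add_cancel_left[of "fm G (zer T x y)"]) (use assms G_sum[of "zer T x y" "zer T x y"] in simp_all)

lemma G_neg [simp]: assumes "f \<in> Ar T" shows "fm G (neg T f) = neg Q (fm G f)"
  by (rule neg_unique[symmetric]) (use assms G_sum[of f "neg T f"] in simp_all)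

lemma G_eqI:
  "\<lbrakk>fm G f = fm G g; f \<in> Ar T; g \<in> Ar T; src T f = src T g; tgt T f = tgt T g\<rbrakk> \<Longrightarrow> f = g"
  by (rule G_faithful[of f "src T g" "tgt T g"]) simp_all

text \<open>An arrow \<open>w\<close> into a suspension is visible in \<open>Q\<close> only through
  \<open>fm \<Omega> (fm G w)\<close>, so equations between such arrows are tested there.\<close>

lemma loop_G_eqI:
  "\<lbrakk>fm \<Omega> (fm G f) = fm \<Omega> (fm G g); f \<in> Ar T; g \<in> Ar T; src T f = src T g; tgt T f = tgt T g\<rbrakk> \<Longrightarrow> f = g"
  by (rule G_eqI, rule loop_faithful[of _ "fo G (src T g)" "fo G (tgt T g)"]) simp_all

lemma loop_G_full:
  assumes "x \<in> Ob T" "y \<in> Ob T" "h \<in> Ar Q" "src Q h = fo \<Omega> (fo G x)" "tgt Q h = fo \<Omega> (fo G y)"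
  obtains f where "f \<in> Ar T" "src T f = x" "tgt T f = y" "fm \<Omega> (fm G f) = h"
proof -
  obtain f' where f': "f' \<in> hom Q (fo G x) (fo G y)" "fm \<Omega> f' = h"
    using loop_full[of "fo G x" "fo G y" h] assms by auto
  obtain f where "f \<in> hom T x y" "fm G f = f'" using G_full[OF assms(1,2) f'(1)] by auto
  then show ?thesis using that f' by auto
qed

lemma G_iso: "iso_arr T a \<Longrightarrow> iso_arr Q (fm G a)"
  by (rule functor_iso[OF G_functor])

lemma \<psi>_natural: "\<lbrakk>f \<in> Ar T; src T f = x; tgt T f = y\<rbrakk> \<Longrightarrow>
    \<psi> y \<cdot>\<^bsub>Q\<^esub> fm \<Omega> (fm G (fm \<Sigma> f)) = fm G f \<cdot>\<^bsub>Q\<^esub> \<psi> x"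
  using \<psi>_nat by blast

text \<open>By naturality of \<psi>, the arrow \<Omega>G\<Sigma>f followed by \<psi> is \<psi>
  followed by Gf, which is additive in f. Cancelling \<psi> and then \<Omega>G leaves additivity of
  \<Sigma>.\<close>

lemma susp_sum:
  assumes [simp]: "f \<in> Ar T" "g \<in> Ar T" "src T f = src T g" "tgt T f = tgt T g"
  shows "fm \<Sigma> (f \<oplus>\<^bsub>T\<^esub> g) = fm \<Sigma> f \<oplus>\<^bsub>T\<^esub> fm \<Sigma> g"
proof (rule loop_G_eqI, rule iso_cancel_left[OF \<psi>_iso[of "tgt T g"]])
  show "\<psi> (tgt T g) \<cdot>\<^bsub>Q\<^esub> fm \<Omega> (fm G (fm \<Sigma> (f \<oplus>\<^bsub>T\<^esub> g))) = \<psi> (tgt T g) \<cdot>\<^bsub>Q\<^esub> fm \<Omega> (fm G (fm \<Sigma> f \<oplus>\<^bsub>T\<^esub> fm \<Sigma> g))"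
    by (simp add: \<psi>_natural[of _ "src T g"])
qed simp_all

definition distinguished :: "('m \<times> 'm \<times> 'm) set" where
  "distinguished = {(u, v, w). triangle_sequence T \<Sigma> u v w \<and>
     (\<psi> (src T u) \<cdot>\<^bsub>Q\<^esub> fm \<Omega> (fm G w), fm G u, fm G v) \<in> \<Delta>}"

lemma distinguished_iff:
  "(u, v, w) \<in> distinguished \<longleftrightarrow> u \<in> Ar T \<and> v \<in> Ar T \<and> w \<in> Ar T \<and> src T v = tgt T u \<and> src T w = tgt T v \<and>
    tgt T w = fo \<Sigma> (src T u) \<and> (\<psi> (src T u) \<cdot>\<^bsub>Q\<^esub> fm \<Omega> (fm G w), fm G u, fm G v) \<in> \<Delta>"
  unfolding distinguished_def triangle_sequence_def by auto

text \<open>Rotating the left triangle of \<open>(v, w, neg T (fm \<Sigma> u))\<close> once more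
  brings \<open>u\<close> back as the middle arrow, by naturality of \<psi>. Both of its first two
  arrows then carry a minus sign, and the isomorphism \<open>neg Q (\<psi> (src T u))\<close> on the
  first vertex absorbs them together.\<close>

lemma rotate_back:
  assumes uvw [simp]: "u \<in> Ar T" "v \<in> Ar T" "w \<in> Ar T" "src T v = tgt T u" "src T w = tgt T v" "tgt T w = fo \<Sigma> (src T u)"
    and d: "(v, w, neg T (fm \<Sigma> u)) \<in> distinguished"
  shows "(u, v, w) \<in> distinguished"
proof -
  have "(\<psi> (src T v) \<cdot>\<^bsub>Q\<^esub> fm \<Omega> (fm G (neg T (fm \<Sigma> u))), fm G v, fm G w) \<in> \<Delta>"
    using d by (simp add: distinguished_iff)
  from tri_rotate[OF this]
  have t: "(neg Q (fm \<Omega> (fm G w)), neg Q (fm G u \<cdot>\<^bsub>Q\<^esub> \<psi> (src T u)), fm G v) \<in> \<Delta>"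
    by (simp add: \<psi>_natural[of u "src T u" "tgt T u"])
  have "(\<psi> (src T u) \<cdot>\<^bsub>Q\<^esub> fm \<Omega> (fm G w), fm G u, fm G v) \<in> \<Delta>"
    by (rule triI_iso[OF t, of _ _ _ "neg Q (\<psi> (src T u))" "ident Q (fo G (tgt T u))" "ident Q (fo G (tgt T v))"])
      (simp_all add: iso_neg \<psi>_iso)
  then show ?thesis by (simp add: distinguished_iff)
qed

text \<open>Unrotating produces a triangle ending in an object \<open>s\<close> with
  \<open>fo \<Omega> s\<close> isomorphic to \<open>fo G x\<close> by \<kappa>. Since \<psi>
  identifies the loop object of \<open>fo G (fo \<Sigma> x)\<close> with \<open>fo G x\<close> too,
  the composite of \<kappa> with the inverse of \<psi> lifts along \<Omega> to \<sigma>, which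
  replaces \<open>s\<close> by the suspension and \<open>c\<close> by \<open>fm G w\<close>.\<close>

lemma rotate_forward:
  assumes d: "(u, v, w) \<in> distinguished"
  shows "(v, w, neg T (fm \<Sigma> u)) \<in> distinguished"
proof -
  have uvw [simp]: "u \<in> Ar T" "v \<in> Ar T" "w \<in> Ar T" "src T v = tgt T u" "src T w = tgt T v" "tgt T w = fo \<Sigma> (src T u)"
    and t: "(\<psi> (src T u) \<cdot>\<^bsub>Q\<^esub> fm \<Omega> (fm G w), fm G u, fm G v) \<in> \<Delta>" using d by (simp_all add: distinguished_iff)
  define x where "x = src T u"
  have x [simp]: "x \<in> Ob T" "src T u = x" by (simp_all add: x_def)
  obtain s \<kappa> c where s [simp]: "s \<in> Ob Q" and \<kappa> [simp]: "\<kappa> \<in> Ar Q" "src Q \<kappa> = fo \<Omega> s" "tgt Q \<kappa> = fo G x"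
    and c [simp]: "c \<in> Ar Q" "src Q c = fo G (tgt T v)" "tgt Q c = s"
    and iso: "iso_arr Q \<kappa>" and kc: "\<kappa> \<cdot>\<^bsub>Q\<^esub> fm \<Omega> c = \<psi> x \<cdot>\<^bsub>Q\<^esub> fm \<Omega> (fm G w)"
    and t': "(neg Q (fm G u \<cdot>\<^bsub>Q\<^esub> \<kappa>), fm G v, c) \<in> \<Delta>"
    using tri_unrotate[OF t] by auto
  note [simp] = arr_inv(1-3)[OF \<psi>_iso[OF x(1)], simplified] arr_inv(6)[OF \<psi>_iso[OF x(1)]]
    arr_inv_simps[OF \<psi>_iso[OF x(1)], simplified] arr_inv(5)[OF \<psi>_iso[OF x(1)], simplified]
  obtain \<sigma> where \<sigma> [simp]: "\<sigma> \<in> Ar Q" "src Q \<sigma> = s" "tgt Q \<sigma> = fo G (fo \<Sigma> x)" and \<sigma>e: "fm \<Omega> \<sigma> = arr_inv (\<psi> x) \<cdot>\<^bsub>Q\<^esub> \<kappa>"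
    using loop_full[of s "fo G (fo \<Sigma> x)" "arr_inv (\<psi> x) \<cdot>\<^bsub>Q\<^esub> \<kappa>"] by auto
  \<comment> \<open>A fully faithful functor reflects isomorphisms: the inverse lifts to \<tau>, and
    the two inverse laws hold because they hold after \<Omega>.\<close>
  have "iso_arr Q (fm \<Omega> \<sigma>)" unfolding \<sigma>e by (rule iso_cmp[OF iso]) simp_all
  then obtain \<tau>' where \<tau>': "\<tau>' \<in> Ar Q" "src Q \<tau>' = fo \<Omega> (fo G (fo \<Sigma> x))" "tgt Q \<tau>' = fo \<Omega> s"
      "\<tau>' \<cdot>\<^bsub>Q\<^esub> fm \<Omega> \<sigma> = ident Q (fo \<Omega> s)" "fm \<Omega> \<sigma> \<cdot>\<^bsub>Q\<^esub> \<tau>' = ident Q (fo \<Omega> (fo G (fo \<Sigma> x)))"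
    by (rule iso_arrE) simp
  obtain \<tau> where \<tau> [simp]: "\<tau> \<in> Ar Q" "src Q \<tau> = fo G (fo \<Sigma> x)" "tgt Q \<tau> = s" and \<tau>e: "fm \<Omega> \<tau> = \<tau>'"
    using loop_full[of "fo G (fo \<Sigma> x)" s \<tau>'] \<tau>' by auto
  have "\<tau> \<cdot>\<^bsub>Q\<^esub> \<sigma> = ident Q s" by (rule loop_faithful[of _ s s]) (use \<tau>' \<tau>e in simp_all)
  moreover have "\<sigma> \<cdot>\<^bsub>Q\<^esub> \<tau> = ident Q (fo G (fo \<Sigma> x))"
    by (rule loop_faithful[of _ "fo G (fo \<Sigma> x)" "fo G (fo \<Sigma> x)"]) (use \<tau>' \<tau>e in simp_all)
  ultimately have \<sigma>i: "iso_arr Q \<sigma>" by (intro iso_arrI[of _ \<tau>]) simp_all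
  have "fm \<Omega> (\<sigma> \<cdot>\<^bsub>Q\<^esub> c) = fm \<Omega> (fm G w)"
    by (simp add: \<sigma>e kc)
  then have \<sigma>c: "\<sigma> \<cdot>\<^bsub>Q\<^esub> c = fm G w"
    by (intro loop_faithful[of "\<sigma> \<cdot>\<^bsub>Q\<^esub> c" "fo G (tgt T v)" "fo G (fo \<Sigma> x)"]) simp_all
  have "(\<psi> (src T v) \<cdot>\<^bsub>Q\<^esub> fm \<Omega> (fm G (neg T (fm \<Sigma> u))), fm G v, fm G w) \<in> \<Delta>"
    by (rule triI_iso[OF t', of _ _ _ "ident Q (fo G (tgt T u))" "ident Q (fo G (tgt T v))" \<sigma>])
      (simp_all add: \<sigma>i \<sigma>c \<sigma>e \<psi>_natural[of u x "tgt T u"])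
  then show ?thesis by (simp add: distinguished_iff)
qed

end

context loop_transport
begin

lemma distinguished_iso:
  assumes d: "(u, v, w) \<in> distinguished" and "triangle_sequence T \<Sigma> u' v' w'"
    and "a \<in> hom T (src T u) (src T u')" "b \<in> hom T (tgt T u) (tgt T u')" "c \<in> hom T (tgt T v) (tgt T v')"
    and i: "iso_arr T a" "iso_arr T b" "iso_arr T c"
    and e: "b \<cdot>\<^bsub>T\<^esub> u = u' \<cdot>\<^bsub>T\<^esub> a" "c \<cdot>\<^bsub>T\<^esub> v = v' \<cdot>\<^bsub>T\<^esub> b" "fm \<Sigma> a \<cdot>\<^bsub>T\<^esub> w = w' \<cdot>\<^bsub>T\<^esub> c"
  shows "(u', v', w') \<in> distinguished"
proof -
  define x x' where "x = src T u" "x' = src T u'"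
  have uvw [simp]: "u \<in> Ar T" "v \<in> Ar T" "w \<in> Ar T" "src T v = tgt T u" "src T w = tgt T v" "tgt T w = fo \<Sigma> x" "src T u = x"
    and t: "(\<psi> x \<cdot>\<^bsub>Q\<^esub> fm \<Omega> (fm G w), fm G u, fm G v) \<in> \<Delta>"
    using d by (simp_all add: distinguished_iff x_x'_def)
  have uvw' [simp]: "u' \<in> Ar T" "v' \<in> Ar T" "w' \<in> Ar T" "src T v' = tgt T u'" "src T w' = tgt T v'" "tgt T w' = fo \<Sigma> x'" "src T u' = x'"
    using assms(2) by (simp_all add: triangle_sequence_def x_x'_def)
  have [simp]: "x \<in> Ob T" "x' \<in> Ob T" using T.src_in_Ob[of u] T.src_in_Ob[of u'] by simp_all
  have abc [simp]: "a \<in> Ar T" "src T a = x" "tgt T a = x'" "b \<in> Ar T" "src T b = tgt T u" "tgt T b = tgt T u'"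
    "c \<in> Ar T" "src T c = tgt T v" "tgt T c = tgt T v'" using assms(3-5) by simp_all
  have "fm \<Omega> (fm G (fm \<Sigma> a \<cdot>\<^bsub>T\<^esub> w)) = fm \<Omega> (fm G (w' \<cdot>\<^bsub>T\<^esub> c))" using e(3) by simp
  then have e3: "fm \<Omega> (fm G w') \<cdot>\<^bsub>Q\<^esub> fm \<Omega> (fm G c) = fm \<Omega> (fm G (fm \<Sigma> a)) \<cdot>\<^bsub>Q\<^esub> fm \<Omega> (fm G w)"
    by simp
  have e1: "fm G b \<cdot>\<^bsub>Q\<^esub> fm G u = fm G u' \<cdot>\<^bsub>Q\<^esub> fm G a" and e2: "fm G c \<cdot>\<^bsub>Q\<^esub> fm G v = fm G v' \<cdot>\<^bsub>Q\<^esub> fm G b"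
    using arg_cong[OF e(1), of "fm G"] arg_cong[OF e(2), of "fm G"] by simp_all
  have "(\<psi> x' \<cdot>\<^bsub>Q\<^esub> fm \<Omega> (fm G w'), fm G u', fm G v') \<in> \<Delta>"
    by (rule triI_iso[OF t, of _ _ _ "fm G a" "fm G b" "fm G c"])
      (simp_all add: G_iso i e1 e2 e3 reassoc[OF \<psi>_natural[of a x x']])
  then show ?thesis by (simp add: distinguished_iff)
qed

lemma distinguished_ident:
  assumes x [simp]: "x \<in> Ob T" and z: "zero_object T z"
  shows "(ident T x, zer T x z, zer T z (fo \<Sigma> x)) \<in> distinguished"
proof -
  have z' [simp]: "z \<in> Ob T" and "ident T z = zer T z z" using z by (simp_all add: T.zero_object_iff)
  then have "ident Q (fo G z) = zer Q (fo G z) (fo G z)" using G_simps(5)[of z] by simp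
  then have "zero_object Q (fo G z)" by (simp add: zero_object_iff)
  from tri_trivial[OF _ this, of "fo G x"] show ?thesis by (simp add: distinguished_iff)
qed

text \<open>The cone of \<open>fm G u\<close> is moved by \<open>e\<close> to an object in the image
  of \<open>G\<close>. The arrow \<open>w\<close> is then forced: \<Omega>G must send it to the
  first arrow of the left triangle, corrected by \<open>fm \<Omega> e\<close> and by the inverse of
  \<psi>.\<close>

lemma distinguished_complete:
  assumes u [simp]: "u \<in> Ar T"
  shows "\<exists>v w. (u, v, w) \<in> distinguished"
proof -
  define x where "x = src T u"
  have x [simp]: "x \<in> Ob T" "src T u = x" by (simp_all add: x_def)
  obtain h v0 where t: "(h, fm G u, v0) \<in> \<Delta>" by (rule tri_extend[of "fm G u"]) simp_all
  have [simp]: "h \<in> Ar Q" "v0 \<in> Ar Q" "src Q h = fo \<Omega> (tgt Q v0)" "tgt Q h = fo G x" "src Q v0 = fo G (tgt T u)"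
    using triD[OF t] by simp_all
  obtain z e where z [simp]: "z \<in> Ob T" and e [simp]: "e \<in> Ar Q" "src Q e = fo G z" "tgt Q e = tgt Q v0" and ei: "iso_arr Q e"
    using G_surj[of "tgt Q v0"] by auto
  note [simp] = arr_inv(1-3)[OF ei, simplified] arr_inv(1-3)[OF \<psi>_iso[OF x(1)], simplified]
    arr_inv_simps[OF \<psi>_iso[OF x(1)], simplified]
  obtain v where v [simp]: "v \<in> Ar T" "src T v = tgt T u" "tgt T v = z" and ve: "fm G v = arr_inv e \<cdot>\<^bsub>Q\<^esub> v0"
    using G_full[of "tgt T u" z "arr_inv e \<cdot>\<^bsub>Q\<^esub> v0"] by auto
  obtain w where w [simp]: "w \<in> Ar T" "src T w = z" "tgt T w = fo \<Sigma> x"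
    and we: "fm \<Omega> (fm G w) = arr_inv (\<psi> x) \<cdot>\<^bsub>Q\<^esub> (h \<cdot>\<^bsub>Q\<^esub> fm \<Omega> e)"
    by (rule loop_G_full[of z "fo \<Sigma> x" "arr_inv (\<psi> x) \<cdot>\<^bsub>Q\<^esub> (h \<cdot>\<^bsub>Q\<^esub> fm \<Omega> e)"]) simp_all
  have "(\<psi> x \<cdot>\<^bsub>Q\<^esub> fm \<Omega> (fm G w), fm G u, fm G v) \<in> \<Delta>"
    by (rule triI_iso[OF t, of _ _ _ "ident Q (fo G x)" "ident Q (fo G (tgt T u))" "arr_inv e"])
      (simp_all add: ve we arr_inv(6)[OF ei] loop_inv(2)[OF ei])
  then show ?thesis by (intro exI[of _ v] exI[of _ w]) (simp add: distinguished_iff)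
qed

lemma distinguished_morphism:
  assumes d: "(u, v, w) \<in> distinguished" and d': "(u', v', w') \<in> distinguished"
    and ab: "a \<in> hom T (src T u) (src T u')" "b \<in> hom T (tgt T u) (tgt T u')" and e: "b \<cdot>\<^bsub>T\<^esub> u = u' \<cdot>\<^bsub>T\<^esub> a"
  shows "\<exists>c \<in> hom T (tgt T v) (tgt T v'). c \<cdot>\<^bsub>T\<^esub> v = v' \<cdot>\<^bsub>T\<^esub> b \<and> fm \<Sigma> a \<cdot>\<^bsub>T\<^esub> w = w' \<cdot>\<^bsub>T\<^esub> c"
proof -
  define x x' where "x = src T u" "x' = src T u'"
  have uvw [simp]: "u \<in> Ar T" "v \<in> Ar T" "w \<in> Ar T" "src T v = tgt T u" "src T w = tgt T v" "tgt T w = fo \<Sigma> x" "src T u = x"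
    and t: "(\<psi> x \<cdot>\<^bsub>Q\<^esub> fm \<Omega> (fm G w), fm G u, fm G v) \<in> \<Delta>"
    using d by (simp_all add: distinguished_iff x_x'_def)
  have uvw' [simp]: "u' \<in> Ar T" "v' \<in> Ar T" "w' \<in> Ar T" "src T v' = tgt T u'" "src T w' = tgt T v'" "tgt T w' = fo \<Sigma> x'" "src T u' = x'"
    and t': "(\<psi> x' \<cdot>\<^bsub>Q\<^esub> fm \<Omega> (fm G w'), fm G u', fm G v') \<in> \<Delta>"
    using d' by (simp_all add: distinguished_iff x_x'_def)
  have [simp]: "x \<in> Ob T" "x' \<in> Ob T" using T.src_in_Ob[of u] T.src_in_Ob[of u'] by simp_all
  have ab' [simp]: "a \<in> Ar T" "src T a = x" "tgt T a = x'" "b \<in> Ar T" "src T b = tgt T u" "tgt T b = tgt T u'"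
    using ab by simp_all
  have e1: "fm G b \<cdot>\<^bsub>Q\<^esub> fm G u = fm G u' \<cdot>\<^bsub>Q\<^esub> fm G a" using arg_cong[OF e, of "fm G"] by simp
  obtain c0 where [simp]: "c0 \<in> Ar Q" "src Q c0 = fo G (tgt T v)" "tgt Q c0 = fo G (tgt T v')" and c0: "c0 \<cdot>\<^bsub>Q\<^esub> fm G v = fm G v' \<cdot>\<^bsub>Q\<^esub> fm G b"
      "fm G a \<cdot>\<^bsub>Q\<^esub> (\<psi> x \<cdot>\<^bsub>Q\<^esub> fm \<Omega> (fm G w)) = (\<psi> x' \<cdot>\<^bsub>Q\<^esub> fm \<Omega> (fm G w')) \<cdot>\<^bsub>Q\<^esub> fm \<Omega> c0"
    using tri_morphism[OF t t', of "fm G a" "fm G b"] e1 by auto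
  obtain c where c [simp]: "c \<in> Ar T" "src T c = tgt T v" "tgt T c = tgt T v'" "fm G c = c0"
    using G_full[of "tgt T v" "tgt T v'" c0] by auto
  have "c \<cdot>\<^bsub>T\<^esub> v = v' \<cdot>\<^bsub>T\<^esub> b" by (rule G_eqI) (simp_all add: c0(1))
  moreover have "fm \<Sigma> a \<cdot>\<^bsub>T\<^esub> w = w' \<cdot>\<^bsub>T\<^esub> c"
  proof (rule loop_G_eqI, rule iso_cancel_left[OF \<psi>_iso[of x']])
    show "\<psi> x' \<cdot>\<^bsub>Q\<^esub> fm \<Omega> (fm G (fm \<Sigma> a \<cdot>\<^bsub>T\<^esub> w)) = \<psi> x' \<cdot>\<^bsub>Q\<^esub> fm \<Omega> (fm G (w' \<cdot>\<^bsub>T\<^esub> c))"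
      using c0(2) by (simp add: reassoc[OF \<psi>_natural[of a x x']])
  qed simp_all
  ultimately show ?thesis by (intro bexI[of _ c]) simp_all
qed

text \<open>The two new arrows are lifted along \<open>G\<close>. Equations between arrows into
  suspensions are checked after \<Omega>G and \<psi>, the others after \<open>G\<close>; naturality
  of \<psi> turns \<open>fm \<Sigma> u\<close> and \<open>fm \<Sigma> i\<close> into
  \<open>fm G u\<close> and \<open>fm G i\<close>.\<close>

lemma distinguished_octahedron:
  assumes uv: "tgt T u = src T v" and d: "(u, i, j) \<in> distinguished" "(v, k, l) \<in> distinguished" "(v \<cdot>\<^bsub>T\<^esub> u, m, n) \<in> distinguished"
  shows "\<exists>f \<in> hom T (tgt T i) (tgt T m). \<exists>g \<in> hom T (tgt T m) (tgt T k).
          f \<cdot>\<^bsub>T\<^esub> i = m \<cdot>\<^bsub>T\<^esub> v \<and> n \<cdot>\<^bsub>T\<^esub> f = j \<and> g \<cdot>\<^bsub>T\<^esub> m = k \<and> l \<cdot>\<^bsub>T\<^esub> g = fm \<Sigma> u \<cdot>\<^bsub>T\<^esub> n \<and>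
          (f, g, fm \<Sigma> i \<cdot>\<^bsub>T\<^esub> l) \<in> distinguished"
proof -
  define x y where "x = src T u" "y = src T v"
  have 1 [simp]: "u \<in> Ar T" "i \<in> Ar T" "j \<in> Ar T" "src T i = y" "src T j = tgt T i" "tgt T j = fo \<Sigma> x" "src T u = x" "tgt T u = y" "src T v = y"
    and t1: "(\<psi> x \<cdot>\<^bsub>Q\<^esub> fm \<Omega> (fm G j), fm G u, fm G i) \<in> \<Delta>"
    using d(1) uv by (simp_all add: distinguished_iff x_y_def)
  have 2 [simp]: "v \<in> Ar T" "k \<in> Ar T" "l \<in> Ar T" "src T k = tgt T v" "src T l = tgt T k" "tgt T l = fo \<Sigma> y"
    and t2: "(\<psi> y \<cdot>\<^bsub>Q\<^esub> fm \<Omega> (fm G l), fm G v, fm G k) \<in> \<Delta>"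
    using d(2) by (simp_all add: distinguished_iff)
  have 3 [simp]: "m \<in> Ar T" "n \<in> Ar T" "src T m = tgt T v" "src T n = tgt T m" "tgt T n = fo \<Sigma> x"
    and t3: "(\<psi> x \<cdot>\<^bsub>Q\<^esub> fm \<Omega> (fm G n), fm G v \<cdot>\<^bsub>Q\<^esub> fm G u, fm G m) \<in> \<Delta>"
    using d(3) by (simp_all add: distinguished_iff)
  have [simp]: "x \<in> Ob T" "y \<in> Ob T" using T.src_in_Ob[of u] T.src_in_Ob[of v] by simp_all
  obtain f0 g0 where f0: "f0 \<in> Ar Q" "src Q f0 = fo G (tgt T i)" "tgt Q f0 = fo G (tgt T m)"
    and g0: "g0 \<in> Ar Q" "src Q g0 = fo G (tgt T m)" "tgt Q g0 = fo G (tgt T k)"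
    and e: "f0 \<cdot>\<^bsub>Q\<^esub> fm G i = fm G m \<cdot>\<^bsub>Q\<^esub> fm G v"
      "(\<psi> x \<cdot>\<^bsub>Q\<^esub> fm \<Omega> (fm G n)) \<cdot>\<^bsub>Q\<^esub> fm \<Omega> f0 = \<psi> x \<cdot>\<^bsub>Q\<^esub> fm \<Omega> (fm G j)"
      "g0 \<cdot>\<^bsub>Q\<^esub> fm G m = fm G k"
      "fm G u \<cdot>\<^bsub>Q\<^esub> (\<psi> x \<cdot>\<^bsub>Q\<^esub> fm \<Omega> (fm G n)) = (\<psi> y \<cdot>\<^bsub>Q\<^esub> fm \<Omega> (fm G l)) \<cdot>\<^bsub>Q\<^esub> fm \<Omega> g0"
    and t4: "(fm G i \<cdot>\<^bsub>Q\<^esub> (\<psi> y \<cdot>\<^bsub>Q\<^esub> fm \<Omega> (fm G l)), f0, g0) \<in> \<Delta>"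
    using tri_octahedron_all[OF _ t1 t2 t3] by auto
  obtain f where f [simp]: "f \<in> Ar T" "src T f = tgt T i" "tgt T f = tgt T m" and fe: "f0 = fm G f"
    using G_full[of "tgt T i" "tgt T m" f0] f0 by auto
  obtain g where g [simp]: "g \<in> Ar T" "src T g = tgt T m" "tgt T g = tgt T k" and ge: "g0 = fm G g"
    using G_full[of "tgt T m" "tgt T k" g0] g0 by auto
  have "f \<cdot>\<^bsub>T\<^esub> i = m \<cdot>\<^bsub>T\<^esub> v" by (rule G_eqI) (use e(1) fe in simp_all)
  moreover have "n \<cdot>\<^bsub>T\<^esub> f = j"
  proof (rule loop_G_eqI, rule iso_cancel_left[OF \<psi>_iso[of x]])
    show "\<psi> x \<cdot>\<^bsub>Q\<^esub> fm \<Omega> (fm G (n \<cdot>\<^bsub>T\<^esub> f)) = \<psi> x \<cdot>\<^bsub>Q\<^esub> fm \<Omega> (fm G j)" using e(2) fe by simp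
  qed simp_all
  moreover have "g \<cdot>\<^bsub>T\<^esub> m = k" by (rule G_eqI) (use e(3) ge in simp_all)
  moreover have "l \<cdot>\<^bsub>T\<^esub> g = fm \<Sigma> u \<cdot>\<^bsub>T\<^esub> n"
  proof (rule loop_G_eqI, rule iso_cancel_left[OF \<psi>_iso[of y]])
    show "\<psi> y \<cdot>\<^bsub>Q\<^esub> fm \<Omega> (fm G (l \<cdot>\<^bsub>T\<^esub> g)) = \<psi> y \<cdot>\<^bsub>Q\<^esub> fm \<Omega> (fm G (fm \<Sigma> u \<cdot>\<^bsub>T\<^esub> n))"
      using e(4) ge by (simp add: reassoc[OF \<psi>_natural[of u x y]])
  qed simp_all
  moreover have "(f, g, fm \<Sigma> i \<cdot>\<^bsub>T\<^esub> l) \<in> distinguished"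
    using t4 fe ge by (simp add: distinguished_iff reassoc[OF \<psi>_natural[of i y "tgt T i"]])
  ultimately show ?thesis by (intro bexI[of _ f] bexI[of _ g]) simp_all
qed

theorem triangulated: "triangulated_category T \<Sigma> distinguished"
proof (unfold_locales, goal_cases)
  case 1 show ?case by (rule susp)
next
  case (2 f x y g) then show ?case by (intro susp_sum) simp_all
next
  case (3 u v w) then show ?case by (simp add: distinguished_def)
next
  case (4 u v w u' v' w' a b c) then show ?case by (rule distinguished_iso)
next
  case (5 x z) then show ?case by (rule distinguished_ident)
next
  case (6 u) then show ?case by (rule distinguished_complete)
next
  case (7 u v w)
  then have "u \<in> Ar T" "v \<in> Ar T" "w \<in> Ar T" "src T v = tgt T u" "src T w = tgt T v" "tgt T w = fo \<Sigma> (src T u)"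
    by (simp_all add: triangle_sequence_def)
  from rotate_back[OF this] show ?case using rotate_forward by blast
next
  case (8 u v w u' v' w' a b) then show ?case by (rule distinguished_morphism)
next
  case (9 u v i j k l m n) then show ?case by (rule distinguished_octahedron)
qed

end

section \<open>Transport of an additive structure along an equivalence\<close>

definition transported_additive ::
  "('q, 'n, 'z) addcat_scheme \<Rightarrow> ('o, 'm) cat \<Rightarrow> ('o, 'm, 'q, 'n) funct \<Rightarrow> ('o, 'm) addcat" where
  "transported_additive Q H G = \<lparr>Ob = Ob H, Ar = Ar H, src = src H, tgt = tgt H, ident = ident H, cmp = cmp H,
     add = (\<lambda>f g. THE h. h \<in> hom H (src H f) (tgt H f) \<and> fm G h = fm G f \<oplus>\<^bsub>Q\<^esub> fm G g),
     zer = (\<lambda>x y. THE h. h \<in> hom H x y \<and> fm G h = zer Q (fo G x) (fo G y)),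
     neg = (\<lambda>f. THE h. h \<in> hom H (src H f) (tgt H f) \<and> fm G h = neg Q (fm G f))\<rparr>"

text \<open>The localization comes without an addition. As \<open>G\<close> is fully faithful, sums,
  zeros and negatives of images have unique preimages, so \<open>THE\<close> is well defined on
  parallel arrows. Truncation returns \<open>H\<close> itself and not a copy, as
  \<open>is_triangulation\<close> demands.\<close>

lemma transported_additive:
  fixes H :: "('o, 'm) cat"
  assumes "additive_category Q" and GF: "is_functor H Q G"
    and faithful: "\<And>x y f g. \<lbrakk>f \<in> hom H x y; g \<in> hom H x y; fm G f = fm G g\<rbrakk> \<Longrightarrow> f = g"
    and full: "\<And>x y h. \<lbrakk>x \<in> Ob H; y \<in> Ob H; h \<in> hom Q (fo G x) (fo G y)\<rbrakk> \<Longrightarrow> \<exists>f \<in> hom H x y. fm G f = h"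
    and surj: "\<And>y. y \<in> Ob Q \<Longrightarrow> \<exists>x \<in> Ob H. \<exists>e \<in> hom Q (fo G x) y. iso_arr Q e"
  shows "additive_category (transported_additive Q H G)" (is "additive_category ?T")
    and "cat.truncate (transported_additive Q H G) = H"
    and "\<lbrakk>f \<in> hom H x y; g \<in> hom H x y\<rbrakk> \<Longrightarrow> fm G (add (transported_additive Q H G) f g) = fm G f \<oplus>\<^bsub>Q\<^esub> fm G g"
proof -
  interpret Q: additive_category Q by fact
  interpret H: category H using is_functorD(1)[OF GF] .
  note G [simp] = is_functorD(3-8)[OF GF]
  have T [simp]: "Ob ?T = Ob H" "Ar ?T = Ar H" "src ?T = src H" "tgt ?T = tgt H" "ident ?T = ident H" "cmp ?T = cmp H"
    by (simp_all add: transported_additive_def)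
  have T_hom [simp]: "hom ?T = hom H" by (intro ext) (simp add: hom_def)
  have eqI: "f = g" if "fm G f = fm G g" "f \<in> Ar H" "g \<in> Ar H" "src H f = src H g" "tgt H f = tgt H g" for f g
    by (rule faithful[of f "src H g" "tgt H g"]) (use that in simp_all)
  have ex1: "\<exists>!f. f \<in> hom H x y \<and> fm G f = h" if "x \<in> Ob H" "y \<in> Ob H" "h \<in> hom Q (fo G x) (fo G y)" for x y h
    using full[OF that] faithful[of _ x y] by blast
  have add: "add ?T f g \<in> hom H x y \<and> fm G (add ?T f g) = fm G f \<oplus>\<^bsub>Q\<^esub> fm G g" if "f \<in> hom H x y" "g \<in> hom H x y" for f g x y
    using theI'[OF ex1[of x y "fm G f \<oplus>\<^bsub>Q\<^esub> fm G g"]] that by (auto simp: transported_additive_def)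
  have zer: "zer ?T x y \<in> hom H x y \<and> fm G (zer ?T x y) = zer Q (fo G x) (fo G y)" if "x \<in> Ob H" "y \<in> Ob H" for x y
    using theI'[OF ex1[of x y "zer Q (fo G x) (fo G y)"]] that by (auto simp: transported_additive_def)
  have neg: "neg ?T f \<in> hom H x y \<and> fm G (neg ?T f) = neg Q (fm G f)" if "f \<in> hom H x y" for f x y
    using theI'[OF ex1[of x y "neg Q (fm G f)"]] that by (auto simp: transported_additive_def)
  show "fm G (add ?T f g) = fm G f \<oplus>\<^bsub>Q\<^esub> fm G g" if "f \<in> hom H x y" "g \<in> hom H x y" for f g x y
    using add[OF that] by simp
  show "cat.truncate ?T = H" by (simp add: cat.truncate_def)
  have add' [simp]: "add ?T f g \<in> Ar H" "src H (add ?T f g) = src H g" "tgt H (add ?T f g) = tgt H g"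
      "fm G (add ?T f g) = fm G f \<oplus>\<^bsub>Q\<^esub> fm G g"
    if "f \<in> Ar H" "g \<in> Ar H" "src H f = src H g" "tgt H f = tgt H g" for f g
    using add[of f "src H g" "tgt H g" g] that by auto
  have zer' [simp]: "zer ?T x y \<in> Ar H" "src H (zer ?T x y) = x" "tgt H (zer ?T x y) = y" "fm G (zer ?T x y) = zer Q (fo G x) (fo G y)"
    if "x \<in> Ob H" "y \<in> Ob H" for x y using zer[OF that] by auto
  have neg' [simp]: "neg ?T f \<in> Ar H" "src H (neg ?T f) = src H f" "tgt H (neg ?T f) = tgt H f" "fm G (neg ?T f) = neg Q (fm G f)"
    if "f \<in> Ar H" for f using neg[of f "src H f" "tgt H f"] that by auto
  have zero: "\<exists>z. zero_object ?T z"
  proof -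
    obtain z0 where z0: "zero_object Q z0" using Q.ex_zero_object by auto
    then have [simp]: "z0 \<in> Ob Q" by (rule Q.zero_object_Ob)
    obtain z e where z [simp]: "z \<in> Ob H" and e [simp]: "e \<in> Ar Q" "src Q e = fo G z" "tgt Q e = z0" and ei: "iso_arr Q e"
      using surj[of z0] by auto
    \<comment> \<open>An isomorphism into a zero object is itself a zero arrow, so the identity of
      \<open>fo G z\<close>, which factors through it, vanishes.\<close>
    have "Q.arr_inv e \<cdot>\<^bsub>Q\<^esub> e = ident Q (fo G z)" using Q.arr_inv(4)[OF ei] by simp
    moreover have "e = zer Q (fo G z) z0" using Q.to_zero[OF z0, of e] by simp
    ultimately have "ident Q (fo G z) = zer Q (fo G z) (fo G z)"
      using Q.arr_inv(1-3)[OF ei] by (metis Q.cmp_zer e G(1) z)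
    then have Gz: "zero_object Q (fo G z)" by (simp add: Q.zero_object_iff)
    have "f = zer ?T z x" if "x \<in> Ob H" "f \<in> hom H z x" for f x
      by (rule eqI) (use that Q.from_zero[OF Gz, of "fm G f"] in simp_all)
    moreover have "f = zer ?T x z" if "x \<in> Ob H" "f \<in> hom H x z" for f x
      by (rule eqI) (use that Q.to_zero[OF Gz, of "fm G f"] in simp_all)
    ultimately have "zero_object ?T z"
      unfolding zero_object_def T_hom T using zer by (metis z)
    then show ?thesis by auto
  qed
  have biproduct: "\<exists>b \<in> Ob H. \<exists>i \<in> hom H x b. \<exists>j \<in> hom H y b. \<exists>p \<in> hom H b x. \<exists>q \<in> hom H b y.
        p \<cdot>\<^bsub>H\<^esub> i = ident H x \<and> q \<cdot>\<^bsub>H\<^esub> j = ident H y \<and> q \<cdot>\<^bsub>H\<^esub> i = zer ?T x y \<and> p \<cdot>\<^bsub>H\<^esub> j = zer ?T y x \<and>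
        add ?T (i \<cdot>\<^bsub>H\<^esub> p) (j \<cdot>\<^bsub>H\<^esub> q) = ident H b"
    if x [simp]: "x \<in> Ob H" and y [simp]: "y \<in> Ob H" for x y
  proof -
    obtain b i j p q where b [simp]: "b \<in> Ob Q" "i \<in> Ar Q" "src Q i = fo G x" "tgt Q i = b" "j \<in> Ar Q" "src Q j = fo G y" "tgt Q j = b"
        "p \<in> Ar Q" "src Q p = b" "tgt Q p = fo G x" "q \<in> Ar Q" "src Q q = b" "tgt Q q = fo G y"
      and bi: "p \<cdot>\<^bsub>Q\<^esub> i = ident Q (fo G x)" "q \<cdot>\<^bsub>Q\<^esub> j = ident Q (fo G y)" "q \<cdot>\<^bsub>Q\<^esub> i = zer Q (fo G x) (fo G y)"
        "p \<cdot>\<^bsub>Q\<^esub> j = zer Q (fo G y) (fo G x)" "(i \<cdot>\<^bsub>Q\<^esub> p) \<oplus>\<^bsub>Q\<^esub> (j \<cdot>\<^bsub>Q\<^esub> q) = ident Q b"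
      by (rule Q.biproductE[of "fo G x" "fo G y"]) simp_all
    obtain c e where c [simp]: "c \<in> Ob H" and e [simp]: "e \<in> Ar Q" "src Q e = fo G c" "tgt Q e = b" and ei: "iso_arr Q e"
      using surj[of b] by auto
    note [simp] = Q.arr_inv(1-5)[OF ei, simplified] Q.arr_inv_simps[OF ei, simplified]
    \<comment> \<open>The biproduct of the images is conjugated by \<open>e\<close> into the image
      of \<open>G\<close>, where fullness lifts its four structure arrows.\<close>
    obtain i' where i' [simp]: "i' \<in> Ar H" "src H i' = x" "tgt H i' = c" "fm G i' = Q.arr_inv e \<cdot>\<^bsub>Q\<^esub> i"
      using full[of x c "Q.arr_inv e \<cdot>\<^bsub>Q\<^esub> i"] by auto
    obtain j' where j' [simp]: "j' \<in> Ar H" "src H j' = y" "tgt H j' = c" "fm G j' = Q.arr_inv e \<cdot>\<^bsub>Q\<^esub> j"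
      using full[of y c "Q.arr_inv e \<cdot>\<^bsub>Q\<^esub> j"] by auto
    obtain p' where p' [simp]: "p' \<in> Ar H" "src H p' = c" "tgt H p' = x" "fm G p' = p \<cdot>\<^bsub>Q\<^esub> e"
      using full[of c x "p \<cdot>\<^bsub>Q\<^esub> e"] by auto
    obtain q' where q' [simp]: "q' \<in> Ar H" "src H q' = c" "tgt H q' = y" "fm G q' = q \<cdot>\<^bsub>Q\<^esub> e"
      using full[of c y "q \<cdot>\<^bsub>Q\<^esub> e"] by auto
    have "fm G (add ?T (i' \<cdot>\<^bsub>H\<^esub> p') (j' \<cdot>\<^bsub>H\<^esub> q')) = Q.arr_inv e \<cdot>\<^bsub>Q\<^esub> (((i \<cdot>\<^bsub>Q\<^esub> p) \<oplus>\<^bsub>Q\<^esub> (j \<cdot>\<^bsub>Q\<^esub> q)) \<cdot>\<^bsub>Q\<^esub> e)"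
      by simp
    also have "\<dots> = ident Q (fo G c)" unfolding bi(5) by simp
    finally have "add ?T (i' \<cdot>\<^bsub>H\<^esub> p') (j' \<cdot>\<^bsub>H\<^esub> q') = ident H c" by (intro eqI) simp_all
    moreover have "p' \<cdot>\<^bsub>H\<^esub> i' = ident H x" by (rule eqI) (simp_all add: bi)
    moreover have "q' \<cdot>\<^bsub>H\<^esub> j' = ident H y" by (rule eqI) (simp_all add: bi)
    moreover have "q' \<cdot>\<^bsub>H\<^esub> i' = zer ?T x y" by (rule eqI) (simp_all add: bi)
    moreover have "p' \<cdot>\<^bsub>H\<^esub> j' = zer ?T y x" by (rule eqI) (simp_all add: bi)
    ultimately show ?thesis
      by (intro bexI[of _ c] bexI[of _ i'] bexI[of _ j'] bexI[of _ p'] bexI[of _ q'] conjI) simp_all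
  qed
  \<comment> \<open>Besides the two existence axioms there remain typing conditions and equations;
    the latter are checked in \<open>Q\<close> through \<open>eqI\<close>.\<close>
  show "additive_category ?T"
    by (unfold_locales, unfold T T_hom)
      (((rule zero biproduct; assumption) | (simp; fail) | (rule eqI; simp add: Q.add_ac))+)
qed

section \<open>Left triangles generated by standard ones\<close>

text \<open>The axioms concern standard triangles only; those of \<open>loop_category\<close> follow for the sequences
  isomorphic to standard ones.\<close>

locale loop_standard = loop_base Q \<Omega>
  for Q :: "('q, 'n, 'z) addcat_scheme" (structure) and \<Omega> :: "('q, 'n, 'q, 'n) funct" +
  fixes S :: "('n \<times> 'n \<times> 'n) set"
  assumes std_sequence: "(k, i, d) \<in> S \<Longrightarrow> left_sequence Q \<Omega> k i d"
    and std_trivial: "x \<in> Ob Q \<Longrightarrow> \<exists>k d. (k, ident Q x, d) \<in> S \<and> zero_object Q (tgt Q d)"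
    and std_weak_cokernel: "\<lbrakk>(k, i, d) \<in> S; t \<in> Ar Q; src Q t = tgt Q i; t \<cdot> i = zer Q (src Q i) (tgt Q t)\<rbrakk>
        \<Longrightarrow> \<exists>s \<in> hom Q (tgt Q d) (tgt Q t). t = s \<cdot> d"
    and std_rotate: "(k, i, d) \<in> S \<Longrightarrow> \<exists>k' i' d' a b. (k', i', d') \<in> S \<and> tgt Q d' = tgt Q i \<and> iso_arr Q a \<and> iso_arr Q b \<and>
        a \<in> hom Q (src Q k) (src Q i') \<and> b \<in> hom Q (tgt Q k) (tgt Q i') \<and>
        a \<cdot> neg Q (fm \<Omega> d) = k' \<and> b \<cdot> k = i' \<cdot> a \<and> i = d' \<cdot> b"
    and std_unrotate: "(k, i, d) \<in> S \<Longrightarrow> \<exists>\<kappa> c k' d' e. (k', d', c) \<in> S \<and> src Q d' = tgt Q i \<and>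
        \<kappa> \<in> hom Q (fo \<Omega> (tgt Q c)) (src Q i) \<and> iso_arr Q \<kappa> \<and> e \<in> hom Q (tgt Q d) (tgt Q d') \<and> iso_arr Q e \<and>
        \<kappa> \<cdot> fm \<Omega> (c \<cdot> e) = k \<and> neg Q (i \<cdot> \<kappa>) = k' \<and> e \<cdot> d = d'"
    and std_morphism: "\<lbrakk>(k, i, d) \<in> S; (k', i', d') \<in> S;
        a \<in> hom Q (src Q i) (src Q i'); b \<in> hom Q (tgt Q i) (tgt Q i'); b \<cdot> i = i' \<cdot> a\<rbrakk> \<Longrightarrow>
        \<exists>c \<in> hom Q (tgt Q d) (tgt Q d'). c \<cdot> d = d' \<cdot> b \<and> a \<cdot> k = k' \<cdot> fm \<Omega> c"
    and std_octahedron: "\<lbrakk>u \<in> Ar Q; v \<in> Ar Q; tgt Q u = src Q v\<rbrakk> \<Longrightarrow>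
        \<exists>i1 d1 k1 e1 i2 d2 k2 e2 d3 k3 f g. (k1, i1, d1) \<in> S \<and> (k2, i2, d2) \<in> S \<and> (k3, i2 \<cdot> i1, d3) \<in> S \<and>
          tgt Q i1 = src Q i2 \<and> iso_arr Q e1 \<and> iso_arr Q e2 \<and> e1 \<in> hom Q (tgt Q i1) (tgt Q u) \<and> e2 \<in> hom Q (tgt Q i2) (tgt Q v) \<and>
          e1 \<cdot> i1 = u \<and> e2 \<cdot> i2 = v \<cdot> e1 \<and>
          f \<in> hom Q (tgt Q d1) (tgt Q d3) \<and> g \<in> hom Q (tgt Q d3) (tgt Q d2) \<and>
          f \<cdot> d1 = d3 \<cdot> i2 \<and> k3 \<cdot> fm \<Omega> f = k1 \<and> g \<cdot> d3 = d2 \<and> i1 \<cdot> k3 = k2 \<cdot> fm \<Omega> g \<and> (d1 \<cdot> k2, f, g) \<in> S"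
begin

lemma std_simps:
  assumes "(k, i, d) \<in> S"
  shows "k \<in> Ar Q" "i \<in> Ar Q" "d \<in> Ar Q" "src Q k = fo \<Omega> (tgt Q d)" "tgt Q k = src Q i" "src Q d = tgt Q i"
  using std_sequence[OF assms] by (simp_all add: left_sequence_def)

definition tri_map :: "'n \<Rightarrow> 'n \<Rightarrow> 'n \<Rightarrow> 'n \<times> 'n \<times> 'n \<Rightarrow> 'n \<times> 'n \<times> 'n \<Rightarrow> bool" where
  "tri_map a b c = (\<lambda>(h, f, g) (h', f', g'). iso_arr Q a \<and> iso_arr Q b \<and> iso_arr Q c \<and>
     src Q a = src Q f \<and> tgt Q a = src Q f' \<and> src Q b = tgt Q f \<and> tgt Q b = tgt Q f' \<and> src Q c = tgt Q g \<and> tgt Q c = tgt Q g' \<and>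
     a \<cdot> h = h' \<cdot> fm \<Omega> c \<and> b \<cdot> f = f' \<cdot> a \<and> c \<cdot> g = g' \<cdot> b)"

definition generated :: "('n \<times> 'n \<times> 'n) set" where
  "generated = {(h, f, g). left_sequence Q \<Omega> h f g \<and>
     (\<exists>k i d a b c. (k, i, d) \<in> S \<and> tri_map a b c (h, f, g) (k, i, d))}"

lemma generated_simps:
  assumes "(h, f, g) \<in> generated"
  shows "h \<in> Ar Q" "f \<in> Ar Q" "g \<in> Ar Q" "src Q h = fo \<Omega> (tgt Q g)" "tgt Q h = src Q f" "src Q g = tgt Q f"
  using assms by (simp_all add: generated_def left_sequence_def)

lemma generatedE:
  assumes t: "(h, f, g) \<in> generated"
  obtains k i d a b c where "(k, i, d) \<in> S" "iso_arr Q a" "iso_arr Q b" "iso_arr Q c"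
     "a \<in> Ar Q" "b \<in> Ar Q" "c \<in> Ar Q"
     "src Q a = src Q f" "tgt Q a = src Q i" "src Q b = tgt Q f" "tgt Q b = tgt Q i" "src Q c = tgt Q g" "tgt Q c = tgt Q d"
     "a \<cdot> h = k \<cdot> fm \<Omega> c" "b \<cdot> f = i \<cdot> a" "c \<cdot> g = d \<cdot> b"
  using t unfolding generated_def tri_map_def by (auto simp: iso_Ar)

lemma generatedI:
  assumes "(k, i, d) \<in> S" "h \<in> Ar Q" "f \<in> Ar Q" "g \<in> Ar Q" "src Q h = fo \<Omega> (tgt Q g)" "tgt Q h = src Q f" "src Q g = tgt Q f"
    "iso_arr Q a" "iso_arr Q b" "iso_arr Q c"
    "src Q a = src Q f" "tgt Q a = src Q i" "src Q b = tgt Q f" "tgt Q b = tgt Q i" "src Q c = tgt Q g" "tgt Q c = tgt Q d"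
    "a \<cdot> h = k \<cdot> fm \<Omega> c" "b \<cdot> f = i \<cdot> a" "c \<cdot> g = d \<cdot> b"
  shows "(h, f, g) \<in> generated"
proof -
  have "tri_map a b c (h, f, g) (k, i, d)" using assms(8-) by (simp add: tri_map_def)
  moreover have "left_sequence Q \<Omega> h f g" using assms(2-7) by (simp add: left_sequence_def)
  ultimately show ?thesis unfolding generated_def using assms(1) by blast
qed

lemma generated_pullback:
  assumes t: "(h', f', g') \<in> generated" and h [simp]: "h \<in> Ar Q" "f \<in> Ar Q" "g \<in> Ar Q" "src Q h = fo \<Omega> (tgt Q g)" "tgt Q h = src Q f" "src Q g = tgt Q f"
    and iso: "iso_arr Q a" "iso_arr Q b" "iso_arr Q c"
    and abc [simp]: "src Q a = src Q f" "tgt Q a = src Q f'" "src Q b = tgt Q f" "tgt Q b = tgt Q f'" "src Q c = tgt Q g" "tgt Q c = tgt Q g'"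
    and e: "a \<cdot> h = h' \<cdot> fm \<Omega> c" "b \<cdot> f = f' \<cdot> a" "c \<cdot> g = g' \<cdot> b"
  shows "(h, f, g) \<in> generated"
proof -
  note [simp] = iso_Ar[OF iso(1)] iso_Ar[OF iso(2)] iso_Ar[OF iso(3)] generated_simps[OF t]
  obtain k i d a' b' c' where s: "(k, i, d) \<in> S" and iso': "iso_arr Q a'" "iso_arr Q b'" "iso_arr Q c'"
     and [simp]: "a' \<in> Ar Q" "b' \<in> Ar Q" "c' \<in> Ar Q"
     "src Q a' = src Q f'" "tgt Q a' = src Q i" "src Q b' = tgt Q f'" "tgt Q b' = tgt Q i" "src Q c' = tgt Q g'" "tgt Q c' = tgt Q d"
     and e': "a' \<cdot> h' = k \<cdot> fm \<Omega> c'" "b' \<cdot> f' = i \<cdot> a'" "c' \<cdot> g' = d \<cdot> b'"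
    by (rule generatedE[OF t])
  note [simp] = std_simps[OF s]
  show ?thesis
    by (rule generatedI[OF s, of _ _ _ "a' \<cdot> a" "b' \<cdot> b" "c' \<cdot> c"])
      (simp_all add: iso_cmp iso iso' e reassoc[OF e'(1)] reassoc[OF e'(2)] reassoc[OF e'(3)])
qed

lemma std_generated: assumes s: "(k, i, d) \<in> S" shows "(k, i, d) \<in> generated"
proof -
  note [simp] = std_simps[OF s]
  show ?thesis
    by (rule generatedI[OF s, of _ _ _ "ident Q (src Q i)" "ident Q (tgt Q i)" "ident Q (tgt Q d)"]) simp_all
qed

lemma inverse_square:
  assumes ab: "iso_arr Q a" "iso_arr Q b" and fg: "f \<in> Ar Q" "g \<in> Ar Q" "src Q f = src Q a" "tgt Q f = src Q b" "src Q g = tgt Q a" "tgt Q g = tgt Q b"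
    and e: "b \<cdot> f = g \<cdot> a"
  shows "arr_inv b \<cdot> g = f \<cdot> arr_inv a"
proof -
  note [simp] = fg iso_Ar[OF ab(1)] iso_Ar[OF ab(2)] arr_inv(1-5)[OF ab(1)] arr_inv(1-5)[OF ab(2)]
    arr_inv_simps[OF ab(1)] arr_inv_simps[OF ab(2)]
  have "arr_inv b \<cdot> ((g \<cdot> a) \<cdot> arr_inv a) = f \<cdot> arr_inv a" by (simp only: e[symmetric]) simp
  then show ?thesis by simp
qed

text \<open>The isomorphism points away from the known triangle, whereas \<open>generated\<close>
  asks for one pointing towards a standard triangle, so all three components are inverted. The
  square that involves \<Omega> is inverted by cancelling \<open>fm \<Omega> c\<close>.\<close>

lemma generated_iso:
  assumes t: "(h, f, g) \<in> generated" and "left_sequence Q \<Omega> h' f' g'"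
    and "a \<in> hom Q (src Q f) (src Q f')" "b \<in> hom Q (tgt Q f) (tgt Q f')" "c \<in> hom Q (tgt Q g) (tgt Q g')"
    and iso: "iso_arr Q a" "iso_arr Q b" "iso_arr Q c"
    and e: "a \<cdot> h = h' \<cdot> fm \<Omega> c" "b \<cdot> f = f' \<cdot> a" "c \<cdot> g = g' \<cdot> b"
  shows "(h', f', g') \<in> generated"
proof -
  have [simp]: "h' \<in> Ar Q" "f' \<in> Ar Q" "g' \<in> Ar Q" "src Q h' = fo \<Omega> (tgt Q g')" "tgt Q h' = src Q f'" "src Q g' = tgt Q f'"
    using assms(2) by (simp_all add: left_sequence_def)
  have [simp]: "a \<in> Ar Q" "src Q a = src Q f" "tgt Q a = src Q f'" "b \<in> Ar Q" "src Q b = tgt Q f" "tgt Q b = tgt Q f'"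
    "c \<in> Ar Q" "src Q c = tgt Q g" "tgt Q c = tgt Q g'" using assms(3-5) by simp_all
  note [simp] = generated_simps[OF t] arr_inv(1-3,6)[OF iso(1)] arr_inv(1-3,6)[OF iso(2)] arr_inv(1-3,6)[OF iso(3)]
  have c': "iso_arr Q (fm \<Omega> c)" by (rule functor_iso[OF loop_functor iso(3)])
  have "arr_inv a \<cdot> h' = h \<cdot> fm \<Omega> (arr_inv c)"
  proof (rule iso_cancel_right[OF c'])
    have "(h \<cdot> fm \<Omega> (arr_inv c)) \<cdot> fm \<Omega> c = h" by (simp add: loop_inv[OF iso(3)])
    moreover have "(arr_inv a \<cdot> h') \<cdot> fm \<Omega> c = h" by (simp add: e(1)[symmetric] arr_inv_simps[OF iso(1)])
    ultimately show "(arr_inv a \<cdot> h') \<cdot> fm \<Omega> c = (h \<cdot> fm \<Omega> (arr_inv c)) \<cdot> fm \<Omega> c" by (rule trans[OF _ sym, rotated])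
  qed simp_all
  moreover have "arr_inv b \<cdot> f' = f \<cdot> arr_inv a" by (rule inverse_square) (simp_all add: iso e)
  moreover have "arr_inv c \<cdot> g' = g \<cdot> arr_inv b" by (rule inverse_square) (simp_all add: iso e)
  ultimately show ?thesis
    by (intro generated_pullback[OF t, of _ _ _ "arr_inv a" "arr_inv b" "arr_inv c"]) simp_all
qed

lemma generated_weak_cokernel:
  assumes t: "(h, f, g) \<in> generated" and x: "t \<in> Ar Q" "src Q t = tgt Q f" "t \<cdot> f = zer Q (src Q f) (tgt Q t)"
  shows "\<exists>s \<in> hom Q (tgt Q g) (tgt Q t). t = s \<cdot> g"
proof -
  note [simp] = generated_simps[OF t] x(1,2)
  obtain k i d a b c where s: "(k, i, d) \<in> S" and iso: "iso_arr Q a" "iso_arr Q b" "iso_arr Q c"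
     and [simp]: "a \<in> Ar Q" "b \<in> Ar Q" "c \<in> Ar Q"
     "src Q a = src Q f" "tgt Q a = src Q i" "src Q b = tgt Q f" "tgt Q b = tgt Q i" "src Q c = tgt Q g" "tgt Q c = tgt Q d"
     and e: "a \<cdot> h = k \<cdot> fm \<Omega> c" "b \<cdot> f = i \<cdot> a" "c \<cdot> g = d \<cdot> b"
    by (rule generatedE[OF t])
  note [simp] = std_simps[OF s] arr_inv(1-3,6)[OF iso(1)] arr_inv(1-3,6)[OF iso(2)]
  have "arr_inv b \<cdot> i = f \<cdot> arr_inv a" by (rule inverse_square) (simp_all add: iso e)
  then have "(t \<cdot> arr_inv b) \<cdot> i = zer Q (src Q i) (tgt Q t)" by (simp add: reassoc[OF x(3)])
  then obtain r where [simp]: "r \<in> Ar Q" "src Q r = tgt Q d" "tgt Q r = tgt Q t" and r: "t \<cdot> arr_inv b = r \<cdot> d"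
    using std_weak_cokernel[OF s, of "t \<cdot> arr_inv b"] by auto
  have "t = (t \<cdot> arr_inv b) \<cdot> b" by (simp add: arr_inv(4)[OF iso(2)])
  also have "\<dots> = (r \<cdot> c) \<cdot> g" unfolding r by (simp add: e)
  finally show ?thesis by (rule bexI) simp
qed

text \<open>The third vertex of the rotated sequence is the old middle one, so \<open>b\<close>
  becomes the third component, while \<open>fm \<Omega> c\<close> and \<open>a\<close> are continued
  by the isomorphisms that \<open>std_rotate\<close> supplies.\<close>

lemma generated_rotate:
  assumes t: "(h, f, g) \<in> generated" shows "(neg Q (fm \<Omega> g), h, f) \<in> generated"
proof -
  note [simp] = generated_simps[OF t]
  obtain k i d a b c where s: "(k, i, d) \<in> S" and iso: "iso_arr Q a" "iso_arr Q b" "iso_arr Q c"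
     and [simp]: "a \<in> Ar Q" "b \<in> Ar Q" "c \<in> Ar Q"
     "src Q a = src Q f" "tgt Q a = src Q i" "src Q b = tgt Q f" "tgt Q b = tgt Q i" "src Q c = tgt Q g" "tgt Q c = tgt Q d"
     and e: "a \<cdot> h = k \<cdot> fm \<Omega> c" "b \<cdot> f = i \<cdot> a" "c \<cdot> g = d \<cdot> b"
    by (rule generatedE[OF t])
  note [simp] = std_simps[OF s]
  obtain k' i' d' a' b' where s': "(k', i', d') \<in> S" and iso': "iso_arr Q a'" "iso_arr Q b'"
    and ab' [simp]: "tgt Q d' = tgt Q i" "a' \<in> Ar Q" "src Q a' = fo \<Omega> (tgt Q d)" "tgt Q a' = src Q i'" "b' \<in> Ar Q" "src Q b' = src Q i" "tgt Q b' = tgt Q i'"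
    and e': "a' \<cdot> neg Q (fm \<Omega> d) = k'" "b' \<cdot> k = i' \<cdot> a'" "i = d' \<cdot> b'"
    using std_rotate[OF s] by auto
  note [simp] = std_simps[OF s']
  have c': "iso_arr Q (fm \<Omega> c)" by (rule functor_iso[OF loop_functor iso(3)])
  have ec: "fm \<Omega> c \<cdot> fm \<Omega> g = fm \<Omega> d \<cdot> fm \<Omega> b" using arg_cong[OF e(3), of "fm \<Omega>"] by simp
  have k': "k' = neg Q (a' \<cdot> fm \<Omega> d)" using e'(1) by simp
  show ?thesis
  proof (rule generatedI[OF s', of _ _ _ "a' \<cdot> fm \<Omega> c" "b' \<cdot> a" b])
    show "(a' \<cdot> fm \<Omega> c) \<cdot> neg Q (fm \<Omega> g) = k' \<cdot> fm \<Omega> b" unfolding k' by (simp add: ec)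
    show "(b' \<cdot> a) \<cdot> h = i' \<cdot> (a' \<cdot> fm \<Omega> c)" by (simp add: e(1) reassoc[OF e'(2)])
    show "b \<cdot> f = d' \<cdot> (b' \<cdot> a)" by (simp add: e(2) reassoc[OF e'(3)[symmetric]])
  qed (simp_all add: iso_cmp iso iso' c')
qed

text \<open>The isomorphism \<kappa> obtained for the standard triangle ends in its first vertex and
  is brought to \<open>src Q f\<close> by the inverse of \<open>a\<close>; likewise the last arrow
  is precomposed with \<open>c\<close>.\<close>

lemma generated_unrotate:
  assumes t: "(h, f, g) \<in> generated"
  shows "\<exists>s \<in> Ob Q. \<exists>\<kappa> \<in> hom Q (fo \<Omega> s) (src Q f). \<exists>c \<in> hom Q (tgt Q g) s.
        iso_arr Q \<kappa> \<and> \<kappa> \<cdot> fm \<Omega> c = h \<and> (neg Q (f \<cdot> \<kappa>), g, c) \<in> generated"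
proof -
  note [simp] = generated_simps[OF t]
  obtain k i d a b c where s: "(k, i, d) \<in> S" and iso: "iso_arr Q a" "iso_arr Q b" "iso_arr Q c"
     and [simp]: "a \<in> Ar Q" "b \<in> Ar Q" "c \<in> Ar Q"
     "src Q a = src Q f" "tgt Q a = src Q i" "src Q b = tgt Q f" "tgt Q b = tgt Q i" "src Q c = tgt Q g" "tgt Q c = tgt Q d"
     and e: "a \<cdot> h = k \<cdot> fm \<Omega> c" "b \<cdot> f = i \<cdot> a" "c \<cdot> g = d \<cdot> b"
    by (rule generatedE[OF t])
  note [simp] = std_simps[OF s] arr_inv(1-3,6)[OF iso(1)]
  obtain \<kappa> c' k' d' r where s': "(k', d', c') \<in> S" and iso': "iso_arr Q \<kappa>" "iso_arr Q r"
    and ab' [simp]: "src Q d' = tgt Q i" "\<kappa> \<in> Ar Q" "src Q \<kappa> = fo \<Omega> (tgt Q c')" "tgt Q \<kappa> = src Q i"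
      "r \<in> Ar Q" "src Q r = tgt Q d" "tgt Q r = tgt Q d'"
    and e': "\<kappa> \<cdot> fm \<Omega> (c' \<cdot> r) = k" "neg Q (i \<cdot> \<kappa>) = k'" "r \<cdot> d = d'"
    using std_unrotate[OF s] by auto
  note [simp] = std_simps[OF s']
  have kk: "\<kappa> \<cdot> (fm \<Omega> c' \<cdot> fm \<Omega> r) = k" using e'(1) by simp
  have fa: "arr_inv b \<cdot> i = f \<cdot> arr_inv a" by (rule inverse_square) (simp_all add: iso e)
  have bf: "b \<cdot> (f \<cdot> (arr_inv a \<cdot> \<kappa>)) = i \<cdot> \<kappa>"
    by (simp add: reassoc[OF e(2)] arr_inv_simps[OF iso(1)])
  show ?thesis
  proof (intro bexI conjI)
    let ?s = "tgt Q c'" and ?\<kappa> = "arr_inv a \<cdot> \<kappa>" and ?c = "c' \<cdot> (r \<cdot> c)"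
    show "?s \<in> Ob Q" "?\<kappa> \<in> hom Q (fo \<Omega> ?s) (src Q f)" "?c \<in> hom Q (tgt Q g) ?s" by simp_all
    show "iso_arr Q ?\<kappa>" by (rule iso_cmp) (simp_all add: iso iso')
    have "?\<kappa> \<cdot> fm \<Omega> ?c = arr_inv a \<cdot> (k \<cdot> fm \<Omega> c)" by (simp add: kk[symmetric])
    then show "?\<kappa> \<cdot> fm \<Omega> ?c = h" by (simp add: e(1)[symmetric] arr_inv_simps[OF iso(1)])
    show "(neg Q (f \<cdot> ?\<kappa>), g, ?c) \<in> generated"
      by (rule generatedI[OF s', of _ _ _ b "r \<cdot> c" "ident Q ?s"])
        (simp_all add: iso_cmp iso iso' bf e'(2) e(3) reassoc[OF e'(3)])
  qed
qed

text \<open>Conjugation by the two isomorphisms gives a square between standard triangles; its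
  filler \<open>w\<close> is conjugated back to \<open>z\<close>.\<close>

lemma generated_morphism:
  assumes t: "(h, f, g) \<in> generated" and t': "(h', f', g') \<in> generated"
    and x: "x \<in> hom Q (src Q f) (src Q f')" and y: "y \<in> hom Q (tgt Q f) (tgt Q f')" and xy: "y \<cdot> f = f' \<cdot> x"
  shows "\<exists>z \<in> hom Q (tgt Q g) (tgt Q g'). z \<cdot> g = g' \<cdot> y \<and> x \<cdot> h = h' \<cdot> fm \<Omega> z"
proof -
  note [simp] = generated_simps[OF t] generated_simps[OF t'] x[simplified] y[simplified]
  obtain k i d a b c where s: "(k, i, d) \<in> S" and iso: "iso_arr Q a" "iso_arr Q b" "iso_arr Q c"
     and [simp]: "a \<in> Ar Q" "b \<in> Ar Q" "c \<in> Ar Q"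
     "src Q a = src Q f" "tgt Q a = src Q i" "src Q b = tgt Q f" "tgt Q b = tgt Q i" "src Q c = tgt Q g" "tgt Q c = tgt Q d"
     and e: "a \<cdot> h = k \<cdot> fm \<Omega> c" "b \<cdot> f = i \<cdot> a" "c \<cdot> g = d \<cdot> b"
    by (rule generatedE[OF t])
  obtain k' i' d' a' b' c' where s': "(k', i', d') \<in> S" and iso': "iso_arr Q a'" "iso_arr Q b'" "iso_arr Q c'"
     and [simp]: "a' \<in> Ar Q" "b' \<in> Ar Q" "c' \<in> Ar Q"
     "src Q a' = src Q f'" "tgt Q a' = src Q i'" "src Q b' = tgt Q f'" "tgt Q b' = tgt Q i'" "src Q c' = tgt Q g'" "tgt Q c' = tgt Q d'"
     and e': "a' \<cdot> h' = k' \<cdot> fm \<Omega> c'" "b' \<cdot> f' = i' \<cdot> a'" "c' \<cdot> g' = d' \<cdot> b'"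
    by (rule generatedE[OF t'])
  note [simp] = std_simps[OF s] std_simps[OF s'] arr_inv(1-3,6)[OF iso(1)] arr_inv(1-3,6)[OF iso(2)] arr_inv(1-3,6)[OF iso'(3)] arr_inv(1-3,6)[OF iso'(1)]
  have bi: "arr_inv b \<cdot> i = f \<cdot> arr_inv a" by (rule inverse_square) (simp_all add: iso e)
  have "(b' \<cdot> (y \<cdot> arr_inv b)) \<cdot> i = i' \<cdot> (a' \<cdot> (x \<cdot> arr_inv a))"
    by (simp add: bi reassoc[OF xy] reassoc[OF e'(2)])
  then obtain w where [simp]: "w \<in> Ar Q" "src Q w = tgt Q d" "tgt Q w = tgt Q d'"
    and w: "w \<cdot> d = d' \<cdot> (b' \<cdot> (y \<cdot> arr_inv b))" "(a' \<cdot> (x \<cdot> arr_inv a)) \<cdot> k = k' \<cdot> fm \<Omega> w"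
    using std_morphism[OF s s', of "a' \<cdot> (x \<cdot> arr_inv a)" "b' \<cdot> (y \<cdot> arr_inv b)"] by auto
  have w2: "a' \<cdot> (x \<cdot> (arr_inv a \<cdot> k)) = k' \<cdot> fm \<Omega> w" using w(2) by simp
  have dcb: "arr_inv c' \<cdot> d' = g' \<cdot> arr_inv b'" by (rule inverse_square) (simp_all add: iso' e')
  define z where "z = arr_inv c' \<cdot> (w \<cdot> c)"
  have z [simp]: "z \<in> Ar Q" "src Q z = tgt Q g" "tgt Q z = tgt Q g'" by (simp_all add: z_def)
  have "z \<cdot> g = arr_inv c' \<cdot> (d' \<cdot> (b' \<cdot> y))"
    by (simp add: z_def e(3) reassoc[OF w(1)] arr_inv(4)[OF iso(2)])
  also have "\<dots> = g' \<cdot> y"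
    by (simp add: reassoc[OF e'(3)[symmetric]] arr_inv_simps[OF iso'(3)])
  finally have zg: "z \<cdot> g = g' \<cdot> y" .
  have "x \<cdot> h = h' \<cdot> fm \<Omega> z"
  proof (rule iso_cancel_left[OF iso'(1)])
    have ch: "fm \<Omega> c' \<cdot> (fm \<Omega> (arr_inv c') \<cdot> t) = t" if "t \<in> Ar Q" "tgt Q t = fo \<Omega> (tgt Q d')" for t
      using that by (simp add: reassoc[OF loop_inv(2)[OF iso'(3)]])
    have "a' \<cdot> (x \<cdot> (arr_inv a \<cdot> (a \<cdot> h))) = (a' \<cdot> (x \<cdot> (arr_inv a \<cdot> k))) \<cdot> fm \<Omega> c"
      by (simp add: e(1))
    also have "\<dots> = k' \<cdot> (fm \<Omega> w \<cdot> fm \<Omega> c)" unfolding w2 by simp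
    finally have "a' \<cdot> (x \<cdot> h) = k' \<cdot> (fm \<Omega> w \<cdot> fm \<Omega> c)" by (simp add: arr_inv_simps[OF iso(1)])
    also have "\<dots> = a' \<cdot> (h' \<cdot> fm \<Omega> z)"
      by (simp add: reassoc[OF e'(1)] z_def ch)
    finally show "a' \<cdot> (x \<cdot> h) = a' \<cdot> (h' \<cdot> fm \<Omega> z)" .
  qed simp_all
  with zg show ?thesis by (intro bexI[of _ z]) simp_all
qed

text \<open>\<open>std_trivial\<close> ends in a zero object of its own choice, and the zero arrow
  from \<open>z\<close> to that object is an isomorphism.\<close>

lemma generated_trivial:
  assumes x [simp]: "x \<in> Ob Q" and z: "zero_object Q z"
  shows "(zer Q (fo \<Omega> z) x, ident Q x, zer Q x z) \<in> generated"
proof -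
  note [simp] = zero_object_Ob[OF z]
  obtain k d where s: "(k, ident Q x, d) \<in> S" and w: "zero_object Q (tgt Q d)" using std_trivial[OF x] by auto
  note [simp] = std_simps[OF s, simplified]
  let ?w = "tgt Q d" and ?c = "zer Q z (tgt Q d)"
  have iw: "ident Q ?w = zer Q ?w ?w" "ident Q z = zer Q z z" using w z by (simp_all add: zero_object_iff)
  have c: "iso_arr Q ?c" by (rule iso_arrI[of _ "zer Q ?w z"]) (simp_all add: iw)
  have z0: "\<And>f. f \<in> Ar Q \<Longrightarrow> src Q f = fo \<Omega> z \<Longrightarrow> f = zer Q (fo \<Omega> z) (tgt Q f)"
  proof -
    fix f assume [simp]: "f \<in> Ar Q" "src Q f = fo \<Omega> z"
    have "zero_object Q (fo \<Omega> z)" using loop_simps(5)[of z] by (simp add: zero_object_iff iw)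
    then show "f = zer Q (fo \<Omega> z) (tgt Q f)" by (rule from_zero) simp_all
  qed
  show ?thesis
    by (rule generatedI[OF s, of _ _ _ "ident Q x" "ident Q x" ?c])
      (use c to_zero[OF w, of d] z0[of "k \<cdot> fm \<Omega> ?c"] in simp_all)
qed

text \<open>Up to the isomorphisms \<open>e1\<close> and \<open>e2\<close>, the pair
  \<open>u\<close>, \<open>v\<close> is the pair \<open>i1\<close>, \<open>i2\<close>, so the
  standard triangles become triangles on \<open>u\<close>, \<open>v\<close> and their composite with
  unchanged third vertices. The correction \<open>e1\<close> of \<open>k2\<close> cancels against
  that of \<open>d1\<close>, so the fourth triangle is the standard one itself.\<close>

lemma generated_octahedron:
  assumes [simp]: "u \<in> Ar Q" "v \<in> Ar Q" and uv: "tgt Q u = src Q v"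
  shows "\<exists>h1 i h2 k h3 m f g. (h1, u, i) \<in> generated \<and> (h2, v, k) \<in> generated \<and> (h3, v \<cdot> u, m) \<in> generated \<and>
          f \<in> hom Q (tgt Q i) (tgt Q m) \<and> g \<in> hom Q (tgt Q m) (tgt Q k) \<and>
          f \<cdot> i = m \<cdot> v \<and> h3 \<cdot> fm \<Omega> f = h1 \<and> g \<cdot> m = k \<and> u \<cdot> h3 = h2 \<cdot> fm \<Omega> g \<and> (i \<cdot> h2, f, g) \<in> generated"
proof -
  note [simp] = uv[symmetric]
  obtain i1 d1 k1 e1 i2 d2 k2 e2 d3 k3 f g where S: "(k1, i1, d1) \<in> S" "(k2, i2, d2) \<in> S" "(k3, i2 \<cdot> i1, d3) \<in> S"
    and c: "tgt Q i1 = src Q i2" and iso: "iso_arr Q e1" "iso_arr Q e2"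
    and e: "e1 \<in> Ar Q" "src Q e1 = tgt Q i1" "tgt Q e1 = tgt Q u" "e2 \<in> Ar Q" "src Q e2 = tgt Q i2" "tgt Q e2 = tgt Q v"
    and ei: "e1 \<cdot> i1 = u" "e2 \<cdot> i2 = v \<cdot> e1"
    and fg: "f \<in> Ar Q" "src Q f = tgt Q d1" "tgt Q f = tgt Q d3" "g \<in> Ar Q" "src Q g = tgt Q d3" "tgt Q g = tgt Q d2"
    and E: "f \<cdot> d1 = d3 \<cdot> i2" "k3 \<cdot> fm \<Omega> f = k1" "g \<cdot> d3 = d2" "i1 \<cdot> k3 = k2 \<cdot> fm \<Omega> g" and S4: "(d1 \<cdot> k2, f, g) \<in> S"
    using std_octahedron[OF assms] by auto
  have "src Q (e1 \<cdot> i1) = src Q i1" by (rule src_cmp) (simp_all add: e std_simps[OF S(1)])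
  then have u: "src Q u = src Q i1" unfolding ei(1) .
  note [simp] = c[symmetric] e fg u std_simps[OF S(1)] std_simps[OF S(2), simplified c[symmetric]] std_simps(1,3-6)[OF S(3)]
    arr_inv(1-3)[OF iso(1)] arr_inv(1-3)[OF iso(2)]
  have [simp]: "tgt Q k2 = tgt Q i1" using std_simps(5)[OF S(2)] by simp
  have ai [simp]: "iso_arr Q (arr_inv e1)" "iso_arr Q (arr_inv e2)" using arr_inv(6) iso by auto
  note es = arr_inv_simps[OF iso(1)] arr_inv_simps[OF iso(2)] arr_inv(4)[OF iso(1)] arr_inv(4)[OF iso(2)]
  have ue: "arr_inv e1 \<cdot> u = i1" by (simp add: ei(1)[symmetric] es)
  have ve: "arr_inv e2 \<cdot> v = i2 \<cdot> arr_inv e1" by (rule inverse_square) (simp_all add: iso ei)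
  have t1: "(k1, u, d1 \<cdot> arr_inv e1) \<in> generated"
    by (rule generatedI[OF S(1), of _ _ _ "ident Q (src Q u)" "arr_inv e1" "ident Q (tgt Q d1)"]) (simp_all add: ue)
  have t2: "(e1 \<cdot> k2, v, d2 \<cdot> arr_inv e2) \<in> generated"
    by (rule generatedI[OF S(2), of _ _ _ "arr_inv e1" "arr_inv e2" "ident Q (tgt Q d2)"]) (simp_all add: es ve)
  have t3: "(k3, v \<cdot> u, d3 \<cdot> arr_inv e2) \<in> generated"
    by (rule generatedI[OF S(3), of _ _ _ "ident Q (src Q u)" "arr_inv e2" "ident Q (tgt Q d3)"])
      (simp_all add: reassoc[OF ve] ue)
  have t4: "((d1 \<cdot> arr_inv e1) \<cdot> (e1 \<cdot> k2), f, g) \<in> generated"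
    using std_generated[OF S4] by (simp add: es)
  have E1: "u \<cdot> k3 = (e1 \<cdot> k2) \<cdot> fm \<Omega> g" by (simp add: ei(1)[symmetric] E(4))
  have E2: "f \<cdot> (d1 \<cdot> arr_inv e1) = (d3 \<cdot> arr_inv e2) \<cdot> v" by (simp add: ve reassoc[OF E(1)])
  have E3: "g \<cdot> (d3 \<cdot> arr_inv e2) = d2 \<cdot> arr_inv e2" by (simp add: reassoc[OF E(3)])
  have f: "f \<in> hom Q (tgt Q (d1 \<cdot> arr_inv e1)) (tgt Q (d3 \<cdot> arr_inv e2))" by simp
  have g: "g \<in> hom Q (tgt Q (d3 \<cdot> arr_inv e2)) (tgt Q (d2 \<cdot> arr_inv e2))" by simp
  show ?thesis
    by (rule exI, rule exI, rule exI, rule exI, rule exI, rule exI, rule exI, rule exI)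
      (rule conjI[OF t1 conjI[OF t2 conjI[OF t3 conjI[OF f conjI[OF g conjI[OF E2 conjI[OF E(2) conjI[OF E3 conjI[OF E1 t4]]]]]]]]])
qed

theorem loop_category: "loop_category Q \<Omega> generated"
proof (unfold_locales, goal_cases)
  case 1 then show ?case by (simp add: generated_def)
next
  case 2 then show ?case by (rule generated_iso)
next
  case 3 then show ?case by (rule generated_trivial)
next
  case 4 then show ?case by (rule generated_weak_cokernel)
next
  case 5 then show ?case by (rule generated_rotate)
next
  case 6 then show ?case by (rule generated_unrotate)
next
  case 7 then show ?case by (rule generated_morphism)
next
  case 8 then show ?case by (rule generated_octahedron)
qed

end

section \<open>Exact categories\<close>

context exact_category
begin

lemma admD:
  assumes "(i, d) \<in> adm A"
  shows "i \<in> Ar A" "d \<in> Ar A" "tgt A i = src A d" "d \<cdot> i = zer A (src A i) (tgt A d)"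
  using adm_kernel[OF assms] unfolding is_kernel_def by auto

lemma is_kernel_ex1:
  "\<lbrakk>is_kernel A k d; t \<in> Ar A; tgt A t = src A d; d \<cdot> t = zer A (src A t) (tgt A d)\<rbrakk>
    \<Longrightarrow> \<exists>!s. s \<in> hom A (src A t) (src A k) \<and> k \<cdot> s = t"
  unfolding is_kernel_def by blast

lemma is_cokernel_ex1:
  "\<lbrakk>is_cokernel A c i; t \<in> Ar A; src A t = tgt A i; t \<cdot> i = zer A (src A i) (tgt A t)\<rbrakk>
    \<Longrightarrow> \<exists>!s. s \<in> hom A (tgt A c) (tgt A t) \<and> s \<cdot> c = t"
  unfolding is_cokernel_def by blast

lemma is_kernel_mono:
  assumes k: "is_kernel A k d" and e: "k \<cdot> f = k \<cdot> g"
    and f: "f \<in> Ar A" "g \<in> Ar A" "tgt A f = src A k" "tgt A g = src A k" "src A f = src A g"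
  shows "f = g"
proof -
  have [simp]: "k \<in> Ar A" "d \<in> Ar A" "tgt A k = src A d" and dk: "d \<cdot> k = zer A (src A k) (tgt A d)"
    using k unfolding is_kernel_def by auto
  note [simp] = f
  have "\<exists>!s. s \<in> hom A (src A (k \<cdot> f)) (src A k) \<and> k \<cdot> s = k \<cdot> f"
    by (rule is_kernel_ex1[OF k]) (simp_all add: reassoc[OF dk])
  then obtain s where "\<And>y. y \<in> hom A (src A (k \<cdot> f)) (src A k) \<and> k \<cdot> y = k \<cdot> f \<Longrightarrow> y = s" by (elim ex1E) blast
  from this[of f] this[of g] show ?thesis using e by simp
qed

lemma is_cokernel_epi:
  assumes c: "is_cokernel A c i" and e: "f \<cdot> c = g \<cdot> c"
    and f: "f \<in> Ar A" "g \<in> Ar A" "src A f = tgt A c" "src A g = tgt A c" "tgt A f = tgt A g"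
  shows "f = g"
proof -
  have [simp]: "c \<in> Ar A" "i \<in> Ar A" "tgt A i = src A c" and ci: "c \<cdot> i = zer A (src A i) (tgt A c)"
    using c unfolding is_cokernel_def by auto
  note [simp] = f
  have "\<exists>!s. s \<in> hom A (tgt A c) (tgt A (f \<cdot> c)) \<and> s \<cdot> c = f \<cdot> c"
    by (rule is_cokernel_ex1[OF c]) (simp_all add: ci)
  then obtain s where "\<And>y. y \<in> hom A (tgt A c) (tgt A (f \<cdot> c)) \<and> y \<cdot> c = f \<cdot> c \<Longrightarrow> y = s" by (elim ex1E) blast
  from this[of f] this[of g] show ?thesis using e by simp
qed

lemmas adm_mono = is_kernel_mono[OF adm_kernel]
lemmas adm_epi = is_cokernel_epi[OF adm_cokernel]

lemma kernel_factor:
  assumes a: "(i, d) \<in> adm A" and t: "t \<in> Ar A" "tgt A t = src A d" "d \<cdot> t = zer A (src A t) (tgt A d)"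
  obtains s where "s \<in> Ar A" "src A s = src A t" "tgt A s = src A i" "i \<cdot> s = t"
  using is_kernel_ex1[OF adm_kernel[OF a] t] by auto

lemma cokernel_factor:
  assumes a: "(i, d) \<in> adm A" and t: "t \<in> Ar A" "src A t = src A d" "t \<cdot> i = zer A (src A i) (tgt A t)"
  obtains s where "s \<in> Ar A" "src A s = tgt A d" "tgt A s = tgt A t" "s \<cdot> d = t"
  using is_cokernel_ex1[OF adm_cokernel[OF a], of t] t admD(3)[OF a] by auto

text \<open>The difference is killed by \<open>d\<close> and factors through \<open>i\<close>. The
  additive form of the conclusion is the one that \<open>stable_eqI\<close> consumes.\<close>

lemma kernel_difference:
  assumes a: "(i, d) \<in> adm A" and t: "t \<in> Ar A" "tgt A t = src A d" "src A t = x" "t' \<in> Ar A" "tgt A t' = src A d" "src A t' = x"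
    and e: "d \<cdot> t = d \<cdot> t'"
  shows "\<exists>s. s \<in> Ar A \<and> src A s = x \<and> tgt A s = src A i \<and> t = t' \<oplus> i \<cdot> s"
proof -
  note [simp] = admD[OF a] t
  have "d \<cdot> (t \<oplus> neg A t') = zer A (src A (t \<oplus> neg A t')) (tgt A d)" by (simp add: e)
  then obtain s where s: "s \<in> Ar A" "src A s = x" "tgt A s = src A i" "i \<cdot> s = t \<oplus> neg A t'"
    using kernel_factor[OF a, of "t \<oplus> neg A t'"] by auto
  then have "t = t' \<oplus> i \<cdot> s" by simp
  with s(1-3) show ?thesis by blast
qed

lemma cokernel_difference:
  assumes a: "(i, d) \<in> adm A" and t: "t \<in> Ar A" "src A t = src A d" "tgt A t = y" "t' \<in> Ar A" "src A t' = src A d" "tgt A t' = y"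
    and e: "t \<cdot> i = t' \<cdot> i"
  shows "\<exists>s. s \<in> Ar A \<and> src A s = tgt A d \<and> tgt A s = y \<and> t = t' \<oplus> s \<cdot> d"
proof -
  note [simp] = admD[OF a] t
  have "(t \<oplus> neg A t') \<cdot> i = zer A (src A i) (tgt A (t \<oplus> neg A t'))" by (simp add: e)
  then obtain s where s: "s \<in> Ar A" "src A s = tgt A d" "tgt A s = y" "s \<cdot> d = t \<oplus> neg A t'"
    using cokernel_factor[OF a, of "t \<oplus> neg A t'"] by auto
  then have "t = t' \<oplus> s \<cdot> d" by simp
  with s(1-3) show ?thesis by blast
qed

lemma is_kernelE:
  assumes k: "is_kernel A k d" and t: "t \<in> Ar A" "tgt A t = src A d" "d \<cdot> t = zer A (src A t) (tgt A d)"
  obtains s where "s \<in> Ar A" "src A s = src A t" "tgt A s = src A k" "k \<cdot> s = t"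
  using is_kernel_ex1[OF k t] by auto

text \<open>Two kernels of \<open>d\<close> are isomorphic over its source, and \<open>adm\<close>
  is closed under isomorphism.\<close>

lemma adm_of_kernel:
  assumes d: "d \<in> deflations A" and k: "is_kernel A k d" shows "(k, d) \<in> adm A"
proof -
  obtain i where a: "(i, d) \<in> adm A" using d unfolding deflations_def by auto
  note [simp] = admD(1-3)[OF a]
  have [simp]: "k \<in> Ar A" "tgt A k = src A d" and dk: "d \<cdot> k = zer A (src A k) (tgt A d)"
    using k unfolding is_kernel_def by auto
  obtain s where s [simp]: "s \<in> Ar A" "src A s = src A i" "tgt A s = src A k" and se: "k \<cdot> s = i"
    by (rule is_kernelE[OF k, of i]) (simp_all add: admD(4)[OF a])
  obtain r where r [simp]: "r \<in> Ar A" "src A r = src A k" "tgt A r = src A i" and re: "i \<cdot> r = k"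
    by (rule kernel_factor[OF a, of k]) (simp_all add: dk)
  have "iso_arr A s"
  proof (rule iso_arrI[of s r])
    show "r \<cdot> s = ident A (src A s)" by (rule adm_mono[OF a]) (simp_all add: reassoc[OF re] se)
    show "s \<cdot> r = ident A (tgt A s)" by (rule is_kernel_mono[OF k]) (simp_all add: reassoc[OF se] re)
  qed simp_all
  then show ?thesis
    by (intro adm_iso[OF a, of k d s "ident A (src A d)" "ident A (tgt A d)"]) (simp_all add: se)
qed

lemma adm_of_cokernel:
  assumes a: "(i, d) \<in> adm A" and c: "is_cokernel A c i" shows "(i, c) \<in> adm A"
proof -
  note [simp] = admD(1-3)[OF a]
  have [simp]: "c \<in> Ar A" "src A c = src A d" and ci: "c \<cdot> i = zer A (src A i) (tgt A c)"
    and uni: "\<And>t. \<lbrakk>t \<in> Ar A; src A t = src A d; t \<cdot> i = zer A (src A i) (tgt A t)\<rbrakk> \<Longrightarrow> \<exists>!s. s \<in> hom A (tgt A c) (tgt A t) \<and> s \<cdot> c = t"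
    using c unfolding is_cokernel_def by auto
  obtain s where s [simp]: "s \<in> Ar A" "src A s = tgt A d" "tgt A s = tgt A c" and se: "s \<cdot> d = c"
    by (rule cokernel_factor[OF a, of c]) (simp_all add: ci)
  have "\<exists>!s. s \<in> hom A (tgt A c) (tgt A d) \<and> s \<cdot> c = d" by (rule uni) (simp_all add: admD(4)[OF a])
  then obtain r where r [simp]: "r \<in> Ar A" "src A r = tgt A c" "tgt A r = tgt A d" and re: "r \<cdot> c = d" by auto
  have "\<exists>!s. s \<in> hom A (tgt A c) (tgt A c) \<and> s \<cdot> c = c" by (rule uni) (simp_all add: ci)
  moreover have "s \<cdot> r \<in> hom A (tgt A c) (tgt A c) \<and> (s \<cdot> r) \<cdot> c = c" by (simp add: re se)
  moreover have "ident A (tgt A c) \<in> hom A (tgt A c) (tgt A c) \<and> ident A (tgt A c) \<cdot> c = c" by simp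
  ultimately have sr: "s \<cdot> r = ident A (tgt A c)" by (metis (no_types, lifting))
  have "iso_arr A s"
  proof (rule iso_arrI[of s r])
    show "r \<cdot> s = ident A (src A s)" by (rule adm_epi[OF a]) (simp_all add: se re)
  qed (simp_all add: sr)
  then show ?thesis
    by (intro adm_iso[OF a, of i c "ident A (src A i)" "ident A (src A d)" s]) (simp_all add: se)
qed

lemma adm_of_cokernelI:
  assumes a: "(i, d) \<in> adm A" and c: "c \<in> Ar A" "src A c = src A d" "c \<cdot> i = zer A (src A i) (tgt A c)"
    and ex: "\<And>t. \<lbrakk>t \<in> Ar A; src A t = src A d; t \<cdot> i = zer A (src A i) (tgt A t)\<rbrakk>
      \<Longrightarrow> \<exists>s. s \<in> Ar A \<and> src A s = tgt A c \<and> tgt A s = tgt A t \<and> s \<cdot> c = t"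
    and epi: "\<And>s s'. \<lbrakk>s \<in> Ar A; s' \<in> Ar A; src A s = tgt A c; src A s' = tgt A c; tgt A s = tgt A s'; s \<cdot> c = s' \<cdot> c\<rbrakk> \<Longrightarrow> s = s'"
  shows "(i, c) \<in> adm A"
proof (rule adm_of_cokernel[OF a])
  show "is_cokernel A c i" unfolding is_cokernel_def
  proof (intro conjI ballI impI)
    fix t assume t: "t \<in> Ar A" "src A t = tgt A i" "t \<cdot> i = zer A (src A i) (tgt A t)"
    then obtain s where s: "s \<in> Ar A" "src A s = tgt A c" "tgt A s = tgt A t" "s \<cdot> c = t"
      using ex[of t] admD[OF a] by auto
    then show "\<exists>!s. s \<in> hom A (tgt A c) (tgt A t) \<and> s \<cdot> c = t"
      by (intro ex1I[of _ s]) (simp, rule epi, simp_all)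
  qed (use admD[OF a] c in simp_all)
qed

text \<open>The kernel of the pulled back deflation is the arrow induced by \<open>k\<close> and
  zero, so both sequences share the kernel object. Existence and uniqueness of induced arrows are
  returned as separate rules.\<close>

lemma pullbackE:
  assumes a: "(k, d) \<in> adm A" and f: "f \<in> Ar A" "tgt A f = tgt A d"
  obtains w f' d' k' where "w \<in> Ob A" "f' \<in> Ar A" "src A f' = w" "tgt A f' = src A d"
    "d' \<in> Ar A" "src A d' = w" "tgt A d' = src A f" "d \<cdot> f' = f \<cdot> d'"
    "(k', d') \<in> adm A" "k' \<in> Ar A" "src A k' = src A k" "tgt A k' = w" "f' \<cdot> k' = k" "d' \<cdot> k' = zer A (src A k) (src A f)"
    "\<And>s t. \<lbrakk>s \<in> Ar A; t \<in> Ar A; tgt A s = src A d; tgt A t = src A f; src A s = src A t; d \<cdot> s = f \<cdot> t\<rbrakk>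
      \<Longrightarrow> \<exists>r. r \<in> Ar A \<and> src A r = src A s \<and> tgt A r = w \<and> f' \<cdot> r = s \<and> d' \<cdot> r = t"
    "\<And>r r'. \<lbrakk>r \<in> Ar A; r' \<in> Ar A; tgt A r = w; tgt A r' = w; src A r = src A r'; f' \<cdot> r = f' \<cdot> r'; d' \<cdot> r = d' \<cdot> r'\<rbrakk> \<Longrightarrow> r = r'"
proof -
  note [simp] = admD[OF a] f
  have "d \<in> deflations A" using a unfolding deflations_def by auto
  then obtain f' d' where pb: "is_pullback A d f f' d'" and d': "d' \<in> deflations A"
    using pullback_deflation[of d f] by auto
  define w where "w = src A d'"
  have fd [simp]: "f' \<in> Ar A" "src A f' = w" "tgt A f' = src A d" "d' \<in> Ar A" "src A d' = w" "tgt A d' = src A f"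
    and sq: "d \<cdot> f' = f \<cdot> d'" using pb unfolding is_pullback_def w_def by auto
  have [simp]: "w \<in> Ob A" using src_in_Ob[OF fd(4)] by simp
  have ex1: "\<exists>!r. r \<in> hom A (src A s) w \<and> f' \<cdot> r = s \<and> d' \<cdot> r = t"
    if "s \<in> Ar A" "t \<in> Ar A" "tgt A s = src A d" "tgt A t = src A f" "src A s = src A t" "d \<cdot> s = f \<cdot> t" for s t
    using pb that unfolding is_pullback_def by simp
  have ex: "\<exists>r. r \<in> Ar A \<and> src A r = src A s \<and> tgt A r = w \<and> f' \<cdot> r = s \<and> d' \<cdot> r = t"
    if "s \<in> Ar A" "t \<in> Ar A" "tgt A s = src A d" "tgt A t = src A f" "src A s = src A t" "d \<cdot> s = f \<cdot> t" for s t
    using ex1[OF that] by auto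
  have mono: "r = r'" if r: "r \<in> Ar A" "r' \<in> Ar A" "tgt A r = w" "tgt A r' = w" "src A r = src A r'" "f' \<cdot> r = f' \<cdot> r'" "d' \<cdot> r = d' \<cdot> r'" for r r'
  proof -
    have "d \<cdot> (f' \<cdot> r') = f \<cdot> (d' \<cdot> r')" using r(1-5) by (simp add: reassoc[OF sq])
    then have "\<exists>!q. q \<in> hom A (src A (f' \<cdot> r')) w \<and> f' \<cdot> q = f' \<cdot> r' \<and> d' \<cdot> q = d' \<cdot> r'"
      using r(1-5) by (intro ex1) simp_all
    then obtain q where "\<And>y. y \<in> hom A (src A (f' \<cdot> r')) w \<and> f' \<cdot> y = f' \<cdot> r' \<and> d' \<cdot> y = d' \<cdot> r' \<Longrightarrow> y = q"
      by (elim ex1E) blast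
    from this[of r] this[of r'] show ?thesis using r by simp
  qed
  obtain k' where k' [simp]: "k' \<in> Ar A" "src A k' = src A k" "tgt A k' = w" and ke: "f' \<cdot> k' = k" "d' \<cdot> k' = zer A (src A k) (src A f)"
    using ex[of k "zer A (src A k) (src A f)"] by auto
  have "is_kernel A k' d'" unfolding is_kernel_def
  proof (intro conjI ballI impI)
    fix t assume t [simp]: "t \<in> Ar A" "tgt A t = src A d'" and dt: "d' \<cdot> t = zer A (src A t) (tgt A d')"
    have "d \<cdot> (f' \<cdot> t) = zer A (src A (f' \<cdot> t)) (tgt A d)" using dt by (simp add: reassoc[OF sq])
    then obtain s where s [simp]: "s \<in> Ar A" "src A s = src A t" "tgt A s = src A k" and se: "k \<cdot> s = f' \<cdot> t"
      using kernel_factor[OF a, of "f' \<cdot> t"] by auto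
    have "k' \<cdot> s = t" by (rule mono) (use dt in \<open>simp_all add: reassoc[OF ke(1)] reassoc[OF ke(2)] se\<close>)
    moreover have "s' = s" if "s' \<in> Ar A" "src A s' = src A t" "tgt A s' = src A k" "k' \<cdot> s' = t" for s'
    proof (rule adm_mono[OF a])
      have "k \<cdot> s' = f' \<cdot> (k' \<cdot> s')" using that(1-3) by (simp add: reassoc[OF ke(1)])
      then show "k \<cdot> s' = k \<cdot> s" using that(4) se by simp
    qed (use that in simp_all)
    ultimately show "\<exists>!s. s \<in> hom A (src A t) (src A k') \<and> k' \<cdot> s = t"
      by (intro ex1I[of _ s]) auto
  qed (simp_all add: ke)
  from adm_of_kernel[OF d' this] have "(k', d') \<in> adm A" .
  then show ?thesis by (rule that[of w f' d' k', rotated 8]) (use sq ke ex mono in \<open>simp_all\<close>)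
qed

text \<open>The axiom only says that \<open>i'\<close> is an inflation. The arrow \<open>d'\<close>
  induced by \<open>d\<close> and zero has the universal property of a cokernel of
  \<open>i'\<close>, so it may replace the cokernel \<open>c\<close> that comes with
  \<open>i'\<close>; both sequences then share the cokernel object.\<close>

lemma pushoutE:
  assumes a: "(i, d) \<in> adm A" and f: "f \<in> Ar A" "src A f = src A i"
  obtains w f' i' d' where "w \<in> Ob A" "f' \<in> Ar A" "src A f' = src A d" "tgt A f' = w"
    "i' \<in> Ar A" "src A i' = tgt A f" "tgt A i' = w" "f' \<cdot> i = i' \<cdot> f"
    "(i', d') \<in> adm A" "d' \<in> Ar A" "src A d' = w" "tgt A d' = tgt A d" "d' \<cdot> f' = d" "d' \<cdot> i' = zer A (tgt A f) (tgt A d)"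
    "\<And>s t. \<lbrakk>s \<in> Ar A; t \<in> Ar A; src A s = src A d; src A t = tgt A f; tgt A s = tgt A t; s \<cdot> i = t \<cdot> f\<rbrakk>
      \<Longrightarrow> \<exists>r. r \<in> Ar A \<and> src A r = w \<and> tgt A r = tgt A s \<and> r \<cdot> f' = s \<and> r \<cdot> i' = t"
    "\<And>r r'. \<lbrakk>r \<in> Ar A; r' \<in> Ar A; src A r = w; src A r' = w; tgt A r = tgt A r'; r \<cdot> f' = r' \<cdot> f'; r \<cdot> i' = r' \<cdot> i'\<rbrakk> \<Longrightarrow> r = r'"
proof -
  note [simp] = admD[OF a] f
  have "i \<in> inflations A" using a unfolding inflations_def by auto
  then obtain f' i' where po: "is_pushout A i f f' i'" and i': "i' \<in> inflations A"
    using pushout_inflation[of i f] by auto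
  then obtain c where c: "(i', c) \<in> adm A" unfolding inflations_def by auto
  define w where "w = tgt A i'"
  have fd [simp]: "f' \<in> Ar A" "src A f' = src A d" "tgt A f' = w" "i' \<in> Ar A" "src A i' = tgt A f" "tgt A i' = w"
    and sq: "f' \<cdot> i = i' \<cdot> f" using po unfolding is_pushout_def w_def by auto
  have [simp]: "w \<in> Ob A" using tgt_in_Ob[OF fd(4)] by simp
  have [simp]: "src A c = w" using admD[OF c] by simp
  have ex1: "\<exists>!r. r \<in> hom A w (tgt A s) \<and> r \<cdot> f' = s \<and> r \<cdot> i' = t"
    if "s \<in> Ar A" "t \<in> Ar A" "src A s = src A d" "src A t = tgt A f" "tgt A s = tgt A t" "s \<cdot> i = t \<cdot> f" for s t
    using po that unfolding is_pushout_def by simp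
  have ex: "\<exists>r. r \<in> Ar A \<and> src A r = w \<and> tgt A r = tgt A s \<and> r \<cdot> f' = s \<and> r \<cdot> i' = t"
    if "s \<in> Ar A" "t \<in> Ar A" "src A s = src A d" "src A t = tgt A f" "tgt A s = tgt A t" "s \<cdot> i = t \<cdot> f" for s t
    using ex1[OF that] by auto
  have epi: "r = r'" if r: "r \<in> Ar A" "r' \<in> Ar A" "src A r = w" "src A r' = w" "tgt A r = tgt A r'" "r \<cdot> f' = r' \<cdot> f'" "r \<cdot> i' = r' \<cdot> i'" for r r'
  proof -
    have "(r' \<cdot> f') \<cdot> i = (r' \<cdot> i') \<cdot> f" using r(1-5) by (simp add: sq)
    then have "\<exists>!q. q \<in> hom A w (tgt A (r' \<cdot> f')) \<and> q \<cdot> f' = r' \<cdot> f' \<and> q \<cdot> i' = r' \<cdot> i'"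
      using r(1-5) by (intro ex1) simp_all
    then obtain q where "\<And>y. y \<in> hom A w (tgt A (r' \<cdot> f')) \<and> y \<cdot> f' = r' \<cdot> f' \<and> y \<cdot> i' = r' \<cdot> i' \<Longrightarrow> y = q"
      by (elim ex1E) blast
    from this[of r] this[of r'] show ?thesis using r by simp
  qed
  obtain d' where d' [simp]: "d' \<in> Ar A" "src A d' = w" "tgt A d' = tgt A d" and de: "d' \<cdot> f' = d" "d' \<cdot> i' = zer A (tgt A f) (tgt A d)"
    using ex[of d "zer A (tgt A f) (tgt A d)"] by auto
  have "(i', d') \<in> adm A"
  proof (rule adm_of_cokernelI[OF c])
    fix t assume t [simp]: "t \<in> Ar A" "src A t = src A c" and ti: "t \<cdot> i' = zer A (src A i') (tgt A t)"
    have "(t \<cdot> f') \<cdot> i = zer A (src A i) (tgt A (t \<cdot> f'))" by (simp add: sq) (simp add: reassoc[OF ti])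
    then obtain s where s [simp]: "s \<in> Ar A" "src A s = tgt A d" "tgt A s = tgt A t" and se: "s \<cdot> d = t \<cdot> f'"
      using cokernel_factor[OF a, of "t \<cdot> f'"] by auto
    have "s \<cdot> d' = t" by (rule epi) (use ti in \<open>simp_all add: de se\<close>)
    then show "\<exists>s. s \<in> Ar A \<and> src A s = tgt A d' \<and> tgt A s = tgt A t \<and> s \<cdot> d' = t"
      by (intro exI[of _ s]) simp
  next
    fix s s' assume s: "s \<in> Ar A" "s' \<in> Ar A" "src A s = tgt A d'" "src A s' = tgt A d'" "tgt A s = tgt A s'" "s \<cdot> d' = s' \<cdot> d'"
    have "(s \<cdot> d') \<cdot> f' = (s' \<cdot> d') \<cdot> f'" using s(6) by simp
    then show "s = s'" using s(1-5) by (intro adm_epi[OF a, of s s']) (simp_all add: de)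
  qed (simp_all add: de)
  then show ?thesis by (rule that[of w f' i' d', rotated 8]) (use sq de ex epi in \<open>simp_all\<close>)
qed

text \<open>A cokernel of an identity is both zero and epic, which makes the identity of its target
  zero.\<close>

lemma identity_sequence:
  assumes x: "x \<in> Ob A"
  obtains d where "(ident A x, d) \<in> adm A" "zero_object A (tgt A d)"
proof -
  obtain d where a: "(ident A x, d) \<in> adm A" using ident_inflation[OF x] unfolding inflations_def by auto
  note [simp] = x admD(2)[OF a] admD(3)[OF a, symmetric, simplified]
  have [simp]: "src A d = x" using admD(3)[OF a] by simp
  have d: "d = zer A x (tgt A d)" using admD(4)[OF a] by simp
  have "ident A (tgt A d) = zer A (tgt A d) (tgt A d)"
  proof (rule adm_epi[OF a])
    have "zer A (tgt A d) (tgt A d) \<cdot> d = zer A x (tgt A d)" by simp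
    then show "ident A (tgt A d) \<cdot> d = zer A (tgt A d) (tgt A d) \<cdot> d" using d by simp
  qed simp_all
  then show ?thesis using that a by (simp add: zero_object_iff)
qed

end

section \<open>Projective model structures\<close>

lemma has_liftingI:
  assumes "\<And>u v. \<lbrakk>u \<in> Ar C; v \<in> Ar C; src C u = src C i; tgt C u = src C p; src C v = tgt C i; tgt C v = tgt C p;
      p \<cdot>\<^bsub>C\<^esub> u = v \<cdot>\<^bsub>C\<^esub> i\<rbrakk> \<Longrightarrow> \<exists>h. h \<in> Ar C \<and> src C h = tgt C i \<and> tgt C h = src C p \<and> h \<cdot>\<^bsub>C\<^esub> i = u \<and> p \<cdot>\<^bsub>C\<^esub> h = v"
  shows "has_lifting C i p"
  using assms unfolding has_lifting_def by simp

lemma has_liftingE: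
  assumes "has_lifting C i p" "u \<in> Ar C" "v \<in> Ar C" "src C u = src C i" "tgt C u = src C p" "src C v = tgt C i" "tgt C v = tgt C p"
      "p \<cdot>\<^bsub>C\<^esub> u = v \<cdot>\<^bsub>C\<^esub> i"
  obtains h where "h \<in> Ar C" "src C h = tgt C i" "tgt C h = src C p" "h \<cdot>\<^bsub>C\<^esub> i = u" "p \<cdot>\<^bsub>C\<^esub> h = v"
  using assms unfolding has_lifting_def by auto

context model_structure
begin

lemma model_Ar [simp]: "f \<in> CoFib M \<Longrightarrow> f \<in> Ar C" "f \<in> Fib M \<Longrightarrow> f \<in> Ar C" "f \<in> Weq M \<Longrightarrow> f \<in> Ar C"
  using CoFib_Ar Fib_Ar Weq_Ar by auto

text \<open>The retract argument: a lift of \<open>f\<close> against its own right factor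
  \<open>q\<close> is a section of \<open>q\<close>, which exhibits \<open>f\<close> as a retract of
  the left factor.\<close>

lemma retract_left:
  assumes f: "f \<in> Ar C" "j \<in> Ar C" "q \<in> Ar C" "tgt C j = src C q" "q \<cdot> j = f" and l: "has_lifting C f q"
  shows "retract_of C f j"
proof -
  note [simp] = f(1-4)
  have [simp]: "src C f = src C j" "tgt C f = tgt C q" using f by auto
  obtain h where [simp]: "h \<in> Ar C" "src C h = tgt C q" "tgt C h = src C q" and h: "h \<cdot> f = j" "q \<cdot> h = ident C (tgt C q)"
    by (rule has_liftingE[OF l, of j "ident C (tgt C q)"]) (simp_all add: f(5))
  show ?thesis unfolding retract_of_def
    by (intro conjI bexI[of _ "ident C (src C j)"] bexI[of _ h] bexI[of _ q]) (simp_all add: h f(5))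
qed

lemma retract_right:
  assumes f: "f \<in> Ar C" "j \<in> Ar C" "q \<in> Ar C" "tgt C j = src C q" "q \<cdot> j = f" and l: "has_lifting C j f"
  shows "retract_of C f q"
proof -
  note [simp] = f(1-4)
  have [simp]: "src C f = src C j" "tgt C f = tgt C q" using f by auto
  obtain h where [simp]: "h \<in> Ar C" "src C h = src C q" "tgt C h = src C j" and h: "h \<cdot> j = ident C (src C j)" "f \<cdot> h = q"
    by (rule has_liftingE[OF l, of "ident C (src C j)" q]) (simp_all add: f(5))
  show ?thesis unfolding retract_of_def
    by (intro conjI bexI[of _ "ident C (tgt C q)"] bexI[of _ h] bexI[of _ j]) (simp_all add: h f(5))
qed

lemma factor_CoFibE:
  assumes "f \<in> Ar C"
  obtains j q where "j \<in> CoFib M" "q \<in> Fib M" "q \<in> Weq M" "src C q = tgt C j" "src C j = src C f" "tgt C q = tgt C f" "q \<cdot> j = f"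
proof -
  obtain j q where "j \<in> CoFib M" "q \<in> Fib M \<inter> Weq M" "tgt C j = src C q" "q \<cdot> j = f" "src C j = src C f" "tgt C q = tgt C f"
    using factor_CoFib[OF assms] by blast
  then show ?thesis by (intro that[of j q]) simp_all
qed

lemma factor_FibE:
  assumes "f \<in> Ar C"
  obtains j q where "j \<in> CoFib M" "j \<in> Weq M" "q \<in> Fib M" "src C q = tgt C j" "src C j = src C f" "tgt C q = tgt C f" "q \<cdot> j = f"
proof -
  obtain j q where "j \<in> CoFib M \<inter> Weq M" "q \<in> Fib M" "tgt C j = src C q" "q \<cdot> j = f" "src C j = src C f" "tgt C q = tgt C f"
    using factor_Fib[OF assms] by blast
  then show ?thesis by (intro that[of j q]) simp_all
qed

text \<open>By factorization and the retract argument, each of the four classes contains every arrow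
  with the matching lifting property. Membership is mostly established below through these four
  rules.\<close>

lemma CoFibI:
  assumes "f \<in> Ar C" "\<And>p. p \<in> Fib M \<Longrightarrow> p \<in> Weq M \<Longrightarrow> has_lifting C f p" shows "f \<in> CoFib M"
proof -
  obtain j q where "j \<in> CoFib M" "q \<in> Fib M \<inter> Weq M" "tgt C j = src C q" "q \<cdot> j = f"
    using factor_CoFib[OF assms(1)] by auto
  then show ?thesis using retract_CoFib retract_left[of f j q] assms by simp
qed

lemma trivial_CoFibI:
  assumes "f \<in> Ar C" "\<And>p. p \<in> Fib M \<Longrightarrow> has_lifting C f p" shows "f \<in> CoFib M \<inter> Weq M"
proof -
  obtain j q where "j \<in> CoFib M \<inter> Weq M" "q \<in> Fib M" "tgt C j = src C q" "q \<cdot> j = f"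
    using factor_Fib[OF assms(1)] by auto
  then show ?thesis using retract_CoFib retract_Weq retract_left[of f j q] assms by simp
qed

lemma FibI:
  assumes "f \<in> Ar C" "\<And>i. i \<in> CoFib M \<Longrightarrow> i \<in> Weq M \<Longrightarrow> has_lifting C i f" shows "f \<in> Fib M"
proof -
  obtain j q where "j \<in> CoFib M \<inter> Weq M" "q \<in> Fib M" "tgt C j = src C q" "q \<cdot> j = f"
    using factor_Fib[OF assms(1)] by auto
  then show ?thesis using retract_Fib retract_right[of f j q] assms by simp
qed

lemma trivial_FibI:
  assumes "f \<in> Ar C" "\<And>i. i \<in> CoFib M \<Longrightarrow> has_lifting C i f" shows "f \<in> Fib M \<inter> Weq M"
proof -
  obtain j q where "j \<in> CoFib M" "q \<in> Fib M \<inter> Weq M" "tgt C j = src C q" "q \<cdot> j = f"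
    using factor_CoFib[OF assms(1)] by auto
  then show ?thesis using retract_Fib retract_Weq retract_right[of f j q] assms by simp
qed

lemma ident_trivial_Fib: "x \<in> Ob C \<Longrightarrow> ident C x \<in> Fib M \<inter> Weq M"
proof (rule trivial_FibI)
  fix i assume x: "x \<in> Ob C" and i: "i \<in> CoFib M"
  show "has_lifting C i (ident C x)"
  proof (rule has_liftingI)
    fix u v assume "u \<in> Ar C" "v \<in> Ar C" "src C u = src C i" "tgt C u = src C (ident C x)" "src C v = tgt C i"
      "tgt C v = tgt C (ident C x)" "ident C x \<cdot> u = v \<cdot> i"
    with x show "\<exists>h. h \<in> Ar C \<and> src C h = tgt C i \<and> tgt C h = src C (ident C x) \<and> h \<cdot> i = u \<and> ident C x \<cdot> h = v"
      by (intro exI[of _ v]) simp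
  qed
qed simp

lemma CoFib_cmp:
  assumes i: "i \<in> CoFib M" and j: "j \<in> CoFib M" and e: "tgt C i = src C j" shows "j \<cdot> i \<in> CoFib M"
proof (rule CoFibI)
  fix p assume p: "p \<in> Fib M" "p \<in> Weq M"
  note [simp] = i j e p
  show "has_lifting C (j \<cdot> i) p"
  proof (rule has_liftingI)
    fix u v assume uv [simp]: "u \<in> Ar C" "v \<in> Ar C" "src C u = src C (j \<cdot> i)" "tgt C u = src C p" "src C v = tgt C (j \<cdot> i)"
      "tgt C v = tgt C p" and sq: "p \<cdot> u = v \<cdot> (j \<cdot> i)"
    obtain h where h [simp]: "h \<in> Ar C" "src C h = src C j" "tgt C h = src C p" and hh: "h \<cdot> i = u" "p \<cdot> h = v \<cdot> j"
      by (rule has_liftingE[OF lift_CoFib[OF i, of p], of u "v \<cdot> j"]) (simp_all add: sq)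
    obtain k where k [simp]: "k \<in> Ar C" "src C k = tgt C j" "tgt C k = src C p" and kk: "k \<cdot> j = h" "p \<cdot> k = v"
      by (rule has_liftingE[OF lift_CoFib[OF j, of p], of h v]) (simp_all add: hh)
    show "\<exists>h. h \<in> Ar C \<and> src C h = tgt C (j \<cdot> i) \<and> tgt C h = src C p \<and> h \<cdot> (j \<cdot> i) = u \<and> p \<cdot> h = v"
      by (intro exI[of _ k]) (simp add: reassoc[OF kk(1)] hh kk)
  qed
qed (use assms in simp)

end

section \<open>Cofibrant, trivial and projective objects\<close>

locale projective_model_structure = exact_category A + model_structure A M
  for A :: "('o, 'm) exactcat" (structure) and M :: "'m model" +
  assumes projective: "projective_model A M"
begin

abbreviation \<C> :: "'o set" where "\<C> \<equiv> cofibrant_objects A M"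
abbreviation \<P> :: "'o set" where "\<P> \<equiv> projective_objects A"

text \<open>\<open>cofibrant_objects\<close> and \<open>fibrant_objects\<close> quantify over zero
  objects; fixing one allows triviality to be stated for a single arrow.\<close>

definition zero :: 'o where "zero = (SOME z. zero_object A z)"

lemma zero: "zero_object A zero"
  unfolding zero_def by (rule someI_ex[OF ex_zero_object])

lemma zero_Ob [simp]: "zero \<in> Ob A"
  using zero by (simp add: zero_object_iff)

definition trivial :: "'o \<Rightarrow> bool" where "trivial x \<longleftrightarrow> x \<in> Ob A \<and> zer A zero x \<in> Weq M"

lemma CoFib_iff: "i \<in> CoFib M \<longleftrightarrow> (\<exists>d. (i, d) \<in> adm A \<and> tgt A d \<in> \<C>)"
  using projective unfolding projective_model_def exact_model_def by blast

lemma CoFibE: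
  assumes "i \<in> CoFib M" obtains d where "(i, d) \<in> adm A" "tgt A d \<in> \<C>"
  using assms CoFib_iff by auto

text \<open>Every kernel is fibrant, so together with \<open>FibE\<close> the fibrations are
  precisely the deflations.\<close>

lemma Fib_of_adm: "(i, d) \<in> adm A \<Longrightarrow> d \<in> Fib M"
proof -
  assume a: "(i, d) \<in> adm A"
  then have "src A i \<in> fibrant_objects A M" using projective admD(1) unfolding projective_model_def by auto
  with a show ?thesis using projective unfolding projective_model_def exact_model_def by blast
qed

lemma FibE:
  assumes "p \<in> Fib M" obtains i where "(i, p) \<in> adm A"
  using assms projective unfolding projective_model_def exact_model_def by blast

lemma cofibrant_Ob [simp]: "x \<in> \<C> \<Longrightarrow> x \<in> Ob A"
  unfolding cofibrant_objects_def by simp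

lemma projective_Ob [simp]: "x \<in> \<P> \<Longrightarrow> x \<in> Ob A"
  unfolding projective_objects_def by simp

lemma trivial_Ob [simp]: "trivial x \<Longrightarrow> x \<in> Ob A"
  unfolding trivial_def by simp

text \<open>The upper half of a lifting square that starts at a zero object is forced. With
  \<open>cofibrantI\<close> this describes cofibrant objects by lifting along trivial fibrations, a
  form free of the choice of a zero object.\<close>

lemma cofibrant_lift:
  assumes x: "x \<in> \<C>" and p: "p \<in> Fib M" "p \<in> Weq M" and f: "f \<in> Ar A" "src A f = x" "tgt A f = tgt A p"
  obtains g where "g \<in> Ar A" "src A g = x" "tgt A g = src A p" "p \<cdot> g = f"
proof -
  obtain z i where z: "zero_object A z" and i: "i \<in> CoFib M" "src A i = z" "tgt A i = x"
    using x unfolding cofibrant_objects_def by auto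
  note [simp] = zero_object_Ob[OF z] i p f
  show ?thesis
  proof (rule has_liftingE[OF lift_CoFib[OF i(1), of p], of "zer A z (src A p)" f])
    show "p \<cdot> zer A z (src A p) = f \<cdot> i" using from_zero[OF z, of "f \<cdot> i"] by simp
  qed (use that in simp_all)
qed

lemma cofibrantI:
  assumes x: "x \<in> Ob A" and l: "\<And>p f. \<lbrakk>p \<in> Fib M; p \<in> Weq M; f \<in> Ar A; src A f = x; tgt A f = tgt A p\<rbrakk> \<Longrightarrow>
      \<exists>g. g \<in> Ar A \<and> src A g = x \<and> tgt A g = src A p \<and> p \<cdot> g = f"
  shows "x \<in> \<C>"
proof -
  note [simp] = x
  have "zer A zero x \<in> CoFib M"
  proof (rule CoFibI)
    fix p assume p [simp]: "p \<in> Fib M" "p \<in> Weq M"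
    show "has_lifting A (zer A zero x) p"
    proof (rule has_liftingI)
      fix u v assume uv: "u \<in> Ar A" "v \<in> Ar A" "src A u = src A (zer A zero x)" "tgt A u = src A p"
        "src A v = tgt A (zer A zero x)" "tgt A v = tgt A p"
      then obtain g where "g \<in> Ar A \<and> src A g = x \<and> tgt A g = src A p \<and> p \<cdot> g = v" using l[of p v] by auto
      then show "\<exists>h. h \<in> Ar A \<and> src A h = tgt A (zer A zero x) \<and> tgt A h = src A p \<and> h \<cdot> zer A zero x = u \<and> p \<cdot> h = v"
        using uv from_zero[OF zero, of u] by (intro exI[of _ g]) simp
    qed
  qed simp
  then show ?thesis unfolding cofibrant_objects_def using x zero
    by (auto intro!: exI[of _ zero] exI[of _ "zer A zero x"])
qed

lemma cofibrant_CoFib: assumes x: "x \<in> \<C>" shows "zer A zero x \<in> CoFib M"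
proof (rule CoFibI)
  fix p assume p [simp]: "p \<in> Fib M" "p \<in> Weq M"
  note [simp] = x
  show "has_lifting A (zer A zero x) p"
  proof (rule has_liftingI)
    fix u v assume uv: "u \<in> Ar A" "v \<in> Ar A" "src A u = src A (zer A zero x)" "tgt A u = src A p"
      "src A v = tgt A (zer A zero x)" "tgt A v = tgt A p"
    then obtain g where "g \<in> Ar A" "src A g = x" "tgt A g = src A p" "p \<cdot> g = v"
      by (elim cofibrant_lift[OF x p, of v, rotated -1]) simp_all
    then show "\<exists>h. h \<in> Ar A \<and> src A h = tgt A (zer A zero x) \<and> tgt A h = src A p \<and> h \<cdot> zer A zero x = u \<and> p \<cdot> h = v"
      using uv from_zero[OF zero, of u] by (intro exI[of _ g]) simp
  qed
qed (use x in simp)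

lemma cofibrant_tgt:
  assumes i: "i \<in> CoFib M" and x: "src A i \<in> \<C>" shows "tgt A i \<in> \<C>"
proof (rule cofibrantI)
  fix p f assume [simp]: "p \<in> Fib M" "p \<in> Weq M" "f \<in> Ar A" "src A f = tgt A i" "tgt A f = tgt A p"
  note [simp] = i
  obtain g where g: "g \<in> Ar A" "src A g = src A i" "tgt A g = src A p" "p \<cdot> g = f \<cdot> i"
    by (rule cofibrant_lift[OF x, of p "f \<cdot> i"]) simp_all
  obtain h where "h \<in> Ar A" "src A h = tgt A i" "tgt A h = src A p" "h \<cdot> i = g" "p \<cdot> h = f"
    by (rule has_liftingE[OF lift_CoFib[OF i, of p], of g f]) (use g in simp_all)
  then show "\<exists>g. g \<in> Ar A \<and> src A g = tgt A i \<and> tgt A g = src A p \<and> p \<cdot> g = f" by blast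
qed (use i in simp)

lemma cofibrant_retract:
  assumes y: "y \<in> \<C>" and sr: "s \<in> Ar A" "r \<in> Ar A" "src A s = x" "tgt A s = y" "src A r = y" "tgt A r = x" "r \<cdot> s = ident A x"
  shows "x \<in> \<C>"
proof (rule cofibrantI)
  fix p f assume [simp]: "p \<in> Fib M" "p \<in> Weq M" "f \<in> Ar A" "src A f = x" "tgt A f = tgt A p"
  note [simp] = sr
  obtain g where [simp]: "g \<in> Ar A" "src A g = y" "tgt A g = src A p" and g: "p \<cdot> g = f \<cdot> r"
    by (rule cofibrant_lift[OF y, of p "f \<cdot> r"]) simp_all
  show "\<exists>g. g \<in> Ar A \<and> src A g = x \<and> tgt A g = src A p \<and> p \<cdot> g = f"
    by (intro exI[of _ "g \<cdot> s"]) (simp add: reassoc[OF g])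
qed (use src_in_Ob[OF sr(1)] sr in simp)

lemma cofibrant_biproduct:
  assumes x: "x \<in> \<C>" and y: "y \<in> \<C>" and b: "i \<in> Ar A" "src A i = x" "tgt A i = b" "j \<in> Ar A" "src A j = y" "tgt A j = b"
    "p \<in> Ar A" "src A p = b" "tgt A p = x" "q \<in> Ar A" "src A q = b" "tgt A q = y"
    "(i \<cdot> p) \<oplus> (j \<cdot> q) = ident A b"
  shows "b \<in> \<C>"
proof (rule cofibrantI)
  note [simp] = b(1-12)
  fix e f assume [simp]: "e \<in> Fib M" "e \<in> Weq M" "f \<in> Ar A" "src A f = b" "tgt A f = tgt A e"
  obtain g where [simp]: "g \<in> Ar A" "src A g = x" "tgt A g = src A e" and g: "e \<cdot> g = f \<cdot> i"
    by (rule cofibrant_lift[OF x, of e "f \<cdot> i"]) simp_all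
  obtain h where [simp]: "h \<in> Ar A" "src A h = y" "tgt A h = src A e" and h: "e \<cdot> h = f \<cdot> j"
    by (rule cofibrant_lift[OF y, of e "f \<cdot> j"]) simp_all
  have "e \<cdot> (g \<cdot> p \<oplus> h \<cdot> q) = f \<cdot> ((i \<cdot> p) \<oplus> (j \<cdot> q))" by (simp add: reassoc[OF g] reassoc[OF h])
  then have "e \<cdot> (g \<cdot> p \<oplus> h \<cdot> q) = f" unfolding b(13) by simp
  then show "\<exists>g. g \<in> Ar A \<and> src A g = b \<and> tgt A g = src A e \<and> e \<cdot> g = f"
    by (intro exI[of _ "g \<cdot> p \<oplus> h \<cdot> q"]) simp
qed (use src_in_Ob[OF b(7)] b in simp)

lemma zero_cofibrant [simp]: "zero \<in> \<C>"
proof (rule cofibrantI)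
  fix p f assume "p \<in> Fib M" "p \<in> Weq M" "f \<in> Ar A" "src A f = zero" "tgt A f = tgt A p"
  then show "\<exists>g. g \<in> Ar A \<and> src A g = zero \<and> tgt A g = src A p \<and> p \<cdot> g = f"
    using from_zero[OF zero, of f] by (intro exI[of _ "zer A zero (src A p)"]) simp
qed simp

lemma projective_lift:
  assumes x: "x \<in> \<P>" and a: "(i, d) \<in> adm A" and f: "f \<in> Ar A" "src A f = x" "tgt A f = tgt A d"
  obtains g where "g \<in> Ar A" "src A g = x" "tgt A g = src A d" "d \<cdot> g = f"
  using assms unfolding projective_objects_def deflations_def by auto

lemma projectiveI:
  assumes x: "x \<in> Ob A" and l: "\<And>i d f. \<lbrakk>(i, d) \<in> adm A; f \<in> Ar A; src A f = x; tgt A f = tgt A d\<rbrakk> \<Longrightarrow>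
      \<exists>g. g \<in> Ar A \<and> src A g = x \<and> tgt A g = src A d \<and> d \<cdot> g = f"
  shows "x \<in> \<P>"
  using assms unfolding projective_objects_def deflations_def by auto

lemma projective_cofibrant [simp]: assumes x: "x \<in> \<P>" shows "x \<in> \<C>"
proof (rule cofibrantI)
  fix p f assume p: "p \<in> Fib M" "p \<in> Weq M" "f \<in> Ar A" "src A f = x" "tgt A f = tgt A p"
  obtain i where "(i, p) \<in> adm A" by (rule FibE[OF p(1)])
  from projective_lift[OF x this p(3-5)] show "\<exists>g. g \<in> Ar A \<and> src A g = x \<and> tgt A g = src A p \<and> p \<cdot> g = f" by blast
qed (use x in simp)

text \<open>Fibrations are deflations, so the arrow from zero to a projective object lifts against
  all of them and is a trivial cofibration. With \<open>trivial_cofibrant_projective\<close> this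
  identifies \<P> with the trivially cofibrant objects.\<close>

lemma projective_trivial [simp]: assumes x: "x \<in> \<P>" shows "trivial x"
proof -
  note [simp] = x
  have "zer A zero x \<in> CoFib M \<inter> Weq M"
  proof (rule trivial_CoFibI)
    fix p assume p [simp]: "p \<in> Fib M"
    obtain i where i: "(i, p) \<in> adm A" by (rule FibE[OF p])
    show "has_lifting A (zer A zero x) p"
    proof (rule has_liftingI)
      fix u v assume uv: "u \<in> Ar A" "v \<in> Ar A" "src A u = src A (zer A zero x)" "tgt A u = src A p"
        "src A v = tgt A (zer A zero x)" "tgt A v = tgt A p"
      then obtain g where "g \<in> Ar A" "src A g = x" "tgt A g = src A p" "p \<cdot> g = v"
        by (elim projective_lift[OF x i, of v, rotated -1]) simp_all
      then show "\<exists>h. h \<in> Ar A \<and> src A h = tgt A (zer A zero x) \<and> tgt A h = src A p \<and> h \<cdot> zer A zero x = u \<and> p \<cdot> h = v"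
        using uv from_zero[OF zero, of u] by (intro exI[of _ g]) simp
    qed
  qed simp
  then show ?thesis by (simp add: trivial_def)
qed

lemma trivial_cofibrant_projective:
  assumes t: "trivial x" and x: "x \<in> \<C>" shows "x \<in> \<P>"
proof (rule projectiveI)
  fix i d f assume a: "(i, d) \<in> adm A" and f: "f \<in> Ar A" "src A f = x" "tgt A f = tgt A d"
  note [simp] = admD(1-3)[OF a] f x
  have "zer A zero x \<in> CoFib M \<inter> Weq M" using t cofibrant_CoFib[OF x] by (simp add: trivial_def)
  from lift_Fib[OF this Fib_of_adm[OF a]]
  obtain h where "h \<in> Ar A" "src A h = x" "tgt A h = src A d" "d \<cdot> h = f"
    by (rule has_liftingE[of _ _ _ "zer A zero (src A d)" f]) simp_all
  then show "\<exists>g. g \<in> Ar A \<and> src A g = x \<and> tgt A g = src A d \<and> d \<cdot> g = f" by blast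
qed (use x in simp)

lemma trivial_Weq_iff:
  assumes w: "w \<in> Weq M" shows "trivial (src A w) \<longleftrightarrow> trivial (tgt A w)"
proof
  assume "trivial (src A w)"
  then have "w \<cdot> zer A zero (src A w) \<in> Weq M" using w by (intro Weq_cmp) (simp_all add: trivial_def)
  then show "trivial (tgt A w)" using w by (simp add: trivial_def)
next
  assume t: "trivial (tgt A w)"
  have "zer A zero (src A w) \<in> Weq M"
    by (rule Weq_cancel_left[OF _ w]) (use t w in \<open>simp_all add: trivial_def\<close>)
  then show "trivial (src A w)" using w by (simp add: trivial_def)
qed

lemma Weq_of_trivial:
  assumes "trivial (src A f)" "trivial (tgt A f)" "f \<in> Ar A" shows "f \<in> Weq M"
  by (rule Weq_cancel_right[of "zer A zero (src A f)"]) (use assms in \<open>simp_all add: trivial_def\<close>)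

lemma zero_trivial [simp]: "trivial zero"
  using ident_trivial_Fib[of zero] zero by (simp add: trivial_def zero_object_iff)

text \<open>\<open>fibrant_objects\<close> provides a fibration to some zero object. Lifting against
  an arrow to a zero object does not depend on which zero object it is, so the fixed one serves as
  well.\<close>

lemma to_zero_Fib: assumes x [simp]: "x \<in> Ob A" shows "zer A x zero \<in> Fib M"
proof (rule FibI)
  obtain z f where z: "zero_object A z" and f [simp]: "f \<in> Fib M" "src A f = x" "tgt A f = z"
  proof -
    have "x \<in> fibrant_objects A M" using projective x unfolding projective_model_def by simp
    then show ?thesis using that unfolding fibrant_objects_def by auto
  qed
  fix i assume i [simp]: "i \<in> CoFib M" "i \<in> Weq M"
  note [simp] = zero_object_Ob[OF z]
  show "has_lifting A i (zer A x zero)"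
  proof (rule has_liftingI)
    fix u v assume uv [simp]: "u \<in> Ar A" "v \<in> Ar A" "src A u = src A i" "tgt A u = src A (zer A x zero)"
      "src A v = tgt A i" "tgt A v = tgt A (zer A x zero)"
    obtain h where "h \<in> Ar A" "src A h = tgt A i" "tgt A h = x" "h \<cdot> i = u"
    proof (rule has_liftingE[OF lift_Fib[of i f], of u "zer A (tgt A i) z"])
      show "f \<cdot> u = zer A (tgt A i) z \<cdot> i" using to_zero[OF z, of "f \<cdot> u"] by simp
    qed simp_all
    then show "\<exists>h. h \<in> Ar A \<and> src A h = tgt A i \<and> tgt A h = src A (zer A x zero) \<and> h \<cdot> i = u \<and> zer A x zero \<cdot> h = v"
      using to_zero[OF zero, of v] by (intro exI[of _ h]) simp
  qed
qed simp

lemma trivial_to_zero: "trivial x \<Longrightarrow> zer A x zero \<in> Weq M"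
  by (rule Weq_of_trivial) simp_all

lemma injective_extend:
  assumes t: "trivial x" and a: "(i, d) \<in> adm A" "tgt A d \<in> \<C>" and f: "f \<in> Ar A" "src A f = src A i" "tgt A f = x"
  obtains g where "g \<in> Ar A" "src A g = src A d" "tgt A g = x" "g \<cdot> i = f"
proof -
  note [simp] = admD(1-3)[OF a(1)] f t
  have "i \<in> CoFib M" using a CoFib_iff by auto
  moreover have "zer A x zero \<in> Fib M \<inter> Weq M" using to_zero_Fib trivial_to_zero[OF t] t by simp
  ultimately have "has_lifting A i (zer A x zero)" by (rule lift_CoFib)
  then show ?thesis
    by (rule has_liftingE[of _ _ _ f "zer A (src A d) zero"]) (use that in simp_all)
qed

text \<open>The arrow from the kernel to zero is the pullback of \<open>p\<close> along the arrow
  from zero, so it inherits lifting against cofibrations.\<close>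

lemma trivial_kernel:
  assumes a: "(k, p) \<in> adm A" and p: "p \<in> Weq M" shows "trivial (src A k)"
proof -
  note [simp] = admD(1-3)[OF a] p
  have "zer A (src A k) zero \<in> Fib M \<inter> Weq M"
  proof (rule trivial_FibI)
    fix i assume i [simp]: "i \<in> CoFib M"
    show "has_lifting A i (zer A (src A k) zero)"
    proof (rule has_liftingI)
      fix u v assume uv [simp]: "u \<in> Ar A" "v \<in> Ar A" "src A u = src A i" "tgt A u = src A (zer A (src A k) zero)"
        "src A v = tgt A i" "tgt A v = tgt A (zer A (src A k) zero)"
      obtain h where h [simp]: "h \<in> Ar A" "src A h = tgt A i" "tgt A h = src A p" and hh: "h \<cdot> i = k \<cdot> u" "p \<cdot> h = zer A (tgt A i) (tgt A p)"
        by (rule has_liftingE[OF lift_CoFib[OF i, of p], of "k \<cdot> u" "zer A (tgt A i) (tgt A p)"])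
          (simp_all add: Fib_of_adm[OF a] reassoc[OF admD(4)[OF a]])
      obtain s where s [simp]: "s \<in> Ar A" "src A s = tgt A i" "tgt A s = src A k" and ks: "k \<cdot> s = h"
        by (rule kernel_factor[OF a, of h]) (simp_all add: hh)
      have "s \<cdot> i = u" by (rule adm_mono[OF a]) (simp_all add: reassoc[OF ks] hh)
      then show "\<exists>h. h \<in> Ar A \<and> src A h = tgt A i \<and> tgt A h = src A (zer A (src A k) zero) \<and> h \<cdot> i = u \<and> zer A (src A k) zero \<cdot> h = v"
        using to_zero[OF zero, of v] by (intro exI[of _ s]) simp
    qed
  qed simp
  then show ?thesis using trivial_Weq_iff[of "zer A (src A k) zero"] by simp
qed

text \<open>Lifting properties are stable under pullback. The universal property is assumed in the
  form that \<open>pullbackE\<close> returns, so either leg of a square obtained there can be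
  regarded as the pulled back arrow.\<close>

lemma trivial_Fib_pullback:
  assumes p: "p \<in> Fib M" "p \<in> Weq M"
    and s: "w \<in> Ob A" "f \<in> Ar A" "tgt A f = tgt A p" "f' \<in> Ar A" "src A f' = w" "tgt A f' = src A p" "p' \<in> Ar A" "src A p' = w" "tgt A p' = src A f"
      "p \<cdot> f' = f \<cdot> p'"
    and ex: "\<And>s t. \<lbrakk>s \<in> Ar A; t \<in> Ar A; tgt A s = src A p; tgt A t = src A f; src A s = src A t; p \<cdot> s = f \<cdot> t\<rbrakk>
      \<Longrightarrow> \<exists>r. r \<in> Ar A \<and> src A r = src A s \<and> tgt A r = w \<and> f' \<cdot> r = s \<and> p' \<cdot> r = t"
    and mono: "\<And>r r'. \<lbrakk>r \<in> Ar A; r' \<in> Ar A; tgt A r = w; tgt A r' = w; src A r = src A r'; f' \<cdot> r = f' \<cdot> r'; p' \<cdot> r = p' \<cdot> r'\<rbrakk> \<Longrightarrow> r = r'"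
  shows "p' \<in> Fib M \<inter> Weq M"
proof (rule trivial_FibI)
  note [simp] = p s(1-9)
  fix i assume i [simp]: "i \<in> CoFib M"
  show "has_lifting A i p'"
  proof (rule has_liftingI)
    fix u v assume uv [simp]: "u \<in> Ar A" "v \<in> Ar A" "src A u = src A i" "tgt A u = src A p'" "src A v = tgt A i" "tgt A v = tgt A p'"
      and sq: "p' \<cdot> u = v \<cdot> i"
    obtain h where h [simp]: "h \<in> Ar A" "src A h = tgt A i" "tgt A h = src A p" and hh: "h \<cdot> i = f' \<cdot> u" "p \<cdot> h = f \<cdot> v"
      by (rule has_liftingE[OF lift_CoFib[OF i, of p], of "f' \<cdot> u" "f \<cdot> v"]) (simp_all add: reassoc[OF s(10)] sq)
    obtain r where r [simp]: "r \<in> Ar A" "src A r = tgt A i" "tgt A r = w" and rr: "f' \<cdot> r = h" "p' \<cdot> r = v"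
      using ex[of h v] hh by auto
    have "r \<cdot> i = u" by (rule mono) (simp_all add: reassoc[OF rr(1)] reassoc[OF rr(2)] hh sq)
    then show "\<exists>h. h \<in> Ar A \<and> src A h = tgt A i \<and> tgt A h = src A p' \<and> h \<cdot> i = u \<and> p' \<cdot> h = v"
      using rr by (intro exI[of _ r]) simp
  qed
qed (use s in simp)

lemma cofibrant_replacement:
  assumes x [simp]: "x \<in> Ob A"
  obtains q where "q \<in> Fib M" "q \<in> Weq M" "src A q \<in> \<C>" "tgt A q = x"
proof -
  obtain j q where "j \<in> CoFib M" "q \<in> Fib M \<inter> Weq M" "tgt A j = src A q" "q \<cdot> j = zer A zero x" "src A j = zero" "tgt A q = x"
    using factor_CoFib[of "zer A zero x"] by auto
  then show ?thesis using that[of q] cofibrant_tgt[of j] by simp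
qed

text \<open>The arrow from zero is factored with the trivial part first: a trivial cofibration out
  of zero has a trivially cofibrant, hence projective, target.\<close>

lemma enough_projectives:
  assumes x [simp]: "x \<in> Ob A"
  obtains i p where "(i, p) \<in> adm A" "src A p \<in> \<P>" "tgt A p = x"
proof -
  obtain j p where j: "j \<in> CoFib M \<inter> Weq M" "p \<in> Fib M" "tgt A j = src A p" "src A j = zero" "tgt A p = x"
    using factor_Fib[of "zer A zero x"] by auto
  then have "src A p \<in> \<P>" using cofibrant_tgt[of j] trivial_Weq_iff[of j] by (intro trivial_cofibrant_projective) auto
  moreover obtain i where "(i, p) \<in> adm A" by (rule FibE[OF j(2)])
  ultimately show ?thesis using that j by blast
qed

text \<open>Factoring the arrow to zero as a cofibration and a trivial fibration makes the middle
  object trivial by two out of three.\<close>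

lemma trivial_envelope:
  assumes x [simp]: "x \<in> Ob A"
  obtains j s where "j \<in> CoFib M" "(j, s) \<in> adm A" "src A j = x" "trivial (src A s)" "tgt A s \<in> \<C>"
proof -
  obtain j q where j: "j \<in> CoFib M" "q \<in> Fib M \<inter> Weq M" "tgt A j = src A q" "src A j = x" "tgt A q = zero"
    using factor_CoFib[of "zer A x zero"] by auto
  obtain s where s: "(j, s) \<in> adm A" "tgt A s \<in> \<C>" by (rule CoFibE[OF j(1)])
  have "trivial (src A s)" using trivial_Weq_iff[of q] j admD(3)[OF s(1)] by simp
  then show ?thesis using that j s by blast
qed

lemma enough_injectives:
  assumes x: "x \<in> \<C>"
  obtains j s where "j \<in> CoFib M" "(j, s) \<in> adm A" "src A j = x" "src A s \<in> \<P>" "tgt A s \<in> \<C>"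
proof -
  obtain j s where j: "j \<in> CoFib M" "(j, s) \<in> adm A" "src A j = x" "trivial (src A s)" "tgt A s \<in> \<C>"
    using trivial_envelope[of x] x by auto
  then have "src A s \<in> \<P>" using cofibrant_tgt[of j] admD(3)[OF j(2)] x by (intro trivial_cofibrant_projective) simp_all
  then show ?thesis using that j by blast
qed

text \<open>To lift \<open>b\<close> along a deflation \<open>e\<close>, solve the square of
  \<open>i\<close> against \<open>e\<close> with zero on top and \<open>b \<cdot> d\<close> below.
  The solution kills \<open>i\<close> and descends to the cokernel.\<close>

lemma trivial_CoFib_cokernel:
  assumes a: "(i, d) \<in> adm A" and i: "i \<in> CoFib M" "i \<in> Weq M" shows "tgt A d \<in> \<P>"
proof (rule projectiveI)
  note [simp] = admD(1-3)[OF a]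
  fix k e b assume e: "(k, e) \<in> adm A" and b [simp]: "b \<in> Ar A" "src A b = tgt A d" "tgt A b = tgt A e"
  note [simp] = admD(1-3)[OF e]
  obtain h where [simp]: "h \<in> Ar A" "src A h = src A d" "tgt A h = src A e" and h: "h \<cdot> i = zer A (src A i) (src A e)" "e \<cdot> h = b \<cdot> d"
    by (rule has_liftingE[OF lift_Fib[OF _ Fib_of_adm[OF e]], of i "zer A (src A i) (src A e)" "b \<cdot> d"])
      (simp_all add: i admD(4)[OF a])
  obtain g where [simp]: "g \<in> Ar A" "src A g = tgt A d" "tgt A g = src A e" and g: "g \<cdot> d = h"
    by (rule cokernel_factor[OF a, of h]) (simp_all add: h)
  have "e \<cdot> g = b" by (rule adm_epi[OF a]) (simp_all add: g h)
  then show "\<exists>g. g \<in> Ar A \<and> src A g = tgt A d \<and> tgt A g = src A e \<and> e \<cdot> g = b" by (intro exI[of _ g]) simp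
qed (use tgt_in_Ob[OF admD(2)[OF a]] in simp)

text \<open>Replacing the cokernel \<open>n\<close> by a cofibrant \<open>l \<rightarrow> n\<close> turns the kernel inclusion into a trivial cofibration with cokernel \<open>l\<close>.\<close>

lemma trivial_cokernel:
  assumes a: "(k, g) \<in> adm A" and t: "trivial (src A k)" "trivial (src A g)" shows "trivial (tgt A g)"
proof -
  note [simp] = admD(1-3)[OF a]
  obtain q where q [simp]: "q \<in> Fib M" "q \<in> Weq M" "src A q \<in> \<C>" "tgt A q = tgt A g"
    by (rule cofibrant_replacement[of "tgt A g"]) simp_all
  obtain w f' g' k' where w [simp]: "w \<in> Ob A" "f' \<in> Ar A" "src A f' = w" "tgt A f' = src A g"
    "g' \<in> Ar A" "src A g' = w" "tgt A g' = src A q" and sq: "g \<cdot> f' = q \<cdot> g'"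
    and a': "(k', g') \<in> adm A" and [simp]: "k' \<in> Ar A" "src A k' = src A k" "tgt A k' = w"
    and ex: "\<And>s t. \<lbrakk>s \<in> Ar A; t \<in> Ar A; tgt A s = src A g; tgt A t = src A q; src A s = src A t; g \<cdot> s = q \<cdot> t\<rbrakk>
      \<Longrightarrow> \<exists>r. r \<in> Ar A \<and> src A r = src A s \<and> tgt A r = w \<and> f' \<cdot> r = s \<and> g' \<cdot> r = t"
    and mono: "\<And>r r'. \<lbrakk>r \<in> Ar A; r' \<in> Ar A; tgt A r = w; tgt A r' = w; src A r = src A r'; f' \<cdot> r = f' \<cdot> r'; g' \<cdot> r = g' \<cdot> r'\<rbrakk> \<Longrightarrow> r = r'"
    by (rule pullbackE[OF a, of q]) simp_all
  \<comment> \<open>The pullback square is read with its legs exchanged: \<open>f'\<close> is the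
    pullback of the trivial fibration \<open>q\<close> along \<open>g\<close>, so \<open>w\<close>
    is trivial like \<open>src A g\<close>.\<close>
  have "f' \<in> Fib M \<inter> Weq M"
  proof (rule trivial_Fib_pullback[of q w g g' f'])
    fix s t assume "s \<in> Ar A" "t \<in> Ar A" "tgt A s = src A q" "tgt A t = src A g" "src A s = src A t" "q \<cdot> s = g \<cdot> t"
    then show "\<exists>r. r \<in> Ar A \<and> src A r = src A s \<and> tgt A r = w \<and> g' \<cdot> r = s \<and> f' \<cdot> r = t"
      using ex[of t s] by auto
  qed (use sq mono in simp_all)
  then have "trivial w" using trivial_Weq_iff[of f'] t by simp
  then have "k' \<in> Weq M" using t by (intro Weq_of_trivial) simp_all
  moreover have "k' \<in> CoFib M" unfolding CoFib_iff by (intro exI[of _ g'] conjI a') simp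
  ultimately have "tgt A g' \<in> \<P>" using trivial_CoFib_cokernel[OF a'] by simp
  then have "trivial (src A q)" by simp
  then show ?thesis using trivial_Weq_iff[of q] by simp
qed

text \<open>With \<open>q : r \<rightarrow> x\<close> a cofibrant replacement and \<open>j : r \<rightarrow> t\<close> a cofibration into a trivial object, \<open>x\<close> embeds
  into the trivial object \<open>t/ker q\<close>. The embedding extends along \<open>i\<close> and lifts to \<open>t\<close>; restricted to \<open>x\<close> the
  lift lands in \<open>r\<close> and splits \<open>q\<close>.\<close>

lemma syzygy_cofibrant:
  assumes a: "(i, d) \<in> adm A" and z: "tgt A d \<in> \<C>" and p: "src A d \<in> \<P>" shows "src A i \<in> \<C>"
proof -
  note [simp] = admD(1-3)[OF a] p z
  define x where "x = src A i"
  have x [simp]: "src A i = x" "x \<in> Ob A" using src_in_Ob[OF admD(1)[OF a]] by (simp_all add: x_def)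
  obtain q where q [simp]: "q \<in> Fib M" "q \<in> Weq M" "src A q \<in> \<C>" "tgt A q = x"
    by (rule cofibrant_replacement[of x]) simp_all
  obtain k where k: "(k, q) \<in> adm A" by (rule FibE[OF q(1)])
  obtain j s where j [simp]: "j \<in> CoFib M" and s: "(j, s) \<in> adm A" and js [simp]: "src A j = src A q" "trivial (src A s)" "tgt A s \<in> \<C>"
    by (rule trivial_envelope[of "src A q"]) simp_all
  note [simp] = admD(1-3)[OF k] admD(2,3)[OF s]
  have "k \<in> inflations A" "j \<in> inflations A" using k s unfolding inflations_def by auto
  then have "j \<cdot> k \<in> inflations A" by (intro cmp_inflation) simp_all
  \<comment> \<open>\<open>g\<close> is the quotient of the trivial object \<open>src A s\<close> by
    the kernel of \<open>q\<close>. That kernel is trivial because \<open>q\<close> is a trivial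
    fibration, so \<open>trivial_cokernel\<close> applies to the quotient.\<close>
  then obtain g where g: "(j \<cdot> k, g) \<in> adm A" unfolding inflations_def by auto
  have [simp]: "g \<in> Ar A" "src A g = src A s" using admD[OF g] by simp_all
  have n: "trivial (tgt A g)"
    by (rule trivial_cokernel[OF g]) (use trivial_kernel[OF k q(2)] in simp_all)
  have gjk: "(g \<cdot> j) \<cdot> k = zer A (src A k) (tgt A g)" using admD(4)[OF g] by simp
  obtain \<nu> where [simp]: "\<nu> \<in> Ar A" "src A \<nu> = x" "tgt A \<nu> = tgt A g" and \<nu>: "\<nu> \<cdot> q = g \<cdot> j"
    by (rule cokernel_factor[OF k, of "g \<cdot> j"]) (use gjk in simp_all)
  obtain e where [simp]: "e \<in> Ar A" "src A e = src A d" "tgt A e = tgt A g" and e: "e \<cdot> i = \<nu>"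
    by (rule injective_extend[OF n a z, of \<nu>]) simp_all
  obtain e' where [simp]: "e' \<in> Ar A" "src A e' = src A d" "tgt A e' = src A s" and e': "g \<cdot> e' = e"
    by (rule projective_lift[OF p g, of e]) simp_all
  have sjk: "s \<cdot> (j \<cdot> k) = zer A (src A k) (tgt A s)" by (simp add: reassoc[OF admD(4)[OF s]])
  \<comment> \<open>\<delta> is the further quotient to the cokernel of \<open>j\<close>. It kills
    \<nu>, so \<open>s\<close> kills \<open>e' \<cdot> i\<close>, which therefore factors through
    \<open>j\<close>.\<close>
  obtain \<delta> where [simp]: "\<delta> \<in> Ar A" "src A \<delta> = tgt A g" "tgt A \<delta> = tgt A s" and \<delta>: "\<delta> \<cdot> g = s"
    by (rule cokernel_factor[OF g, of s]) (simp_all add: sjk)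
  have "\<delta> \<cdot> \<nu> = zer A x (tgt A s)"
    by (rule adm_epi[OF k]) (simp_all add: \<nu> reassoc[OF \<delta>] admD(4)[OF s])
  moreover have "s \<cdot> (e' \<cdot> i) = \<delta> \<cdot> (g \<cdot> (e' \<cdot> i))" by (simp add: reassoc[OF \<delta>])
  ultimately have "s \<cdot> (e' \<cdot> i) = zer A (src A (e' \<cdot> i)) (tgt A s)"
    by (simp add: reassoc[OF e'] e)
  then obtain t where [simp]: "t \<in> Ar A" "src A t = x" "tgt A t = src A q" and t: "j \<cdot> t = e' \<cdot> i"
    using kernel_factor[OF s, of "e' \<cdot> i"] by auto
  have \<nu>t: "\<nu> \<cdot> (q \<cdot> t) = \<nu>" by (simp add: reassoc[OF \<nu>] t reassoc[OF e'] e)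
  \<comment> \<open>If \<nu> kills \<open>b\<close>, pull \<open>q\<close> back along
    \<open>b\<close>. Then \<open>g\<close> kills \<open>j \<cdot> f'\<close>, so \<open>f'\<close>
    factors through the kernel of \<open>q\<close>; hence \<open>b \<cdot> d'\<close> is zero, and
    the deflation \<open>d'\<close> is epic. Cancelling \<nu> then shows that \<open>t\<close>
    splits \<open>q\<close>.\<close>
  have \<nu>_mono: "b = zer A (src A b) x" if b [simp]: "b \<in> Ar A" "tgt A b = x" and \<nu>b: "\<nu> \<cdot> b = zer A (src A b) (tgt A g)" for b
  proof -
    obtain w f' d' k' where w [simp]: "w \<in> Ob A" "f' \<in> Ar A" "src A f' = w" "tgt A f' = src A q"
      "d' \<in> Ar A" "src A d' = w" "tgt A d' = src A b" and sq: "q \<cdot> f' = b \<cdot> d'" and a': "(k', d') \<in> adm A"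
      by (rule pullbackE[OF k, of b]) simp_all
    have "g \<cdot> (j \<cdot> f') = \<nu> \<cdot> (q \<cdot> f')" by (simp add: reassoc[OF \<nu>])
    also have "\<dots> = zer A w (tgt A g)" by (simp add: sq reassoc[OF \<nu>b])
    finally have "g \<cdot> (j \<cdot> f') = zer A w (tgt A g)" .
    then obtain c where [simp]: "c \<in> Ar A" "src A c = w" "tgt A c = src A k" and c: "(j \<cdot> k) \<cdot> c = j \<cdot> f'"
      using kernel_factor[OF g, of "j \<cdot> f'"] by auto
    have "f' = k \<cdot> c" by (rule adm_mono[OF s]) (use c in simp_all)
    then have bd: "b \<cdot> d' = zer A w x" using sq by (simp add: reassoc[OF admD(4)[OF k]])
    show ?thesis by (rule adm_epi[OF a']) (simp_all add: bd)
  qed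
  have "q \<cdot> t \<oplus> neg A (ident A x) = zer A x x"
    using \<nu>_mono[of "q \<cdot> t \<oplus> neg A (ident A x)"] by (simp add: \<nu>t)
  then have "q \<cdot> t = ident A x" by (simp add: diff_zer_iff)
  then show ?thesis using cofibrant_retract[OF q(3), of t q x] by simp
qed

end

section \<open>The stable category\<close>

context projective_model_structure
begin

definition null :: "'m \<Rightarrow> bool" where
  "null f \<longleftrightarrow> (\<exists>a b. a \<in> Ar A \<and> b \<in> Ar A \<and> tgt A a = src A b \<and> src A b \<in> \<P> \<and> f = b \<cdot> a)"

lemma nullI: "\<lbrakk>a \<in> Ar A; b \<in> Ar A; tgt A a = src A b; src A b \<in> \<P>\<rbrakk> \<Longrightarrow> null (b \<cdot> a)"
  unfolding null_def by blast

lemma nullE: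
  assumes "null f"
  obtains a b where "a \<in> Ar A" "b \<in> Ar A" "tgt A a = src A b" "src A b \<in> \<P>" "f = b \<cdot> a" "src A a = src A f" "tgt A b = tgt A f"
  using assms unfolding null_def by auto

lemma null_Ar: "null f \<Longrightarrow> f \<in> Ar A"
  by (auto elim: nullE)

lemma null_cmp_left: assumes "null f" "g \<in> Ar A" "tgt A f = src A g" shows "null (g \<cdot> f)"
proof -
  obtain a b where ab [simp]: "a \<in> Ar A" "b \<in> Ar A" "tgt A a = src A b" "src A b \<in> \<P>" and f: "f = b \<cdot> a" "tgt A b = tgt A f"
    using assms(1) by (rule nullE)
  have [simp]: "tgt A b = src A g" using f assms by simp
  have "null ((g \<cdot> b) \<cdot> a)" by (rule nullI) (simp_all add: assms)
  then show ?thesis unfolding f(1) using assms by simp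
qed

lemma null_cmp_right: assumes "null f" "g \<in> Ar A" "tgt A g = src A f" shows "null (f \<cdot> g)"
proof -
  obtain a b where ab [simp]: "a \<in> Ar A" "b \<in> Ar A" "tgt A a = src A b" "src A b \<in> \<P>" and f: "f = b \<cdot> a" "src A a = src A f"
    using assms(1) by (rule nullE)
  have [simp]: "src A a = tgt A g" using f assms by simp
  have "null (b \<cdot> (a \<cdot> g))" by (rule nullI) (simp_all add: assms)
  then show ?thesis unfolding f(1) using assms by simp
qed

lemma null_neg: assumes "null f" shows "null (neg A f)"
proof -
  obtain a b where ab [simp]: "a \<in> Ar A" "b \<in> Ar A" "tgt A a = src A b" "src A b \<in> \<P>" and f: "f = b \<cdot> a"
    using assms(1) by (rule nullE)
  have "null (b \<cdot> neg A a)" by (rule nullI) simp_all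
  then show ?thesis unfolding f by simp
qed

lemma projective_biproduct:
  assumes x: "x \<in> \<P>" and y: "y \<in> \<P>" and b: "i \<in> Ar A" "src A i = x" "tgt A i = b" "j \<in> Ar A" "src A j = y" "tgt A j = b"
    "p \<in> Ar A" "src A p = b" "tgt A p = x" "q \<in> Ar A" "src A q = b" "tgt A q = y"
    "(i \<cdot> p) \<oplus> (j \<cdot> q) = ident A b"
  shows "b \<in> \<P>"
proof (rule projectiveI)
  note [simp] = b(1-12)
  fix k e f assume e: "(k, e) \<in> adm A" and [simp]: "f \<in> Ar A" "src A f = b" "tgt A f = tgt A e"
  note [simp] = admD(1-3)[OF e]
  obtain g where [simp]: "g \<in> Ar A" "src A g = x" "tgt A g = src A e" and g: "e \<cdot> g = f \<cdot> i"
    by (rule projective_lift[OF x e, of "f \<cdot> i"]) simp_all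
  obtain h where [simp]: "h \<in> Ar A" "src A h = y" "tgt A h = src A e" and h: "e \<cdot> h = f \<cdot> j"
    by (rule projective_lift[OF y e, of "f \<cdot> j"]) simp_all
  have "e \<cdot> (g \<cdot> p \<oplus> h \<cdot> q) = f \<cdot> ((i \<cdot> p) \<oplus> (j \<cdot> q))" by (simp add: reassoc[OF g] reassoc[OF h])
  then have "e \<cdot> (g \<cdot> p \<oplus> h \<cdot> q) = f" unfolding b(13) by simp
  then show "\<exists>g. g \<in> Ar A \<and> src A g = b \<and> tgt A g = src A e \<and> e \<cdot> g = f"
    by (intro exI[of _ "g \<cdot> p \<oplus> h \<cdot> q"]) simp
qed (use src_in_Ob[OF b(7)] b in simp)

text \<open>Two factorizations are combined through the biproduct of their projective
  objects.\<close>

lemma null_add: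
  assumes "null f" "null g" and fg: "src A f = src A g" "tgt A f = tgt A g" shows "null (f \<oplus> g)"
proof -
  obtain a b where ab [simp]: "a \<in> Ar A" "b \<in> Ar A" "tgt A a = src A b" "src A b \<in> \<P>" and f: "f = b \<cdot> a" "src A a = src A f" "tgt A b = tgt A f"
    using assms(1) by (rule nullE)
  obtain a' b' where ab' [simp]: "a' \<in> Ar A" "b' \<in> Ar A" "tgt A a' = src A b'" "src A b' \<in> \<P>" and g: "g = b' \<cdot> a'" "src A a' = src A g" "tgt A b' = tgt A g"
    using assms(2) by (rule nullE)
  have [simp]: "src A a' = src A a" "tgt A b' = tgt A b" using f(2,3) g(2,3) fg by simp_all
  obtain c i j p q where [simp]: "c \<in> Ob A" "i \<in> Ar A" "src A i = src A b" "tgt A i = c" "j \<in> Ar A" "src A j = src A b'" "tgt A j = c"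
    "p \<in> Ar A" "src A p = c" "tgt A p = src A b" "q \<in> Ar A" "src A q = c" "tgt A q = src A b'"
    and bi: "p \<cdot> i = ident A (src A b)" "q \<cdot> j = ident A (src A b')" "q \<cdot> i = zer A (src A b) (src A b')" "p \<cdot> j = zer A (src A b') (src A b)"
    "(i \<cdot> p) \<oplus> (j \<cdot> q) = ident A c"
    by (rule biproductE[of "src A b" "src A b'"]) simp_all
  have [simp]: "c \<in> \<P>" by (rule projective_biproduct[of "src A b" "src A b'" i c j p q]) (simp_all add: bi)
  have "null ((b \<cdot> p \<oplus> b' \<cdot> q) \<cdot> (i \<cdot> a \<oplus> j \<cdot> a'))" by (rule nullI) simp_all
  moreover have "(b \<cdot> p \<oplus> b' \<cdot> q) \<cdot> (i \<cdot> a \<oplus> j \<cdot> a') = f \<oplus> g"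
    unfolding f(1) g(1) by (simp add: reassoc[OF bi(1)] reassoc[OF bi(2)] reassoc[OF bi(3)] reassoc[OF bi(4)])
  ultimately show ?thesis by simp
qed

lemma zero_projective [simp]: "zero \<in> \<P>"
  by (rule trivial_cofibrant_projective) simp_all

lemma null_zer [simp]: assumes "x \<in> Ob A" "y \<in> Ob A" shows "null (zer A x y)"
  using nullI[of "zer A x zero" "zer A zero y"] assms by simp

text \<open>An arrow from a cofibrant object lifts to a cofibrant replacement of its target; when
  the target is trivial, that replacement is trivially cofibrant and so projective.\<close>

lemma null_to_trivial:
  assumes f [simp]: "f \<in> Ar A" and x: "src A f \<in> \<C>" and y: "trivial (tgt A f)" shows "null f"
proof -
  note [simp] = x y
  obtain q where q [simp]: "q \<in> Fib M" "q \<in> Weq M" "src A q \<in> \<C>" "tgt A q = tgt A f"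
    by (rule cofibrant_replacement[of "tgt A f"]) simp_all
  have "src A q \<in> \<P>" by (rule trivial_cofibrant_projective) (simp_all add: trivial_Weq_iff)
  moreover obtain g where "g \<in> Ar A" "src A g = src A f" "tgt A g = src A q" "q \<cdot> g = f"
    by (rule cofibrant_lift[OF x q(1,2), of f]) simp_all
  ultimately show ?thesis using nullI[of g q] by simp
qed

section \<open>Stable equality and the additive stable category\<close>

definition stable_eq :: "'m \<Rightarrow> 'm \<Rightarrow> bool" (infix \<open>\<approx>\<close> 50) where
  "f \<approx> g \<longleftrightarrow> f \<in> Ar A \<and> g \<in> Ar A \<and> src A f = src A g \<and> tgt A f = tgt A g \<and> null (f \<oplus> neg A g)"

lemma stable_eqI:
  assumes e: "f = g \<oplus> h" and h: "null h" and g [simp]: "g \<in> Ar A" "src A h = src A g" "tgt A h = tgt A g"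
  shows "f \<approx> g"
proof -
  note [simp] = null_Ar[OF h]
  have "f \<in> Ar A" "src A f = src A g" "tgt A f = tgt A g" unfolding e by simp_all
  moreover from this have "f \<oplus> neg A g = h" by (subst diff_eq_iff[of f g h "src A g" "tgt A g"]) (simp_all add: e)
  ultimately show ?thesis unfolding stable_eq_def using h by simp
qed

lemma stable_eqE:
  assumes "f \<approx> g"
  obtains h where "f = g \<oplus> h" "null h" "h \<in> Ar A" "src A h = src A g" "tgt A h = tgt A g"
    "f \<in> Ar A" "g \<in> Ar A" "src A f = src A g" "tgt A f = tgt A g"
proof -
  have [simp]: "f \<in> Ar A" "g \<in> Ar A" "src A f = src A g" "tgt A f = tgt A g" and n: "null (f \<oplus> neg A g)"
    using assms unfolding stable_eq_def by auto
  show ?thesis by (rule that[of "f \<oplus> neg A g"]) (simp_all add: n)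
qed

lemma stable_refl [simp]: "f \<in> Ar A \<Longrightarrow> f \<approx> f"
  unfolding stable_eq_def by simp

lemma stable_sym: assumes "f \<approx> g" shows "g \<approx> f"
proof -
  obtain h where e: "f = g \<oplus> h" and h: "null h" and [simp]: "h \<in> Ar A" "src A h = src A g" "tgt A h = tgt A g" "g \<in> Ar A"
    using assms by (rule stable_eqE)
  have "g = (g \<oplus> h) \<oplus> neg A h" by (simp add: add_associate)
  then have "g = f \<oplus> neg A h" by (simp only: e)
  then show ?thesis by (rule stable_eqI) (simp_all add: null_neg h e)
qed

lemma stable_trans: assumes "f \<approx> g" "g \<approx> k" shows "f \<approx> k"
proof -
  obtain h where e: "f = g \<oplus> h" and h: "null h" and [simp]: "h \<in> Ar A" "src A h = src A g" "tgt A h = tgt A g" "g \<in> Ar A"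
    using assms(1) by (rule stable_eqE)
  obtain h' where e': "g = k \<oplus> h'" and h': "null h'" and g: "h' \<in> Ar A" "src A h' = src A k" "tgt A h' = tgt A k" "k \<in> Ar A"
     "src A g = src A k" "tgt A g = tgt A k"
    using assms(2) by (rule stable_eqE)
  note [simp] = g
  have "f = (k \<oplus> h') \<oplus> h" using e e' by simp
  also have "\<dots> = k \<oplus> (h' \<oplus> h)" by (rule add_associate) simp_all
  finally show ?thesis by (rule stable_eqI) (simp_all add: null_add h h')
qed

lemma stable_cmp:
  assumes "f \<approx> f'" "g \<approx> g'" "tgt A f = src A g" shows "g \<cdot> f \<approx> g' \<cdot> f'"
proof -
  obtain h where e: "f = f' \<oplus> h" and h: "null h" and [simp]: "h \<in> Ar A" "src A h = src A f'" "tgt A h = tgt A f'" "f' \<in> Ar A"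
     and f: "f \<in> Ar A" "src A f = src A f'" "tgt A f = tgt A f'"
    using assms(1) by (rule stable_eqE)
  obtain k where e': "g = g' \<oplus> k" and k: "null k" and [simp]: "k \<in> Ar A" "src A k = src A g'" "tgt A k = tgt A g'" "g' \<in> Ar A"
     and g: "src A g = src A g'" "tgt A g = tgt A g'" 
    using assms(2) by (rule stable_eqE)
  have [simp]: "tgt A f' = src A g'" using assms(3) f g by simp
  have "g \<cdot> f = g' \<cdot> f \<oplus> k \<cdot> f" unfolding e' using f by simp
  also have "\<dots> = (g' \<cdot> f' \<oplus> g' \<cdot> h) \<oplus> k \<cdot> f" using e by simp
  also have "\<dots> = g' \<cdot> f' \<oplus> (g' \<cdot> h \<oplus> k \<cdot> f)" by (rule add_associate) (simp_all add: f)
  finally show ?thesis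
    by (rule stable_eqI) (simp_all add: null_add null_cmp_left null_cmp_right h k f)
qed

lemma stable_add:
  assumes "f \<approx> f'" "g \<approx> g'" "src A f = src A g" "tgt A f = tgt A g" shows "f \<oplus> g \<approx> f' \<oplus> g'"
proof -
  obtain h where e: "f = f' \<oplus> h" and h: "null h" and [simp]: "h \<in> Ar A" "src A h = src A f'" "tgt A h = tgt A f'" "f' \<in> Ar A"
     and f: "f \<in> Ar A" "src A f = src A f'" "tgt A f = tgt A f'"
    using assms(1) by (rule stable_eqE)
  obtain k where e': "g = g' \<oplus> k" and k: "null k" and [simp]: "k \<in> Ar A" "src A k = src A g'" "tgt A k = tgt A g'" "g' \<in> Ar A"
     and g: "src A g = src A g'" "tgt A g = tgt A g'" 
    using assms(2) by (rule stable_eqE)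
  have [simp]: "src A f' = src A g'" "tgt A f' = tgt A g'" using assms f g by simp_all
  have "f \<oplus> g = (f' \<oplus> g') \<oplus> (h \<oplus> k)" unfolding e e' by (simp add: add_ac)
  then show ?thesis by (rule stable_eqI) (simp_all add: null_add h k)
qed

lemma stable_neg: assumes "f \<approx> g" shows "neg A f \<approx> neg A g"
proof -
  obtain h where e: "f = g \<oplus> h" and h: "null h" and [simp]: "h \<in> Ar A" "src A h = src A g" "tgt A h = tgt A g" "g \<in> Ar A"
    using assms by (rule stable_eqE)
  have "neg A f = neg A g \<oplus> neg A h" unfolding e by simp
  then show ?thesis by (rule stable_eqI) (simp_all add: null_neg h)
qed

lemma stable_zer_iff: "\<lbrakk>f \<in> Ar A; src A f = x; tgt A f = y\<rbrakk> \<Longrightarrow> f \<approx> zer A x y \<longleftrightarrow> null f"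
  unfolding stable_eq_def by auto

definition cls :: "'m \<Rightarrow> 'm set" where "cls f = quot_class A \<P> f"

lemma mem_cls: assumes "f \<in> Ar A" shows "g \<in> cls f \<longleftrightarrow> f \<approx> g"
proof -
  have "(\<exists>p \<in> \<P>. \<exists>a \<in> hom A (src A f) p. \<exists>b \<in> hom A p (tgt A f). f \<oplus> neg A g = b \<cdot> a) \<longleftrightarrow> null (f \<oplus> neg A g)"
    if g [simp]: "g \<in> Ar A" "src A g = src A f" "tgt A g = tgt A f"
  proof
    assume "\<exists>p \<in> \<P>. \<exists>a \<in> hom A (src A f) p. \<exists>b \<in> hom A p (tgt A f). f \<oplus> neg A g = b \<cdot> a"
    then obtain p a b where "p \<in> \<P>" "a \<in> hom A (src A f) p" "b \<in> hom A p (tgt A f)" and e: "f \<oplus> neg A g = b \<cdot> a" by blast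
    then show "null (f \<oplus> neg A g)" unfolding e by (intro nullI) simp_all
  next
    assume "null (f \<oplus> neg A g)"
    then obtain a b where ab: "a \<in> Ar A" "b \<in> Ar A" "tgt A a = src A b" "src A b \<in> \<P>" and e: "f \<oplus> neg A g = b \<cdot> a"
      and "src A a = src A (f \<oplus> neg A g)" "tgt A b = tgt A (f \<oplus> neg A g)"
      by (rule nullE)
    moreover have "src A (f \<oplus> neg A g) = src A f" "tgt A (f \<oplus> neg A g) = tgt A f" using assms by simp_all
    ultimately have "src A a = src A f" "tgt A b = tgt A f" by metis+
    with ab e show "\<exists>p \<in> \<P>. \<exists>a \<in> hom A (src A f) p. \<exists>b \<in> hom A p (tgt A f). f \<oplus> neg A g = b \<cdot> a"
      by - (rule bexI[of _ "src A b"], rule bexI[of _ a], rule bexI[of _ b], simp_all)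
  qed
  then show ?thesis unfolding cls_def quot_class_def stable_eq_def using assms by auto
qed

lemma cls_eq_iff: assumes [simp]: "f \<in> Ar A" "g \<in> Ar A" shows "cls f = cls g \<longleftrightarrow> f \<approx> g"
proof
  assume "cls f = cls g"
  then have "g \<in> cls f" by (simp add: mem_cls)
  then show "f \<approx> g" by (simp add: mem_cls)
next
  assume "f \<approx> g"
  then have "f \<approx> h \<longleftrightarrow> g \<approx> h" for h using stable_sym stable_trans by blast
  then show "cls f = cls g" by (intro set_eqI) (simp add: mem_cls)
qed

lemma clsI: "f \<approx> g \<Longrightarrow> cls f = cls g"
  using cls_eq_iff[of f g] by (auto simp: stable_eq_def)

abbreviation SC :: "('o, 'm set) cat" where "SC \<equiv> stable_category A M"

text \<open>\<open>stable_category\<close> is a bare category, and this equips it with an addition.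
  As for composition in \<open>add_quotient\<close>, each operation is a union over representatives,
  which \<open>Union_cls\<close> collapses to a single class.\<close>

definition SA :: "('o, 'm set) addcat" where
  "SA = \<lparr>Ob = Ob SC, Ar = Ar SC, src = src SC, tgt = tgt SC, ident = ident SC, cmp = cmp SC,
     add = (\<lambda>S T. \<Union>{cls (f \<oplus> g) | f g. f \<in> S \<and> g \<in> T}), zer = (\<lambda>x y. cls (zer A x y)),
     neg = (\<lambda>S. \<Union>{cls (neg A f) | f. f \<in> S})\<rparr>"

text \<open>Oriented towards \<open>SA\<close>, so that one set of rules about classes serves both
  records.\<close>

lemma SA_SC [simp]: "Ob SC = Ob SA" "Ar SC = Ar SA" "src SC = src SA" "tgt SC = tgt SA" "ident SC = ident SA" "cmp SC = cmp SA"
  by (simp_all add: SA_def)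

lemma hom_SC [simp]: "hom SC = hom SA"
  by (intro ext) (simp add: hom_def)

lemma iso_SC [simp]: "iso_arr SC f = iso_arr SA f"
  by (simp add: iso_arr_def)

lemma Ob_SA [simp]: "Ob SA = \<C>"
  by (simp add: SA_def add_quotient_def)

lemma cls_Ar [simp]: "\<lbrakk>f \<in> Ar A; src A f \<in> \<C>; tgt A f \<in> \<C>\<rbrakk> \<Longrightarrow> cls f \<in> Ar SA"
  by (auto simp: SA_def add_quotient_def cls_def)

lemma SA_ArE:
  assumes "S \<in> Ar SA" obtains f where "f \<in> Ar A" "src A f \<in> \<C>" "tgt A f \<in> \<C>" "S = cls f"
  using assms by (auto simp: SA_def add_quotient_def cls_def)

lemma src_cls [simp]: assumes "f \<in> Ar A" shows "src SA (cls f) = src A f"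
proof -
  have "src A ` cls f = {src A f}" using assms mem_cls[OF assms] by (auto simp: stable_eq_def image_iff intro!: exI[of _ f])
  then show ?thesis by (simp add: SA_def add_quotient_def)
qed

lemma tgt_cls [simp]: assumes "f \<in> Ar A" shows "tgt SA (cls f) = tgt A f"
proof -
  have "tgt A ` cls f = {tgt A f}" using assms mem_cls[OF assms] by (auto simp: stable_eq_def image_iff intro!: exI[of _ f])
  then show ?thesis by (simp add: SA_def add_quotient_def)
qed

lemma ident_SA [simp]: "ident SA x = cls (ident A x)"
  by (simp add: SA_def add_quotient_def cls_def)

lemma Union_cls:
  assumes "X \<noteq> {}" and "\<And>f. f \<in> X \<Longrightarrow> f \<approx> g" shows "\<Union>{cls f | f. f \<in> X} = cls g"
proof -
  have "cls f = cls g" if "f \<in> X" for f using assms(2)[OF that] by (rule clsI)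
  then have "{cls f | f. f \<in> X} = {cls g}" using assms(1) by auto
  then show ?thesis by simp
qed

lemma cmp_SA [simp]:
  assumes [simp]: "f \<in> Ar A" "g \<in> Ar A" "tgt A f = src A g" shows "cls g \<cdot>\<^bsub>SA\<^esub> cls f = cls (g \<cdot> f)"
proof -
  have "cls g \<cdot>\<^bsub>SA\<^esub> cls f = \<Union>{cls h | h. h \<in> {g' \<cdot> f' | f' g'. f' \<in> cls f \<and> g' \<in> cls g}}"
    unfolding SA_def add_quotient_def cls_def by (simp, rule arg_cong[of _ _ Union]) blast
  also have "\<dots> = cls (g \<cdot> f)"
  proof (rule Union_cls)
    show "{g' \<cdot> f' | f' g'. f' \<in> cls f \<and> g' \<in> cls g} \<noteq> {}" using mem_cls[of f f] mem_cls[of g g] by auto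
    fix h assume "h \<in> {g' \<cdot> f' | f' g'. f' \<in> cls f \<and> g' \<in> cls g}"
    then show "h \<approx> g \<cdot> f" by (auto simp: mem_cls intro!: stable_sym[OF stable_cmp])
  qed
  finally show ?thesis .
qed

lemma add_SA [simp]:
  assumes [simp]: "f \<in> Ar A" "g \<in> Ar A" "src A f = src A g" "tgt A f = tgt A g" shows "cls f \<oplus>\<^bsub>SA\<^esub> cls g = cls (f \<oplus> g)"
proof -
  have "cls f \<oplus>\<^bsub>SA\<^esub> cls g = \<Union>{cls h | h. h \<in> {f' \<oplus> g' | f' g'. f' \<in> cls f \<and> g' \<in> cls g}}"
    unfolding SA_def by (simp, rule arg_cong[of _ _ Union]) blast
  also have "\<dots> = cls (f \<oplus> g)"
  proof (rule Union_cls)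
    show "{f' \<oplus> g' | f' g'. f' \<in> cls f \<and> g' \<in> cls g} \<noteq> {}" using mem_cls[of f f] mem_cls[of g g] by auto
    fix h assume "h \<in> {f' \<oplus> g' | f' g'. f' \<in> cls f \<and> g' \<in> cls g}"
    then show "h \<approx> f \<oplus> g" by (auto simp: mem_cls intro!: stable_sym[OF stable_add])
  qed
  finally show ?thesis .
qed

lemma neg_SA [simp]: assumes [simp]: "f \<in> Ar A" shows "neg SA (cls f) = cls (neg A f)"
proof -
  have "neg SA (cls f) = \<Union>{cls h | h. h \<in> neg A ` cls f}"
    unfolding SA_def by (simp, rule arg_cong[of _ _ Union]) blast
  also have "\<dots> = cls (neg A f)"
  proof (rule Union_cls)
    show "neg A ` cls f \<noteq> {}" using mem_cls[of f f] by auto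
    fix h assume "h \<in> neg A ` cls f"
    then show "h \<approx> neg A f" by (auto simp: mem_cls intro!: stable_sym[OF stable_neg])
  qed
  finally show ?thesis .
qed

lemma zer_SA [simp]: "zer SA x y = cls (zer A x y)"
  unfolding SA_def by simp

lemma SA_homE:
  assumes "S \<in> hom SA x y" obtains f where "f \<in> Ar A" "src A f = x" "tgt A f = y" "x \<in> \<C>" "y \<in> \<C>" "S = cls f"
proof -
  have "S \<in> Ar SA" using assms by simp
  then obtain f where "f \<in> Ar A" "src A f \<in> \<C>" "tgt A f \<in> \<C>" "S = cls f" by (rule SA_ArE)
  then show ?thesis using that[of f] assms by simp
qed

lemma stable_additive_category: "additive_category SA"
proof (unfold_locales, goal_cases)
  case (1 f) then show ?case by (auto elim: SA_ArE)
next
  case (2 f) then show ?case by (auto elim: SA_ArE)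
next
  case (3 x) then show ?case by simp
next
  case (4 f x y g z) then show ?case by (elim SA_homE) simp
next
  case (5 f x y) then show ?case by (elim SA_homE) simp
next
  case (6 f x y) then show ?case by (elim SA_homE) simp
next
  case (7 f w x g y h z) then show ?case by (elim SA_homE) simp
next
  case (8 f x y g) then show ?case by (elim SA_homE) simp
next
  case (9 x y) then show ?case by simp
next
  case (10 f x y) then show ?case by (elim SA_homE) simp
next
  case (11 f x y g h) then show ?case by (elim SA_homE) (simp add: add_associate)
next
  case (12 f x y g)
  then obtain f0 g0 where "f0 \<in> Ar A" "src A f0 = x" "tgt A f0 = y" "f = cls f0" "g0 \<in> Ar A" "src A g0 = x" "tgt A g0 = y" "g = cls g0"
    by (elim SA_homE)
  then show ?case by (simp add: add_ac)
next
  case (13 f x y) then show ?case by (elim SA_homE) simp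
next
  case (14 f x y) then show ?case by (elim SA_homE) simp
next
  case (15 f x y g h z) then show ?case by (elim SA_homE) simp
next
  case (16 f x y g z h) then show ?case by (elim SA_homE) simp
next
  case 17
  have uniq: "\<exists>!f. f \<in> hom SA zero x" "\<exists>!f. f \<in> hom SA x zero" if x: "x \<in> \<C>" for x
  proof -
    have "f = cls (zer A zero x)" if "f \<in> hom SA zero x" for f
      using that by (rule SA_homE) (use from_zero[OF zero] in auto)
    then show "\<exists>!f. f \<in> hom SA zero x" using x by (intro ex1I[of _ "cls (zer A zero x)"]) simp_all
    have "f = cls (zer A x zero)" if "f \<in> hom SA x zero" for f
      using that by (rule SA_homE) (use to_zero[OF zero] in auto)
    then show "\<exists>!f. f \<in> hom SA x zero" using x by (intro ex1I[of _ "cls (zer A x zero)"]) simp_all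
  qed
  show ?case unfolding zero_object_def by (intro exI[of _ zero] conjI ballI uniq) simp_all
next
  case (18 x y)
  then have [simp]: "x \<in> \<C>" "y \<in> \<C>" by simp_all
  obtain b i j p q where [simp]: "b \<in> Ob A" "i \<in> Ar A" "src A i = x" "tgt A i = b" "j \<in> Ar A" "src A j = y" "tgt A j = b"
    "p \<in> Ar A" "src A p = b" "tgt A p = x" "q \<in> Ar A" "src A q = b" "tgt A q = y"
    and bi: "p \<cdot> i = ident A x" "q \<cdot> j = ident A y" "q \<cdot> i = zer A x y" "p \<cdot> j = zer A y x"
    "(i \<cdot> p) \<oplus> (j \<cdot> q) = ident A b"
    by (rule biproductE[of x y]) simp_all
  have [simp]: "b \<in> \<C>" by (rule cofibrant_biproduct[of x y i b j p q]) (simp_all add: bi)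
  show ?case
    by (intro bexI[of _ b] bexI[of _ "cls i"] bexI[of _ "cls j"] bexI[of _ "cls p"] bexI[of _ "cls q"] conjI) (simp_all add: bi)
qed

sublocale SA: additive_category SA
  by (rule stable_additive_category)

lemma iso_cls:
  assumes "f \<in> Ar A" "g \<in> Ar A" "src A g = tgt A f" "tgt A g = src A f" "src A f \<in> \<C>" "tgt A f \<in> \<C>"
    "g \<cdot> f \<approx> ident A (src A f)" "f \<cdot> g \<approx> ident A (tgt A f)"
  shows "iso_arr SA (cls f)"
  by (rule SA.iso_arrI[of _ "cls g"]) (use assms clsI[OF assms(7)] clsI[OF assms(8)] in simp_all)

text \<open>Cofibrancy of the target gives a section \<open>s\<close>. The composite
  \<open>s \<cdot> q\<close> differs from the identity by an arrow through the trivial kernel, and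
  arrows from cofibrant objects to trivial ones are null.\<close>

lemma trivial_Fib_stable_iso:
  assumes q [simp]: "q \<in> Fib M" "q \<in> Weq M" and c [simp]: "src A q \<in> \<C>" "tgt A q \<in> \<C>"
  obtains s where "s \<in> Ar A" "src A s = tgt A q" "tgt A s = src A q" "q \<cdot> s = ident A (tgt A q)" "s \<cdot> q \<approx> ident A (src A q)"
    "iso_arr SA (cls q)"
proof -
  obtain k where k: "(k, q) \<in> adm A" by (rule FibE[OF q(1)])
  note [simp] = admD(1,3)[OF k]
  obtain s where [simp]: "s \<in> Ar A" "src A s = tgt A q" "tgt A s = src A q" and s: "q \<cdot> s = ident A (tgt A q)"
    by (rule cofibrant_lift[OF c(2) q, of "ident A (tgt A q)"]) simp_all
  have "\<exists>n. n \<in> Ar A \<and> src A n = src A q \<and> tgt A n = src A k \<and> s \<cdot> q = ident A (src A q) \<oplus> k \<cdot> n"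
    by (rule kernel_difference[OF k]) (simp_all add: reassoc[OF s])
  then obtain n where [simp]: "n \<in> Ar A" "src A n = src A q" "tgt A n = src A k" and n: "s \<cdot> q = ident A (src A q) \<oplus> k \<cdot> n"
    by blast
  have "null (k \<cdot> n)" using trivial_kernel[OF k] by (intro null_cmp_left null_to_trivial) simp_all
  then have "s \<cdot> q \<approx> ident A (src A q)" by (intro stable_eqI[OF n]) simp_all
  then show ?thesis using that[of s] iso_cls[of q s] s by simp
qed

end

section \<open>The triangulated structure of the stable category\<close>

context projective_model_structure
begin

text \<open>The arrow \<open>g\<close> is induced by \<open>f\<close> on kernels. The lifts defining \<open>\<Omega>\<close> and the connecting arrows are instances,
  so that their compatibilities all come from uniqueness modulo projectives.\<close>

definition lifts :: "'m \<Rightarrow> 'm \<Rightarrow> 'm \<Rightarrow> 'm \<Rightarrow> 'm \<Rightarrow> 'm \<Rightarrow> bool" where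
  "lifts i p i' p' f g \<longleftrightarrow> g \<in> Ar A \<and> src A g = src A i \<and> tgt A g = src A i' \<and>
     (\<exists>h. h \<in> Ar A \<and> src A h = src A p \<and> tgt A h = src A p' \<and> p' \<cdot> h = f \<cdot> p \<and> i' \<cdot> g = h \<cdot> i)"

lemma liftsI:
  "\<lbrakk>g \<in> Ar A; src A g = src A i; tgt A g = src A i'; h \<in> Ar A; src A h = src A p; tgt A h = src A p'; p' \<cdot> h = f \<cdot> p; i' \<cdot> g = h \<cdot> i\<rbrakk>
    \<Longrightarrow> lifts i p i' p' f g"
  unfolding lifts_def by blast

lemma liftsE:
  assumes "lifts i p i' p' f g"
  obtains h where "h \<in> Ar A" "src A h = src A p" "tgt A h = src A p'" "p' \<cdot> h = f \<cdot> p" "i' \<cdot> g = h \<cdot> i"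
  using assms unfolding lifts_def by blast

lemma liftsD:
  assumes "lifts i p i' p' f g"
  shows "g \<in> Ar A" "src A g = src A i" "tgt A g = src A i'"
  using assms unfolding lifts_def by auto

lemma lifts_ex:
  assumes a: "(i, p) \<in> adm A" and a': "(i', p') \<in> adm A" and p: "src A p \<in> \<P>" and f: "f \<in> Ar A" "src A f = tgt A p" "tgt A f = tgt A p'"
  shows "\<exists>g. lifts i p i' p' f g"
proof -
  note [simp] = admD(1-3)[OF a] admD(1-3)[OF a'] f p
  obtain h where [simp]: "h \<in> Ar A" "src A h = src A p" "tgt A h = src A p'" and h: "p' \<cdot> h = f \<cdot> p"
    by (rule projective_lift[OF p a', of "f \<cdot> p"]) simp_all
  have "p' \<cdot> (h \<cdot> i) = zer A (src A (h \<cdot> i)) (tgt A p')" by (simp add: reassoc[OF h] admD(4)[OF a])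
  then obtain g where "g \<in> Ar A" "src A g = src A i" "tgt A g = src A i'" "i' \<cdot> g = h \<cdot> i"
    using kernel_factor[OF a', of "h \<cdot> i"] by auto
  with h show ?thesis by (intro exI[of _ g] liftsI[of _ _ _ h]) simp_all
qed

text \<open>The null part of \<open>f\<close> factors through a projective, whose arrow to the
  target of \<open>p'\<close> lifts along \<open>p'\<close>. Up to this correction, which dies on
  \<open>i\<close>, the lifts \<open>h\<close> and \<open>h'\<close> agree after \<open>p'\<close>
  and so differ by some \<open>n\<close> into the kernel. Hence \<open>g\<close> and
  \<open>g'\<close> differ by \<open>n \<cdot> i\<close>, which passes through the projective source
  of \<open>p\<close>.\<close>

lemma lifts_unique:
  assumes a: "(i, p) \<in> adm A" and a': "(i', p') \<in> adm A" and p: "src A p \<in> \<P>" and ff: "f \<approx> f'"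
    and f: "src A f = tgt A p" "tgt A f = tgt A p'" and g: "lifts i p i' p' f g" and g': "lifts i p i' p' f' g'"
  shows "g \<approx> g'"
proof -
  note [simp] = admD(1-3)[OF a] admD(1-3)[OF a'] p liftsD[OF g] liftsD[OF g']
  obtain w where fw: "f = f' \<oplus> w" and w: "null w" and [simp]: "w \<in> Ar A" "src A w = src A f'" "tgt A w = tgt A f'" "f' \<in> Ar A"
     and f': "src A f = src A f'" "tgt A f = tgt A f'"
    using ff by (rule stable_eqE)
  have [simp]: "src A f' = tgt A p" "tgt A f' = tgt A p'" using f f' by simp_all
  obtain u v where [simp]: "u \<in> Ar A" "v \<in> Ar A" "tgt A u = src A v" "src A v \<in> \<P>" and wvu: "w = v \<cdot> u" and uv: "src A u = src A w" "tgt A v = tgt A w"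
    using w by (rule nullE)
  have [simp]: "src A u = tgt A p" "tgt A v = tgt A p'" using uv by simp_all
  obtain v' where [simp]: "v' \<in> Ar A" "src A v' = src A v" "tgt A v' = src A p'" and v': "p' \<cdot> v' = v"
    by (rule projective_lift[of "src A v", OF _ a', of v]) simp_all
  obtain h where [simp]: "h \<in> Ar A" "src A h = src A p" "tgt A h = src A p'" and h: "p' \<cdot> h = f \<cdot> p" "i' \<cdot> g = h \<cdot> i"
    using g by (rule liftsE)
  obtain h' where [simp]: "h' \<in> Ar A" "src A h' = src A p" "tgt A h' = src A p'" and h': "p' \<cdot> h' = f' \<cdot> p" "i' \<cdot> g' = h' \<cdot> i"
    using g' by (rule liftsE)
  have "p' \<cdot> h = p' \<cdot> (h' \<oplus> v' \<cdot> (u \<cdot> p))" unfolding h(1) fw wvu by (simp add: h'(1) reassoc[OF v'])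
  then have "\<exists>n. n \<in> Ar A \<and> src A n = src A p \<and> tgt A n = src A i' \<and> h = (h' \<oplus> v' \<cdot> (u \<cdot> p)) \<oplus> i' \<cdot> n"
    by (intro kernel_difference[OF a']) simp_all
  then obtain n where [simp]: "n \<in> Ar A" "src A n = src A p" "tgt A n = src A i'" and n: "h = (h' \<oplus> v' \<cdot> (u \<cdot> p)) \<oplus> i' \<cdot> n"
    by blast
  have "h \<cdot> i = i' \<cdot> (g' \<oplus> n \<cdot> i)" unfolding n by (simp add: admD(4)[OF a] h'(2))
  then have "i' \<cdot> g = i' \<cdot> (g' \<oplus> n \<cdot> i)" unfolding h(2) .
  then have "g = g' \<oplus> n \<cdot> i" by (rule adm_mono[OF a']) simp_all
  then show ?thesis by (rule stable_eqI) (simp_all add: nullI)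
qed

lemma lifts_cmp:
  assumes a: "(i, p) \<in> adm A" "(i', p') \<in> adm A" "(i'', p'') \<in> adm A"
    and f: "f \<in> Ar A" "src A f = tgt A p" "tgt A f = tgt A p'" "f' \<in> Ar A" "src A f' = tgt A p'" "tgt A f' = tgt A p''"
    and g: "lifts i p i' p' f g" and g': "lifts i' p' i'' p'' f' g'"
  shows "lifts i p i'' p'' (f' \<cdot> f) (g' \<cdot> g)"
proof -
  note [simp] = admD(1-3)[OF a(1)] admD(1-3)[OF a(2)] admD(1-3)[OF a(3)] f liftsD[OF g] liftsD[OF g']
  obtain h where [simp]: "h \<in> Ar A" "src A h = src A p" "tgt A h = src A p'" and h: "p' \<cdot> h = f \<cdot> p" "i' \<cdot> g = h \<cdot> i"
    using g by (rule liftsE)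
  obtain h' where [simp]: "h' \<in> Ar A" "src A h' = src A p'" "tgt A h' = src A p''" and h': "p'' \<cdot> h' = f' \<cdot> p'" "i'' \<cdot> g' = h' \<cdot> i'"
    using g' by (rule liftsE)
  show ?thesis by (rule liftsI[of _ _ _ "h' \<cdot> h"]) (simp_all add: reassoc[OF h'(1)] reassoc[OF h'(2)] h)
qed

lemma lifts_ident:
  assumes a: "(i, p) \<in> adm A" shows "lifts i p i p (ident A (tgt A p)) (ident A (src A i))"
  by (rule liftsI[of _ _ _ "ident A (src A p)"]) (simp_all add: admD[OF a])

lemma lifts_add:
  assumes a: "(i, p) \<in> adm A" "(i', p') \<in> adm A"
    and f: "f \<in> Ar A" "src A f = tgt A p" "tgt A f = tgt A p'" "f' \<in> Ar A" "src A f' = tgt A p" "tgt A f' = tgt A p'"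
    and g: "lifts i p i' p' f g" and g': "lifts i p i' p' f' g'"
  shows "lifts i p i' p' (f \<oplus> f') (g \<oplus> g')"
proof -
  note [simp] = admD(1-3)[OF a(1)] admD(1-3)[OF a(2)] f liftsD[OF g] liftsD[OF g']
  obtain h where [simp]: "h \<in> Ar A" "src A h = src A p" "tgt A h = src A p'" and h: "p' \<cdot> h = f \<cdot> p" "i' \<cdot> g = h \<cdot> i"
    using g by (rule liftsE)
  obtain h' where [simp]: "h' \<in> Ar A" "src A h' = src A p" "tgt A h' = src A p'" and h': "p' \<cdot> h' = f' \<cdot> p" "i' \<cdot> g' = h' \<cdot> i"
    using g' by (rule liftsE)
  show ?thesis by (rule liftsI[of _ _ _ "h \<oplus> h'"]) (simp_all add: h h')
qed

lemma lifts_neg: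
  assumes a: "(i, p) \<in> adm A" "(i', p') \<in> adm A"
    and f: "f \<in> Ar A" "src A f = tgt A p" "tgt A f = tgt A p'"
    and g: "lifts i p i' p' f g"
  shows "lifts i p i' p' (neg A f) (neg A g)"
proof -
  note [simp] = admD(1-3)[OF a(1)] admD(1-3)[OF a(2)] f liftsD[OF g]
  obtain h where [simp]: "h \<in> Ar A" "src A h = src A p" "tgt A h = src A p'" and h: "p' \<cdot> h = f \<cdot> p" "i' \<cdot> g = h \<cdot> i"
    using g by (rule liftsE)
  show ?thesis by (rule liftsI[of _ _ _ "neg A h"]) (simp_all add: h)
qed

text \<open>A stable form of Schanuel's lemma: lifts of the identity in both directions compose to
  lifts of the identity, which are unique in the stable category.\<close>

lemma lifts_iso:
  assumes a: "(i, p) \<in> adm A" "(i', p') \<in> adm A" and p: "src A p \<in> \<P>" "src A p' \<in> \<P>" and z: "tgt A p' = tgt A p"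
    and c: "src A i \<in> \<C>" "src A i' \<in> \<C>" and g: "lifts i p i' p' (ident A (tgt A p)) g"
  shows "iso_arr SA (cls g)"
proof -
  note [simp] = admD(1-3)[OF a(1)] admD(1-3)[OF a(2)] z c liftsD[OF g]
  obtain g' where g': "lifts i' p' i p (ident A (tgt A p)) g'"
    using lifts_ex[OF a(2,1) p(2), of "ident A (tgt A p)"] by auto
  note [simp] = liftsD[OF g']
  show ?thesis
  proof (rule iso_cls[of g g'])
    have "lifts i p i p (ident A (tgt A p) \<cdot> ident A (tgt A p)) (g' \<cdot> g)"
      by (rule lifts_cmp[OF a(1) a(2) a(1) _ _ _ _ _ _ g g']) simp_all
    then show "g' \<cdot> g \<approx> ident A (src A g)"
      using lifts_unique[OF a(1) a(1) p(1) stable_refl _ _ _ lifts_ident[OF a(1)]] by simp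
    have "lifts i' p' i' p' (ident A (tgt A p) \<cdot> ident A (tgt A p)) (g \<cdot> g')"
      by (rule lifts_cmp[OF a(2) a(1) a(2) _ _ _ _ _ _ g' g]) simp_all
    then show "g \<cdot> g' \<approx> ident A (tgt A g)"
      using lifts_unique[OF a(2) a(2) p(2) stable_refl _ _ _ lifts_ident[OF a(2)]] by simp
  qed simp_all
qed

end

section \<open>The loop functor on the stable category\<close>

locale looped_model_structure = projective_model_structure A M
  for A :: "('o, 'm) exactcat" (structure) and M :: "'m model" +
  fixes \<iota> \<pi> :: "'o \<Rightarrow> 'm"
  assumes choice: "loop_choice A (cofibrant_objects A M) \<iota> \<pi>"
begin

abbreviation \<Omega> :: "('o, 'm set, 'o, 'm set) funct" where "\<Omega> \<equiv> loop_functor A \<iota> \<pi>"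

lemma loop_adm: "x \<in> \<C> \<Longrightarrow> (\<iota> x, \<pi> x) \<in> adm A"
  using choice unfolding loop_choice_def by auto

text \<open>\<open>syzygy_cofibrant\<close> enters here, to keep \<Omega> inside the cofibrant
  objects.\<close>

lemma loop_choice_simps [simp]:
  assumes x: "x \<in> \<C>"
  shows "\<iota> x \<in> Ar A" "\<pi> x \<in> Ar A" "tgt A (\<pi> x) = x" "tgt A (\<iota> x) = src A (\<pi> x)" "src A (\<pi> x) \<in> \<P>" "src A (\<iota> x) \<in> \<C>"
proof -
  show 1: "\<iota> x \<in> Ar A" "\<pi> x \<in> Ar A" "tgt A (\<pi> x) = x" "tgt A (\<iota> x) = src A (\<pi> x)" "src A (\<pi> x) \<in> \<P>"
    using x choice admD(1-3)[OF loop_adm[OF x]] unfolding loop_choice_def by auto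
  show "src A (\<iota> x) \<in> \<C>" by (rule syzygy_cofibrant[OF loop_adm[OF x]]) (simp_all add: 1 x)
qed

abbreviation llift :: "'m \<Rightarrow> 'm \<Rightarrow> bool" where
  "llift f g \<equiv> lifts (\<iota> (src A f)) (\<pi> (src A f)) (\<iota> (tgt A f)) (\<pi> (tgt A f)) f g"

lemma loop_lift_iff:
  "\<lbrakk>f \<in> Ar A; src A f \<in> \<C>; tgt A f \<in> \<C>\<rbrakk> \<Longrightarrow> loop_lift A \<iota> \<pi> f g \<longleftrightarrow> llift f g"
  unfolding loop_lift_def lifts_def Let_def by auto

lemma connecting_iff:
  "tgt A d \<in> \<C> \<Longrightarrow> connecting A \<iota> \<pi> i d k \<longleftrightarrow>
    lifts (\<iota> (tgt A d)) (\<pi> (tgt A d)) i d (ident A (tgt A d)) k"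
  unfolding connecting_def lifts_def Let_def by auto

lemma llift_ex:
  assumes "f \<in> Ar A" "src A f \<in> \<C>" "tgt A f \<in> \<C>" obtains g where "llift f g" "g \<in> Ar A" "src A g = src A (\<iota> (src A f))" "tgt A g = src A (\<iota> (tgt A f))"
  using lifts_ex[OF loop_adm loop_adm, of "src A f" "tgt A f" f] assms liftsD by auto

lemma llift_unique:
  assumes "f \<approx> f'" "src A f \<in> \<C>" "tgt A f \<in> \<C>" "llift f g" "llift f' g'" shows "g \<approx> g'"
proof -
  have [simp]: "src A f' = src A f" "tgt A f' = tgt A f" using assms(1) by (auto simp: stable_eq_def)
  show ?thesis
    by (rule lifts_unique[OF loop_adm loop_adm, of "src A f" "tgt A f" f f']) (use assms in simp_all)
qed

lemma fo_loop [simp]: "fo \<Omega> x = src A (\<iota> x)"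
  by (simp add: loop_functor_def)

lemma loop_cls:
  assumes f [simp]: "f \<in> Ar A" "src A f \<in> \<C>" "tgt A f \<in> \<C>" and g: "llift f g"
  shows "fm \<Omega> (cls f) = cls g"
proof -
  have "fm \<Omega> (cls f) = \<Union>{cls h | h. h \<in> {h. \<exists>f' \<in> cls f. loop_lift A \<iota> \<pi> f' h}}"
    unfolding loop_functor_def cls_def by (simp, rule arg_cong[of _ _ Union]) blast
  also have "\<dots> = cls g"
  proof (rule Union_cls)
    show "{h. \<exists>f' \<in> cls f. loop_lift A \<iota> \<pi> f' h} \<noteq> {}"
      using g mem_cls[of f f] loop_lift_iff[of f g] by auto
    fix h assume "h \<in> {h. \<exists>f' \<in> cls f. loop_lift A \<iota> \<pi> f' h}"
    then obtain f' where ff: "f \<approx> f'" and h: "loop_lift A \<iota> \<pi> f' h" using mem_cls[of f] by auto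
    then have f' [simp]: "f' \<in> Ar A" "src A f' = src A f" "tgt A f' = tgt A f" by (auto simp: stable_eq_def)
    have "llift f' h" using h loop_lift_iff[of f' h] by simp
    then show "h \<approx> g" using llift_unique[OF stable_sym[OF ff]] g by simp
  qed
  finally show ?thesis .
qed

lemma loop_functor: "is_functor SA SA \<Omega>"
  unfolding is_functor_def
proof (intro conjI ballI impI)
  show "category SA" "category SA" by (rule SA.category_axioms)+
next
  fix x assume "x \<in> Ob SA" then show "fo \<Omega> x \<in> Ob SA" by simp
next
  fix f assume "f \<in> Ar SA"
  then obtain f0 where f0 [simp]: "f0 \<in> Ar A" "src A f0 \<in> \<C>" "tgt A f0 \<in> \<C>" and f: "f = cls f0" by (rule SA_ArE)
  obtain g where g: "llift f0 g" and [simp]: "g \<in> Ar A" "src A g = src A (\<iota> (src A f0))" "tgt A g = src A (\<iota> (tgt A f0))"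
    by (rule llift_ex[OF f0])
  show "fm \<Omega> f \<in> hom SA (fo \<Omega> (src SA f)) (fo \<Omega> (tgt SA f))" unfolding f by (simp add: loop_cls[OF f0 g])
next
  fix x assume "x \<in> Ob SA"
  then have [simp]: "x \<in> \<C>" by simp
  have "llift (ident A x) (ident A (src A (\<iota> x)))" using lifts_ident[OF loop_adm, of x] by simp
  then show "fm \<Omega> (ident SA x) = ident SA (fo \<Omega> x)" by (simp add: loop_cls)
next
  fix f g assume "f \<in> Ar SA" "g \<in> Ar SA" and fg: "tgt SA f = src SA g"
  then obtain f0 g0 where f0 [simp]: "f0 \<in> Ar A" "src A f0 \<in> \<C>" "tgt A f0 \<in> \<C>" and f: "f = cls f0"
    and g0: "g0 \<in> Ar A" "src A g0 \<in> \<C>" "tgt A g0 \<in> \<C>" and g: "g = cls g0" by (elim SA_ArE)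
  note [simp] = g0(1,3)
  have [simp]: "src A g0 = tgt A f0" using fg f g by simp
  obtain f1 where f1: "llift f0 f1" and [simp]: "f1 \<in> Ar A" "src A f1 = src A (\<iota> (src A f0))" "tgt A f1 = src A (\<iota> (tgt A f0))"
    by (rule llift_ex[OF f0])
  obtain g1 where g1: "llift g0 g1" and [simp]: "g1 \<in> Ar A" "src A g1 = src A (\<iota> (tgt A f0))" "tgt A g1 = src A (\<iota> (tgt A g0))"
    by (rule llift_ex[OF g0]) simp
  have "llift (g0 \<cdot> f0) (g1 \<cdot> f1)"
    using lifts_cmp[OF loop_adm loop_adm loop_adm, of "src A f0" "tgt A f0" "tgt A g0" f0 g0 f1 g1] f1 g1 by simp
  then have "fm \<Omega> (cls (g0 \<cdot> f0)) = cls (g1 \<cdot> f1)" by (intro loop_cls) simp_all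
  moreover have "fm \<Omega> f = cls f1" unfolding f by (rule loop_cls[OF f0 f1])
  moreover have "fm \<Omega> g = cls g1" unfolding g by (rule loop_cls[OF g0 g1])
  ultimately show "fm \<Omega> (g \<cdot>\<^bsub>SA\<^esub> f) = fm \<Omega> g \<cdot>\<^bsub>SA\<^esub> fm \<Omega> f" unfolding f g by simp
qed

lemma loop_add:
  assumes "f \<in> hom SA x y" "g \<in> hom SA x y"
  shows "fm \<Omega> (f \<oplus>\<^bsub>SA\<^esub> g) = fm \<Omega> f \<oplus>\<^bsub>SA\<^esub> fm \<Omega> g"
proof -
  obtain f0 where f0 [simp]: "f0 \<in> Ar A" "src A f0 = x" "tgt A f0 = y" and xy [simp]: "x \<in> \<C>" "y \<in> \<C>" and f: "f = cls f0"
    using assms(1) by (rule SA_homE)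
  obtain g0 where g0 [simp]: "g0 \<in> Ar A" "src A g0 = x" "tgt A g0 = y" and g: "g = cls g0"
    using assms(2) by (rule SA_homE)
  obtain f1 where f1: "llift f0 f1" and [simp]: "f1 \<in> Ar A" "src A f1 = src A (\<iota> x)" "tgt A f1 = src A (\<iota> y)"
    by (rule llift_ex[of f0]) simp_all
  obtain g1 where g1: "llift g0 g1" and [simp]: "g1 \<in> Ar A" "src A g1 = src A (\<iota> x)" "tgt A g1 = src A (\<iota> y)"
    by (rule llift_ex[of g0]) simp_all
  have "llift (f0 \<oplus> g0) (f1 \<oplus> g1)"
    using lifts_add[OF loop_adm loop_adm, of x y f0 g0 f1 g1] f1 g1 by simp
  then have "fm \<Omega> (cls (f0 \<oplus> g0)) = cls (f1 \<oplus> g1)" by (intro loop_cls) simp_all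
  moreover have "fm \<Omega> f = cls f1" unfolding f by (rule loop_cls[OF _ _ _ f1]) simp_all
  moreover have "fm \<Omega> g = cls g1" unfolding g by (rule loop_cls[OF _ _ _ g1]) simp_all
  ultimately show ?thesis unfolding f g by simp
qed

text \<open>Projectives act as relative injectives: the cokernel of \<open>\<iota> x\<close> is the
  cofibrant \<open>x\<close>, so an arrow between syzygies extends to the projective covers and then
  induces an arrow on cokernels.\<close>

lemma loop_full:
  assumes "x \<in> Ob SA" "y \<in> Ob SA" "g \<in> hom SA (fo \<Omega> x) (fo \<Omega> y)"
  shows "\<exists>f \<in> hom SA x y. fm \<Omega> f = g"
proof -
  have [simp]: "x \<in> \<C>" "y \<in> \<C>" using assms by simp_all
  obtain g0 where g0 [simp]: "g0 \<in> Ar A" "src A g0 = src A (\<iota> x)" "tgt A g0 = src A (\<iota> y)" and g: "g = cls g0"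
    using SA_homE[OF assms(3)] by auto
  obtain h where [simp]: "h \<in> Ar A" "src A h = src A (\<pi> x)" "tgt A h = src A (\<pi> y)" and h: "h \<cdot> \<iota> x = \<iota> y \<cdot> g0"
    by (rule injective_extend[OF _ loop_adm[of x], of "src A (\<pi> y)" "\<iota> y \<cdot> g0"]) simp_all
  obtain f where f [simp]: "f \<in> Ar A" "src A f = x" "tgt A f = y" and fe: "f \<cdot> \<pi> x = \<pi> y \<cdot> h"
    by (rule cokernel_factor[OF loop_adm[of x], of "\<pi> y \<cdot> h"])
      (simp_all add: h reassoc[OF admD(4)[OF loop_adm[of y]]])
  have "llift f g0" by (rule liftsI[of _ _ _ h]) (simp_all add: fe h)
  then show ?thesis unfolding g by (intro bexI[of _ "cls f"] loop_cls) simp_all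
qed

text \<open>The first half \<open>u\<close> of a factorization of \<open>g\<close> extends along
  \<open>\<iota> x\<close>. Subtracting the resulting arrow from the lift \<open>h\<close> leaves
  one that kills \<open>\<iota> x\<close>, hence \<open>r \<cdot> \<pi> x\<close>, and then
  \<open>f\<close> equals \<open>\<pi> y \<cdot> r\<close>.\<close>

lemma loop_reflects_null:
  assumes f: "f \<in> Ar A" "src A f = x" "tgt A f = y" "x \<in> \<C>" "y \<in> \<C>" and g: "llift f g" "null g" shows "null f"
proof -
  note [simp] = f
  obtain u v where [simp]: "u \<in> Ar A" "v \<in> Ar A" "tgt A u = src A v" "src A v \<in> \<P>" and e: "g = v \<cdot> u" and uv: "src A u = src A g" "tgt A v = tgt A g"
    using g(2) by (rule nullE)
  have [simp]: "src A u = src A (\<iota> x)" "tgt A v = src A (\<iota> y)" using uv liftsD[OF g(1)] by simp_all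
  obtain u' where [simp]: "u' \<in> Ar A" "src A u' = src A (\<pi> x)" "tgt A u' = src A v" and u': "u' \<cdot> \<iota> x = u"
    by (rule injective_extend[OF _ loop_adm[of x], of "src A v" u]) simp_all
  obtain h where [simp]: "h \<in> Ar A" "src A h = src A (\<pi> x)" "tgt A h = src A (\<pi> y)" and h: "\<pi> y \<cdot> h = f \<cdot> \<pi> x" "\<iota> y \<cdot> g = h \<cdot> \<iota> x"
    using liftsE[OF g(1)] by auto
  have "\<exists>r. r \<in> Ar A \<and> src A r = tgt A (\<pi> x) \<and> tgt A r = src A (\<pi> y) \<and> h = \<iota> y \<cdot> (v \<cdot> u') \<oplus> r \<cdot> \<pi> x"
    by (rule cokernel_difference[OF loop_adm[of x]]) (simp_all add: u' h(2)[symmetric] e)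
  then obtain r where [simp]: "r \<in> Ar A" "src A r = x" "tgt A r = src A (\<pi> y)" and r: "h = \<iota> y \<cdot> (v \<cdot> u') \<oplus> r \<cdot> \<pi> x" by auto
  have "f \<cdot> \<pi> x = (\<pi> y \<cdot> r) \<cdot> \<pi> x"
    unfolding h(1)[symmetric] r by (simp add: reassoc[OF admD(4)[OF loop_adm[of y]]])
  then have "f = \<pi> y \<cdot> r" by (rule adm_epi[OF loop_adm[OF f(4)]]) simp_all
  then show ?thesis using nullI[of r "\<pi> y"] by simp
qed

lemma loop_faithful:
  assumes "f \<in> hom SA x y" "g \<in> hom SA x y" "fm \<Omega> f = fm \<Omega> g"
  shows "f = g"
proof -
  obtain f0 where f0 [simp]: "f0 \<in> Ar A" "src A f0 = x" "tgt A f0 = y" and xy [simp]: "x \<in> \<C>" "y \<in> \<C>" and f: "f = cls f0"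
    using assms(1) by (rule SA_homE)
  obtain g0 where g0 [simp]: "g0 \<in> Ar A" "src A g0 = x" "tgt A g0 = y" and g: "g = cls g0"
    using assms(2) by (rule SA_homE)
  obtain f1 where f1: "llift f0 f1" and [simp]: "f1 \<in> Ar A" "src A f1 = src A (\<iota> x)" "tgt A f1 = src A (\<iota> y)"
    by (rule llift_ex[of f0]) simp_all
  obtain g1 where g1: "llift g0 g1" and [simp]: "g1 \<in> Ar A" "src A g1 = src A (\<iota> x)" "tgt A g1 = src A (\<iota> y)"
    by (rule llift_ex[of g0]) simp_all
  have "fm \<Omega> f = cls f1" unfolding f by (rule loop_cls[OF _ _ _ f1]) simp_all
  moreover have "fm \<Omega> g = cls g1" unfolding g by (rule loop_cls[OF _ _ _ g1]) simp_all
  ultimately have "cls f1 = cls g1" using assms(3) by metis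
  then have "f1 \<approx> g1" using cls_eq_iff[of f1 g1] by simp
  then have n: "null (f1 \<oplus> neg A g1)" unfolding stable_eq_def by simp
  have f1': "lifts (\<iota> x) (\<pi> x) (\<iota> y) (\<pi> y) f0 f1" and g1': "lifts (\<iota> x) (\<pi> x) (\<iota> y) (\<pi> y) g0 g1"
    using f1 g1 by simp_all
  have "lifts (\<iota> x) (\<pi> x) (\<iota> y) (\<pi> y) (neg A g0) (neg A g1)"
    by (rule lifts_neg[OF loop_adm loop_adm _ _ _ g1']) simp_all
  from lifts_add[OF loop_adm loop_adm _ _ _ _ _ _ f1' this]
  have l: "llift (f0 \<oplus> neg A g0) (f1 \<oplus> neg A g1)" by simp
  have "null (f0 \<oplus> neg A g0)" by (rule loop_reflects_null[OF _ _ _ xy l n]) simp_all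
  then show ?thesis unfolding f g by (intro clsI) (simp add: stable_eq_def)
qed

text \<open>The preimage is a cosyzygy: \<open>z\<close> embeds into a projective with cofibrant
  cokernel, and \<open>lifts_iso\<close> compares \<open>z\<close> with the chosen syzygy of that
  cokernel.\<close>

lemma loop_surj:
  assumes "z \<in> Ob SA" shows "\<exists>s \<in> Ob SA. \<exists>e \<in> hom SA (fo \<Omega> s) z. iso_arr SA e"
proof -
  obtain j s where j: "j \<in> CoFib M" "(j, s) \<in> adm A" "src A j = z" "src A s \<in> \<P>" "tgt A s \<in> \<C>"
    using enough_injectives[of z] assms by auto
  note [simp] = admD(1-3)[OF j(2)] j(3-5) loop_choice_simps[OF j(5)]
  obtain g where g: "lifts (\<iota> (tgt A s)) (\<pi> (tgt A s)) j s (ident A (tgt A s)) g"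
    using lifts_ex[OF loop_adm[OF j(5)] j(2), of "ident A (tgt A s)"] by auto
  have "iso_arr SA (cls g)"
    by (rule lifts_iso[OF loop_adm[OF j(5)] j(2)]) (use g assms in simp_all)
  moreover have "cls g \<in> hom SA (fo \<Omega> (tgt A s)) z" using liftsD[OF g] assms by simp
  ultimately show ?thesis using j(5) by auto
qed

end

section \<open>Standard left triangles and their axioms\<close>

context looped_model_structure
begin

definition standard :: "('m set \<times> 'm set \<times> 'm set) set" where
  "standard = {(cls k, cls i, cls d) | k i d. (i, d) \<in> adm A \<and> src A i \<in> \<C> \<and> src A d \<in> \<C> \<and> tgt A d \<in> \<C> \<and>
     lifts (\<iota> (tgt A d)) (\<pi> (tgt A d)) i d (ident A (tgt A d)) k}"

abbreviation conn :: "'m \<Rightarrow> 'm \<Rightarrow> 'm \<Rightarrow> bool" where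
  "conn i d k \<equiv> lifts (\<iota> (tgt A d)) (\<pi> (tgt A d)) i d (ident A (tgt A d)) k"

lemma standardE:
  assumes "(K, I, D) \<in> standard"
  obtains k i d where "K = cls k" "I = cls i" "D = cls d" "(i, d) \<in> adm A" "src A i \<in> \<C>" "src A d \<in> \<C>" "tgt A d \<in> \<C>" "conn i d k"
    "i \<in> Ar A" "d \<in> Ar A" "tgt A i = src A d" "k \<in> Ar A" "src A k = src A (\<iota> (tgt A d))" "tgt A k = src A i"
  using assms unfolding standard_def by (auto dest: liftsD admD)

lemma standardI:
  "\<lbrakk>(i, d) \<in> adm A; src A i \<in> \<C>; src A d \<in> \<C>; tgt A d \<in> \<C>; conn i d k\<rbrakk> \<Longrightarrow> (cls k, cls i, cls d) \<in> standard"
  unfolding standard_def by blast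

lemma conn_ex:
  assumes "(i, d) \<in> adm A" "tgt A d \<in> \<C>"
  obtains k where "conn i d k" "k \<in> Ar A" "src A k = src A (\<iota> (tgt A d))" "tgt A k = src A i"
proof -
  have "\<exists>k. conn i d k"
    by (rule lifts_ex[OF loop_adm assms(1)]) (use assms in simp_all)
  then show ?thesis using that liftsD by blast
qed

lemma conn_unique:
  assumes a: "(i, d) \<in> adm A" and c: "src A c = x" "tgt A c = tgt A d" "c \<in> Ar A" "x \<in> \<C>"
    and k: "lifts (\<iota> x) (\<pi> x) i d c k" "lifts (\<iota> x) (\<pi> x) i d c k'"
  shows "cls k = cls k'"
  by (rule clsI, rule lifts_unique[OF loop_adm[OF c(4)] a _ stable_refl _ _ k]) (use c in simp_all)

text \<open>A connecting arrow followed by a morphism of sequences over \<open>c\<close> is a lift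
  of \<open>c\<close>; by \<open>loop_conn\<close> so is the loop of \<open>c\<close> followed by
  the other connecting arrow. \<open>conn_unique\<close> equates the two, which is the naturality of
  connecting arrows.\<close>

lemma conn_cmp:
  assumes a: "(i, d) \<in> adm A" "(i', d') \<in> adm A" and c: "c \<in> Ar A" "src A c = tgt A d" "tgt A c = tgt A d'" "tgt A d \<in> \<C>"
    and k: "conn i d k" and g: "lifts i d i' d' c g"
  shows "lifts (\<iota> (tgt A d)) (\<pi> (tgt A d)) i' d' c (g \<cdot> k)"
  using lifts_cmp[OF loop_adm[OF c(4)] a(1) a(2) _ _ _ _ _ _ k g] c admD(2)[OF a(1)] by simp

lemma loop_conn:
  assumes a: "(i', d') \<in> adm A" and c: "c \<in> Ar A" "src A c = x" "tgt A c = tgt A d'" "x \<in> \<C>" "tgt A d' \<in> \<C>"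
    and k': "conn i' d' k'" and g: "llift c g"
  shows "lifts (\<iota> x) (\<pi> x) i' d' c (k' \<cdot> g)"
proof -
  have g': "lifts (\<iota> x) (\<pi> x) (\<iota> (tgt A d')) (\<pi> (tgt A d')) c g" using g c by simp
  show ?thesis
    using lifts_cmp[OF loop_adm[OF c(4)] loop_adm[OF c(5)] a _ _ _ _ _ _ g' k'] c admD(2)[OF a] by simp
qed

lemma standard_sequence: assumes "(K, I, D) \<in> standard" shows "left_sequence SA \<Omega> K I D"
proof -
  obtain k i d where e: "K = cls k" "I = cls i" "D = cls d" and [simp]: "src A i \<in> \<C>" "src A d \<in> \<C>" "tgt A d \<in> \<C>"
    "i \<in> Ar A" "d \<in> Ar A" "tgt A i = src A d" "k \<in> Ar A" "src A k = src A (\<iota> (tgt A d))" "tgt A k = src A i"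
    using assms by (rule standardE)
  show ?thesis unfolding left_sequence_def e by simp
qed

lemma standard_trivial:
  assumes "x \<in> Ob SA" shows "\<exists>k d. (k, ident SA x, d) \<in> standard \<and> zero_object SA (tgt SA d)"
proof -
  have x [simp]: "x \<in> \<C>" using assms by simp
  obtain d where a: "(ident A x, d) \<in> adm A" and z: "zero_object A (tgt A d)" by (rule identity_sequence[of x]) simp_all
  note [simp] = admD(2)[OF a]
  have [simp]: "src A d = x" using admD(3)[OF a] by simp
  have iz: "ident A (tgt A d) = zer A (tgt A d) (tgt A d)" using z by (simp add: zero_object_iff)
  \<comment> \<open>The zero object that ends the sequence need not be \<open>zero\<close>, but it
    is a retract of it.\<close>
  have [simp]: "tgt A d \<in> \<C>"
    by (rule cofibrant_retract[OF zero_cofibrant, of "zer A (tgt A d) zero" "zer A zero (tgt A d)"]) (simp_all add: iz)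
  obtain k where k: "conn (ident A x) d k" by (rule conn_ex[OF a]) simp_all
  have "(cls k, cls (ident A x), cls d) \<in> standard" by (rule standardI[OF a]) (simp_all add: k)
  moreover have "zero_object SA (tgt SA (cls d))" by (simp add: SA.zero_object_iff iz)
  ultimately show ?thesis unfolding ident_SA by blast
qed

text \<open>If \<open>f \<cdot> i\<close> factors through a projective as
  \<open>v \<cdot> u\<close>, then \<open>u\<close> extends along \<open>i\<close> to some
  \<open>u'\<close>, and \<open>f\<close> minus \<open>v \<cdot> u'\<close> kills \<open>i\<close>
  on the nose, so it factors through \<open>d\<close>.\<close>

lemma standard_weak_cokernel:
  assumes s: "(K, I, D) \<in> standard" and t: "T \<in> Ar SA" "src SA T = tgt SA I" "T \<cdot>\<^bsub>SA\<^esub> I = zer SA (src SA I) (tgt SA T)"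
  shows "\<exists>S \<in> hom SA (tgt SA D) (tgt SA T). T = S \<cdot>\<^bsub>SA\<^esub> D"
proof -
  obtain k i d where e: "K = cls k" "I = cls i" "D = cls d" and a: "(i, d) \<in> adm A" and [simp]: "src A i \<in> \<C>" "src A d \<in> \<C>" "tgt A d \<in> \<C>"
    "i \<in> Ar A" "d \<in> Ar A" "tgt A i = src A d"
    using s by (rule standardE)
  obtain f where f [simp]: "f \<in> Ar A" "src A f \<in> \<C>" "tgt A f \<in> \<C>" and fe: "T = cls f" using t(1) by (rule SA_ArE)
  have [simp]: "src A f = src A d" using t(2) by (simp add: e fe)
  have "f \<cdot> i \<approx> zer A (src A i) (tgt A f)" using t(3) by (simp add: e fe cls_eq_iff)
  then have "null (f \<cdot> i)" by (simp add: stable_zer_iff)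
  then obtain u v where [simp]: "u \<in> Ar A" "v \<in> Ar A" "tgt A u = src A v" "src A v \<in> \<P>" and uv: "f \<cdot> i = v \<cdot> u" "src A u = src A (f \<cdot> i)" "tgt A v = tgt A (f \<cdot> i)"
    by (rule nullE)
  have [simp]: "src A u = src A i" "tgt A v = tgt A f" using uv(2,3) by simp_all
  obtain u' where [simp]: "u' \<in> Ar A" "src A u' = src A d" "tgt A u' = src A v" and u': "u' \<cdot> i = u"
    by (rule injective_extend[OF _ a, of "src A v" u]) simp_all
  have "\<exists>r. r \<in> Ar A \<and> src A r = tgt A d \<and> tgt A r = tgt A f \<and> f = v \<cdot> u' \<oplus> r \<cdot> d"
    by (rule cokernel_difference[OF a]) (simp_all add: u' uv(1))
  then obtain r where [simp]: "r \<in> Ar A" "src A r = tgt A d" "tgt A r = tgt A f" and r: "f = v \<cdot> u' \<oplus> r \<cdot> d" by auto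
  have r': "f = r \<cdot> d \<oplus> v \<cdot> u'" by (subst r, rule add_commute) simp_all
  have "f \<approx> r \<cdot> d" by (rule stable_eqI[OF r']) (simp_all add: nullI)
  then have "T = cls r \<cdot>\<^bsub>SA\<^esub> D" unfolding fe e by (simp add: cls_eq_iff)
  then show ?thesis by (rule bexI) (simp add: e fe)
qed

text \<open>The pullback \<open>w\<close> of \<open>d\<close> along \<open>P \<rightarrow> z\<close> is an extension of \<open>y\<close> by \<open>\<Omega>z\<close>, and \<open>w\<close> is \<open>x \<oplus> P\<close>, so it is
  stably isomorphic to \<open>x\<close>.\<close>

lemma standard_rotate:
  assumes s: "(K, I, D) \<in> standard"
  shows "\<exists>k' i' d' a b. (k', i', d') \<in> standard \<and> tgt SA d' = tgt SA I \<and> iso_arr SA a \<and> iso_arr SA b \<and>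
        a \<in> hom SA (src SA K) (src SA i') \<and> b \<in> hom SA (tgt SA K) (tgt SA i') \<and>
        a \<cdot>\<^bsub>SA\<^esub> neg SA (fm \<Omega> D) = k' \<and> b \<cdot>\<^bsub>SA\<^esub> K = i' \<cdot>\<^bsub>SA\<^esub> a \<and> I = d' \<cdot>\<^bsub>SA\<^esub> b"
proof -
  obtain k i d where e: "K = cls k" "I = cls i" "D = cls d" and a: "(i, d) \<in> adm A" and [simp]: "src A i \<in> \<C>" "src A d \<in> \<C>" "tgt A d \<in> \<C>"
    and k: "conn i d k" and [simp]: "i \<in> Ar A" "d \<in> Ar A" "tgt A i = src A d" "k \<in> Ar A" "src A k = src A (\<iota> (tgt A d))" "tgt A k = src A i"
    using s by (rule standardE)
  obtain l where [simp]: "l \<in> Ar A" "src A l = src A (\<pi> (tgt A d))" "tgt A l = src A d" and l: "d \<cdot> l = \<pi> (tgt A d)" "i \<cdot> k = l \<cdot> \<iota> (tgt A d)"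
    using liftsE[OF k] by auto
  obtain w f' d' i' where [simp]: "w \<in> Ob A" "f' \<in> Ar A" "src A f' = w" "tgt A f' = src A (\<pi> (tgt A d))"
    "d' \<in> Ar A" "src A d' = w" "tgt A d' = src A d" and sq: "\<pi> (tgt A d) \<cdot> f' = d \<cdot> d'"
    and a': "(i', d') \<in> adm A" and [simp]: "i' \<in> Ar A" "src A i' = src A (\<iota> (tgt A d))" "tgt A i' = w"
    and i': "f' \<cdot> i' = \<iota> (tgt A d)" "d' \<cdot> i' = zer A (src A (\<iota> (tgt A d))) (src A d)"
    and ex: "\<And>s t. \<lbrakk>s \<in> Ar A; t \<in> Ar A; tgt A s = src A (\<pi> (tgt A d)); tgt A t = src A d; src A s = src A t; \<pi> (tgt A d) \<cdot> s = d \<cdot> t\<rbrakk>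
      \<Longrightarrow> \<exists>r. r \<in> Ar A \<and> src A r = src A s \<and> tgt A r = w \<and> f' \<cdot> r = s \<and> d' \<cdot> r = t"
    and mono: "\<And>r r'. \<lbrakk>r \<in> Ar A; r' \<in> Ar A; tgt A r = w; tgt A r' = w; src A r = src A r'; f' \<cdot> r = f' \<cdot> r'; d' \<cdot> r = d' \<cdot> r'\<rbrakk> \<Longrightarrow> r = r'"
    by (rule pullbackE[OF loop_adm[of "tgt A d"], of d]) simp_all
  \<comment> \<open>The decomposition of \<open>w\<close>: \<open>b\<close> is the inclusion of the
    first vertex, with components zero and \<open>i\<close>; \<tau> is the section of
    \<open>f'\<close> given by the lift \<open>l\<close>.\<close>
  obtain b where [simp]: "b \<in> Ar A" "src A b = src A i" "tgt A b = w" and b: "f' \<cdot> b = zer A (src A i) (src A (\<pi> (tgt A d)))" "d' \<cdot> b = i"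
    using ex[of "zer A (src A i) (src A (\<pi> (tgt A d)))" i] admD(4)[OF a] by auto
  obtain \<tau> where [simp]: "\<tau> \<in> Ar A" "src A \<tau> = src A (\<pi> (tgt A d))" "tgt A \<tau> = w" and \<tau>: "f' \<cdot> \<tau> = ident A (src A (\<pi> (tgt A d)))" "d' \<cdot> \<tau> = l"
    using ex[of "ident A (src A (\<pi> (tgt A d)))" l] l(1) by auto
  \<comment> \<open>\<open>d'\<close> and \<open>l \<cdot> f'\<close> agree after \<open>d\<close>;
    their difference \<open>r\<close> is the projection of \<open>w\<close> onto the first
    vertex.\<close>
  have "\<exists>r. r \<in> Ar A \<and> src A r = w \<and> tgt A r = src A i \<and> d' = l \<cdot> f' \<oplus> i \<cdot> r"
    by (rule kernel_difference[OF a]) (simp_all add: reassoc[OF l(1)] sq)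
  then obtain r where [simp]: "r \<in> Ar A" "src A r = w" "tgt A r = src A i" and r: "d' = l \<cdot> f' \<oplus> i \<cdot> r" by auto
  have br: "b \<cdot> r \<oplus> \<tau> \<cdot> f' = ident A w"
  proof (rule mono)
    show "f' \<cdot> (b \<cdot> r \<oplus> \<tau> \<cdot> f') = f' \<cdot> ident A w" by (simp add: reassoc[OF b(1)] reassoc[OF \<tau>(1)])
    have "d' \<cdot> (b \<cdot> r \<oplus> \<tau> \<cdot> f') = i \<cdot> r \<oplus> l \<cdot> f'" by (simp add: reassoc[OF b(2)] reassoc[OF \<tau>(2)])
    also have "\<dots> = l \<cdot> f' \<oplus> i \<cdot> r" by (rule add_commute) simp_all
    finally show "d' \<cdot> (b \<cdot> r \<oplus> \<tau> \<cdot> f') = d' \<cdot> ident A w" using r[symmetric] by simp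
  qed simp_all
  have rb: "r \<cdot> b = ident A (src A i)"
  proof (rule adm_mono[OF a])
    have "(l \<cdot> f' \<oplus> i \<cdot> r) \<cdot> b = i" unfolding r[symmetric] by (rule b(2))
    then show "i \<cdot> (r \<cdot> b) = i \<cdot> ident A (src A i)" by (simp add: b(1))
  qed simp_all
  have wC [simp]: "w \<in> \<C>"
    by (rule cofibrant_biproduct[of "src A i" "src A (\<pi> (tgt A d))" b w \<tau> r f']) (simp_all add: br)
  have iso_b: "iso_arr SA (cls b)"
  proof (rule iso_cls[of b r])
    have "ident A w \<approx> b \<cdot> r" by (rule stable_eqI[OF br[symmetric]]) (simp_all add: nullI)
    then show "b \<cdot> r \<approx> ident A (tgt A b)" by (simp add: stable_sym)
  qed (simp_all add: rb)
  obtain k'' where k'': "conn i' d' k''" and [simp]: "k'' \<in> Ar A" "src A k'' = src A (\<iota> (src A d))" "tgt A k'' = src A (\<iota> (tgt A d))"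
    by (rule conn_ex[OF a']) simp_all
  \<comment> \<open>\<open>f'\<close> is a morphism from the pullback sequence to the chosen
    resolution that is the identity on kernels, so the connecting arrow of the pullback sequence
    represents the loop of \<open>d\<close>.\<close>
  have l1: "lifts i' d' (\<iota> (tgt A d)) (\<pi> (tgt A d)) d (ident A (src A (\<iota> (tgt A d))))"
    by (rule liftsI[of _ _ _ f']) (simp_all add: sq i')
  have "llift d (ident A (src A (\<iota> (tgt A d))) \<cdot> k'')"
    using conn_cmp[OF a' loop_adm _ _ _ _ k'' l1] by simp
  then have \<Omega>d: "fm \<Omega> (cls d) = cls k''" by (intro loop_cls) simp_all
  \<comment> \<open>The sign of the rotation: \<open>b \<cdot> k\<close> and \<open>i'\<close> have
    opposite classes, since their sum passes through the projective by \<tau>. Minus the identity as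
    first component absorbs this sign together with that of
    \<open>neg SA (fm \<Omega> D)\<close>.\<close>
  have bk: "b \<cdot> k = neg A i' \<oplus> \<tau> \<cdot> \<iota> (tgt A d)"
  proof (rule mono)
    show "f' \<cdot> (b \<cdot> k) = f' \<cdot> (neg A i' \<oplus> \<tau> \<cdot> \<iota> (tgt A d))" by (simp add: reassoc[OF b(1)] reassoc[OF \<tau>(1)] i')
    show "d' \<cdot> (b \<cdot> k) = d' \<cdot> (neg A i' \<oplus> \<tau> \<cdot> \<iota> (tgt A d))" by (simp add: reassoc[OF b(2)] reassoc[OF \<tau>(2)] i' l(2))
  qed simp_all
  have bk': "cls (b \<cdot> k) = cls (neg A i')" by (rule clsI, rule stable_eqI[OF bk]) (simp_all add: nullI)
  have iso_a: "iso_arr SA (cls (neg A (ident A (src A i'))))"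
    using SA.iso_neg[OF SA.iso_ident[of "src A i'"]] by simp
  have std: "(cls k'', cls i', cls d') \<in> standard" by (rule standardI[OF a']) (use k'' in simp_all)
  show ?thesis
  proof (rule exI[of _ "cls k''"], rule exI[of _ "cls i'"], rule exI[of _ "cls d'"], rule exI[of _ "cls (neg A (ident A (src A i')))"], rule exI[of _ "cls b"], intro conjI)
    show "cls (neg A (ident A (src A i'))) \<cdot>\<^bsub>SA\<^esub> neg SA (fm \<Omega> D) = cls k''"
      unfolding e \<Omega>d by simp
    show "cls b \<cdot>\<^bsub>SA\<^esub> K = cls i' \<cdot>\<^bsub>SA\<^esub> cls (neg A (ident A (src A i')))" unfolding e by (simp add: bk')
    show "I = cls d' \<cdot>\<^bsub>SA\<^esub> cls b" unfolding e by (simp add: b)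
  qed (use std iso_a iso_b in \<open>simp_all add: e\<close>)
qed

text \<open>Dually, the pushout \<open>v\<close> of \<open>x \<rightarrow> I\<close> along \<open>x \<rightarrow> y\<close> is an extension of the cosyzygy by \<open>y\<close>, and is
  stably isomorphic to \<open>z\<close>.\<close>

lemma standard_unrotate:
  assumes s: "(K, I, D) \<in> standard"
  shows "\<exists>\<kappa> c k' d' e. (k', d', c) \<in> standard \<and> src SA d' = tgt SA I \<and>
        \<kappa> \<in> hom SA (fo \<Omega> (tgt SA c)) (src SA I) \<and> iso_arr SA \<kappa> \<and> e \<in> hom SA (tgt SA D) (tgt SA d') \<and> iso_arr SA e \<and>
        \<kappa> \<cdot>\<^bsub>SA\<^esub> fm \<Omega> (c \<cdot>\<^bsub>SA\<^esub> e) = K \<and> neg SA (I \<cdot>\<^bsub>SA\<^esub> \<kappa>) = k' \<and> e \<cdot>\<^bsub>SA\<^esub> D = d'"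
proof -
  obtain k i d where e: "K = cls k" "I = cls i" "D = cls d" and a: "(i, d) \<in> adm A" and [simp]: "src A i \<in> \<C>" "src A d \<in> \<C>" "tgt A d \<in> \<C>"
    and k: "conn i d k" and [simp]: "i \<in> Ar A" "d \<in> Ar A" "tgt A i = src A d" "k \<in> Ar A" "src A k = src A (\<iota> (tgt A d))" "tgt A k = src A i"
    using s by (rule standardE)
  obtain j s where j: "j \<in> CoFib M" and js: "(j, s) \<in> adm A" and [simp]: "src A j = src A i" "src A s \<in> \<P>" "tgt A s \<in> \<C>"
    by (rule enough_injectives[of "src A i"]) simp_all
  note [simp] = admD(1-3)[OF js]
  obtain v f' m c0 where [simp]: "v \<in> Ob A" "f' \<in> Ar A" "src A f' = src A s" "tgt A f' = v"
    "m \<in> Ar A" "src A m = src A d" "tgt A m = v" and sq: "f' \<cdot> j = m \<cdot> i"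
    and am: "(m, c0) \<in> adm A" and [simp]: "c0 \<in> Ar A" "src A c0 = v" "tgt A c0 = tgt A s" and c0: "c0 \<cdot> f' = s" "c0 \<cdot> m = zer A (src A d) (tgt A s)"
    and ex: "\<And>s' t. \<lbrakk>s' \<in> Ar A; t \<in> Ar A; src A s' = src A s; src A t = src A d; tgt A s' = tgt A t; s' \<cdot> j = t \<cdot> i\<rbrakk>
      \<Longrightarrow> \<exists>r. r \<in> Ar A \<and> src A r = v \<and> tgt A r = tgt A s' \<and> r \<cdot> f' = s' \<and> r \<cdot> m = t"
    and epi: "\<And>r r'. \<lbrakk>r \<in> Ar A; r' \<in> Ar A; src A r = v; src A r' = v; tgt A r = tgt A r'; r \<cdot> f' = r' \<cdot> f'; r \<cdot> m = r' \<cdot> m\<rbrakk> \<Longrightarrow> r = r'"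
    by (rule pushoutE[OF js, of i]) simp_all
  have "m \<in> CoFib M" unfolding CoFib_iff by (intro exI[of _ c0] conjI am) simp
  then have vC [simp]: "v \<in> \<C>" using cofibrant_tgt[of m] by simp
  \<comment> \<open>The relative injectivity of \<open>src A s\<close> lets \<open>j\<close> extend
    along \<open>i\<close>; this is what splits the pushout, with \<delta> and \<rho> as its two
    projections.\<close>
  obtain \<epsilon> where [simp]: "\<epsilon> \<in> Ar A" "src A \<epsilon> = src A d" "tgt A \<epsilon> = src A s" and \<epsilon>: "\<epsilon> \<cdot> i = j"
    by (rule injective_extend[OF _ a, of "src A s" j]) simp_all
  obtain \<delta> where [simp]: "\<delta> \<in> Ar A" "src A \<delta> = v" "tgt A \<delta> = tgt A d" and \<delta>: "\<delta> \<cdot> f' = zer A (src A s) (tgt A d)" "\<delta> \<cdot> m = d"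
    using ex[of "zer A (src A s) (tgt A d)" d] admD(4)[OF a] by auto
  obtain \<rho> where [simp]: "\<rho> \<in> Ar A" "src A \<rho> = v" "tgt A \<rho> = src A s" and \<rho>: "\<rho> \<cdot> f' = ident A (src A s)" "\<rho> \<cdot> m = \<epsilon>"
    using ex[of "ident A (src A s)" \<epsilon>] \<epsilon> by auto
  \<comment> \<open>\<open>m\<close> and \<open>f' \<cdot> \<epsilon>\<close> agree on
    \<open>i\<close>; their difference descends to \<sigma>, the inclusion of the third vertex of
    the given sequence into the pushout.\<close>
  have "\<exists>r. r \<in> Ar A \<and> src A r = tgt A d \<and> tgt A r = v \<and> m = f' \<cdot> \<epsilon> \<oplus> r \<cdot> d"
    by (rule cokernel_difference[OF a]) (simp_all add: \<epsilon> sq)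
  then obtain \<sigma> where [simp]: "\<sigma> \<in> Ar A" "src A \<sigma> = tgt A d" "tgt A \<sigma> = v" and \<sigma>: "m = f' \<cdot> \<epsilon> \<oplus> \<sigma> \<cdot> d" by auto
  have \<sigma>': "m = \<sigma> \<cdot> d \<oplus> f' \<cdot> \<epsilon>" by (subst \<sigma>, rule add_commute) simp_all
  have \<delta>\<sigma>: "\<delta> \<cdot> \<sigma> = ident A (tgt A d)"
  proof (rule adm_epi[OF a])
    have "\<delta> \<cdot> (f' \<cdot> \<epsilon> \<oplus> \<sigma> \<cdot> d) = d" unfolding \<sigma>[symmetric] by (rule \<delta>(2))
    then show "(\<delta> \<cdot> \<sigma>) \<cdot> d = ident A (tgt A d) \<cdot> d" by (simp add: reassoc[OF \<delta>(1)])
  qed simp_all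
  have \<sigma>\<delta>: "\<sigma> \<cdot> \<delta> \<oplus> f' \<cdot> \<rho> = ident A v"
  proof (rule epi)
    show "(\<sigma> \<cdot> \<delta> \<oplus> f' \<cdot> \<rho>) \<cdot> f' = ident A v \<cdot> f'" by (simp add: \<delta> \<rho>)
    show "(\<sigma> \<cdot> \<delta> \<oplus> f' \<cdot> \<rho>) \<cdot> m = ident A v \<cdot> m" using \<sigma>'[symmetric] by (simp add: \<delta> \<rho>)
  qed simp_all
  have iso_\<sigma>: "iso_arr SA (cls \<sigma>)"
  proof (rule iso_cls[of \<sigma> \<delta>])
    have "ident A v \<approx> \<sigma> \<cdot> \<delta>" by (rule stable_eqI[OF \<sigma>\<delta>[symmetric]]) (simp_all add: nullI)
    then show "\<sigma> \<cdot> \<delta> \<approx> ident A (tgt A \<sigma>)" by (simp add: stable_sym)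
  qed (simp_all add: \<delta>\<sigma>)
  have \<sigma>d: "cls (\<sigma> \<cdot> d) = cls m"
    by (rule sym, rule clsI, rule stable_eqI[OF \<sigma>']) (simp_all add: nullI)
  obtain \<kappa> where \<kappa>: "lifts (\<iota> (tgt A s)) (\<pi> (tgt A s)) j s (ident A (tgt A s)) \<kappa>"
    and [simp]: "\<kappa> \<in> Ar A" "src A \<kappa> = src A (\<iota> (tgt A s))" "tgt A \<kappa> = src A i"
    by (rule conn_ex[OF js]) simp_all
  have iso_\<kappa>: "iso_arr SA (cls \<kappa>)" by (rule lifts_iso[OF loop_adm[of "tgt A s"] js]) (simp_all add: \<kappa>)
  \<comment> \<open>\<open>f'\<close> is a morphism of sequences over the identity that induces
    \<open>i\<close> on kernels, so the connecting arrow of the pushout sequence is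
    \<open>i \<cdot> \<kappa>\<close>.\<close>
  have lm: "lifts j s m c0 (ident A (tgt A s)) i"
    by (rule liftsI[of _ _ _ f']) (simp_all add: c0 sq)
  have "conn m c0 (i \<cdot> \<kappa>)" using conn_cmp[OF js am _ _ _ _ \<kappa> lm] by simp
  then have std: "(cls (i \<cdot> \<kappa>), cls m, cls c0) \<in> standard" by (intro standardI[OF am]) simp_all
  obtain w where w: "llift (c0 \<cdot> \<sigma>) w" and [simp]: "w \<in> Ar A" "src A w = src A (\<iota> (tgt A d))" "tgt A w = src A (\<iota> (tgt A s))"
    by (rule llift_ex[of "c0 \<cdot> \<sigma>"]) simp_all
  have c0m: "c0 \<cdot> (\<sigma> \<cdot> d) \<oplus> s \<cdot> \<epsilon> = zer A (src A d) (tgt A s)"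
  proof -
    have "c0 \<cdot> (\<sigma> \<cdot> d \<oplus> f' \<cdot> \<epsilon>) = zer A (src A d) (tgt A s)" unfolding \<sigma>'[symmetric] by (rule c0(2))
    then show ?thesis by (simp add: reassoc[OF c0(1)])
  qed
  \<comment> \<open>The sign arises because \<open>c0\<close> kills \<open>m\<close>, the sum of
    \<sigma>d and f'\<epsilon>. Hence \<epsilon> is a morphism of sequences over minus
    \<open>c0 \<cdot> \<sigma>\<close> that is the identity on kernels, and
    \<open>\<kappa> \<cdot> w\<close> represents minus \<open>k\<close>. The required isomorphism is
    therefore \<open>cls (neg A \<kappa>)\<close>.\<close>
  have s\<epsilon>: "s \<cdot> \<epsilon> = neg A (c0 \<cdot> (\<sigma> \<cdot> d))" by (rule neg_unique[symmetric]) (simp_all add: c0m)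
  have "lifts i d j s (neg A (c0 \<cdot> \<sigma>)) (ident A (src A i))"
    by (rule liftsI[of _ _ _ \<epsilon>]) (simp_all add: s\<epsilon> \<epsilon>)
  from conn_cmp[OF a js _ _ _ _ k this]
  have kk: "lifts (\<iota> (tgt A d)) (\<pi> (tgt A d)) j s (neg A (c0 \<cdot> \<sigma>)) k" by simp
  have "lifts (\<iota> (tgt A d)) (\<pi> (tgt A d)) j s (neg A (neg A (c0 \<cdot> \<sigma>))) (neg A k)"
    by (rule lifts_neg[OF loop_adm js _ _ _ kk]) simp_all
  then have nk: "lifts (\<iota> (tgt A d)) (\<pi> (tgt A d)) j s (c0 \<cdot> \<sigma>) (neg A k)" by simp
  have kw: "lifts (\<iota> (tgt A d)) (\<pi> (tgt A d)) j s (c0 \<cdot> \<sigma>) (\<kappa> \<cdot> w)"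
    by (rule loop_conn[OF js _ _ _ _ _ \<kappa> w]) simp_all
  have "cls (\<kappa> \<cdot> w) = cls (neg A k)" by (rule conn_unique[OF js _ _ _ _ kw nk]) simp_all
  then have "neg SA (cls (\<kappa> \<cdot> w)) = neg SA (cls (neg A k))" by simp
  then have kwk: "cls (neg A (\<kappa> \<cdot> w)) = cls k" by simp
  have \<Omega>w: "fm \<Omega> (cls (c0 \<cdot> \<sigma>)) = cls w" by (rule loop_cls[OF _ _ _ w]) simp_all
  have "iso_arr SA (cls (neg A \<kappa>))" using SA.iso_neg[OF iso_\<kappa>] by simp
  show ?thesis
  proof (rule exI[of _ "cls (neg A \<kappa>)"], rule exI[of _ "cls c0"], rule exI[of _ "cls (i \<cdot> \<kappa>)"], rule exI[of _ "cls m"], rule exI[of _ "cls \<sigma>"], intro conjI)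
    show "iso_arr SA (cls (neg A \<kappa>))" by fact
    show "cls (neg A \<kappa>) \<cdot>\<^bsub>SA\<^esub> fm \<Omega> (cls c0 \<cdot>\<^bsub>SA\<^esub> cls \<sigma>) = K"
      unfolding e by (simp add: \<Omega>w kwk)
    show "neg SA (I \<cdot>\<^bsub>SA\<^esub> cls (neg A \<kappa>)) = cls (i \<cdot> \<kappa>)" unfolding e by simp
    show "cls \<sigma> \<cdot>\<^bsub>SA\<^esub> D = cls m" unfolding e by (simp add: \<sigma>d)
  qed (use std iso_\<sigma> in \<open>simp_all add: e\<close>)
qed

text \<open>The square commutes only up to a null arrow \<open>v \<cdot> u\<close>. Extending
  \<open>u\<close> along \<open>i\<close> allows \<open>y\<close> to be changed within its class to
  \<open>y'\<close>, for which the square commutes strictly and \<open>c\<close> is induced on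
  cokernels.\<close>

lemma standard_morphism:
  assumes s: "(K, I, D) \<in> standard" and s': "(K', I', D') \<in> standard"
    and ab: "X \<in> hom SA (src SA I) (src SA I')" "Y \<in> hom SA (tgt SA I) (tgt SA I')" "Y \<cdot>\<^bsub>SA\<^esub> I = I' \<cdot>\<^bsub>SA\<^esub> X"
  shows "\<exists>Z \<in> hom SA (tgt SA D) (tgt SA D'). Z \<cdot>\<^bsub>SA\<^esub> D = D' \<cdot>\<^bsub>SA\<^esub> Y \<and> X \<cdot>\<^bsub>SA\<^esub> K = K' \<cdot>\<^bsub>SA\<^esub> fm \<Omega> Z"
proof -
  obtain k i d where e: "K = cls k" "I = cls i" "D = cls d" and a: "(i, d) \<in> adm A" and [simp]: "src A i \<in> \<C>" "src A d \<in> \<C>" "tgt A d \<in> \<C>"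
    and k: "conn i d k" and [simp]: "i \<in> Ar A" "d \<in> Ar A" "tgt A i = src A d" "k \<in> Ar A" "src A k = src A (\<iota> (tgt A d))" "tgt A k = src A i"
    using s by (rule standardE)
  obtain k' i' d' where e': "K' = cls k'" "I' = cls i'" "D' = cls d'" and a': "(i', d') \<in> adm A" and [simp]: "src A i' \<in> \<C>" "src A d' \<in> \<C>" "tgt A d' \<in> \<C>"
    and k': "conn i' d' k'" and [simp]: "i' \<in> Ar A" "d' \<in> Ar A" "tgt A i' = src A d'" "k' \<in> Ar A" "src A k' = src A (\<iota> (tgt A d'))" "tgt A k' = src A i'"
    using s' by (rule standardE)
  have X0: "X \<in> hom SA (src A i) (src A i')" and Y0: "Y \<in> hom SA (src A d) (src A d')" using ab by (simp_all add: e e')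
  obtain x where [simp]: "x \<in> Ar A" "src A x = src A i" "tgt A x = src A i'" and X: "X = cls x" using X0 by (rule SA_homE)
  obtain y where [simp]: "y \<in> Ar A" "src A y = src A d" "tgt A y = src A d'" and Y: "Y = cls y" using Y0 by (rule SA_homE)
  have "y \<cdot> i \<approx> i' \<cdot> x" using ab(3) unfolding X Y e e' by (simp add: cls_eq_iff)
  then obtain h where h: "y \<cdot> i = i' \<cdot> x \<oplus> h" "null h" "src A h = src A (i' \<cdot> x)" "tgt A h = tgt A (i' \<cdot> x)"
    by (rule stable_eqE)
  obtain u v where [simp]: "u \<in> Ar A" "v \<in> Ar A" "tgt A u = src A v" "src A v \<in> \<P>" and uv: "h = v \<cdot> u" "src A u = src A h" "tgt A v = tgt A h"
    using h(2) by (rule nullE)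
  have [simp]: "src A u = src A i" "tgt A v = src A d'" using uv(2,3) h(3,4) by simp_all
  obtain u' where [simp]: "u' \<in> Ar A" "src A u' = src A d" "tgt A u' = src A v" and u': "u' \<cdot> i = u"
    by (rule injective_extend[OF _ a, of "src A v" u]) simp_all
  define y' where "y' = y \<oplus> neg A (v \<cdot> u')"
  have [simp]: "y' \<in> Ar A" "src A y' = src A d" "tgt A y' = src A d'" by (simp_all add: y'_def)
  have yy: "cls y' = cls y" by (rule clsI, rule stable_eqI[OF y'_def]) (simp_all add: null_neg nullI)
  have y'i: "y' \<cdot> i = i' \<cdot> x" by (simp add: y'_def u' h(1) uv(1) add_associate)
  have "(d' \<cdot> y') \<cdot> i = zer A (src A i) (tgt A (d' \<cdot> y'))" by (simp add: y'i reassoc[OF admD(4)[OF a']])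
  then obtain c where [simp]: "c \<in> Ar A" "src A c = tgt A d" "tgt A c = tgt A d'" and c: "c \<cdot> d = d' \<cdot> y'"
    using cokernel_factor[OF a, of "d' \<cdot> y'"] by auto
  obtain w where w: "llift c w" and [simp]: "w \<in> Ar A" "src A w = src A (\<iota> (tgt A d))" "tgt A w = src A (\<iota> (tgt A d'))"
    by (rule llift_ex[of c]) simp_all
  have "lifts i d i' d' c x" by (rule liftsI[of _ _ _ y']) (simp_all add: c y'i)
  from conn_cmp[OF a a' _ _ _ _ k this]
  have l1: "lifts (\<iota> (tgt A d)) (\<pi> (tgt A d)) i' d' c (x \<cdot> k)" by simp
  have l2: "lifts (\<iota> (tgt A d)) (\<pi> (tgt A d)) i' d' c (k' \<cdot> w)"
    by (rule loop_conn[OF a' _ _ _ _ _ k' w]) simp_all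
  have xk: "cls (x \<cdot> k) = cls (k' \<cdot> w)" by (rule conn_unique[OF a' _ _ _ _ l1 l2]) simp_all
  have \<Omega>w: "fm \<Omega> (cls c) = cls w" by (rule loop_cls[OF _ _ _ w]) simp_all
  have "D' \<cdot>\<^bsub>SA\<^esub> Y = cls (d' \<cdot> y')" unfolding e' Y yy[symmetric] by simp
  then have "cls c \<cdot>\<^bsub>SA\<^esub> D = D' \<cdot>\<^bsub>SA\<^esub> Y" unfolding e by (simp add: c)
  moreover have "X \<cdot>\<^bsub>SA\<^esub> K = K' \<cdot>\<^bsub>SA\<^esub> fm \<Omega> (cls c)" unfolding X e e' \<Omega>w by (simp add: xk)
  ultimately show ?thesis by (intro bexI[of _ "cls c"]) (simp_all add: e e')
qed

text \<open>\<open>f\<close> lifts against trivial fibrations: a lift for \<open>i2\<close> that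
  restricts to \<open>u \<cdot> d1\<close> kills the composite inflation and descends along
  \<open>d3\<close>. So \<open>f\<close> is a cofibration and in particular an inflation, and
  \<open>g\<close> has the universal property of its cokernel.\<close>

lemma noether:
  assumes a1: "(i1, d1) \<in> adm A" and a2: "(i2, d2) \<in> adm A" and a3: "(i2 \<cdot> i1, d3) \<in> adm A" and c: "tgt A d1 \<in> \<C>" "tgt A d2 \<in> \<C>"
    and t: "src A d1 = src A i2"
  obtains f g where "(f, g) \<in> adm A" "f \<in> Ar A" "src A f = tgt A d1" "tgt A f = tgt A d3" "g \<in> Ar A" "src A g = tgt A d3" "tgt A g = tgt A d2"
    "f \<cdot> d1 = d3 \<cdot> i2" "g \<cdot> d3 = d2"
proof -
  note [simp] = admD(1-3)[OF a1] admD(1-3)[OF a2] admD(2)[OF a3] t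
  have [simp]: "src A d3 = src A d2" using admD(3)[OF a3] by simp
  have z3: "d3 \<cdot> (i2 \<cdot> i1) = zer A (src A i1) (tgt A d3)" using admD(4)[OF a3] by simp
  obtain f where f [simp]: "f \<in> Ar A" "src A f = tgt A d1" "tgt A f = tgt A d3" and fe: "f \<cdot> d1 = d3 \<cdot> i2"
    by (rule cokernel_factor[OF a1, of "d3 \<cdot> i2"]) (simp_all add: z3)
  obtain g where g [simp]: "g \<in> Ar A" "src A g = tgt A d3" "tgt A g = tgt A d2" and ge: "g \<cdot> d3 = d2"
    by (rule cokernel_factor[OF a3, of d2]) (simp_all add: reassoc[OF admD(4)[OF a2]])
  have i2: "i2 \<in> CoFib M" unfolding CoFib_iff by (intro exI[of _ d2] conjI a2 c)
  have "f \<in> CoFib M"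
  proof (rule CoFibI)
    fix p assume p [simp]: "p \<in> Fib M" "p \<in> Weq M"
    show "has_lifting A f p"
    proof (rule has_liftingI)
      fix u v assume [simp]: "u \<in> Ar A" "v \<in> Ar A" "src A u = src A f" "tgt A u = src A p" "src A v = tgt A f" "tgt A v = tgt A p"
        and uv: "p \<cdot> u = v \<cdot> f"
      obtain h where [simp]: "h \<in> Ar A" "src A h = src A d2" "tgt A h = src A p" and h: "h \<cdot> i2 = u \<cdot> d1" "p \<cdot> h = v \<cdot> d3"
        by (rule has_liftingE[OF lift_CoFib[OF i2, of p], of "u \<cdot> d1" "v \<cdot> d3"]) (simp_all add: reassoc[OF uv] fe)
      have "h \<cdot> (i2 \<cdot> i1) = zer A (src A i1) (src A p)" by (simp add: reassoc[OF h(1)] admD(4)[OF a1])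
      then obtain h' where [simp]: "h' \<in> Ar A" "src A h' = tgt A d3" "tgt A h' = src A p" and h': "h' \<cdot> d3 = h"
        using cokernel_factor[OF a3, of h] by auto
      have "h' \<cdot> f = u" by (rule adm_epi[OF a1]) (simp_all add: fe reassoc[OF h'] h(1))
      moreover have "p \<cdot> h' = v" by (rule adm_epi[OF a3]) (simp_all add: h' h(2))
      ultimately show "\<exists>h. h \<in> Ar A \<and> src A h = tgt A f \<and> tgt A h = src A p \<and> h \<cdot> f = u \<and> p \<cdot> h = v"
        by (intro exI[of _ h']) simp
    qed
  qed simp
  then obtain c where fc: "(f, c) \<in> adm A" by (rule CoFibE)
  have [simp]: "src A c = tgt A d3" using admD(3)[OF fc] by simp
  have "(f, g) \<in> adm A"
  proof (rule adm_of_cokernelI[OF fc])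
    show "g \<cdot> f = zer A (src A f) (tgt A g)"
      by (rule adm_epi[OF a1]) (simp_all add: fe reassoc[OF ge] admD(4)[OF a2])
  next
    fix t assume [simp]: "t \<in> Ar A" "src A t = src A c" and tf: "t \<cdot> f = zer A (src A f) (tgt A t)"
    have "t \<cdot> (d3 \<cdot> i2) = zer A (src A i2) (tgt A t)" unfolding fe[symmetric] by (simp add: reassoc[OF tf])
    then have "(t \<cdot> d3) \<cdot> i2 = zer A (src A i2) (tgt A (t \<cdot> d3))" by simp
    then obtain s where [simp]: "s \<in> Ar A" "src A s = tgt A d2" "tgt A s = tgt A t" and s: "s \<cdot> d2 = t \<cdot> d3"
      using cokernel_factor[OF a2, of "t \<cdot> d3"] by auto
    have "s \<cdot> g = t" by (rule adm_epi[OF a3]) (simp_all add: ge s)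
    then show "\<exists>s. s \<in> Ar A \<and> src A s = tgt A g \<and> tgt A s = tgt A t \<and> s \<cdot> g = t" by (intro exI[of _ s]) simp
  next
    fix s s' assume s: "s \<in> Ar A" "s' \<in> Ar A" "src A s = tgt A g" "src A s' = tgt A g" "tgt A s = tgt A s'" "s \<cdot> g = s' \<cdot> g"
    have "(s \<cdot> g) \<cdot> d3 = (s' \<cdot> g) \<cdot> d3" using s(6) by simp
    then have sd: "s \<cdot> d2 = s' \<cdot> d2" using s(1-5) by (simp add: ge)
    show "s = s'" by (rule adm_epi[OF a2 sd]) (use s in simp_all)
  qed simp_all
  then show ?thesis using that f g fe ge by blast
qed

text \<open>Factoring \<open>u\<close> and then \<open>v \<cdot> q1\<close> into a cofibration and a
  trivial fibration replaces the pair by composable inflations \<open>i1\<close>, \<open>i2\<close>,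
  with trivial fibrations as stable isomorphisms. The cokernels of \<open>i1\<close>,
  \<open>i2\<close> and their composite form an admissible sequence by
  \<open>noether\<close>.\<close>

lemma standard_octahedron:
  assumes "U \<in> Ar SA" "V \<in> Ar SA" and UV: "tgt SA U = src SA V"
  shows "\<exists>i1 d1 k1 e1 i2 d2 k2 e2 d3 k3 f g. (k1, i1, d1) \<in> standard \<and> (k2, i2, d2) \<in> standard \<and> (k3, i2 \<cdot>\<^bsub>SA\<^esub> i1, d3) \<in> standard \<and>
          tgt SA i1 = src SA i2 \<and> iso_arr SA e1 \<and> iso_arr SA e2 \<and> e1 \<in> hom SA (tgt SA i1) (tgt SA U) \<and> e2 \<in> hom SA (tgt SA i2) (tgt SA V) \<and>
          e1 \<cdot>\<^bsub>SA\<^esub> i1 = U \<and> e2 \<cdot>\<^bsub>SA\<^esub> i2 = V \<cdot>\<^bsub>SA\<^esub> e1 \<and>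
          f \<in> hom SA (tgt SA d1) (tgt SA d3) \<and> g \<in> hom SA (tgt SA d3) (tgt SA d2) \<and>
          f \<cdot>\<^bsub>SA\<^esub> d1 = d3 \<cdot>\<^bsub>SA\<^esub> i2 \<and> k3 \<cdot>\<^bsub>SA\<^esub> fm \<Omega> f = k1 \<and> g \<cdot>\<^bsub>SA\<^esub> d3 = d2 \<and> i1 \<cdot>\<^bsub>SA\<^esub> k3 = k2 \<cdot>\<^bsub>SA\<^esub> fm \<Omega> g \<and> (d1 \<cdot>\<^bsub>SA\<^esub> k2, f, g) \<in> standard"
proof -
  obtain u where [simp]: "u \<in> Ar A" "src A u \<in> \<C>" "tgt A u \<in> \<C>" and U: "U = cls u" using assms(1) by (rule SA_ArE)
  obtain v where v [simp]: "v \<in> Ar A" "src A v \<in> \<C>" "tgt A v \<in> \<C>" and V: "V = cls v" using assms(2) by (rule SA_ArE)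
  have [simp]: "src A v = tgt A u" using UV by (simp add: U V)
  obtain i1 q1 where [simp]: "i1 \<in> CoFib M" and q1: "q1 \<in> Fib M" "q1 \<in> Weq M" and qs1 [simp]: "src A q1 = tgt A i1" "src A i1 = src A u" "tgt A q1 = tgt A u"
    and qi1: "q1 \<cdot> i1 = u" by (rule factor_CoFibE[of u]) simp_all
  have c1 [simp]: "tgt A i1 \<in> \<C>" by (rule cofibrant_tgt) simp_all
  note [simp] = q1
  obtain i2 q2 where [simp]: "i2 \<in> CoFib M" and q2: "q2 \<in> Fib M" "q2 \<in> Weq M" and qs2 [simp]: "src A q2 = tgt A i2" "src A i2 = tgt A i1" "tgt A q2 = tgt A v"
    and qi2: "q2 \<cdot> i2 = v \<cdot> q1" by (rule factor_CoFibE[of "v \<cdot> q1"]) simp_all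
  note [simp] = q2
  have c2 [simp]: "tgt A i2 \<in> \<C>" by (rule cofibrant_tgt) simp_all
  have e1: "iso_arr SA (cls q1)" by (rule trivial_Fib_stable_iso[of q1]) simp_all
  have e2: "iso_arr SA (cls q2)" by (rule trivial_Fib_stable_iso[of q2]) simp_all
  obtain d1 where a1: "(i1, d1) \<in> adm A" and d1 [simp]: "tgt A d1 \<in> \<C>" by (rule CoFibE[of i1]) simp_all
  obtain d2 where a2: "(i2, d2) \<in> adm A" and d2 [simp]: "tgt A d2 \<in> \<C>" by (rule CoFibE[of i2]) simp_all
  have i12: "i2 \<cdot> i1 \<in> CoFib M" by (rule CoFib_cmp) simp_all
  obtain d3 where a3: "(i2 \<cdot> i1, d3) \<in> adm A" and [simp]: "tgt A d3 \<in> \<C>" by (rule CoFibE[OF i12])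
  have [simp]: "d1 \<in> Ar A" "src A d1 = tgt A i1" "d2 \<in> Ar A" "src A d2 = tgt A i2" "d3 \<in> Ar A" "src A d3 = tgt A i2"
    using admD(2,3)[OF a1] admD(2,3)[OF a2] admD(2,3)[OF a3] by simp_all
  obtain f g where a4: "(f, g) \<in> adm A" and [simp]: "f \<in> Ar A" "src A f = tgt A d1" "tgt A f = tgt A d3" "g \<in> Ar A" "src A g = tgt A d3" "tgt A g = tgt A d2"
    and fg: "f \<cdot> d1 = d3 \<cdot> i2" "g \<cdot> d3 = d2" by (rule noether[OF a1 a2 a3]) simp_all
  obtain k1 where k1: "conn i1 d1 k1" and [simp]: "k1 \<in> Ar A" "src A k1 = src A (\<iota> (tgt A d1))" "tgt A k1 = src A u" by (rule conn_ex[OF a1]) simp_all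
  obtain k2 where k2: "conn i2 d2 k2" and [simp]: "k2 \<in> Ar A" "src A k2 = src A (\<iota> (tgt A d2))" "tgt A k2 = tgt A i1" by (rule conn_ex[OF a2]) simp_all
  obtain k3 where k3: "conn (i2 \<cdot> i1) d3 k3" and [simp]: "k3 \<in> Ar A" "src A k3 = src A (\<iota> (tgt A d3))" "tgt A k3 = src A u" by (rule conn_ex[OF a3]) simp_all
  obtain f1 where f1: "llift f f1" and [simp]: "f1 \<in> Ar A" "src A f1 = src A (\<iota> (tgt A d1))" "tgt A f1 = src A (\<iota> (tgt A d3))" by (rule llift_ex[of f]) simp_all
  obtain g1 where g1: "llift g g1" and [simp]: "g1 \<in> Ar A" "src A g1 = src A (\<iota> (tgt A d3))" "tgt A g1 = src A (\<iota> (tgt A d2))" by (rule llift_ex[of g]) simp_all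
  have \<Omega>: "fm \<Omega> (cls f) = cls f1" "fm \<Omega> (cls g) = cls g1"
    using loop_cls[OF _ _ _ f1] loop_cls[OF _ _ _ g1] by simp_all
  \<comment> \<open>Three morphisms of sequences, with middle arrows \<open>i2\<close>, an identity
    and \<open>d3\<close>, yield the two relations between connecting arrows and the connecting
    arrow of the fourth sequence.\<close>
  have "lifts i1 d1 (i2 \<cdot> i1) d3 f (ident A (src A u))" by (rule liftsI[of _ _ _ i2]) (simp_all add: fg)
  from conn_cmp[OF a1 a3 _ _ _ _ k1 this]
  have l1: "lifts (\<iota> (tgt A d1)) (\<pi> (tgt A d1)) (i2 \<cdot> i1) d3 f k1" by simp
  have l1': "lifts (\<iota> (tgt A d1)) (\<pi> (tgt A d1)) (i2 \<cdot> i1) d3 f (k3 \<cdot> f1)"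
    by (rule loop_conn[OF a3 _ _ _ _ _ k3 f1]) simp_all
  have kf: "cls (k3 \<cdot> f1) = cls k1" by (rule conn_unique[OF a3 _ _ _ _ l1' l1]) simp_all
  have "lifts (i2 \<cdot> i1) d3 i2 d2 g i1" by (rule liftsI[of _ _ _ "ident A (tgt A i2)"]) (simp_all add: fg)
  from conn_cmp[OF a3 a2 _ _ _ _ k3 this]
  have l2: "lifts (\<iota> (tgt A d3)) (\<pi> (tgt A d3)) i2 d2 g (i1 \<cdot> k3)" by simp
  have l2': "lifts (\<iota> (tgt A d3)) (\<pi> (tgt A d3)) i2 d2 g (k2 \<cdot> g1)"
    by (rule loop_conn[OF a2 _ _ _ _ _ k2 g1]) simp_all
  have kg: "cls (i1 \<cdot> k3) = cls (k2 \<cdot> g1)" by (rule conn_unique[OF a2 _ _ _ _ l2 l2']) simp_all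
  have "lifts i2 d2 f g (ident A (tgt A d2)) d1" by (rule liftsI[of _ _ _ d3]) (simp_all add: fg)
  from conn_cmp[OF a2 a4 _ _ _ _ k2 this]
  have k4: "conn f g (d1 \<cdot> k2)" by simp
  have s1: "(cls k1, cls i1, cls d1) \<in> standard" by (rule standardI[OF a1]) (simp_all add: k1)
  have s2: "(cls k2, cls i2, cls d2) \<in> standard" by (rule standardI[OF a2]) (simp_all add: k2)
  have s3: "(cls k3, cls i2 \<cdot>\<^bsub>SA\<^esub> cls i1, cls d3) \<in> standard" using standardI[OF a3 _ _ _ k3] by simp
  have s4: "(cls d1 \<cdot>\<^bsub>SA\<^esub> cls k2, cls f, cls g) \<in> standard" using standardI[OF a4 _ _ _ k4] by simp
  show ?thesis
  proof (rule exI[of _ "cls i1"], rule exI[of _ "cls d1"], rule exI[of _ "cls k1"], rule exI[of _ "cls q1"],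
      rule exI[of _ "cls i2"], rule exI[of _ "cls d2"], rule exI[of _ "cls k2"], rule exI[of _ "cls q2"],
      rule exI[of _ "cls d3"], rule exI[of _ "cls k3"], rule exI[of _ "cls f"], rule exI[of _ "cls g"], intro conjI)
    show "cls q2 \<cdot>\<^bsub>SA\<^esub> cls i2 = V \<cdot>\<^bsub>SA\<^esub> cls q1" unfolding V by (simp add: qi2)
    show "cls q1 \<cdot>\<^bsub>SA\<^esub> cls i1 = U" unfolding U by (simp add: qi1)
    show "cls k3 \<cdot>\<^bsub>SA\<^esub> fm \<Omega> (cls f) = cls k1" unfolding \<Omega> by (simp add: kf)
    show "cls i1 \<cdot>\<^bsub>SA\<^esub> cls k3 = cls k2 \<cdot>\<^bsub>SA\<^esub> fm \<Omega> (cls g)" unfolding \<Omega> by (simp add: kg)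
  qed (fact s1 s2 s3 s4 e1 e2 | simp add: fg U V)+
qed

sublocale L: loop_standard SA \<Omega> standard
proof (unfold_locales, goal_cases)
  case 1 show ?case by (rule loop_functor)
next
  case 2 then show ?case by (rule loop_add)
next
  case 3 then show ?case by (rule loop_full)
next
  case 4 then show ?case by (rule loop_faithful)
next
  case 5 then show ?case by (rule standard_sequence)
next
  case 6 then show ?case by (rule standard_trivial)
next
  case 7 then show ?case by (rule standard_weak_cokernel)
next
  case 8 then show ?case by (rule standard_rotate)
next
  case 9 then show ?case by (rule standard_unrotate)
next
  case 10 then show ?case by (rule standard_morphism)
next
  case 11 then show ?case by (rule standard_octahedron)
qed

end

section \<open>The homotopy category\<close>

context category
begin

lemma is_path_Ob: "is_path C W x p y \<Longrightarrow> x \<in> Ob C \<and> y \<in> Ob C"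
proof (induction p arbitrary: x)
  case (Cons l p) then show ?case by (cases l) (auto simp: src_Ob tgt_Ob)
qed simp

lemma is_path_append: "is_path C W x p u \<Longrightarrow> is_path C W u q y \<Longrightarrow> is_path C W x (p @ q) y"
proof (induction p arbitrary: x)
  case (Cons l p) then show ?case by (cases l) auto
qed simp

lemma path_eq_paths: "path_eq C W x y p q \<Longrightarrow> is_path C W x p y \<and> is_path C W x q y"
  by (induction rule: path_eq.induct) (auto intro: is_path_append)

lemma path_eq_append:
  assumes p: "path_eq C W x u p p'" and q: "path_eq C W u y q q'"
  shows "path_eq C W x y (p @ q) (p' @ q')"
proof (rule path_trans)
  note P = path_eq_paths[OF p] path_eq_paths[OF q]
  have x: "x \<in> Ob C" "y \<in> Ob C" using is_path_Ob P by blast+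
  show "path_eq C W x y (p @ q) (p' @ q)" using path_cong[OF _ p, of x "[]" q y] P x by simp
  show "path_eq C W x y (p' @ q) (p' @ q')" using path_cong[OF _ q, of x p' "[]" y] P x by simp
qed

lemma loc_class_eq_iff:
  assumes "is_path C W x p y"
  shows "loc_class C W x p y = loc_class C W x q y \<longleftrightarrow> path_eq C W x y p q"
proof
  assume "loc_class C W x p y = loc_class C W x q y"
  moreover have "path_eq C W x y p p" using assms by (rule path_refl)
  ultimately have "path_eq C W x y q p" unfolding loc_class_def by blast
  then show "path_eq C W x y p q" by (rule path_sym)
next
  assume "path_eq C W x y p q"
  then have "path_eq C W x y p r \<longleftrightarrow> path_eq C W x y q r" for r by (blast intro: path_sym path_trans)
  then have "path_eq C W x y p = path_eq C W x y q" by (rule ext)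
  then show "loc_class C W x p y = loc_class C W x q y" unfolding loc_class_def by simp
qed

lemma loc_classI: "path_eq C W x y p q \<Longrightarrow> loc_class C W x p y = loc_class C W x q y"
  using loc_class_eq_iff path_eq_paths by blast

lemma loc_Ob [simp]: "Ob (localization C W) = Ob C"
  and loc_ident [simp]: "ident (localization C W) x = loc_class C W x [] x"
  and loc_Ar [simp]: "is_path C W x p y \<Longrightarrow> loc_class C W x p y \<in> Ar (localization C W)"
  and loc_src [simp]: "src (localization C W) (loc_class C W x p y) = x"
  and loc_tgt [simp]: "tgt (localization C W) (loc_class C W x p y) = y"
  by (auto simp: localization_def loc_class_def)

lemma loc_ArE:
  assumes "f \<in> Ar (localization C W)" obtains x p y where "is_path C W x p y" "f = loc_class C W x p y"
  using assms by (auto simp: localization_def)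

lemma loc_cmp [simp]:
  assumes p: "is_path C W x p y" and q: "is_path C W y q z"
  shows "cmp (localization C W) (loc_class C W y q z) (loc_class C W x p y) = loc_class C W x (p @ q) z"
proof -
  have "(\<exists>p'. path_eq C W x y p p' \<and> (\<exists>q'. path_eq C W y z q q' \<and> path_eq C W x z (p' @ q') r)) \<longleftrightarrow>
      path_eq C W x z (p @ q) r" for r
  proof
    assume "\<exists>p'. path_eq C W x y p p' \<and> (\<exists>q'. path_eq C W y z q q' \<and> path_eq C W x z (p' @ q') r)"
    then show "path_eq C W x z (p @ q) r" by (blast intro: path_trans path_eq_append)
  next
    assume "path_eq C W x z (p @ q) r"
    then show "\<exists>p'. path_eq C W x y p p' \<and> (\<exists>q'. path_eq C W y z q q' \<and> path_eq C W x z (p' @ q') r)"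
      using path_refl[OF p] path_refl[OF q] by blast
  qed
  then show ?thesis by (simp add: localization_def loc_class_def Bex_def)
qed

lemma loc_homE:
  assumes "f \<in> hom (localization C W) x y" obtains p where "is_path C W x p y" "f = loc_class C W x p y"
proof -
  have "f \<in> Ar (localization C W)" using assms by simp
  then obtain a p b where "is_path C W a p b" "f = loc_class C W a p b" by (rule loc_ArE)
  then show ?thesis using that assms by auto
qed

lemma loc_category: "category (localization C W)"
proof (unfold_locales, goal_cases)
  case (1 f) then show ?case by (elim loc_ArE) (use is_path_Ob in simp)
next
  case (2 f) then show ?case by (elim loc_ArE) (use is_path_Ob in simp)
next
  case (3 x) then show ?case by simp
next
  case (4 f x y g z) then show ?case by (elim loc_homE) (simp add: is_path_append)
next
  case (5 f x y)
  then obtain p where p: "is_path C W x p y" "f = loc_class C W x p y" by (rule loc_homE)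
  then have "is_path C W x [] x" using is_path_Ob by simp
  from loc_cmp[OF this p(1)] show ?case by (simp add: p(2))
next
  case (6 f x y)
  then obtain p where p: "is_path C W x p y" "f = loc_class C W x p y" by (rule loc_homE)
  then have "is_path C W y [] y" using is_path_Ob by simp
  from loc_cmp[OF p(1) this] show ?case by (simp add: p(2))
next
  case (7 f w x g y h z) then show ?case by (elim loc_homE) (simp add: is_path_append)
qed

lemma loc_arrow_hom [simp]:
  assumes "f \<in> Ar C"
  shows "loc_arrow C W f \<in> Ar (localization C W)" "src (localization C W) (loc_arrow C W f) = src C f"
    "tgt (localization C W) (loc_arrow C W f) = tgt C f"
  using assms by (simp_all add: loc_arrow_def)

lemma loc_arrow_cmp:
  assumes "f \<in> Ar C" "g \<in> Ar C" "tgt C f = src C g"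
  shows "cmp (localization C W) (loc_arrow C W g) (loc_arrow C W f) = loc_arrow C W (g \<cdot> f)"
proof -
  have "path_eq C W (src C f) (tgt C g) [Fwd f, Fwd g] [Fwd (g \<cdot> f)]"
    by (rule path_cmp[where y = "src C g"]) (use assms in simp_all)
  then have "loc_class C W (src C f) [Fwd f, Fwd g] (tgt C g) = loc_class C W (src C f) [Fwd (g \<cdot> f)] (tgt C g)"
    by (rule loc_classI)
  then show ?thesis using assms by (simp add: loc_arrow_def)
qed

lemma loc_arrow_ident: "x \<in> Ob C \<Longrightarrow> loc_arrow C W (ident C x) = loc_class C W x [] x"
  unfolding loc_arrow_def by (simp add: loc_classI path_ident)

lemma loc_arrow_inverse:
  assumes w: "w \<in> W" "w \<in> Ar C"
  shows "cmp (localization C W) (loc_class C W (tgt C w) [Bwd w] (src C w)) (loc_arrow C W w) = ident (localization C W) (src C w)"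
    "cmp (localization C W) (loc_arrow C W w) (loc_class C W (tgt C w) [Bwd w] (src C w)) = ident (localization C W) (tgt C w)"
    "iso_arr (localization C W) (loc_arrow C W w)"
proof -
  interpret H: category "localization C W" by (rule loc_category)
  have b: "is_path C W (tgt C w) [Bwd w] (src C w)" using w by simp
  have f: "is_path C W (src C w) [Fwd w] (tgt C w)" using w by simp
  show 1: "cmp (localization C W) (loc_class C W (tgt C w) [Bwd w] (src C w)) (loc_arrow C W w) = ident (localization C W) (src C w)"
    unfolding loc_arrow_def loc_cmp[OF f b] loc_ident
    by (rule loc_classI) (use path_inv[where w = w and W = W and C = C] w in simp)
  show 2: "cmp (localization C W) (loc_arrow C W w) (loc_class C W (tgt C w) [Bwd w] (src C w)) = ident (localization C W) (tgt C w)"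
    unfolding loc_arrow_def loc_cmp[OF b f] loc_ident
    by (rule loc_classI) (use path_inv'[where w = w and W = W and C = C] w in simp)
  show "iso_arr (localization C W) (loc_arrow C W w)"
    by (rule H.iso_arrI[of _ "loc_class C W (tgt C w) [Bwd w] (src C w)"]) (use w 1 2 in simp_all)
qed

end

section \<open>Comparison of the stable category with the localization\<close>

context projective_model_structure
begin

abbreviation HC :: "('o, ('o, 'm) loc_arr) cat" where "HC \<equiv> localization A (Weq M)"

abbreviation \<gamma> :: "'m \<Rightarrow> ('o, 'm) loc_arr" where "\<gamma> \<equiv> loc_arrow A (Weq M)"

sublocale HC: category HC
  by (rule loc_category)

text \<open>A lift has the prescribed component \<open>v\<close> in \<open>x\<close>; its component
  in \<open>y\<close> is an extension of \<open>q \<cdot> u\<close>, which exists since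
  \<open>y\<close> is trivial and the cokernel of \<open>c\<close> cofibrant.\<close>

lemma projection_trivial_Fib:
  assumes b: "i \<in> Ar A" "src A i = x" "tgt A i = b" "j \<in> Ar A" "src A j = y" "tgt A j = b"
    "p \<in> Ar A" "src A p = b" "tgt A p = x" "q \<in> Ar A" "src A q = b" "tgt A q = y"
    and bi: "p \<cdot> i = ident A x" "p \<cdot> j = zer A y x" "(i \<cdot> p) \<oplus> (j \<cdot> q) = ident A b" and y: "trivial y"
  shows "p \<in> Fib M \<inter> Weq M"
proof (rule trivial_FibI)
  note [simp] = b y
  have [simp]: "x \<in> Ob A" "b \<in> Ob A" using src_in_Ob[OF b(1)] src_in_Ob[OF b(7)] by simp_all
  fix c assume c [simp]: "c \<in> CoFib M"
  obtain d where a: "(c, d) \<in> adm A" and d: "tgt A d \<in> \<C>" by (rule CoFibE[OF c])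
  note [simp] = admD(2)[OF a] admD(3)[OF a]
  show "has_lifting A c p"
  proof (rule has_liftingI)
    fix u v assume [simp]: "u \<in> Ar A" "v \<in> Ar A" "src A u = src A c" "tgt A u = src A p" "src A v = tgt A c" "tgt A v = tgt A p"
      and uv: "p \<cdot> u = v \<cdot> c"
    obtain e where [simp]: "e \<in> Ar A" "src A e = src A d" "tgt A e = y" and e: "e \<cdot> c = q \<cdot> u"
      by (rule injective_extend[OF y a d, of "q \<cdot> u"]) simp_all
    have "(i \<cdot> v \<oplus> j \<cdot> e) \<cdot> c = ((i \<cdot> p) \<oplus> (j \<cdot> q)) \<cdot> u" by (simp add: uv e)
    then have "(i \<cdot> v \<oplus> j \<cdot> e) \<cdot> c = u" unfolding bi(3) by simp
    moreover have "p \<cdot> (i \<cdot> v \<oplus> j \<cdot> e) = v" by (simp add: reassoc[OF bi(1)] reassoc[OF bi(2)])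
    ultimately show "\<exists>h. h \<in> Ar A \<and> src A h = tgt A c \<and> tgt A h = src A p \<and> h \<cdot> c = u \<and> p \<cdot> h = v"
      by (intro exI[of _ "i \<cdot> v \<oplus> j \<cdot> e"]) simp
  qed
qed (use b in simp)

text \<open>Both \<open>(1, a)\<close> and \<open>(1, 0)\<close> are sections of the weak equivalence \<open>x \<oplus> P \<rightarrow> x\<close>, so they agree in the homotopy category.\<close>

lemma loc_arrow_stable:
  assumes "f \<approx> g" shows "\<gamma> f = \<gamma> g"
proof -
  obtain h where f: "f = g \<oplus> h" and h: "null h" "src A h = src A g" "tgt A h = tgt A g" and [simp]: "g \<in> Ar A"
    using assms by (rule stable_eqE)
  obtain a c where [simp]: "a \<in> Ar A" "c \<in> Ar A" "tgt A a = src A c" "src A c \<in> \<P>" and hca: "h = c \<cdot> a" and ac: "src A a = src A h" "tgt A c = tgt A h"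
    using h(1) by (rule nullE)
  have [simp]: "src A a = src A g" "tgt A c = tgt A g" using ac h by simp_all
  obtain b i j p q where b: "b \<in> Ob A" "i \<in> Ar A" "src A i = src A g" "tgt A i = b" "j \<in> Ar A" "src A j = src A c" "tgt A j = b"
    "p \<in> Ar A" "src A p = b" "tgt A p = src A g" "q \<in> Ar A" "src A q = b" "tgt A q = src A c"
    and bi: "p \<cdot> i = ident A (src A g)" "q \<cdot> j = ident A (src A c)" "q \<cdot> i = zer A (src A g) (src A c)" "p \<cdot> j = zer A (src A c) (src A g)"
    "(i \<cdot> p) \<oplus> (j \<cdot> q) = ident A b"
    by (rule biproductE[of "src A g" "src A c"]) simp_all
  note [simp] = b
  have "p \<in> Fib M \<inter> Weq M"
    by (rule projection_trivial_Fib[of i "src A g" b j "src A c" p q]) (simp_all add: bi)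
  then have p: "iso_arr HC (\<gamma> p)" by (intro loc_arrow_inverse(3)) simp_all
  have "\<gamma> p \<cdot>\<^bsub>HC\<^esub> \<gamma> (i \<oplus> j \<cdot> a) = \<gamma> p \<cdot>\<^bsub>HC\<^esub> \<gamma> i"
    by (simp add: loc_arrow_cmp bi reassoc[OF bi(4)])
  then have e: "\<gamma> (i \<oplus> j \<cdot> a) = \<gamma> i"
    by (rule HC.iso_cancel_left[OF p, rotated -1]) simp_all
  \<comment> \<open>The arrow on the biproduct with components \<open>g\<close> and \<open>c\<close>
    restricts to \<open>g\<close> along the section \<open>i\<close> and to \<open>f\<close> along
    the section \<open>i \<oplus> j \<cdot> a\<close>.\<close>
  have 1: "(g \<cdot> p \<oplus> c \<cdot> q) \<cdot> i = g" by (simp add: bi)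
  have 2: "(g \<cdot> p \<oplus> c \<cdot> q) \<cdot> (i \<oplus> j \<cdot> a) = f"
    by (simp add: f hca bi reassoc[OF bi(1)] reassoc[OF bi(2)] reassoc[OF bi(3)] reassoc[OF bi(4)])
  have "\<gamma> f = \<gamma> (g \<cdot> p \<oplus> c \<cdot> q) \<cdot>\<^bsub>HC\<^esub> \<gamma> (i \<oplus> j \<cdot> a)" unfolding 2[symmetric] by (simp add: loc_arrow_cmp)
  also have "\<dots> = \<gamma> g" unfolding e by (simp add: loc_arrow_cmp 1)
  finally show ?thesis .
qed

abbreviation \<F> :: "('o, 'm set, 'o, ('o, 'm) loc_arr) funct" where "\<F> \<equiv> stable_to_Ho A M"

lemma fo_F [simp]: "fo \<F> x = x"
  by (simp add: stable_to_Ho_def)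

lemma fm_F [simp]: assumes f: "f \<in> Ar A" shows "fm \<F> (cls f) = \<gamma> f"
proof -
  have "\<gamma> g = \<gamma> f" if "g \<in> cls f" for g using that loc_arrow_stable[of f g] mem_cls[OF f, of g] by simp
  then have "\<gamma> ` cls f = (\<lambda>_. \<gamma> f) ` cls f" by (rule image_cong[OF refl])
  also have "\<dots> = {\<gamma> f}" by (rule image_constant[of f]) (use f in \<open>simp add: mem_cls\<close>)
  finally show ?thesis by (simp add: stable_to_Ho_def)
qed

lemma F_functor_SA: "is_functor SA HC \<F>"
  unfolding is_functor_def
proof (intro conjI ballI impI)
  show "category SA" by (rule SA.category_axioms)
  show "category HC" by (rule HC.category_axioms)
next
  fix f assume "f \<in> Ar SA" then show "fm \<F> f \<in> hom HC (fo \<F> (src SA f)) (fo \<F> (tgt SA f))"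
    by (elim SA_ArE) simp
next
  fix f g assume "f \<in> Ar SA" "g \<in> Ar SA" "tgt SA f = src SA g"
  then show "fm \<F> (g \<cdot>\<^bsub>SA\<^esub> f) = fm \<F> g \<cdot>\<^bsub>HC\<^esub> fm \<F> f"
    by (elim SA_ArE) (simp add: loc_arrow_cmp)
qed (simp_all add: loc_arrow_ident)

text \<open>Cofibrant objects are replaced by themselves, so that replacement after \<F> is the
  identity on the nose and the unit consists of identities.\<close>

definition repl :: "'o \<Rightarrow> 'm" where
  "repl x = (if x \<in> \<C> then ident A x else SOME q. q \<in> Fib M \<and> q \<in> Weq M \<and> src A q \<in> \<C> \<and> tgt A q = x)"

abbreviation R :: "'o \<Rightarrow> 'o" where "R x \<equiv> src A (repl x)"

lemma repl:
  assumes x: "x \<in> Ob A" shows "repl x \<in> Fib M \<and> repl x \<in> Weq M \<and> R x \<in> \<C> \<and> tgt A (repl x) = x"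
proof (cases "x \<in> \<C>")
  case True then show ?thesis using ident_trivial_Fib[of x] by (simp add: repl_def)
next
  case False
  have "\<exists>q. q \<in> Fib M \<and> q \<in> Weq M \<and> src A q \<in> \<C> \<and> tgt A q = x" using cofibrant_replacement[OF x] by blast
  from someI_ex[OF this] show ?thesis using False by (simp add: repl_def)
qed

lemma repl_simps [simp]:
  "x \<in> Ob A \<Longrightarrow> repl x \<in> Fib M" "x \<in> Ob A \<Longrightarrow> repl x \<in> Weq M" "x \<in> Ob A \<Longrightarrow> R x \<in> \<C>" "x \<in> Ob A \<Longrightarrow> tgt A (repl x) = x"
  using repl by auto

lemma repl_cofibrant: "x \<in> \<C> \<Longrightarrow> repl x = ident A x"
  by (simp add: repl_def)

text \<open>Two lifts differ by an arrow through the trivial kernel of \<open>q\<close>, and that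
  arrow is null because its source is cofibrant.\<close>

lemma trivial_Fib_lift_unique:
  assumes q [simp]: "q \<in> Fib M" "q \<in> Weq M" and g [simp]: "g \<in> Ar A" "g' \<in> Ar A" "tgt A g = src A q" "tgt A g' = src A q" "src A g' = src A g"
    and c [simp]: "src A g \<in> \<C>" and e: "q \<cdot> g = q \<cdot> g'"
  shows "g \<approx> g'"
proof -
  obtain k where k: "(k, q) \<in> adm A" by (rule FibE[OF q(1)])
  note [simp] = admD(1,3)[OF k]
  have "\<exists>n. n \<in> Ar A \<and> src A n = src A g \<and> tgt A n = src A k \<and> g = g' \<oplus> k \<cdot> n"
    by (rule kernel_difference[OF k]) (simp_all add: e)
  then obtain n where [simp]: "n \<in> Ar A" "src A n = src A g" "tgt A n = src A k" and n: "g = g' \<oplus> k \<cdot> n" by blast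
  have "null (k \<cdot> n)" using trivial_kernel[OF k] by (intro null_cmp_left null_to_trivial) simp_all
  then show ?thesis by (rule stable_eqI[OF n]) simp_all
qed

definition rlift :: "'m \<Rightarrow> 'm \<Rightarrow> bool" where
  "rlift f g \<longleftrightarrow> f \<in> Ar A \<and> g \<in> Ar A \<and> src A g = R (src A f) \<and> tgt A g = R (tgt A f) \<and> repl (tgt A f) \<cdot> g = f \<cdot> repl (src A f)"

lemma rlift_ex: assumes [simp]: "f \<in> Ar A" shows "\<exists>g. rlift f g"
proof -
  obtain g where "g \<in> Ar A" "src A g = R (src A f)" "tgt A g = R (tgt A f)" "repl (tgt A f) \<cdot> g = f \<cdot> repl (src A f)"
    by (rule cofibrant_lift[of "R (src A f)" "repl (tgt A f)" "f \<cdot> repl (src A f)"]) simp_all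
  then show ?thesis unfolding rlift_def by auto
qed

lemma rlift_unique: assumes "rlift f g" "rlift f g'" shows "g \<approx> g'"
  by (rule trivial_Fib_lift_unique[of "repl (tgt A f)"]) (use assms in \<open>simp_all add: rlift_def\<close>)

definition lift_cls :: "'m \<Rightarrow> 'm set" where "lift_cls f = cls (SOME g. rlift f g)"

lemma lift_cls_eq: assumes "rlift f g" shows "lift_cls f = cls g"
proof -
  have "rlift f (SOME g. rlift f g)" using assms by (rule someI)
  then show ?thesis unfolding lift_cls_def using rlift_unique[OF _ assms] clsI by blast
qed

lemma lift_cls_E:
  assumes "f \<in> Ar A" obtains g where "lift_cls f = cls g" "g \<in> Ar A" "src A g = R (src A f)" "tgt A g = R (tgt A f)"
    "repl (tgt A f) \<cdot> g = f \<cdot> repl (src A f)"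
  using rlift_ex[OF assms] lift_cls_eq that unfolding rlift_def by blast

lemma lift_cls_Ar [simp]: assumes f: "f \<in> Ar A" shows "lift_cls f \<in> Ar SA" "src SA (lift_cls f) = R (src A f)" "tgt SA (lift_cls f) = R (tgt A f)"
proof -
  obtain g where "lift_cls f = cls g" "g \<in> Ar A" "src A g = R (src A f)" "tgt A g = R (tgt A f)" by (rule lift_cls_E[OF f])
  then show "lift_cls f \<in> Ar SA" "src SA (lift_cls f) = R (src A f)" "tgt SA (lift_cls f) = R (tgt A f)" using f by simp_all
qed

lemma lift_cls_cmp:
  assumes [simp]: "f \<in> Ar A" "g \<in> Ar A" "tgt A f = src A g" shows "lift_cls (g \<cdot> f) = lift_cls g \<cdot>\<^bsub>SA\<^esub> lift_cls f"
proof -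
  obtain f' where f: "lift_cls f = cls f'" and [simp]: "f' \<in> Ar A" "src A f' = R (src A f)" "tgt A f' = R (src A g)"
    and fe: "repl (src A g) \<cdot> f' = f \<cdot> repl (src A f)" using lift_cls_E[OF assms(1)] assms(3) by metis
  obtain g' where g: "lift_cls g = cls g'" and [simp]: "g' \<in> Ar A" "src A g' = R (src A g)" "tgt A g' = R (tgt A g)"
    and ge: "repl (tgt A g) \<cdot> g' = g \<cdot> repl (src A g)" by (rule lift_cls_E[OF assms(2)])
  have "rlift (g \<cdot> f) (g' \<cdot> f')" by (simp add: rlift_def reassoc[OF ge] fe)
  then show ?thesis by (simp add: lift_cls_eq f g)
qed

lemma lift_cls_cofibrant: assumes "f \<in> Ar A" "src A f \<in> \<C>" "tgt A f \<in> \<C>" shows "lift_cls f = cls f"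
  by (rule lift_cls_eq) (use assms in \<open>simp add: rlift_def repl_cofibrant\<close>)

lemma lift_cls_ident: assumes [simp]: "x \<in> Ob A" shows "lift_cls (ident A x) = cls (ident A (R x))"
  by (rule lift_cls_eq) (simp add: rlift_def)

text \<open>All objects are fibrant, so \<open>j\<close> has a retraction \<open>r\<close>. The
  composite \<open>j \<cdot> r\<close> differs from the identity by an arrow that factors through
  the cokernel of \<open>j\<close>, which is projective.\<close>

lemma trivial_CoFib_stable_iso:
  assumes j [simp]: "j \<in> CoFib M" "j \<in> Weq M" and c [simp]: "src A j \<in> \<C>" shows "iso_arr SA (cls j)"
proof -
  obtain d where a: "(j, d) \<in> adm A" by (rule CoFibE[OF j(1)])
  have d: "tgt A d \<in> \<P>" by (rule trivial_CoFib_cokernel[OF a j])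
  have tC [simp]: "tgt A j \<in> \<C>" by (rule cofibrant_tgt) simp_all
  note [simp] = admD(2)[OF a]
  have [simp]: "src A d = tgt A j" using admD(3)[OF a] by simp
  have l: "has_lifting A j (zer A (src A j) zero)" by (rule lift_Fib) (simp_all add: to_zero_Fib)
  obtain r where [simp]: "r \<in> Ar A" "src A r = tgt A j" "tgt A r = src A j" and r: "r \<cdot> j = ident A (src A j)"
    by (rule has_liftingE[OF l, of "ident A (src A j)" "zer A (tgt A j) zero"]) simp_all
  have "\<exists>s. s \<in> Ar A \<and> src A s = tgt A d \<and> tgt A s = tgt A j \<and> j \<cdot> r = ident A (tgt A j) \<oplus> s \<cdot> d"
    by (rule cokernel_difference[OF a]) (simp_all add: r)
  then obtain s where [simp]: "s \<in> Ar A" "src A s = tgt A d" "tgt A s = tgt A j" and s: "j \<cdot> r = ident A (tgt A j) \<oplus> s \<cdot> d" by blast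
  have "j \<cdot> r \<approx> ident A (tgt A j)" by (rule stable_eqI[OF s]) (simp_all add: nullI d)
  then show ?thesis by (intro iso_cls[of j r]) (simp_all add: r)
qed

text \<open>The lift \<open>g\<close> is a weak equivalence by two out of three, and so is the
  fibration in its factorization after a trivial cofibration. Between cofibrant objects both factors
  are stable isomorphisms.\<close>

lemma lift_cls_Weq_iso: assumes w [simp]: "w \<in> Weq M" shows "iso_arr SA (lift_cls w)"
proof -
  obtain g where g: "lift_cls w = cls g" and [simp]: "g \<in> Ar A" "src A g = R (src A w)" "tgt A g = R (tgt A w)"
    and ge: "repl (tgt A w) \<cdot> g = w \<cdot> repl (src A w)" by (rule lift_cls_E[of w]) simp_all
  have "w \<cdot> repl (src A w) \<in> Weq M" by (rule Weq_cmp) simp_all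
  then have gW: "g \<in> Weq M" by (intro Weq_cancel_left[of g "repl (tgt A w)"]) (simp_all add: ge)
  obtain j p where j [simp]: "j \<in> CoFib M" "j \<in> Weq M" "p \<in> Fib M" "src A p = tgt A j" "src A j = R (src A w)" "tgt A p = R (tgt A w)" and pj: "p \<cdot> j = g"
    by (rule factor_FibE[of g]) simp_all
  have p [simp]: "p \<in> Weq M" by (rule Weq_cancel_right[of j]) (simp_all add: pj gW)
  have [simp]: "tgt A j \<in> \<C>" by (rule cofibrant_tgt) simp_all
  have "iso_arr SA (cls p)" by (rule trivial_Fib_stable_iso[of p]) simp_all
  moreover have "iso_arr SA (cls j)" by (rule trivial_CoFib_stable_iso) simp_all
  ultimately have "iso_arr SA (cls p \<cdot>\<^bsub>SA\<^esub> cls j)" by (intro SA.iso_cmp) simp_all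
  then show ?thesis by (simp add: g pj)
qed

text \<open>The value of a zigzag after cofibrant replacement, where weak equivalences become invertible.\<close>

fun pathval :: "'o \<Rightarrow> 'm letter list \<Rightarrow> 'm set" where
  "pathval x [] = cls (ident A (R x))"
| "pathval x (Fwd f # p) = pathval (tgt A f) p \<cdot>\<^bsub>SA\<^esub> lift_cls f"
| "pathval x (Bwd w # p) = pathval (src A w) p \<cdot>\<^bsub>SA\<^esub> SA.arr_inv (lift_cls w)"

lemma lift_cls_inv [simp]:
  assumes "w \<in> Weq M"
  shows "SA.arr_inv (lift_cls w) \<in> Ar SA" "src SA (SA.arr_inv (lift_cls w)) = R (tgt A w)" "tgt SA (SA.arr_inv (lift_cls w)) = R (src A w)"
    "lift_cls w \<cdot>\<^bsub>SA\<^esub> SA.arr_inv (lift_cls w) = cls (ident A (R (tgt A w)))" "SA.arr_inv (lift_cls w) \<cdot>\<^bsub>SA\<^esub> lift_cls w = cls (ident A (R (src A w)))"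
  using SA.arr_inv[OF lift_cls_Weq_iso[OF assms]] assms by simp_all

lemma pathval_hom:
  "is_path A (Weq M) x p y \<Longrightarrow> pathval x p \<in> Ar SA \<and> src SA (pathval x p) = R x \<and> tgt SA (pathval x p) = R y"
proof (induction x p rule: pathval.induct)
  case (1 x)
  then have "x \<in> Ob A" "y = x" by auto
  then show ?case by simp
next
  case (2 x f p) then show ?case by auto
next
  case (3 x w p) then show ?case by auto
qed

lemma ident_cls_cmp [simp]: "\<lbrakk>f \<in> Ar SA; tgt SA f = x; x \<in> \<C>\<rbrakk> \<Longrightarrow> cls (ident A x) \<cdot>\<^bsub>SA\<^esub> f = f"
  "\<lbrakk>f \<in> Ar SA; src SA f = x; x \<in> \<C>\<rbrakk> \<Longrightarrow> f \<cdot>\<^bsub>SA\<^esub> cls (ident A x) = f"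
  using SA.ident_cmp[of f x] SA.cmp_ident[of f x] by simp_all

lemma pathval_append:
  "\<lbrakk>is_path A (Weq M) x p u; is_path A (Weq M) u q y\<rbrakk> \<Longrightarrow> pathval x (p @ q) = pathval u q \<cdot>\<^bsub>SA\<^esub> pathval x p"
proof (induction x p rule: pathval.induct)
  case (1 x)
  then have "u = x" "x \<in> Ob A" by auto
  then show ?case using pathval_hom[OF 1(2)] by simp
next
  case (2 x f p) then show ?case using pathval_hom[of "tgt A f" p u] pathval_hom[of u q y] by auto
next
  case (3 x w p) then show ?case using pathval_hom[of "src A w" p u] pathval_hom[of u q y] by auto
qed

text \<open>The value satisfies every generating relation of \<open>path_eq\<close>: composition and
  identities by functoriality of the lifts, cancellation because lifted weak equivalences are
  invertible. It therefore descends to the localization.\<close>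

lemma pathval_eq: "path_eq A (Weq M) x y p q \<Longrightarrow> pathval x p = pathval x q"
proof (induction rule: path_eq.induct)
  case (path_cong x p u v q q' r y)
  have "is_path A (Weq M) u q v" "is_path A (Weq M) u q' v" using path_eq_paths[OF path_cong(2)] by auto
  then show ?case using path_cong pathval_append[of x p u "q @ r" y] pathval_append[of x p u "q' @ r" y]
      pathval_append[of u q v r y] pathval_append[of u q' v r y] is_path_append by metis
next
  case (path_cmp f x y g z)
  then have [simp]: "f \<in> Ar A" "src A f = x" "tgt A f = y" "g \<in> Ar A" "src A g = y" "tgt A g = z" by simp_all
  have [simp]: "y \<in> Ob A" "z \<in> Ob A" using tgt_in_Ob[of f] tgt_in_Ob[of g] by simp_all
  show ?case by (simp add: lift_cls_cmp)
next
  case (path_ident x) then show ?case by (simp add: lift_cls_ident)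
next
  case (path_inv w x y)
  then have [simp]: "w \<in> Weq M" "src A w = x" "tgt A w = y" by simp_all
  have [simp]: "x \<in> Ob A" "y \<in> Ob A" using src_in_Ob[of w] tgt_in_Ob[of w] by simp_all
  show ?case using lift_cls_inv(5)[of w] by simp
next
  case (path_inv' w x y)
  then have [simp]: "w \<in> Weq M" "src A w = x" "tgt A w = y" by simp_all
  have [simp]: "x \<in> Ob A" "y \<in> Ob A" using src_in_Ob[of w] tgt_in_Ob[of w] by simp_all
  show ?case using lift_cls_inv(4)[of w] by simp
qed auto

definition replacement :: "('o, ('o, 'm) loc_arr, 'o, 'm set) funct" (\<open>\<G>\<close>) where
  "\<G> = \<lparr>fo = R, fm = (\<lambda>(x, S, y). pathval x (SOME p. p \<in> S))\<rparr>"

lemma fo_replacement [simp]: "fo \<G> x = R x"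
  by (simp add: replacement_def)

lemma fm_replacement [simp]: assumes p: "is_path A (Weq M) x p y" shows "fm \<G> (loc_class A (Weq M) x p y) = pathval x p"
proof -
  have "path_eq A (Weq M) x y p p" using p by (rule path_refl)
  then have "path_eq A (Weq M) x y p (SOME q. path_eq A (Weq M) x y p q)" by (rule someI)
  from pathval_eq[OF this] show ?thesis by (simp add: replacement_def loc_class_def)
qed

lemma replacement_functor_SA: "is_functor HC SA \<G>"
  unfolding is_functor_def
proof (intro conjI ballI impI)
  show "category SA" by (rule SA.category_axioms)
  show "category HC" by (rule HC.category_axioms)
next
  fix f assume "f \<in> Ar HC"
  then obtain x p y where "is_path A (Weq M) x p y" "f = loc_class A (Weq M) x p y" by (rule loc_ArE)
  then show "fm \<G> f \<in> hom SA (fo \<G> (src HC f)) (fo \<G> (tgt HC f))" using pathval_hom by simp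
next
  fix f g assume "f \<in> Ar HC" "g \<in> Ar HC" and fg: "tgt HC f = src HC g"
  then obtain x p y y' q z where p: "is_path A (Weq M) x p y" "f = loc_class A (Weq M) x p y"
    and q: "is_path A (Weq M) y' q z" "g = loc_class A (Weq M) y' q z" by (elim loc_ArE)
  have [simp]: "y' = y" using fg p q by simp
  show "fm \<G> (g \<cdot>\<^bsub>HC\<^esub> f) = fm \<G> g \<cdot>\<^bsub>SA\<^esub> fm \<G> f"
    using p q pathval_append[OF p(1), of q z] is_path_append[OF p(1), of q z] by simp
qed simp_all

text \<open>Induction along the zigzag. A forward letter uses the square that defines the lift of
  its arrow, a backward letter the same square inverted in the localization.\<close>

lemma counit_natural:
  "is_path A (Weq M) x p y \<Longrightarrow> \<gamma> (repl y) \<cdot>\<^bsub>HC\<^esub> fm \<F> (pathval x p) = loc_class A (Weq M) x p y \<cdot>\<^bsub>HC\<^esub> \<gamma> (repl x)"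
proof (induction x p rule: pathval.induct)
  case (1 x)
  then have x [simp]: "x \<in> Ob A" "y = x" by auto
  have idg: "loc_class A (Weq M) x [] x \<cdot>\<^bsub>HC\<^esub> \<gamma> (repl x) = \<gamma> (repl x)"
    using HC.ident_cmp[of "\<gamma> (repl x)" x] by simp
  show ?case by (simp add: loc_arrow_cmp idg)
next
  case (2 x f p)
  then have f [simp]: "f \<in> Ar A" "src A f = x" and p: "is_path A (Weq M) (tgt A f) p y" by auto
  have [simp]: "x \<in> Ob A" using src_in_Ob[of f] by simp
  have [simp]: "y \<in> Ob A" using is_path_Ob[OF p] by simp
  obtain g where g: "lift_cls f = cls g" and [simp]: "g \<in> Ar A" "src A g = R x" "tgt A g = R (tgt A f)"
    and ge: "repl (tgt A f) \<cdot> g = f \<cdot> repl x" using lift_cls_E[of f] f by metis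
  note P = pathval_hom[OF p]
  have PF [simp]: "fm \<F> (pathval (tgt A f) p) \<in> Ar HC" "src HC (fm \<F> (pathval (tgt A f) p)) = R (tgt A f)" "tgt HC (fm \<F> (pathval (tgt A f) p)) = R y"
    using P is_functorD(4-6)[OF F_functor_SA, of "pathval (tgt A f) p"] by simp_all
  have "fm \<F> (pathval x (Fwd f # p)) = fm \<F> (pathval (tgt A f) p) \<cdot>\<^bsub>HC\<^esub> \<gamma> g"
    using is_functorD(8)[OF F_functor_SA, of "lift_cls f" "pathval (tgt A f) p"] P by (simp add: g)
  then have "\<gamma> (repl y) \<cdot>\<^bsub>HC\<^esub> fm \<F> (pathval x (Fwd f # p)) = (\<gamma> (repl y) \<cdot>\<^bsub>HC\<^esub> fm \<F> (pathval (tgt A f) p)) \<cdot>\<^bsub>HC\<^esub> \<gamma> g"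
    by simp
  also have "\<dots> = (loc_class A (Weq M) (tgt A f) p y \<cdot>\<^bsub>HC\<^esub> \<gamma> (repl (tgt A f))) \<cdot>\<^bsub>HC\<^esub> \<gamma> g"
    using 2(1)[OF p] by simp
  also have "\<dots> = loc_class A (Weq M) (tgt A f) p y \<cdot>\<^bsub>HC\<^esub> (\<gamma> f \<cdot>\<^bsub>HC\<^esub> \<gamma> (repl x))"
    using p by (simp add: loc_arrow_cmp ge)
  also have "\<dots> = (loc_class A (Weq M) (tgt A f) p y \<cdot>\<^bsub>HC\<^esub> \<gamma> f) \<cdot>\<^bsub>HC\<^esub> \<gamma> (repl x)"
    using p by simp
  also have "loc_class A (Weq M) (tgt A f) p y \<cdot>\<^bsub>HC\<^esub> \<gamma> f = loc_class A (Weq M) x (Fwd f # p) y"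
    using loc_cmp[of "Weq M" x "[Fwd f]" "tgt A f" p y] p by (simp add: loc_arrow_def)
  finally show ?case .
next
  case (3 x w p)
  then have w [simp]: "w \<in> Weq M" "tgt A w = x" and p: "is_path A (Weq M) (src A w) p y" by auto
  have [simp]: "x \<in> Ob A" using tgt_in_Ob[of w] by simp
  have [simp]: "y \<in> Ob A" using is_path_Ob[OF p] by simp
  obtain g where g: "lift_cls w = cls g" and [simp]: "g \<in> Ar A" "src A g = R (src A w)" "tgt A g = R x"
    and ge: "repl x \<cdot> g = w \<cdot> repl (src A w)" using lift_cls_E[of w] w model_Ar(3) by metis
  note P = pathval_hom[OF p]
  have PF [simp]: "fm \<F> (pathval (src A w) p) \<in> Ar HC" "src HC (fm \<F> (pathval (src A w) p)) = R (src A w)" "tgt HC (fm \<F> (pathval (src A w) p)) = R y"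
    using P is_functorD(4-6)[OF F_functor_SA, of "pathval (src A w) p"] by simp_all
  let ?v = "fm \<F> (SA.arr_inv (lift_cls w))" and ?b = "loc_class A (Weq M) x [Bwd w] (src A w)"
  have b [simp]: "?b \<in> Ar HC" by simp
  have v [simp]: "?v \<in> Ar HC" "src HC ?v = R x" "tgt HC ?v = R (src A w)"
    using is_functorD(4-6)[OF F_functor_SA, of "SA.arr_inv (lift_cls w)"] by simp_all
  have gv: "\<gamma> g \<cdot>\<^bsub>HC\<^esub> ?v = loc_class A (Weq M) (R x) [] (R x)"
  proof -
    have "fm \<F> (lift_cls w \<cdot>\<^bsub>SA\<^esub> SA.arr_inv (lift_cls w)) = fm \<F> (lift_cls w) \<cdot>\<^bsub>HC\<^esub> ?v"
      by (rule is_functorD(8)[OF F_functor_SA]) simp_all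
    moreover have "fm \<F> (lift_cls w) = \<gamma> g" unfolding g by simp
    ultimately show ?thesis by (simp add: loc_arrow_ident)
  qed
  have bw: "?b \<cdot>\<^bsub>HC\<^esub> \<gamma> w = loc_class A (Weq M) (src A w) [] (src A w)" using loc_arrow_inverse(1)[of w "Weq M"] by simp
  have idl: "loc_class A (Weq M) a [] a \<cdot>\<^bsub>HC\<^esub> t = t" if "t \<in> Ar HC" "tgt HC t = a" for t a using HC.ident_cmp[OF that] by simp
  have idr: "t \<cdot>\<^bsub>HC\<^esub> loc_class A (Weq M) a [] a = t" if "t \<in> Ar HC" "src HC t = a" for t a using HC.cmp_ident[OF that] by simp
  \<comment> \<open>Insert \<open>?b\<close> followed against \<open>\<gamma> w\<close>, which is an
    identity, use the square of \<open>g\<close>, and cancel \<open>\<gamma> g\<close> with its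
    inverse \<open>?v\<close>.\<close>
  have "\<gamma> (repl (src A w)) \<cdot>\<^bsub>HC\<^esub> ?v = (?b \<cdot>\<^bsub>HC\<^esub> \<gamma> w) \<cdot>\<^bsub>HC\<^esub> (\<gamma> (repl (src A w)) \<cdot>\<^bsub>HC\<^esub> ?v)"
    unfolding bw by (simp add: idl)
  also have "\<dots> = ?b \<cdot>\<^bsub>HC\<^esub> ((\<gamma> w \<cdot>\<^bsub>HC\<^esub> \<gamma> (repl (src A w))) \<cdot>\<^bsub>HC\<^esub> ?v)" by simp
  also have "\<gamma> w \<cdot>\<^bsub>HC\<^esub> \<gamma> (repl (src A w)) = \<gamma> (repl x) \<cdot>\<^bsub>HC\<^esub> \<gamma> g" by (simp add: loc_arrow_cmp ge)
  also have "?b \<cdot>\<^bsub>HC\<^esub> ((\<gamma> (repl x) \<cdot>\<^bsub>HC\<^esub> \<gamma> g) \<cdot>\<^bsub>HC\<^esub> ?v) = ?b \<cdot>\<^bsub>HC\<^esub> \<gamma> (repl x)" by (simp add: gv idr)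
  finally have key: "\<gamma> (repl (src A w)) \<cdot>\<^bsub>HC\<^esub> ?v = ?b \<cdot>\<^bsub>HC\<^esub> \<gamma> (repl x)" .
  have "fm \<F> (pathval x (Bwd w # p)) = fm \<F> (pathval (src A w) p) \<cdot>\<^bsub>HC\<^esub> ?v"
    using is_functorD(8)[OF F_functor_SA, of "SA.arr_inv (lift_cls w)" "pathval (src A w) p"] P by simp
  then have "\<gamma> (repl y) \<cdot>\<^bsub>HC\<^esub> fm \<F> (pathval x (Bwd w # p)) = (\<gamma> (repl y) \<cdot>\<^bsub>HC\<^esub> fm \<F> (pathval (src A w) p)) \<cdot>\<^bsub>HC\<^esub> ?v"
    by simp
  also have "\<dots> = (loc_class A (Weq M) (src A w) p y \<cdot>\<^bsub>HC\<^esub> \<gamma> (repl (src A w))) \<cdot>\<^bsub>HC\<^esub> ?v"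
    using 3(1)[OF p] by simp
  also have "\<dots> = loc_class A (Weq M) (src A w) p y \<cdot>\<^bsub>HC\<^esub> (?b \<cdot>\<^bsub>HC\<^esub> \<gamma> (repl x))"
    using p by (simp add: key)
  also have "\<dots> = (loc_class A (Weq M) (src A w) p y \<cdot>\<^bsub>HC\<^esub> ?b) \<cdot>\<^bsub>HC\<^esub> \<gamma> (repl x)"
    by (rule HC.assoc[symmetric]) (use p in simp_all)
  also have "loc_class A (Weq M) (src A w) p y \<cdot>\<^bsub>HC\<^esub> ?b = loc_class A (Weq M) x (Bwd w # p) y"
    using loc_cmp[of "Weq M" x "[Bwd w]" "src A w" p y] p by simp
  finally show ?case .
qed

end

section \<open>Invariance of categorical notions under forgetting the addition\<close>

lemma triple_set_eqI: "(\<And>u v w. (u, v, w) \<in> X \<longleftrightarrow> (u, v, w) \<in> Y) \<Longrightarrow> X = Y"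
  by (simp add: set_eq_iff)

text \<open>\<open>is_triangulation\<close> asks for an additive record whose truncation is the
  given category. Functors and equivalences stated for the bare category must be moved to that
  record, and these rules do so.\<close>

lemma truncate_fields:
  "Ob (cat.truncate T) = Ob T" "Ar (cat.truncate T) = Ar T" "src (cat.truncate T) = src T" "tgt (cat.truncate T) = tgt T"
  "ident (cat.truncate T) = ident T" "cmp (cat.truncate T) = cmp T"
  by (simp_all add: cat.truncate_def)

lemma truncate_hom: "hom (cat.truncate T) = hom T"
  by (intro ext) (simp add: truncate_fields)

lemma truncate_category: "category (cat.truncate T) = category T"
  unfolding category_def truncate_hom truncate_fields ..

lemma truncate_iso: "iso_arr (cat.truncate T) f = iso_arr T f"
  unfolding iso_arr_def truncate_hom truncate_fields ..

lemma truncate_functor: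
  "is_functor (cat.truncate S) T F = is_functor S T F" "is_functor S (cat.truncate T) F = is_functor S T F"
  unfolding is_functor_def truncate_hom truncate_fields truncate_category by simp_all

lemma truncate_nat_iso: "nat_iso (cat.truncate S) (cat.truncate T) F G \<eta> = nat_iso S T F G \<eta>"
  unfolding nat_iso_def truncate_hom truncate_fields truncate_iso truncate_functor by simp

lemma truncate_equivalence: "is_equivalence (cat.truncate S) (cat.truncate T) F = is_equivalence S T F"
  unfolding is_equivalence_def quasi_inverse_def truncate_functor truncate_nat_iso by simp

context projective_model_structure
begin

lemma truncate_SA: "cat.truncate SA = SC"
  by (simp add: cat.truncate_def SA_def add_quotient_def)

lemma SC_functor: "is_functor SC T F = is_functor SA T F" "is_functor S SC F' = is_functor S SA F'"
  unfolding truncate_SA[symmetric] by (rule truncate_functor)+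

lemma unit: "nat_iso SC SC fid (fcomp \<G> \<F>) (\<lambda>x. cls (ident A x))"
proof -
  have "is_functor SA SA (fcomp \<G> \<F>)" by (rule functor_fcomp[OF F_functor_SA replacement_functor_SA])
  moreover have "fm \<G> (fm \<F> f) = f" if "f \<in> Ar SA" for f
    using that by (rule SA_ArE) (simp add: loc_arrow_def lift_cls_cofibrant repl_cofibrant)
  moreover have "R x = x" if "x \<in> \<C>" for x using that by (simp add: repl_cofibrant)
  moreover have "iso_arr SA (cls (ident A x))" if "x \<in> \<C>" for x using SA.iso_ident[of x] that by simp
  moreover have "cls (ident A (tgt SA f)) \<cdot>\<^bsub>SA\<^esub> f = f \<cdot>\<^bsub>SA\<^esub> cls (ident A (src SA f))" if "f \<in> Ar SA" for f
    using that by (rule SA_ArE) simp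
  ultimately show ?thesis
    unfolding nat_iso_def SC_functor using functor_fid[OF SA.category_axioms] by simp
qed

lemma counit: "nat_iso HC HC (fcomp \<F> \<G>) fid (\<lambda>x. \<gamma> (repl x))"
proof -
  have "is_functor HC HC (fcomp \<F> \<G>)" by (rule functor_fcomp[OF replacement_functor_SA F_functor_SA])
  moreover have "\<gamma> (repl (tgt HC f)) \<cdot>\<^bsub>HC\<^esub> fm \<F> (fm \<G> f) = f \<cdot>\<^bsub>HC\<^esub> \<gamma> (repl (src HC f))" if "f \<in> Ar HC" for f
    using that by (rule loc_ArE) (simp add: counit_natural)
  moreover have "iso_arr HC (\<gamma> (repl x))" if "x \<in> Ob A" for x by (rule loc_arrow_inverse(3)) (use that in simp_all)
  ultimately show ?thesis
    unfolding nat_iso_def using functor_fid[OF HC.category_axioms] by simp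
qed

lemma stable_to_Ho_equivalence: "quasi_inverse SC HC \<F> \<G>"
  unfolding quasi_inverse_def SC_functor using F_functor_SA replacement_functor_SA unit counit by blast

lemma ex_loop_choice: "\<exists>\<iota> \<pi>. loop_choice A \<C> \<iota> \<pi>"
proof -
  have "\<exists>i p. (i, p) \<in> adm A \<and> tgt A p = x \<and> src A p \<in> \<P>" if "x \<in> \<C>" for x
    by (rule enough_projectives[of x]) (use that in auto)
  then show ?thesis unfolding loop_choice_def by metis
qed

lemma ex_left_triangulation: "\<exists>\<Omega> \<Delta>. Ho_left_triangulation A M \<Omega> \<Delta>"
  using ex_loop_choice stable_to_Ho_equivalence unit unfolding Ho_left_triangulation_def Let_def Ho_def by blast

end

section \<open>Triangulation of the homotopy category\<close>

context looped_model_structure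
begin

lemma left_triangles_generated: "stable_left_triangles A M \<iota> \<pi> = L.generated"
proof (rule set_eqI, clarify)
  fix h f g
  have "(\<exists>i d k a b c. (i, d) \<in> adm A \<and> src A i \<in> \<C> \<and> tgt A i \<in> \<C> \<and> tgt A d \<in> \<C> \<and> connecting A \<iota> \<pi> i d k \<and>
          a \<in> hom SA (src SA f) (src A i) \<and> b \<in> hom SA (tgt SA f) (tgt A i) \<and> c \<in> hom SA (tgt SA g) (tgt A d) \<and>
          iso_arr SA a \<and> iso_arr SA b \<and> iso_arr SA c \<and>
          a \<cdot>\<^bsub>SA\<^esub> h = cls k \<cdot>\<^bsub>SA\<^esub> fm \<Omega> c \<and> b \<cdot>\<^bsub>SA\<^esub> f = cls i \<cdot>\<^bsub>SA\<^esub> a \<and> c \<cdot>\<^bsub>SA\<^esub> g = cls d \<cdot>\<^bsub>SA\<^esub> b) \<longleftrightarrow>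
        (\<exists>K I D a b c. (K, I, D) \<in> standard \<and> L.tri_map a b c (h, f, g) (K, I, D))" (is "?l \<longleftrightarrow> ?r")
  proof
    assume ?l
    then obtain i d k a b c where a: "(i, d) \<in> adm A" and c: "src A i \<in> \<C>" "tgt A i \<in> \<C>" "tgt A d \<in> \<C>" "connecting A \<iota> \<pi> i d k"
      and m: "a \<in> hom SA (src SA f) (src A i)" "b \<in> hom SA (tgt SA f) (tgt A i)" "c \<in> hom SA (tgt SA g) (tgt A d)"
          "iso_arr SA a" "iso_arr SA b" "iso_arr SA c"
          "a \<cdot>\<^bsub>SA\<^esub> h = cls k \<cdot>\<^bsub>SA\<^esub> fm \<Omega> c" "b \<cdot>\<^bsub>SA\<^esub> f = cls i \<cdot>\<^bsub>SA\<^esub> a" "c \<cdot>\<^bsub>SA\<^esub> g = cls d \<cdot>\<^bsub>SA\<^esub> b" by blast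
    have "(cls k, cls i, cls d) \<in> standard"
      by (rule standardI[OF a]) (use c admD(3)[OF a] connecting_iff in simp_all)
    moreover have "L.tri_map a b c (h, f, g) (cls k, cls i, cls d)"
      unfolding L.tri_map_def using m admD(1-3)[OF a] by simp
    ultimately show ?r by blast
  next
    assume ?r
    then obtain K I D a b c where s: "(K, I, D) \<in> standard" and m: "L.tri_map a b c (h, f, g) (K, I, D)" by blast
    obtain k i d where e: "K = cls k" "I = cls i" "D = cls d" and a: "(i, d) \<in> adm A" and c: "src A i \<in> \<C>" "src A d \<in> \<C>" "tgt A d \<in> \<C>" "conn i d k"
       and i: "i \<in> Ar A" "d \<in> Ar A" "tgt A i = src A d"
      using s by (rule standardE)
    have "connecting A \<iota> \<pi> i d k" using c by (simp add: connecting_iff)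
    moreover have "a \<in> hom SA (src SA f) (src A i)" "b \<in> hom SA (tgt SA f) (tgt A i)" "c \<in> hom SA (tgt SA g) (tgt A d)"
      using m i SA.iso_Ar unfolding L.tri_map_def e by simp_all
    moreover have "iso_arr SA a" "iso_arr SA b" "iso_arr SA c"
          "a \<cdot>\<^bsub>SA\<^esub> h = cls k \<cdot>\<^bsub>SA\<^esub> fm \<Omega> c" "b \<cdot>\<^bsub>SA\<^esub> f = cls i \<cdot>\<^bsub>SA\<^esub> a" "c \<cdot>\<^bsub>SA\<^esub> g = cls d \<cdot>\<^bsub>SA\<^esub> b"
      using m unfolding L.tri_map_def e by simp_all
    moreover have "tgt A i \<in> \<C>" using c(2) i(3) by simp
    ultimately show ?l using a c by blast
  qed
  then show "(h, f, g) \<in> stable_left_triangles A M \<iota> \<pi> \<longleftrightarrow> (h, f, g) \<in> L.generated"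
    unfolding stable_left_triangles_def L.generated_def Let_def cls_def[symmetric] hom_SC iso_SC SA_SC
    by (simp add: left_sequence_def)
qed

text \<open>\<open>G\<close> and \<eta> are arbitrary here, because
  \<open>Ho_left_triangulation\<close> does not say which quasi-inverse was taken; \<G> only
  witnesses that one exists.\<close>

theorem triangulated:
  assumes q: "quasi_inverse SC HC \<F> G" and \<eta>: "nat_iso SC SC fid (fcomp G \<F>) \<eta>"
  shows "left_triangulation_is_triangulated HC (fcomp \<F> (fcomp \<Omega> G))
    (transport_left_triangles SC HC \<F> G \<eta> \<Omega> (stable_left_triangles A M \<iota> \<pi>))"
proof -
  let ?\<Omega> = "fcomp \<F> (fcomp \<Omega> G)"
  have G: "is_functor HC SA G" using q unfolding quasi_inverse_def SC_functor by simp
  note [simp] = is_functorD(3-8)[OF G]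
  note q' = quasi_inverse_sym[OF q]
  have G_faithful: "f = g" if "f \<in> hom HC x y" "g \<in> hom HC x y" "fm G f = fm G g" for f g x y
    using quasi_inverse_faithful[OF q' that] .
  have G_full: "\<exists>f \<in> hom HC x y. fm G f = h" if "x \<in> Ob HC" "y \<in> Ob HC" "h \<in> hom SA (fo G x) (fo G y)" for x y h
    using quasi_inverse_full[OF q', of x y h] that by simp
  have G_surj: "\<exists>x \<in> Ob HC. \<exists>e \<in> hom SA (fo G x) y. iso_arr SA e" if "y \<in> Ob SA" for y
    using quasi_inverse_ess_surj[OF q', of y] that by simp
  have F_full: "\<exists>f \<in> hom SA x y. fm \<F> f = h" if "x \<in> Ob SA" "y \<in> Ob SA" "h \<in> hom HC (fo \<F> x) (fo \<F> y)" for x y h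
    using quasi_inverse_full[OF q, of x y h] that by simp
  have F_faithful: "f = g" if "f \<in> hom SA x y" "g \<in> hom SA x y" "fm \<F> f = fm \<F> g" for f g x y
    using quasi_inverse_faithful[OF q, of f x y g] that by simp
  note F = is_functorD(3-8)[OF F_functor_SA] and \<Omega>F = is_functorD(3-8)[OF loop_functor]
  note \<eta>D = nat_isoD(3-6)[OF \<eta>, simplified] and \<eta>_nat = nat_isoD(7)[OF \<eta>, simplified]
  \<comment> \<open>\<Omega> is fully faithful and essentially surjective by
    \<open>loop_full\<close>, \<open>loop_faithful\<close> and \<open>loop_surj\<close>; composing
    with the equivalences \<open>G\<close> and \<F> preserves this.\<close>
  have eq: "is_equivalence HC HC ?\<Omega>"
  proof (rule equivalenceI)
    show "is_functor HC HC ?\<Omega>" by (intro functor_fcomp[OF _ F_functor_SA] functor_fcomp[OF G loop_functor])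
  next
    fix x y f g assume fg: "f \<in> hom HC x y" "g \<in> hom HC x y" "fm ?\<Omega> f = fm ?\<Omega> g"
    have "fm \<Omega> (fm G f) = fm \<Omega> (fm G g)"
      by (rule F_faithful[of _ "fo \<Omega> (fo G x)" "fo \<Omega> (fo G y)"]) (use fg \<Omega>F in simp_all)
    then have "fm G f = fm G g" by (intro loop_faithful[of "fm G f" "fo G x" "fo G y"]) (use fg in simp_all)
    then show "f = g" using G_faithful fg by blast
  next
    fix x y h assume x: "x \<in> Ob HC" "y \<in> Ob HC" and h: "h \<in> hom HC (fo ?\<Omega> x) (fo ?\<Omega> y)"
    have Gx: "fo G x \<in> Ob SA" "fo G y \<in> Ob SA" using is_functorD(3)[OF G] x by auto
    obtain h1 where h1: "h1 \<in> hom SA (fo \<Omega> (fo G x)) (fo \<Omega> (fo G y))" "fm \<F> h1 = h"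
      using F_full[OF \<Omega>F(1)[OF Gx(1)] \<Omega>F(1)[OF Gx(2)], of h] h by auto
    obtain h2 where h2: "h2 \<in> hom SA (fo G x) (fo G y)" "fm \<Omega> h2 = h1" using loop_full[OF Gx h1(1)] by blast
    obtain h3 where h3: "h3 \<in> hom HC x y" "fm G h3 = h2" using G_full[OF x h2(1)] by blast
    show "\<exists>f \<in> hom HC x y. fm ?\<Omega> f = h" using h1 h2 h3 by (intro bexI[of _ h3]) simp_all
  next
    fix y assume "y \<in> Ob HC"
    then obtain z e where z: "z \<in> Ob SA" "e \<in> hom HC (fo \<F> z) y" "iso_arr HC e" using quasi_inverse_ess_surj[OF q, of y] by auto
    obtain s e1 where s: "s \<in> Ob SA" "e1 \<in> hom SA (fo \<Omega> s) z" "iso_arr SA e1" using loop_surj[OF z(1)] by blast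
    obtain x e2 where x: "x \<in> Ob HC" "e2 \<in> hom SA (fo G x) s" "iso_arr SA e2" using G_surj[OF s(1)] by blast
    let ?e = "e \<cdot>\<^bsub>HC\<^esub> fm \<F> (e1 \<cdot>\<^bsub>SA\<^esub> fm \<Omega> e2)"
    have "iso_arr SA (fm \<Omega> e2)" by (rule functor_iso[OF loop_functor x(3)])
    then have "iso_arr SA (e1 \<cdot>\<^bsub>SA\<^esub> fm \<Omega> e2)" by (rule SA.iso_cmp[OF _ s(3)]) (use x s \<Omega>F in simp)
    then have "iso_arr HC (fm \<F> (e1 \<cdot>\<^bsub>SA\<^esub> fm \<Omega> e2))" by (rule functor_iso[OF F_functor_SA])
    then have "iso_arr HC ?e" by (rule HC.iso_cmp[OF _ z(3)]) (use x s z \<Omega>F F in simp)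
    moreover have "?e \<in> hom HC (fo ?\<Omega> x) y" using x s z \<Omega>F F by simp
    ultimately show "\<exists>x \<in> Ob HC. \<exists>e \<in> hom HC (fo ?\<Omega> x) y. iso_arr HC e" using x(1) by blast
  qed
  have "is_triangulation HC \<Sigma> {(u, v, w). triangle_sequence HC \<Sigma> u v w \<and>
      (\<theta> (src HC u) \<cdot>\<^bsub>HC\<^esub> fm ?\<Omega> w, u, v) \<in> transport_left_triangles SC HC \<F> G \<eta> \<Omega> (stable_left_triangles A M \<iota> \<pi>)}"
    if \<Sigma>: "quasi_inverse HC HC ?\<Omega> \<Sigma>" and \<theta>: "nat_iso HC HC (fcomp ?\<Omega> \<Sigma>) fid \<theta>" for \<Sigma> \<theta>
  proof -
    \<comment> \<open>The addition on the localization is the one pulled back along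
      \<open>G\<close>, so that \<open>G\<close> is additive by construction.\<close>
    define T where "T = transported_additive SA HC G"
    have T: "cat.truncate T = HC" "additive_category T"
      and T_add: "\<And>f g x y. \<lbrakk>f \<in> hom HC x y; g \<in> hom HC x y\<rbrakk> \<Longrightarrow> fm G (f \<oplus>\<^bsub>T\<^esub> g) = fm G f \<oplus>\<^bsub>SA\<^esub> fm G g"
      unfolding T_def by (rule transported_additive[OF stable_additive_category G G_faithful G_full G_surj]; assumption)+
    have TH: "Ob T = Ob HC" "Ar T = Ar HC" "src T = src HC" "tgt T = tgt HC" "ident T = ident HC" "cmp T = cmp HC" "hom T = hom HC"
      unfolding T(1)[symmetric] by (simp_all only: truncate_fields truncate_hom)
    note \<theta>D = nat_isoD(3-6)[OF \<theta>, simplified] and \<theta>_nat = nat_isoD(7)[OF \<theta>, simplified]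
    have S: "is_functor HC HC \<Sigma>" using \<Sigma> unfolding quasi_inverse_def by simp
    note SD = is_functorD(3-8)[OF S]
    \<comment> \<open>The unit leads from \<Omega>G\<Sigma>x to its image under \<open>G\<close>
      after \<F>, and \<open>fm G (\<theta> x)\<close> from there to Gx.\<close>
    define \<psi> where "\<psi> x = fm G (\<theta> x) \<cdot>\<^bsub>SA\<^esub> \<eta> (fo \<Omega> (fo G (fo \<Sigma> x)))" for x
    have GO: "fo G x \<in> \<C>" if "x \<in> Ob A" for x using is_functorD(3)[OF G] that by simp
    have \<Omega>O: "src A (\<iota> x) \<in> \<C>" if "x \<in> \<C>" for x using that by simp
    have SO: "fo \<Sigma> x \<in> Ob A" if "x \<in> Ob A" for x using SD(1)[of x] that by simp
    \<comment> \<open>Naturality of \<eta> moves it past the loop of \<open>fm G w\<close>. The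
      first arrow prescribed by \<open>transport_left_triangles\<close> thus becomes the one in the
      definition of \<open>distinguished\<close>.\<close>
    have key: "fm G (\<theta> x \<cdot>\<^bsub>HC\<^esub> fm ?\<Omega> w) \<cdot>\<^bsub>SA\<^esub> \<eta> (fo \<Omega> (fo G y)) = \<psi> x \<cdot>\<^bsub>SA\<^esub> fm \<Omega> (fm G w)"
      if x: "x \<in> Ob A" and w: "w \<in> Ar HC" "src HC w = y" "tgt HC w = fo \<Sigma> x" for x y w
    proof -
      have y: "y \<in> Ob A" using HC.src_in_Ob[OF w(1)] w by simp
      note [simp] = x y w \<theta>D[OF x] GO \<Omega>O SO \<eta>D
      have Gw [simp]: "fm G w \<in> Ar SA" "src SA (fm G w) = fo G y" "tgt SA (fm G w) = fo G (fo \<Sigma> x)" by simp_all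
      have W [simp]: "fm \<Omega> (fm G w) \<in> Ar SA" "src SA (fm \<Omega> (fm G w)) = src A (\<iota> (fo G y))" "tgt SA (fm \<Omega> (fm G w)) = src A (\<iota> (fo G (fo \<Sigma> x)))"
        using \<Omega>F(2-4)[OF Gw(1)] by simp_all
      have FW [simp]: "fm \<F> (fm \<Omega> (fm G w)) \<in> Ar HC" "src HC (fm \<F> (fm \<Omega> (fm G w))) = src A (\<iota> (fo G y))"
        "tgt HC (fm \<F> (fm \<Omega> (fm G w))) = src A (\<iota> (fo G (fo \<Sigma> x)))"
        using F(2-4)[OF W(1)] by simp_all
      have "fm G (\<theta> x \<cdot>\<^bsub>HC\<^esub> fm ?\<Omega> w) \<cdot>\<^bsub>SA\<^esub> \<eta> (fo \<Omega> (fo G y)) = fm G (\<theta> x) \<cdot>\<^bsub>SA\<^esub> (fm G (fm \<F> (fm \<Omega> (fm G w))) \<cdot>\<^bsub>SA\<^esub> \<eta> (src A (\<iota> (fo G y))))"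
        by simp
      also have "fm G (fm \<F> (fm \<Omega> (fm G w))) \<cdot>\<^bsub>SA\<^esub> \<eta> (src A (\<iota> (fo G y))) = \<eta> (src A (\<iota> (fo G (fo \<Sigma> x)))) \<cdot>\<^bsub>SA\<^esub> fm \<Omega> (fm G w)"
        using \<eta>_nat[OF W(1)] by simp
      finally show ?thesis by (simp add: \<psi>_def)
    qed
    have \<psi>: "\<psi> x \<in> hom SA (fo \<Omega> (fo G (fo \<Sigma> x))) (fo G x)" "iso_arr SA (\<psi> x)" if x: "x \<in> Ob A" for x
    proof -
      note [simp] = x \<theta>D[OF x] GO \<Omega>O SO \<eta>D
      show "\<psi> x \<in> hom SA (fo \<Omega> (fo G (fo \<Sigma> x))) (fo G x)" by (simp add: \<psi>_def)
      have "iso_arr SA (fm G (\<theta> x))" by (rule functor_iso[OF G]) simp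
      then show "iso_arr SA (\<psi> x)" unfolding \<psi>_def by (intro SA.iso_cmp) simp_all
    qed
    have \<psi>_nat: "\<psi> (tgt HC f) \<cdot>\<^bsub>SA\<^esub> fm \<Omega> (fm G (fm \<Sigma> f)) = fm G f \<cdot>\<^bsub>SA\<^esub> \<psi> (src HC f)" if f: "f \<in> Ar HC" for f
    proof -
      have x: "src HC f \<in> Ob A" "tgt HC f \<in> Ob A" using HC.src_in_Ob[OF f] HC.tgt_in_Ob[OF f] by simp_all
      note [simp] = x f \<theta>D[OF x(1)] GO \<Omega>O SO \<eta>D
      have "\<psi> (tgt HC f) \<cdot>\<^bsub>SA\<^esub> fm \<Omega> (fm G (fm \<Sigma> f))
          = fm G (\<theta> (tgt HC f) \<cdot>\<^bsub>HC\<^esub> fm ?\<Omega> (fm \<Sigma> f)) \<cdot>\<^bsub>SA\<^esub> \<eta> (fo \<Omega> (fo G (fo \<Sigma> (src HC f))))"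
        by (rule key[symmetric]) (use SD(2-4)[OF f] in simp_all)
      also have "\<dots> = fm G (f \<cdot>\<^bsub>HC\<^esub> \<theta> (src HC f)) \<cdot>\<^bsub>SA\<^esub> \<eta> (fo \<Omega> (fo G (fo \<Sigma> (src HC f))))"
        using \<theta>_nat[OF f] by simp
      also have "\<dots> = fm G f \<cdot>\<^bsub>SA\<^esub> \<psi> (src HC f)" unfolding \<psi>_def by simp
      finally show ?thesis .
    qed
    have GT: "is_functor T SA G" using G truncate_functor(1)[of T SA G] by (simp only: T(1))
    have "is_equivalence HC HC \<Sigma>" unfolding is_equivalence_def using quasi_inverse_sym[OF \<Sigma>] by blast
    then have ST: "is_equivalence T T \<Sigma>" using truncate_equivalence[of T T \<Sigma>] by (simp only: T(1))
    have "loop_transport SA \<Omega> L.generated T G \<Sigma> \<psi>"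
      unfolding loop_transport_def loop_transport_axioms_def TH
      using L.loop_category T(2) GT T_add G_full G_faithful G_surj ST \<psi> \<psi>_nat by (simp add: Bex_def)
    then interpret TR: loop_transport SA \<Omega> L.generated T G \<Sigma> \<psi> .
    have "(u, v, w) \<in> {(u, v, w). triangle_sequence HC \<Sigma> u v w \<and>
      (\<theta> (src HC u) \<cdot>\<^bsub>HC\<^esub> fm ?\<Omega> w, u, v) \<in> transport_left_triangles SC HC \<F> G \<eta> \<Omega> (stable_left_triangles A M \<iota> \<pi>)}
      \<longleftrightarrow> (u, v, w) \<in> TR.distinguished" for u v w
    proof (cases "triangle_sequence HC \<Sigma> u v w")
      case True
      then have t: "u \<in> Ar HC" "v \<in> Ar HC" "w \<in> Ar HC" "src HC v = tgt HC u" "src HC w = tgt HC v" "tgt HC w = fo \<Sigma> (src HC u)"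
        by (simp_all add: triangle_sequence_def)
      have x: "src HC u \<in> Ob A" "tgt HC v \<in> Ob A" using HC.src_in_Ob[OF t(1)] HC.tgt_in_Ob[OF t(2)] by simp_all
      note [simp] = t x \<theta>D[OF x(1)]
      have Gw: "fm G w \<in> Ar SA" "src SA (fm G w) = fo G (tgt HC v)" "tgt SA (fm G w) = fo G (fo \<Sigma> (src HC u))" by simp_all
      have \<Omega>w: "fm \<Omega> (fm G w) \<in> Ar SA" using \<Omega>F(2)[OF Gw(1)] .
      have w: "fm ?\<Omega> w \<in> Ar HC" "src HC (fm ?\<Omega> w) = src A (\<iota> (fo G (tgt HC v)))" "tgt HC (fm ?\<Omega> w) = src A (\<iota> (fo G (fo \<Sigma> (src HC u))))"
        using F(2-4)[OF \<Omega>w] \<Omega>F(3,4)[OF Gw(1)] Gw by simp_all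
      note [simp] = w[simplified]
      have "left_sequence HC (fcomp \<F> (fcomp \<Omega> G)) (\<theta> (src HC u) \<cdot>\<^bsub>HC\<^esub> fm ?\<Omega> w) u v"
        by (simp add: left_sequence_def)
      then show ?thesis
        using True key[OF x(1) t(3) t(5) t(6)]
        by (simp add: TR.distinguished_def triangle_sequence_def TH transport_left_triangles_def left_triangles_generated)
    next
      case False
      then have "\<not> triangle_sequence T \<Sigma> u v w" unfolding triangle_sequence_def TH .
      with False show ?thesis by (simp add: TR.distinguished_def)
    qed
    then have "{(u, v, w). triangle_sequence HC \<Sigma> u v w \<and>
      (\<theta> (src HC u) \<cdot>\<^bsub>HC\<^esub> fm ?\<Omega> w, u, v) \<in> transport_left_triangles SC HC \<F> G \<eta> \<Omega> (stable_left_triangles A M \<iota> \<pi>)} = TR.distinguished"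
      by (rule triple_set_eqI)
    then show ?thesis unfolding is_triangulation_def using TR.triangulated T(1) by auto
  qed
  with eq show ?thesis unfolding left_triangulation_is_triangulated_def by blast
qed

end

theorem corollary5p4:
  fixes A :: "('o, 'm) exactcat" and M :: "'m model"
  assumes "exact_category A" and "weakly_idempotent_complete A" and "model_structure A M"
  shows "(exact_model A M \<and> weakly_projective_model A M \<longleftrightarrow> projective_model A M) \<and>
    (projective_model A M \<longrightarrow>
      (\<exists>\<Omega> \<Delta>. Ho_left_triangulation A M \<Omega> \<Delta>) \<and>
      (\<forall>\<Omega> \<Delta>. Ho_left_triangulation A M \<Omega> \<Delta> \<longrightarrow> left_triangulation_is_triangulated (Ho A M) \<Omega> \<Delta>))"
proof (intro conjI impI allI)
  show "exact_model A M \<and> weakly_projective_model A M \<longleftrightarrow> projective_model A M"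
    unfolding projective_model_def weakly_projective_model_def exact_model_def deflations_def by blast
next
  assume p: "projective_model A M"
  interpret projective_model_structure A M
    by (intro projective_model_structure.intro projective_model_structure_axioms.intro assms p)
  show "\<exists>\<Omega> \<Delta>. Ho_left_triangulation A M \<Omega> \<Delta>" by (rule ex_left_triangulation)
next
  fix \<Omega> \<Delta>
  assume p: "projective_model A M" and t: "Ho_left_triangulation A M \<Omega> \<Delta>"
  \<comment> \<open>The choices hidden in the predicate are exposed; the claim is proved for each of
    them.\<close>
  obtain \<iota> \<pi> G \<eta> where c: "loop_choice A (cofibrant_objects A M) \<iota> \<pi>"
    and q: "quasi_inverse (stable_category A M) (Ho A M) (stable_to_Ho A M) G"
    and \<eta>: "nat_iso (stable_category A M) (stable_category A M) fid (fcomp G (stable_to_Ho A M)) \<eta>"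
    and e: "\<Omega> = fcomp (stable_to_Ho A M) (fcomp (loop_functor A \<iota> \<pi>) G)"
      "\<Delta> = transport_left_triangles (stable_category A M) (Ho A M) (stable_to_Ho A M) G \<eta>
             (loop_functor A \<iota> \<pi>) (stable_left_triangles A M \<iota> \<pi>)"
    using t unfolding Ho_left_triangulation_def Let_def by blast
  interpret looped_model_structure A M \<iota> \<pi>
    by (intro looped_model_structure.intro looped_model_structure_axioms.intro
      projective_model_structure.intro projective_model_structure_axioms.intro assms p c)
  show "left_triangulation_is_triangulated (Ho A M) \<Omega> \<Delta>"
    unfolding e Ho_def by (rule triangulated[OF q[unfolded Ho_def] \<eta>])
qed

end
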